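(* Let $N=3$, $4\le p<6$, suppose $V,f,Q$ satisfy (V1)–(V3) and (D1)–(D2), and let $a>0$ be such that $\Phi_p(\phi_1)<0$. Then there exists $\delta_0>0$ such that for every $\lambda_1(f_\Omega)\le\lambda<\lambda_1(f_\Omega)+\delta_0$ there is $\mu^*>0$ such that for all $\mu>\mu^*$, $\overline{\Lambda^-_\mu}\cap\overline{\Theta^+_\mu(p)}=\emptyset$ (closures in $X_\mu$).
   Context: Conditions on $V,f,Q:\mathbb{R}^3\to\mathbb{R}$: (V1) $V$ nonnegative and continuous; (V2) there is $c>0$ with $\{V<c\}$ nonempty of finite measure; (V3) $\Omega=\mathrm{int}\{V=0\}$ is a nonempty bounded smooth domain with $\overline\Omega=\{V=0\}$; (D1) $f\in L^{3/2}(\mathbb{R}^3)$, $f^+\not\equiv0$ in $\Omega$; (D2) $Q\in L^\infty(\mathbb{R}^3)$, $Q^+\not\equiv0$ in $\Omega$. $X=\{u\in H^1(\mathbb{R}^3):\int Vu^2<\infty\}$, $\|u\|_{D^{1,2}}^2=\int|\nabla u|^2$, $\|u\|_\mu^2=\int(|\nabla u|^2+\mu Vu^2)$, $X_\mu=(X,\|\cdot\|_\mu)$. $\Lambda^-_\mu=\{u\in X:\|u\|_\mu=1,\ \|u\|_\mu^2-\lambda\int fu^2dx<0\}$; $\Phi_p(u)=\int Q|u|^pdx$ if $p\ne4$ and $\Phi_4(u)=\int Q|u|^4dx-a\|u\|_{D^{1,2}}^4$; $\Theta^+_\mu(p)=\{u\in X:\|u\|_\mu=1,\ \Phi_p(u)>0\}$.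 $\lambda_1(f_\Omega)$ is the positive principal eigenvalue of $-\Delta u=\lambda f_\Omega u$ in $\Omega$, $u=0$ on $\partial\Omega$ ($f_\Omega=f|_{\overline\Omega}$), and $\phi_1$ the positive principal eigenfunction normalized by $\int_\Omega f_\Omega\phi_1^2=1$, extended by zero to $\mathbb{R}^3$. *)

theory Defs
  imports "HOL-Analysis.Analysis"
begin

type_synonym R3 = "real ^ 3"

definition partial :: "3 \<Rightarrow> (R3 \<Rightarrow> real) \<Rightarrow> R3 \<Rightarrow> real" where
  "partial i g x = frechet_derivative g (at x) (axis i 1)"

fun Ck :: "nat \<Rightarrow> (R3 \<Rightarrow> real) \<Rightarrow> bool" where
  "Ck 0 g = continuous_on UNIV g"
| "Ck (Suc k) g = (g differentiable_on UNIV \<and> continuous_on UNIV g \<and> (\<forall>i. Ck k (partial i g)))"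

definition smooth :: "(R3 \<Rightarrow> real) \<Rightarrow> bool" where
  "smooth g \<longleftrightarrow> (\<forall>k. Ck k g)"

definition tsupport :: "(R3 \<Rightarrow> real) \<Rightarrow> R3 set" where
  "tsupport g = closure {x. g x \<noteq> 0}"

definition test_fun :: "R3 set \<Rightarrow> (R3 \<Rightarrow> real) \<Rightarrow> bool" where
  "test_fun U g \<longleftrightarrow> smooth g \<and> compact (tsupport g) \<and> tsupport g \<subseteq> U"

definition smooth_bounded_domain :: "R3 set \<Rightarrow> bool" where
  "smooth_bounded_domain \<Omega> \<longleftrightarrow> open \<Omega> \<and> connected \<Omega> \<and> bounded \<Omega> \<and> \<Omega> \<noteq> {} \<and>
     (\<exists>\<rho>. smooth \<rho> \<and> \<Omega> = {x. \<rho> x < 0} \<and> frontier \<Omega> = {x. \<rho> x = 0} \<and>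
          (\<forall>x\<in>frontier \<Omega>. frechet_derivative \<rho> (at x) \<noteq> (\<lambda>v. 0)))"

definition weak_grad :: "(R3 \<Rightarrow> real) \<Rightarrow> (R3 \<Rightarrow> R3) \<Rightarrow> bool" where
  "weak_grad u G \<longleftrightarrow> G \<in> borel_measurable lebesgue \<and>
     (\<forall>\<phi> i. test_fun UNIV \<phi> \<longrightarrow>
        integrable lebesgue (\<lambda>x. u x * partial i \<phi> x) \<and>
        integrable lebesgue (\<lambda>x. G x $ i * \<phi> x) \<and>
        (\<integral>x. u x * partial i \<phi> x \<partial>lebesgue) = - (\<integral>x. G x $ i * \<phi> x \<partial>lebesgue))"

definition H1 :: "(R3 \<Rightarrow> real) set" where
  "H1 = {u. u \<in> borel_measurable lebesgue \<and> integrable lebesgue (\<lambda>x. (u x)\<^sup>2) \<and>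
            (\<exists>G. weak_grad u G \<and> integrable lebesgue (\<lambda>x. (norm (G x))\<^sup>2))}"

definition grad :: "(R3 \<Rightarrow> real) \<Rightarrow> R3 \<Rightarrow> R3" where
  "grad u = (SOME G. weak_grad u G \<and> integrable lebesgue (\<lambda>x. (norm (G x))\<^sup>2))"

definition D12sq :: "(R3 \<Rightarrow> real) \<Rightarrow> real" where
  "D12sq u = (\<integral>x. (norm (grad u x))\<^sup>2 \<partial>lebesgue)"

definition H1_norm :: "(R3 \<Rightarrow> real) \<Rightarrow> real" where
  "H1_norm u = sqrt (D12sq u + (\<integral>x. (u x)\<^sup>2 \<partial>lebesgue))"

definition H10 :: "R3 set \<Rightarrow> (R3 \<Rightarrow> real) set" where
  "H10 \<Omega> = {u \<in> H1. \<exists>\<phi>s. (\<forall>n. test_fun \<Omega> (\<phi>s n)) \<and>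
                 (\<lambda>n. H1_norm (\<lambda>x. u x - \<phi>s n x)) \<longlonglongrightarrow> 0}"

definition Xsp :: "(R3 \<Rightarrow> real) \<Rightarrow> (R3 \<Rightarrow> real) set" where
  "Xsp V = {u \<in> H1. integrable lebesgue (\<lambda>x. V x * (u x)\<^sup>2)}"

definition norm_mu :: "(R3 \<Rightarrow> real) \<Rightarrow> real \<Rightarrow> (R3 \<Rightarrow> real) \<Rightarrow> real" where
  "norm_mu V \<mu> u = sqrt (D12sq u + \<mu> * (\<integral>x. V x * (u x)\<^sup>2 \<partial>lebesgue))"

definition Xclosure :: "(R3 \<Rightarrow> real) \<Rightarrow> real \<Rightarrow> (R3 \<Rightarrow> real) set \<Rightarrow> (R3 \<Rightarrow> real) set" where
  "Xclosure V \<mu> A = {u \<in> Xsp V. \<forall>e>0. \<exists>v\<in>A. norm_mu V \<mu> (\<lambda>x. u x - v x) < e}"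

definition Lambda_minus :: "(R3 \<Rightarrow> real) \<Rightarrow> (R3 \<Rightarrow> real) \<Rightarrow> real \<Rightarrow> real \<Rightarrow> (R3 \<Rightarrow> real) set" where
  "Lambda_minus V f lam \<mu> = {u \<in> Xsp V. norm_mu V \<mu> u = 1 \<and>
      (norm_mu V \<mu> u)\<^sup>2 - lam * (\<integral>x. f x * (u x)\<^sup>2 \<partial>lebesgue) < 0}"

definition Phi :: "(R3 \<Rightarrow> real) \<Rightarrow> real \<Rightarrow> real \<Rightarrow> (R3 \<Rightarrow> real) \<Rightarrow> real" where
  "Phi Q a p u = (if p \<noteq> 4 then (\<integral>x. Q x * \<bar>u x\<bar> powr p \<partial>lebesgue)
                  else (\<integral>x. Q x * \<bar>u x\<bar> powr 4 \<partial>lebesgue) - a * (D12sq u)\<^sup>2)"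

definition Theta_plus :: "(R3 \<Rightarrow> real) \<Rightarrow> (R3 \<Rightarrow> real) \<Rightarrow> real \<Rightarrow> real \<Rightarrow> real \<Rightarrow> (R3 \<Rightarrow> real) set" where
  "Theta_plus V Q a p \<mu> = {u \<in> Xsp V. norm_mu V \<mu> u = 1 \<and> Phi Q a p u > 0}"

text \<open>(lam1, phi1) is the positive principal eigenpair of -Delta u = lam f u in Omega,
  u = 0 on the boundary (weak sense), phi1 > 0 in Omega, normalized by
  int_Omega f phi1^2 = 1, and extended by zero outside Omega.\<close>
definition principal_eigenpair :: "(R3 \<Rightarrow> real) \<Rightarrow> R3 set \<Rightarrow> real \<Rightarrow> (R3 \<Rightarrow> real) \<Rightarrow> bool" where
  "principal_eigenpair f \<Omega> lam1 phi1 \<longleftrightarrow> lam1 > 0 \<and> phi1 \<in> H10 \<Omega> \<and>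
     (\<forall>x. x \<notin> \<Omega> \<longrightarrow> phi1 x = 0) \<and>
     (AE x in lebesgue. x \<in> \<Omega> \<longrightarrow> phi1 x > 0) \<and>
     (\<forall>\<phi>. test_fun \<Omega> \<phi> \<longrightarrow>
        (\<integral>x. grad phi1 x \<bullet> (\<chi> i. partial i \<phi> x) \<partial>lebesgue)
          = lam1 * (\<integral>x. f x * phi1 x * \<phi> x \<partial>lebesgue)) \<and>
     (\<integral>x. indicator \<Omega> x * f x * (phi1 x)\<^sup>2 \<partial>lebesgue) = 1"

end

(*
  If the closures met for lambda arbitrarily close to lambda_1 and mu arbitrarily large, there would be
  v_n in Lambda^- and w_n in Theta^+ with ||v_n - w_n||_mu -> 0, mu_n -> infinity, lambda_n -> lambda_1.
  As {V < c} has finite measure and mu_n int V v_n^2 <= 1, no L^2 mass escapes, and a subsequence of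
  (v_n), hence of (w_n), converges in L^2 to some v_0 which vanishes where V > 0; thus v_0 is in H_0^1(Omega).
  Passing to the limit, int |grad v_0|^2 <= 1 <= lambda_1 int f v_0^2.  By Picone's inequality
    int_Omega |grad v_0 - (v_0/phi_1) grad phi_1|^2 <= int |grad v_0|^2 - lambda_1 int f v_0^2 <= 0
  the quotient v_0/phi_1 is constant, so v_0 = k phi_1 with k <> 0.  As p < 6, Phi_p (lower semicontinuity of
  the gradient norm being used for p = 4) gives Phi_p(v_0) >= 0, whereas Phi_p(v_0) = |k|^p Phi_p(phi_1) < 0.
*)
theory Submission
  imports Defs "HOL-Library.Diagonal_Subsequence"
begin

section \<open>Square-integrable functions\<close>

text \<open>The limit argument supplies only L^2 convergence and bounded gradients, and every step
  has to live with that. For f in L^(3/2) the form int f u^2 is not L^2-continuous; the Sobolev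
  inequality, kept with a free parameter, makes the large values of f negligible on bounded sets of
  gradients. It also controls differences of |u|^p, by a small multiple of sixth powers plus a large
  multiple of the squared difference. A limit gradient of no larger norm is obtained from nearly
  minimal gradients in shrinking L^2 neighbourhoods, which are Cauchy by the parallelogram law. The
  two sets play different roles: the constraint 1 < lambda int f v^2 survives as a weak inequality
  and keeps the limit away from zero, while Phi_p is tested on the second sequence, which has the
  same L^2 limit because the well of V lets gradient and potential control L^2. The statement speaks
  of Lebesgue measurable functions with a gradient picked by choice. Estimates are made for Borel
  pairs (u, G), G an L^2 limit of gradients of test functions approximating u, and transferred by
  uniqueness of weak gradients.\<close>

abbreviation borel_fun :: "('a::topological_space \<Rightarrow> 'b::topological_space) \<Rightarrow> bool" where
  "borel_fun f \<equiv> f \<in> borel_measurable borel"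

abbreviation nn_lborel :: "('a::euclidean_space \<Rightarrow> ennreal) \<Rightarrow> ennreal" (binder "NNINT " 10) where
  "nn_lborel g \<equiv> nn_integral lborel g"

text \<open>The squared L^2 norm with values in \<open>ennreal\<close>: estimates carry no
  integrability side conditions, and finiteness is a separate hypothesis. One definition serves
  functions and gradients.\<close>

definition L2sq :: "('a::euclidean_space \<Rightarrow> 'b::{real_normed_vector, second_countable_topology}) \<Rightarrow> ennreal" where
  "L2sq f = (NNINT x. ennreal ((norm (f x))\<^sup>2))"

lemma L2sq_cong_AE: "AE x in lborel. f x = g x \<Longrightarrow> L2sq f = L2sq g"
  unfolding L2sq_def by (rule nn_integral_cong_AE) auto

lemma L2sq_mono: "(\<And>x. norm (f x) \<le> norm (g x)) \<Longrightarrow> L2sq f \<le> L2sq g"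
  unfolding L2sq_def by (intro nn_integral_mono ennreal_leI power_mono) auto

lemma L2sq_zero [simp]: "L2sq (\<lambda>x. 0) = 0"
  by (simp add: L2sq_def)

lemma L2sq_uminus [simp]: "L2sq (\<lambda>x. - f x) = L2sq f"
  by (simp add: L2sq_def)

lemma L2sq_commute: "L2sq (\<lambda>x. f x - g x) = L2sq (\<lambda>x. g x - f x)"
  by (simp add: L2sq_def norm_minus_commute)

lemma L2sq_scaleR:
  assumes [measurable]: "borel_fun f"
  shows "L2sq (\<lambda>x. c *\<^sub>R f x) = ennreal (c\<^sup>2) * L2sq f"
  unfolding L2sq_def by (subst nn_integral_cmult[symmetric]) (auto simp: ennreal_mult' power_mult_distrib)

text \<open>The gap between the two sides is the nonnegative quantity (e a - b)^2 / e. The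
  coefficient 1 + e of a^2 can be taken close to 1, which convergence of norms requires; e = 1 gives
  the crude factor 2 used elsewhere.\<close>

lemma sq_add_eps:
  fixes a b e :: real
  assumes "e > 0"
  shows "(a + b)\<^sup>2 \<le> (1 + e) * a\<^sup>2 + (1 + 1/e) * b\<^sup>2"
proof -
  have "0 \<le> (e * a - b)\<^sup>2 / e" using assms by simp
  also have "\<dots> = (1 + e) * a\<^sup>2 + (1 + 1/e) * b\<^sup>2 - (a + b)\<^sup>2"
    using assms by (simp add: field_simps power2_eq_square)
  finally show ?thesis by simp
qed

lemma L2sq_add_eps:
  assumes [measurable]: "borel_fun f" "borel_fun g" and e: "e > 0"
  shows "L2sq (\<lambda>x. f x + g x) \<le> ennreal (1 + e) * L2sq f + ennreal (1 + 1/e) * L2sq g"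
proof -
  have "L2sq (\<lambda>x. f x + g x) \<le>
      (NNINT x. ennreal (1 + e) * ennreal ((norm (f x))\<^sup>2) + ennreal (1 + 1/e) * ennreal ((norm (g x))\<^sup>2))"
    unfolding L2sq_def
  proof (rule nn_integral_mono)
    fix x
    have "(norm (f x + g x))\<^sup>2 \<le> (norm (f x) + norm (g x))\<^sup>2"
      by (intro power_mono norm_triangle_ineq) auto
    also note sq_add_eps[OF e]
    finally show "ennreal ((norm (f x + g x))\<^sup>2) \<le>
        ennreal (1 + e) * ennreal ((norm (f x))\<^sup>2) + ennreal (1 + 1/e) * ennreal ((norm (g x))\<^sup>2)"
      using e by (simp add: ennreal_mult'[symmetric] ennreal_plus[symmetric] ennreal_leI del: ennreal_plus)
  qed
  also have "\<dots> = ennreal (1 + e) * L2sq f + ennreal (1 + 1/e) * L2sq g"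
    unfolding L2sq_def by (subst nn_integral_add) (auto simp: nn_integral_cmult)
  finally show ?thesis .
qed

lemma L2sq_add:
  assumes "borel_fun f" "borel_fun g"
  shows "L2sq (\<lambda>x. f x + g x) \<le> 2 * L2sq f + 2 * L2sq g"
  using L2sq_add_eps[OF assms, of 1] by simp

lemma L2sq_diff:
  assumes [measurable]: "borel_fun f" "borel_fun g"
  shows "L2sq (\<lambda>x. f x - g x) \<le> 2 * L2sq f + 2 * L2sq g"
  using L2sq_add[of f "\<lambda>x. - g x"] by simp

lemma L2sq_triangle:
  assumes [measurable]: "borel_fun f" "borel_fun g" "borel_fun h"
  shows "L2sq (\<lambda>x. f x - h x) \<le> 2 * L2sq (\<lambda>x. f x - g x) + 2 * L2sq (\<lambda>x. g x - h x)"
  using L2sq_add[of "\<lambda>x. f x - g x" "\<lambda>x. g x - h x"] by simp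

lemma ennreal_finite_combination:
  "a < (\<infinity>::ennreal) \<Longrightarrow> b < \<infinity> \<Longrightarrow> 2 * a + 2 * b < \<infinity>"
  by (simp add: ennreal_mult_less_top)

lemma L2sq_finite_add:
  assumes "borel_fun f" "borel_fun g" "L2sq f < \<infinity>" "L2sq g < \<infinity>"
  shows "L2sq (\<lambda>x. f x + g x) < \<infinity>"
  using L2sq_add[OF assms(1,2)] ennreal_finite_combination[OF assms(3,4)] by order

lemma L2sq_finite_diff:
  assumes "borel_fun f" "borel_fun g" "L2sq f < \<infinity>" "L2sq g < \<infinity>"
  shows "L2sq (\<lambda>x. f x - g x) < \<infinity>"
  using L2sq_diff[OF assms(1,2)] ennreal_finite_combination[OF assms(3,4)] by order

lemma L2sq_finite_from_approx:
  assumes [measurable]: "borel_fun f" "borel_fun g"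
    and "L2sq (\<lambda>x. f x - g x) < \<infinity>" "L2sq g < \<infinity>"
  shows "L2sq f < \<infinity>"
  using L2sq_finite_add[of "\<lambda>x. f x - g x" g] assms by simp

lemma integrable_iff_L2sq:
  assumes [measurable]: "borel_fun f"
  shows "integrable lborel (\<lambda>x. (norm (f x))\<^sup>2) \<longleftrightarrow> L2sq f < \<infinity>"
  by (subst integrable_iff_bounded) (auto simp: L2sq_def)

lemma integral_eq_L2sq:
  assumes [measurable]: "borel_fun f"
  shows "(LBINT x. (norm (f x))\<^sup>2) = enn2real (L2sq f)"
  unfolding L2sq_def by (rule integral_eq_nn_integral) auto

lemma L2sq_eq_integral:
  assumes [measurable]: "borel_fun f" and "L2sq f < \<infinity>"
  shows "L2sq f = ennreal (LBINT x. (norm (f x))\<^sup>2)"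
  using assms by (simp add: integral_eq_L2sq)

lemma L2sq_eq_0_AE:
  assumes [measurable]: "borel_fun f" and "L2sq f = 0"
  shows "AE x in lborel. f x = 0"
proof -
  have "AE x in lborel. ennreal ((norm (f x))\<^sup>2) = 0"
    using assms(2) unfolding L2sq_def by (subst (asm) nn_integral_0_iff_AE) auto
  then show ?thesis by (auto simp: ennreal_eq_0_iff)
qed

lemma L2_Cauchy_Schwarz:
  assumes [measurable]: "borel_fun f" "borel_fun g"
  shows "(NNINT x. ennreal (norm (f x) * norm (g x)))\<^sup>2 \<le> L2sq f * L2sq g"
  using Cauchy_Schwarz_nn_integral[of "\<lambda>x. ennreal (norm (f x))" lborel "\<lambda>x. ennreal (norm (g x))"]
  by (simp add: L2sq_def ennreal_mult' ennreal_power)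

lemma L2_inner_integrable:
  fixes f g :: "'a::euclidean_space \<Rightarrow> 'b::euclidean_space"
  assumes [measurable]: "borel_fun f" "borel_fun g"
    and fin: "L2sq f < \<infinity>" "L2sq g < \<infinity>"
  shows "integrable lborel (\<lambda>x. f x \<bullet> g x)"
proof (rule Bochner_Integration.integrable_bound)
  show "integrable lborel (\<lambda>x. (norm (f x))\<^sup>2 + (norm (g x))\<^sup>2)"
    using fin by (intro Bochner_Integration.integrable_add) (auto simp: integrable_iff_L2sq)
  show "AE x in lborel. norm (f x \<bullet> g x) \<le> norm ((norm (f x))\<^sup>2 + (norm (g x))\<^sup>2)"
  proof (rule AE_I2)
    fix x
    have "\<bar>f x \<bullet> g x\<bar> \<le> norm (f x) * norm (g x)" by (rule Cauchy_Schwarz_ineq2)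
    also have "\<dots> \<le> (norm (f x))\<^sup>2 + (norm (g x))\<^sup>2"
      using sum_squares_bound[of "norm (f x)" "norm (g x)"] mult_nonneg_nonneg[OF norm_ge_zero[of "f x"] norm_ge_zero[of "g x"]]
      by linarith
    finally show "norm (f x \<bullet> g x) \<le> norm ((norm (f x))\<^sup>2 + (norm (g x))\<^sup>2)" by simp
  qed
qed auto

lemma L2_inner_bound:
  fixes f g :: "'a::euclidean_space \<Rightarrow> 'b::euclidean_space"
  assumes [measurable]: "borel_fun f" "borel_fun g"
    and fin: "L2sq f < \<infinity>" "L2sq g < \<infinity>"
  shows "(LBINT x. f x \<bullet> g x)\<^sup>2 \<le> enn2real (L2sq f) * enn2real (L2sq g)"
proof -
  have "ennreal \<bar>(LBINT x. f x \<bullet> g x)\<bar> \<le> (NNINT x. ennreal (norm (f x \<bullet> g x)))"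
    using integral_norm_bound_ennreal[OF L2_inner_integrable[OF assms]] by simp
  also have "\<dots> \<le> (NNINT x. ennreal (norm (f x) * norm (g x)))"
    by (intro nn_integral_mono ennreal_leI) (simp add: Cauchy_Schwarz_ineq2)
  finally have "(ennreal \<bar>(LBINT x. f x \<bullet> g x)\<bar>)\<^sup>2 \<le> (NNINT x. ennreal (norm (f x) * norm (g x)))\<^sup>2"
    by (rule power_mono) simp
  also have "\<dots> \<le> L2sq f * L2sq g" by (rule L2_Cauchy_Schwarz) auto
  also have "\<dots> = ennreal (enn2real (L2sq f)) * ennreal (enn2real (L2sq g))" using fin by simp
  finally show ?thesis by (simp add: ennreal_power ennreal_mult'[symmetric])
qed

section \<open>Convergence in L^2\<close>

definition L2lim :: "(nat \<Rightarrow> 'a::euclidean_space \<Rightarrow> 'b::{real_normed_vector, second_countable_topology}) \<Rightarrow> ('a \<Rightarrow> 'b) \<Rightarrow> bool" where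
  "L2lim F f \<longleftrightarrow> (\<lambda>n. L2sq (\<lambda>x. F n x - f x)) \<longlonglongrightarrow> 0"

lemma tendsto_0_ennreal_combination:
  fixes a b :: "nat \<Rightarrow> ennreal"
  assumes "a \<longlonglongrightarrow> 0" "b \<longlonglongrightarrow> 0" and c: "c < \<infinity>" "d < \<infinity>" and le: "\<And>n. F n \<le> c * a n + d * b n"
  shows "F \<longlonglongrightarrow> 0"
proof (rule tendsto_sandwich[of "\<lambda>_. 0" F sequentially "\<lambda>n. c * a n + d * b n"])
  have "(\<lambda>n. c * a n + d * b n) \<longlonglongrightarrow> c * 0 + d * 0"
    using c by (intro tendsto_add ennreal_tendsto_cmult assms) auto
  then show "(\<lambda>n. c * a n + d * b n) \<longlonglongrightarrow> 0" by simp
qed (use le in auto)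

lemma L2limD: "L2lim F f \<Longrightarrow> e > 0 \<Longrightarrow> eventually (\<lambda>n. L2sq (\<lambda>x. F n x - f x) < e) sequentially"
  unfolding L2lim_def by (rule order_tendstoD)

lemma L2lim_subseq: "L2lim F f \<Longrightarrow> strict_mono r \<Longrightarrow> L2lim (\<lambda>n. F (r n)) f"
  unfolding L2lim_def using LIMSEQ_subseq_LIMSEQ[of _ 0 r] by (auto simp: comp_def)

lemma L2lim_const [simp]: "L2lim (\<lambda>n. f) f"
  by (simp add: L2lim_def)

lemma L2lim_from_diff:
  assumes [measurable]: "\<And>n. borel_fun (F n)" "\<And>n. borel_fun (G n)" "borel_fun f"
    and "L2lim F f" "(\<lambda>n. L2sq (\<lambda>x. G n x - F n x)) \<longlonglongrightarrow> 0"
  shows "L2lim G f"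
  unfolding L2lim_def
  by (rule tendsto_0_ennreal_combination[OF assms(5) assms(4)[unfolded L2lim_def], of 2 2])
    (auto intro: L2sq_triangle)

lemma L2lim_add:
  assumes [measurable]: "\<And>n. borel_fun (F n)" "\<And>n. borel_fun (G n)"
     "borel_fun f" "borel_fun g"
    and "L2lim F f" "L2lim G g"
  shows "L2lim (\<lambda>n x. F n x + G n x) (\<lambda>x. f x + g x)"
  unfolding L2lim_def
proof (rule tendsto_0_ennreal_combination[OF assms(5,6)[unfolded L2lim_def], of 2 2])
  fix n
  show "L2sq (\<lambda>x. F n x + G n x - (f x + g x)) \<le> 2 * L2sq (\<lambda>x. F n x - f x) + 2 * L2sq (\<lambda>x. G n x - g x)"
    using L2sq_add[of "\<lambda>x. F n x - f x" "\<lambda>x. G n x - g x"] by (simp add: algebra_simps)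
qed auto

text \<open>Splits c_n F_n - d f into c_n (F_n - f) and (c_n - d) f. The first part is at most C
  times an L^2-small function; the second tends to zero by dominated convergence with majorant (2
  C)^2 |f|^2, so pointwise convergence of the coefficients is enough.\<close>

lemma L2lim_mult_bounded:
  assumes [measurable]: "\<And>n. borel_fun (F n)" "borel_fun f"
     "\<And>n. borel_fun (c n)" "borel_fun d"
    and lim: "L2lim F f" and fin: "L2sq f < \<infinity>"
    and bd: "\<And>n x. \<bar>c n x\<bar> \<le> C" and cd: "AE x in lborel. (\<lambda>n. c n x) \<longlonglongrightarrow> d x"
  shows "L2lim (\<lambda>n x. c n x *\<^sub>R F n x) (\<lambda>x. d x *\<^sub>R f x)"
proof -
  have C0: "C \<ge> 0" using bd[of 0 undefined] by linarith
  have dom: "(\<lambda>n. L2sq (\<lambda>x. (c n x - d x) *\<^sub>R f x)) \<longlonglongrightarrow> (\<integral>\<^sup>+x. 0 \<partial>(lborel::'a measure))"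
    unfolding L2sq_def
  proof (rule nn_integral_dominated_convergence)
    show "(NNINT x. ennreal ((2 * C)\<^sup>2) * ennreal ((norm (f x))\<^sup>2)) < \<infinity>"
      using fin by (simp add: nn_integral_cmult L2sq_def[symmetric] ennreal_mult_less_top)
    show "AE x in lborel. ennreal ((norm ((c n x - d x) *\<^sub>R f x))\<^sup>2) \<le> ennreal ((2 * C)\<^sup>2) * ennreal ((norm (f x))\<^sup>2)" for n
      using cd
    proof eventually_elim
      case (elim x)
      have "\<bar>d x\<bar> \<le> C"
        by (rule Lim_bounded[OF tendsto_rabs[OF elim], of 0]) (use bd in auto)
      then have "\<bar>c n x - d x\<bar> \<le> 2 * C" using bd[of n x] by linarith
      then have "\<bar>c n x - d x\<bar>\<^sup>2 \<le> (2 * C)\<^sup>2" by (rule power_mono) simp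
      then have "(norm ((c n x - d x) *\<^sub>R f x))\<^sup>2 \<le> (2 * C)\<^sup>2 * (norm (f x))\<^sup>2"
        unfolding norm_scaleR power_mult_distrib[of "\<bar>c n x - d x\<bar>"] by (rule mult_right_mono) simp
      then show ?case by (simp add: ennreal_mult'[symmetric] ennreal_leI)
    qed
    show "AE x in lborel. (\<lambda>n. ennreal ((norm ((c n x - d x) *\<^sub>R f x))\<^sup>2)) \<longlonglongrightarrow> 0"
      using cd
    proof eventually_elim
      case (elim x)
      have "(\<lambda>n. (norm ((c n x - d x) *\<^sub>R f x))\<^sup>2) \<longlonglongrightarrow> (norm ((d x - d x) *\<^sub>R f x))\<^sup>2"
        by (intro tendsto_intros elim)
      then show ?case by (simp add: tendsto_ennreal_iff[where x=0, simplified])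
    qed
  qed auto
  show ?thesis
    unfolding L2lim_def
  proof (rule tendsto_0_ennreal_combination[where a = "\<lambda>n. L2sq (\<lambda>x. F n x - f x)" and b = "\<lambda>n. L2sq (\<lambda>x. (c n x - d x) *\<^sub>R f x)"
        and c = "2 * ennreal (C\<^sup>2)" and d = 2])
    fix n
    have "L2sq (\<lambda>x. c n x *\<^sub>R F n x - d x *\<^sub>R f x) \<le> 2 * L2sq (\<lambda>x. c n x *\<^sub>R (F n x - f x)) + 2 * L2sq (\<lambda>x. (c n x - d x) *\<^sub>R f x)"
      using L2sq_add[of "\<lambda>x. c n x *\<^sub>R (F n x - f x)" "\<lambda>x. (c n x - d x) *\<^sub>R f x"]
      by (simp add: algebra_simps)
    also have "L2sq (\<lambda>x. c n x *\<^sub>R (F n x - f x)) \<le> L2sq (\<lambda>x. C *\<^sub>R (F n x - f x))"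
      using bd C0 by (intro L2sq_mono) (auto intro!: mult_right_mono)
    also have "\<dots> = ennreal (C\<^sup>2) * L2sq (\<lambda>x. F n x - f x)" by (rule L2sq_scaleR) auto
    finally show "L2sq (\<lambda>x. c n x *\<^sub>R F n x - d x *\<^sub>R f x) \<le> 2 * ennreal (C\<^sup>2) * L2sq (\<lambda>x. F n x - f x) + 2 * L2sq (\<lambda>x. (c n x - d x) *\<^sub>R f x)"
      by (simp add: mult.assoc mult_left_mono add_right_mono)
  qed (use lim dom in \<open>auto simp: L2lim_def ennreal_mult_less_top\<close>)
qed

lemma L2lim_scaleR:
  assumes [measurable]: "\<And>n. borel_fun (F n)" "borel_fun f"
    and lim: "L2lim F f"
  shows "L2lim (\<lambda>n x. c *\<^sub>R F n x) (\<lambda>x. c *\<^sub>R f x)"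
  unfolding L2lim_def
proof (rule tendsto_0_ennreal_combination[OF lim[unfolded L2lim_def] tendsto_const, of "ennreal (c\<^sup>2)" 0])
  fix n
  have "L2sq (\<lambda>x. c *\<^sub>R F n x - c *\<^sub>R f x) = L2sq (\<lambda>x. c *\<^sub>R (F n x - f x))" by (simp add: algebra_simps)
  then show "L2sq (\<lambda>x. c *\<^sub>R F n x - c *\<^sub>R f x) \<le> ennreal (c\<^sup>2) * L2sq (\<lambda>x. F n x - f x) + 0 * 0"
    by (simp add: L2sq_scaleR)
qed auto

text \<open>\<open>L2sq_add_eps\<close> in both directions compares the squared norms up to the
  factor 1 + e and an error that vanishes for fixed e. Letting n grow before e shrinks gives
  convergence of the squared norms.\<close>

lemma L2lim_norm:
  assumes [measurable]: "\<And>n. borel_fun (F n)" "borel_fun f"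
    and lim: "L2lim F f" and fin: "L2sq f < \<infinity>" "\<And>n. L2sq (F n) < \<infinity>"
  shows "(\<lambda>n. enn2real (L2sq (F n))) \<longlonglongrightarrow> enn2real (L2sq f)"
proof -
  define D where "D n = enn2real (L2sq (\<lambda>x. F n x - f x))" for n
  have Dfin: "L2sq (\<lambda>x. F n x - f x) < \<infinity>" for n by (rule L2sq_finite_diff) (use fin in auto)
  have D0: "D \<longlonglongrightarrow> 0"
  proof -
    have "(\<lambda>n. ennreal (D n)) \<longlonglongrightarrow> ennreal 0"
      using lim Dfin by (simp add: D_def L2lim_def)
    then show ?thesis by (subst (asm) tendsto_ennreal_iff) (auto simp: D_def)
  qed
  have up: "enn2real (L2sq (F n)) \<le> (1 + e) * enn2real (L2sq f) + (1 + 1/e) * D n" if "e > 0" for e n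
  proof -
    have "L2sq (F n) \<le> ennreal (1 + e) * L2sq f + ennreal (1 + 1/e) * L2sq (\<lambda>x. F n x - f x)"
      using L2sq_add_eps[of f "\<lambda>x. F n x - f x" e] that by simp
    also have "\<dots> = ennreal ((1 + e) * enn2real (L2sq f) + (1 + 1/e) * D n)"
      unfolding D_def using that fin(1) Dfin[of n]
      by (subst ennreal_plus) (auto simp: ennreal_mult)
    finally have "enn2real (L2sq (F n)) \<le> enn2real (ennreal ((1 + e) * enn2real (L2sq f) + (1 + 1/e) * D n))"
      by (intro enn2real_mono) auto
    then show ?thesis using that by (subst (asm) enn2real_ennreal) (auto simp: D_def)
  qed
  have low: "enn2real (L2sq f) \<le> (1 + e) * enn2real (L2sq (F n)) + (1 + 1/e) * D n" if "e > 0" for e n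
  proof -
    have "L2sq f \<le> ennreal (1 + e) * L2sq (F n) + ennreal (1 + 1/e) * L2sq (\<lambda>x. f x - F n x)"
      using L2sq_add_eps[of "F n" "\<lambda>x. f x - F n x" e] that by simp
    also have "L2sq (\<lambda>x. f x - F n x) = L2sq (\<lambda>x. F n x - f x)" by (rule L2sq_commute)
    also have "ennreal (1 + e) * L2sq (F n) + ennreal (1 + 1/e) * L2sq (\<lambda>x. F n x - f x)
       = ennreal ((1 + e) * enn2real (L2sq (F n)) + (1 + 1/e) * D n)"
      unfolding D_def using that fin Dfin[of n]
      by (subst ennreal_plus) (auto simp: ennreal_mult)
    finally have "enn2real (L2sq f) \<le> enn2real (ennreal ((1 + e) * enn2real (L2sq (F n)) + (1 + 1/e) * D n))"
      by (intro enn2real_mono) auto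
    then show ?thesis using that by (subst (asm) enn2real_ennreal) (auto simp: D_def)
  qed
  define s where "s = enn2real (L2sq f)"
  have s0: "s \<ge> 0" by (simp add: s_def)
  show ?thesis unfolding s_def[symmetric]
  proof (rule LIMSEQ_I)
    fix r :: real assume r: "r > 0"
    \<comment> \<open>With this e the product e * (s + r + 1) is at most r/4. The upper estimate
      first yields a < s + r, so that e * a is at most r/4 as well and the lower estimate can be
      closed.\<close>
    define e where "e = min 1 (r / (4 * (s + r + 1)))"
    have e: "e > 0" "e \<le> 1" using r s0 by (auto simp: e_def)
    have "e \<le> r / (4 * (s + r + 1))" by (simp add: e_def)
    then have "e * (4 * (s + r + 1)) \<le> r" using r s0 by (subst (asm) pos_le_divide_eq) auto
    then have er: "e * (s + r + 1) \<le> r / 4" by (simp only: mult.left_commute[of e 4])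
    have "(\<lambda>n. (1 + 1/e) * D n) \<longlonglongrightarrow> (1 + 1/e) * 0" by (intro tendsto_intros D0)
    then have "eventually (\<lambda>n. (1 + 1/e) * D n < r / 4) sequentially"
      using r by (intro order_tendstoD) auto
    then obtain N where N: "\<And>n. n \<ge> N \<Longrightarrow> (1 + 1/e) * D n < r / 4" by (auto simp: eventually_sequentially)
    show "\<exists>no. \<forall>n\<ge>no. norm (enn2real (L2sq (F n)) - s) < r"
    proof (intro exI allI impI)
      fix n assume n: "n \<ge> N"
      define a where "a = enn2real (L2sq (F n))"
      have a0: "a \<ge> 0" by (simp add: a_def)
      have 1: "a \<le> s + e * s + r / 4" using up[OF e(1), of n] N[OF n] unfolding a_def s_def distrib_right[of 1 e] by linarith
      have 2: "s \<le> a + e * a + r / 4" using low[OF e(1), of n] N[OF n] unfolding a_def s_def distrib_right[of 1 e] by linarith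
      have es: "e * s \<le> r / 4" using er mult_left_mono[of s "s + r + 1" e] e r by linarith
      have "a < s + r" using 1 es r by linarith
      then have "e * a \<le> r / 4" using er mult_left_mono[of a "s + r + 1" e] e by linarith
      then have "\<bar>a - s\<bar> < r" using 1 2 es r by linarith
      then show "norm (enn2real (L2sq (F n)) - s) < r" by (simp only: a_def real_norm_def)
    qed
  qed
qed

lemma tendsto_0_of_sq_le:
  fixes a b :: "nat \<Rightarrow> real"
  assumes le: "\<And>n. (a n)\<^sup>2 \<le> b n" and b: "b \<longlonglongrightarrow> 0"
  shows "a \<longlonglongrightarrow> 0"
proof -
  have "(\<lambda>n. (a n)\<^sup>2) \<longlonglongrightarrow> 0"
    by (rule tendsto_sandwich[OF _ _ tendsto_const b]) (simp_all add: le)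
  then show ?thesis by (simp add: tendsto_power_zero power_tendsto_0_iff)
qed

lemma L2lim_inner:
  fixes f g :: "'a::euclidean_space \<Rightarrow> 'b::euclidean_space"
  assumes [measurable]: "\<And>n. borel_fun (F n)" "borel_fun f" "borel_fun g"
    and lim: "L2lim F f" and fin: "\<And>n. L2sq (F n) < \<infinity>" "L2sq f < \<infinity>" "L2sq g < \<infinity>"
  shows "(\<lambda>n. (LBINT x. F n x \<bullet> g x)) \<longlonglongrightarrow> (LBINT x. f x \<bullet> g x)"
proof -
  have Dfin: "L2sq (\<lambda>x. F n x - f x) < \<infinity>" for n by (rule L2sq_finite_diff) (use fin in auto)
  have "(\<lambda>n. ennreal (enn2real (L2sq (\<lambda>x. F n x - f x)))) \<longlonglongrightarrow> ennreal 0"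
    using lim Dfin by (simp add: L2lim_def)
  then have D0: "(\<lambda>n. enn2real (L2sq (\<lambda>x. F n x - f x))) \<longlonglongrightarrow> 0"
    by (subst (asm) tendsto_ennreal_iff) auto
  have eq: "(LBINT x. F n x \<bullet> g x) - (LBINT x. f x \<bullet> g x) = (LBINT x. (F n x - f x) \<bullet> g x)" for n
    by (subst Bochner_Integration.integral_diff[symmetric])
      (auto intro!: L2_inner_integrable fin simp: inner_diff_left)
  have b: "((LBINT x. F n x \<bullet> g x) - (LBINT x. f x \<bullet> g x))\<^sup>2
      \<le> enn2real (L2sq (\<lambda>x. F n x - f x)) * enn2real (L2sq g)" for n
    unfolding eq by (rule L2_inner_bound) (use Dfin fin in auto)
  have "(\<lambda>n. enn2real (L2sq (\<lambda>x. F n x - f x)) * enn2real (L2sq g)) \<longlonglongrightarrow> 0"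
    using tendsto_mult[OF D0 tendsto_const] by simp
  from tendsto_0_of_sq_le[OF b this] show ?thesis by (subst (asm) LIM_zero_iff)
qed

text \<open>The weight 2^k keeps the integral of the sum of 2^k |F (k+1) - F k|^2 finite, because
  2^k 4^(-k) = 2^(-k). Almost everywhere the squared increments are therefore O(2^(-k)), and the
  increments are summable.\<close>

lemma L2sq_fast_AE_Cauchy:
  fixes F :: "nat \<Rightarrow> 'a::euclidean_space \<Rightarrow> 'b::{banach, second_countable_topology}"
  assumes [measurable]: "\<And>n. borel_fun (F n)"
    and fast: "\<And>k. L2sq (\<lambda>x. F (Suc k) x - F k x) \<le> ennreal ((1/4)^k)"
  shows "AE x in lborel. convergent (\<lambda>k. F k x)"
proof -
  have "(NNINT x. (\<Sum>k. ennreal (2^k) * ennreal ((norm (F (Suc k) x - F k x))\<^sup>2)))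
     = (\<Sum>k. ennreal (2^k) * L2sq (\<lambda>x. F (Suc k) x - F k x))"
    unfolding L2sq_def by (subst nn_integral_suminf) (auto simp: nn_integral_cmult)
  also have "\<dots> \<le> (\<Sum>k. ennreal ((1/2)^k))"
  proof (rule suminf_le)
    fix k
    have "ennreal (2^k) * L2sq (\<lambda>x. F (Suc k) x - F k x) \<le> ennreal (2^k) * ennreal ((1/4)^k)"
      by (intro mult_left_mono fast) simp
    also have "\<dots> = ennreal ((1/2)^k)"
      by (subst ennreal_mult'[symmetric]) (auto simp: power_mult_distrib[symmetric])
    finally show "ennreal (2^k) * L2sq (\<lambda>x. F (Suc k) x - F k x) \<le> ennreal ((1/2)^k)" .
  qed auto
  also have "\<dots> < \<infinity>"
    by (subst suminf_ennreal2) auto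
  finally have "AE x in lborel. (\<Sum>k. ennreal (2^k) * ennreal ((norm (F (Suc k) x - F k x))\<^sup>2)) \<noteq> \<infinity>"
    by (intro nn_integral_PInf_AE) auto
  then show ?thesis
  proof eventually_elim
    case (elim x)
    define d where "d k = norm (F (Suc k) x - F k x)" for k
    define C where "C = enn2real (\<Sum>k. ennreal (2^k) * ennreal ((d k)\<^sup>2))"
    have "2^k * (d k)\<^sup>2 \<le> C" for k
    proof -
      have "ennreal (2^k) * ennreal ((d k)\<^sup>2) \<le> (\<Sum>k. ennreal (2^k) * ennreal ((d k)\<^sup>2))"
        using sum_le_suminf[of "\<lambda>k. ennreal (2^k) * ennreal ((d k)\<^sup>2)" "{k}"] by auto
      also have "\<dots> = ennreal C" using elim by (simp add: C_def d_def less_top)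
      finally show ?thesis by (simp add: ennreal_mult'[symmetric] C_def)
    qed
    then have dk: "(d k)\<^sup>2 \<le> C * (1/2)^k" for k by (simp add: field_simps)
    have C0: "C \<ge> 0" by (simp add: C_def)
    \<comment> \<open>The ratio 3/4 dominates the square root of 1/2 because 1/2 <= 9/16, and C + 1
      serves because C <= (C + 1)^2.\<close>
    have "d k \<le> (C + 1) * (3/4)^k" for k
    proof (rule power2_le_imp_le)
      have "(d k)\<^sup>2 \<le> C * (1/2)^k" by (rule dk)
      also have "\<dots> \<le> (C + 1)\<^sup>2 * (9/16)^k"
        using C0 by (intro mult_mono power_mono) (auto simp: power2_eq_square algebra_simps)
      also have "(9/16::real)^k = (3/4)^k * (3/4)^k" by (simp flip: power_mult_distrib)
      finally show "(d k)\<^sup>2 \<le> ((C + 1) * (3/4)^k)\<^sup>2" by (simp add: power2_eq_square mult_ac)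
      show "0 \<le> (C + 1) * (3/4)^k" using C0 by simp
    qed
    then have dle: "norm (F (Suc k) x - F k x) \<le> (C + 1) * (3/4)^k" for k by (simp add: d_def)
    have "summable (\<lambda>k. (C + 1) * (3/4::real)^k)"
      by (rule summable_mult, rule summable_geometric) simp
    then have "summable (\<lambda>k. F (Suc k) x - F k x)"
      by (rule summable_comparison_test') (rule dle)
    then have "convergent (\<lambda>n. F n x - F 0 x)"
      unfolding summable_iff_convergent sum_lessThan_telescope[of "\<lambda>k. F k x"] .
    then have "convergent (\<lambda>n. F n x - F 0 x + F 0 x)"
      by (rule convergent_add) (rule convergent_const)
    then show ?case by simp
  qed
qed

text \<open>Riesz-Fischer, stated together with the almost everywhere convergent subsequence because
  later arguments need both.\<close>

lemma L2_complete:
  fixes F :: "nat \<Rightarrow> 'a::euclidean_space \<Rightarrow> 'b::{banach, second_countable_topology}"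
  assumes meas [measurable]: "\<And>n. borel_fun (F n)"
    and Cauchy: "\<And>e. e > (0::real) \<Longrightarrow> \<exists>N. \<forall>m\<ge>N. \<forall>n\<ge>N. L2sq (\<lambda>x. F m x - F n x) \<le> ennreal e"
  shows "\<exists>f r. borel_fun f \<and> L2lim F f \<and> strict_mono r \<and> (AE x in lborel. (\<lambda>k. F (r k) x) \<longlonglongrightarrow> f x)"
proof -
  have "\<forall>k. \<exists>N. \<forall>m\<ge>N. \<forall>n\<ge>N. L2sq (\<lambda>x. F m x - F n x) \<le> ennreal ((1/4)^k)"
    using Cauchy by simp
  from choice[OF this] obtain N where "\<forall>k. \<forall>m\<ge>N k. \<forall>n\<ge>N k. L2sq (\<lambda>x. F m x - F n x) \<le> ennreal ((1/4)^k)"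
    by (rule exE)
  then have N: "\<And>k m n. m \<ge> N k \<Longrightarrow> n \<ge> N k \<Longrightarrow> L2sq (\<lambda>x. F m x - F n x) \<le> ennreal ((1/4)^k)"
    by blast
  \<comment> \<open>The maximum with \<open>Suc s\<close> makes the indices strictly increasing
    while they stay above the thresholds N k.\<close>
  define r where "r = rec_nat (N 0) (\<lambda>k s. max (Suc s) (N (Suc k)))"
  have r_Suc: "r (Suc k) = max (Suc (r k)) (N (Suc k))" for k by (simp add: r_def)
  have r_mono: "strict_mono r" by (intro strict_mono_Suc_iff[THEN iffD2]) (auto simp: r_Suc)
  have rN: "r k \<ge> N k" for k by (cases k) (auto simp: r_Suc, simp add: r_def)
  have "AE x in lborel. convergent (\<lambda>k. F (r k) x)"
  proof (rule L2sq_fast_AE_Cauchy)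
    fix k
    have "r (Suc k) \<ge> N k" using rN[of k] r_mono by (meson lessI less_imp_le order_trans strict_monoD)
    then show "L2sq (\<lambda>x. F (r (Suc k)) x - F (r k) x) \<le> ennreal ((1/4)^k)" by (intro N rN) 
  qed simp
  then have ae: "AE x in lborel. (\<lambda>k. F (r k) x) \<longlonglongrightarrow> lim (\<lambda>k. F (r k) x)"
    by eventually_elim (simp add: convergent_LIMSEQ_iff)
  define f where "f x = lim (\<lambda>k. F (r k) x)" for x
  have f_meas [measurable]: "borel_fun f" unfolding f_def by measurable
  have "L2lim F f" unfolding L2lim_def
  proof (rule order_tendstoI)
    fix a :: ennreal assume "a > 0"
    then obtain b where b: "0 < b" "b < a" using dense by blast
    define e where "e = enn2real b"
    have "b < top" using b(2) by (rule order_less_le_trans) simp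
    then have e: "e > 0" "ennreal e < a" using b by (auto simp: e_def enn2real_positive_iff)
    then obtain M where M: "\<And>m n. m \<ge> M \<Longrightarrow> n \<ge> M \<Longrightarrow> L2sq (\<lambda>x. F m x - F n x) \<le> ennreal e" using Cauchy by meson
    show "\<forall>\<^sub>F n in sequentially. L2sq (\<lambda>x. F n x - f x) < a"
      using eventually_ge_at_top[of M]
    proof eventually_elim
      case (elim n)
      \<comment> \<open>Fatou along the subsequence turns the Cauchy estimate for F n - F (r k) into
        the estimate for F n - f.\<close>
      have "L2sq (\<lambda>x. F n x - f x) = (NNINT x. liminf (\<lambda>k. ennreal ((norm (F n x - F (r k) x))\<^sup>2)))"
        unfolding L2sq_def
      proof (rule nn_integral_cong_AE)
        show "AE x in lborel. ennreal ((norm (F n x - f x))\<^sup>2) = liminf (\<lambda>k. ennreal ((norm (F n x - F (r k) x))\<^sup>2))"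
          using ae
        proof eventually_elim
          case (elim x)
          have "(\<lambda>k. (norm (F n x - F (r k) x))\<^sup>2) \<longlonglongrightarrow> (norm (F n x - f x))\<^sup>2"
            unfolding f_def by (intro tendsto_intros elim)
          from lim_imp_Liminf[OF _ tendsto_ennrealI[OF this]] show ?case by simp
        qed
      qed
      also have "\<dots> \<le> liminf (\<lambda>k. L2sq (\<lambda>x. F n x - F (r k) x))"
        unfolding L2sq_def by (rule nn_integral_liminf) auto
      also have "\<dots> \<le> ennreal e"
      proof (rule Liminf_le)
        show "\<forall>\<^sub>F k in sequentially. L2sq (\<lambda>x. F n x - F (r k) x) \<le> ennreal e"
          using eventually_ge_at_top[of M]
        proof eventually_elim
          case (elim k)
          then show ?case using \<open>M \<le> n\<close> by (intro M) (use seq_suble[OF r_mono, of k] in auto)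
        qed
      qed simp
      finally show ?case using e by order
    qed
  qed auto
  then show ?thesis using ae r_mono f_meas unfolding f_def by blast
qed

text \<open>The sequence is Cauchy, so completeness yields a subsequence converging almost
  everywhere to some g, and g = f almost everywhere because L^2 limits are unique.\<close>

lemma L2lim_AE_subseq:
  fixes f :: "'a::euclidean_space \<Rightarrow> 'b::{banach, second_countable_topology}"
  assumes meas [measurable]: "\<And>n. borel_fun (F n)" "borel_fun f"
    and lim: "L2lim F f"
  shows "\<exists>r. strict_mono r \<and> (AE x in lborel. (\<lambda>k. F (r k) x) \<longlonglongrightarrow> f x)"
proof -
  have "\<exists>N. \<forall>m\<ge>N. \<forall>n\<ge>N. L2sq (\<lambda>x. F m x - F n x) \<le> ennreal e" if "e > 0" for e :: real
  proof -
    have "eventually (\<lambda>n. L2sq (\<lambda>x. F n x - f x) < ennreal (e/4)) sequentially"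
      by (rule L2limD[OF lim]) (use that in simp)
    then obtain N where N: "\<And>n. n \<ge> N \<Longrightarrow> L2sq (\<lambda>x. F n x - f x) < ennreal (e/4)"
      by (auto simp: eventually_sequentially)
    have "L2sq (\<lambda>x. F m x - F n x) \<le> ennreal e" if "m \<ge> N" "n \<ge> N" for m n
    proof -
      have "L2sq (\<lambda>x. F m x - F n x) \<le> 2 * L2sq (\<lambda>x. F m x - f x) + 2 * L2sq (\<lambda>x. f x - F n x)"
        by (rule L2sq_triangle) auto
      also have "L2sq (\<lambda>x. f x - F n x) = L2sq (\<lambda>x. F n x - f x)" by (rule L2sq_commute)
      also have "2 * L2sq (\<lambda>x. F m x - f x) + 2 * L2sq (\<lambda>x. F n x - f x) \<le> 2 * ennreal (e/4) + 2 * ennreal (e/4)"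
        using N that by (intro add_mono mult_left_mono) (auto intro: less_imp_le)
      also have "\<dots> = ennreal e"
        using \<open>e > 0\<close> by (simp add: ennreal_mult'[symmetric] ennreal_plus[symmetric] del: ennreal_plus ennreal_numeral flip: ennreal_numeral)
      finally show ?thesis .
    qed
    then show ?thesis by blast
  qed
  from L2_complete[of F, OF meas(1) this] obtain g r where
    g [measurable]: "borel_fun g" "L2lim F g" and r: "strict_mono r"
    and ae: "AE x in lborel. (\<lambda>k. F (r k) x) \<longlonglongrightarrow> g x" by blast
  have "(\<lambda>n. L2sq (\<lambda>x. f x - g x)) \<longlonglongrightarrow> 0"
  proof (rule tendsto_0_ennreal_combination[OF lim[unfolded L2lim_def] g(2)[unfolded L2lim_def], of 2 2])
    fix n show "L2sq (\<lambda>x. f x - g x) \<le> 2 * L2sq (\<lambda>x. F n x - f x) + 2 * L2sq (\<lambda>x. F n x - g x)"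
      using L2sq_triangle[of f "F n" g] by (simp add: L2sq_commute[of f])
  qed auto
  then have "L2sq (\<lambda>x. f x - g x) = 0" by (simp add: LIMSEQ_const_iff)
  then have "AE x in lborel. f x - g x = 0" by (intro L2sq_eq_0_AE) auto
  with ae have "AE x in lborel. (\<lambda>k. F (r k) x) \<longlonglongrightarrow> f x" by eventually_elim simp
  with r show ?thesis by blast
qed

section \<open>Smooth functions with compact support\<close>

definition gr :: "(R3 \<Rightarrow> real) \<Rightarrow> R3 \<Rightarrow> R3" where
  "gr g x = (\<chi> i. partial i g x)"

lemma gr_nth [simp]: "gr g x $ i = partial i g x"
  by (simp add: gr_def)

lemma partial_eq: "(g has_derivative D) (at x) \<Longrightarrow> partial i g x = D (axis i 1)"
  unfolding partial_def by (simp add: frechet_derivative_at[symmetric])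

lemma gr_eqI: "(g has_derivative (\<lambda>v. w \<bullet> v)) (at x) \<Longrightarrow> gr g x = w"
  by (simp add: vec_eq_iff partial_eq inner_axis)

lemma has_derivative_gr:
  assumes "g differentiable (at x)"
  shows "(g has_derivative (\<lambda>v. gr g x \<bullet> v)) (at x)"
proof -
  have D: "(g has_derivative frechet_derivative g (at x)) (at x)"
    using assms by (simp add: frechet_derivative_works)
  have "frechet_derivative g (at x) v = gr g x \<bullet> v" for v
  proof -
    have lin: "linear (frechet_derivative g (at x))" using D by (rule has_derivative_linear)
    have "v = (\<Sum>i\<in>UNIV. v $ i *\<^sub>R axis i 1)"
      using basis_expansion[of v] by (simp add: scalar_mult_eq_scaleR)
    then have "frechet_derivative g (at x) v = frechet_derivative g (at x) (\<Sum>i\<in>UNIV. v $ i *\<^sub>R axis i 1)" by simp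
    also have "\<dots> = (\<Sum>i\<in>UNIV. v $ i * frechet_derivative g (at x) (axis i 1))"
      by (simp add: linear_sum[OF lin] linear_cmul[OF lin])
    also have "\<dots> = gr g x \<bullet> v" by (simp add: inner_vec_def partial_def mult.commute)
    finally show ?thesis .
  qed
  then have "frechet_derivative g (at x) = (\<lambda>v. gr g x \<bullet> v)" by auto
  with D show ?thesis by simp
qed

lemma Ck_SucD: "Ck (Suc k) g \<Longrightarrow> Ck k g"
proof (induction k arbitrary: g)
  case (Suc k)
  then have "Ck k (partial i g)" for i by simp
  with Suc.prems show ?case by simp
qed simp

text \<open>The form in which regularity is proved by induction: exhibit the gradient w and check
  its components one order lower.\<close>

lemma Ck_SucI:
  assumes "\<And>x. (g has_derivative (\<lambda>v. w x \<bullet> v)) (at x)" "\<And>i. Ck k (\<lambda>x. w x $ i)"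
  shows "Ck (Suc k) g"
proof -
  have "g differentiable_on UNIV" using assms(1) by (auto simp: differentiable_on_def differentiable_def)
  moreover have "partial i g = (\<lambda>x. w x $ i)" for i
    by (intro ext) (simp add: partial_eq[OF assms(1)] inner_axis)
  moreover have "continuous_on UNIV g"
    by (rule differentiable_imp_continuous_on) fact
  ultimately show ?thesis using assms(2) by simp
qed

lemma Ck_Suc_has_derivative: "Ck (Suc k) g \<Longrightarrow> (g has_derivative (\<lambda>v. gr g x \<bullet> v)) (at x)"
  by (rule has_derivative_gr) (auto simp: differentiable_on_def)

lemma Ck_const: "Ck k (\<lambda>x. c)"
proof (induction k arbitrary: c)
  case (Suc k)
  show ?case by (rule Ck_SucI[where w="\<lambda>x. 0"]) (auto simp: Suc)
qed simp

lemma Ck_add: "Ck k g \<Longrightarrow> Ck k h \<Longrightarrow> Ck k (\<lambda>x. g x + h x)"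
proof (induction k arbitrary: g h)
  case (Suc k)
  show ?case
  proof (rule Ck_SucI[where w="\<lambda>x. gr g x + gr h x"])
    show "((\<lambda>x. g x + h x) has_derivative (\<lambda>v. (gr g x + gr h x) \<bullet> v)) (at x)" for x
      using has_derivative_add[OF Ck_Suc_has_derivative[OF Suc.prems(1)] Ck_Suc_has_derivative[OF Suc.prems(2)]]
      by (simp add: inner_add_left)
    show "Ck k (\<lambda>x. (gr g x + gr h x) $ i)" for i using Suc by simp
  qed
qed (auto intro: continuous_on_add)

lemma Ck_mult: "Ck k g \<Longrightarrow> Ck k h \<Longrightarrow> Ck k (\<lambda>x. g x * h x)"
proof (induction k arbitrary: g h)
  case (Suc k)
  show ?case
  proof (rule Ck_SucI[where w="\<lambda>x. g x *\<^sub>R gr h x + h x *\<^sub>R gr g x"])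
    show "((\<lambda>x. g x * h x) has_derivative (\<lambda>v. (g x *\<^sub>R gr h x + h x *\<^sub>R gr g x) \<bullet> v)) (at x)" for x
      using has_derivative_mult[OF Ck_Suc_has_derivative[OF Suc.prems(1)] Ck_Suc_has_derivative[OF Suc.prems(2)]]
      by (simp add: inner_add_left algebra_simps)
    show "Ck k (\<lambda>x. (g x *\<^sub>R gr h x + h x *\<^sub>R gr g x) $ i)" for i
      using Suc Ck_SucD by (auto intro!: Ck_add Suc.IH simp del: Ck.simps) auto
  qed
qed (auto intro: continuous_on_mult)

lemma Ck_sum: "finite S \<Longrightarrow> (\<And>s. s \<in> S \<Longrightarrow> Ck k (g s)) \<Longrightarrow> Ck k (\<lambda>x. \<Sum>s\<in>S. g s x)"
  by (induction S rule: finite_induct) (auto intro: Ck_const Ck_add)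

lemma Ck_proj: "Ck k (\<lambda>x. x $ i)"
proof (cases k)
  case (Suc m)
  have "((\<lambda>x::R3. x $ i) has_derivative (\<lambda>v. axis i 1 \<bullet> v)) (at x)" for x
    by (simp add: inner_axis' bounded_linear_imp_has_derivative bounded_linear_vec_nth)
  then show ?thesis unfolding Suc by (rule Ck_SucI) (rule Ck_const)
qed (auto intro: continuous_intros)

lemma Ck_affine: "Ck k g \<Longrightarrow> Ck k (\<lambda>x. g (c *\<^sub>R x + a))"
proof (induction k arbitrary: g)
  case 0
  then show ?case by (auto intro!: continuous_on_compose2[of UNIV g] continuous_intros)
next
  case (Suc k)
  show ?case
  proof (rule Ck_SucI[where w="\<lambda>x. c *\<^sub>R gr g (c *\<^sub>R x + a)"])
    show "((\<lambda>x. g (c *\<^sub>R x + a)) has_derivative (\<lambda>v. (c *\<^sub>R gr g (c *\<^sub>R x + a)) \<bullet> v)) (at x)" for x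
    proof -
      have "((\<lambda>x. c *\<^sub>R x + a) has_derivative (\<lambda>v. c *\<^sub>R v)) (at x)" by (auto intro!: derivative_eq_intros)
      from has_derivative_compose[OF this Ck_Suc_has_derivative[OF Suc.prems]] show ?thesis by simp
    qed
    show "Ck k (\<lambda>x. (c *\<^sub>R gr g (c *\<^sub>R x + a)) $ i)" for i
      using Suc by (auto intro!: Ck_mult Ck_const)
  qed
qed

lemma gr_affine:
  assumes "g differentiable (at (c *\<^sub>R x + a))"
  shows "gr (\<lambda>x. g (c *\<^sub>R x + a)) x = c *\<^sub>R gr g (c *\<^sub>R x + a)"
proof (rule gr_eqI)
  have "((\<lambda>x. c *\<^sub>R x + a) has_derivative (\<lambda>v. c *\<^sub>R v)) (at x)" by (auto intro!: derivative_eq_intros)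
  from has_derivative_compose[OF this has_derivative_gr[OF assms]]
  show "((\<lambda>x. g (c *\<^sub>R x + a)) has_derivative (\<lambda>v. (c *\<^sub>R gr g (c *\<^sub>R x + a)) \<bullet> v)) (at x)" by simp
qed

text \<open>The chain rule sends h k to h (Suc k), so the induction on n has to treat all members of
  the family at once.\<close>

lemma Ck_compose_family:
  assumes h: "\<And>k t. (h k has_real_derivative h (Suc k) t) (at t)"
  shows "Ck n r \<Longrightarrow> Ck n (\<lambda>x. h k (r x))"
proof (induction n arbitrary: k)
  case 0
  have "continuous_on UNIV (h k)"
    using h by (meson DERIV_isCont continuous_at_imp_continuous_on)
  then show ?case using 0 by (auto intro: continuous_on_compose2)
next
  case (Suc n)
  show ?case
  proof (rule Ck_SucI[where w="\<lambda>x. h (Suc k) (r x) *\<^sub>R gr r x"])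
    show "((\<lambda>x. h k (r x)) has_derivative (\<lambda>v. (h (Suc k) (r x) *\<^sub>R gr r x) \<bullet> v)) (at x)" for x
      using has_derivative_compose[OF Ck_Suc_has_derivative[OF Suc.prems] h[of k, unfolded has_field_derivative_def]]
      by (simp add: mult.commute)
    have "Ck n (\<lambda>x. h (Suc k) (r x))" using Suc.IH Ck_SucD[OF Suc.prems] by blast
    moreover have "Ck n (partial i r)" for i using Suc.prems by simp
    ultimately show "Ck n (\<lambda>x. (h (Suc k) (r x) *\<^sub>R gr r x) $ i)" for i
      by (auto intro!: Ck_mult)
  qed
qed

section \<open>A flat exponential and the smooth bump built from it\<close>

lemma poly_times_exp_minus_tendsto_0: "((\<lambda>s. poly q s * exp (- s)) \<longlongrightarrow> (0::real)) at_top"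
proof -
  have "((\<lambda>s. \<Sum>i\<le>degree q. coeff q i * (s ^ i / exp s)) \<longlongrightarrow> (\<Sum>i\<le>degree q. coeff q i * 0)) at_top"
    by (intro tendsto_sum tendsto_mult tendsto_const tendsto_power_div_exp_0)
  then show ?thesis
    by (simp add: poly_altdef sum_distrib_right exp_minus divide_inverse mult.assoc)
qed

text \<open>The functions q(1/t) exp(-1/t), extended by zero to t <= 0. Carrying an arbitrary
  polynomial q makes the class closed under differentiation.\<close>

definition flat :: "real poly \<Rightarrow> real \<Rightarrow> real" where
  "flat q t = (if t \<le> 0 then 0 else poly q (1/t) * exp (- (1/t)))"

text \<open>For t > 0 the inner derivative of 1/t contributes 1/t^2, that is the polynomial X^2 =
  \<open>[:0,0,1:]\<close>, and the two terms of the product rule give q - q'. At 0 the exponential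
  beats every power of 1/t.\<close>

lemma flat_has_derivative:
  "(flat q has_real_derivative flat ([:0,0,1:] * (q - pderiv q)) t) (at t)"
proof -
  consider "t < 0" | "t = 0" | "t > 0" by linarith
  then show ?thesis
  proof cases
    case 1
    have "((\<lambda>_. 0) has_real_derivative 0) (at t)" by simp
    moreover have "eventually (\<lambda>s. s \<in> {..<0}) (nhds t)"
      using 1 by (intro eventually_nhds_in_open) auto
    then have "eventually (\<lambda>s. 0 = flat q s) (nhds t)"
      by eventually_elim (simp add: flat_def)
    ultimately have "(flat q has_real_derivative 0) (at t)"
      using DERIV_cong_ev[of t t "\<lambda>_. 0" "flat q" 0 0] by simp
    then show ?thesis using 1 by (simp add: flat_def)
  next
    case 2
    have "((\<lambda>y. flat q y / y) \<longlongrightarrow> 0) (at 0)"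
    proof (rule filterlim_split_at_real)
      have "eventually (\<lambda>y::real. y \<in> {..<0}) (at_left 0)" by (simp add: eventually_at_filter)
      then have "eventually (\<lambda>y. flat q y / y = 0) (at_left 0)"
        by eventually_elim (simp add: flat_def)
      then show "((\<lambda>y. flat q y / y) \<longlongrightarrow> 0) (at_left 0)" by (rule tendsto_eventually)
      \<comment> \<open>Dividing by y multiplies the polynomial in 1/y by its variable, which is
        \<open>pCons 0 q\<close>.\<close>
      have "((\<lambda>y. poly (pCons 0 q) (inverse y) * exp (- inverse y)) \<longlongrightarrow> (0::real)) (at_right 0)"
        by (rule filterlim_compose[OF poly_times_exp_minus_tendsto_0 filterlim_inverse_at_top_right])
      moreover have "eventually (\<lambda>y::real. y \<in> {0<..}) (at_right 0)" by (simp add: eventually_at_filter)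
      then have "eventually (\<lambda>y. poly (pCons 0 q) (inverse y) * exp (- inverse y) = flat q y / y) (at_right 0)"
        by eventually_elim (simp add: flat_def field_simps)
      ultimately show "((\<lambda>y. flat q y / y) \<longlongrightarrow> 0) (at_right 0)"
        by (rule Lim_transform_eventually)
    qed
    then have "(flat q has_real_derivative 0) (at 0)"
      by (simp add: has_field_derivative_iff flat_def)
    then show ?thesis using 2 by (simp add: flat_def)
  next
    case 3
    have "((\<lambda>t. poly q (1/t) * exp (- (1/t))) has_real_derivative
        flat ([:0,0,1:] * (q - pderiv q)) t) (at t)"
      using 3 by (auto intro!: derivative_eq_intros poly_DERIV[THEN DERIV_chain2] simp: flat_def field_simps power2_eq_square)
    moreover have "eventually (\<lambda>s. s \<in> {0<..}) (nhds t)"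
      using 3 by (intro eventually_nhds_in_open) auto
    then have "eventually (\<lambda>s. poly q (1/s) * exp (- (1/s)) = flat q s) (nhds t)"
      by eventually_elim (simp add: flat_def)
    ultimately show ?thesis
      using DERIV_cong_ev[of t t "\<lambda>t. poly q (1/t) * exp (- (1/t))" "flat q"] by simp
  qed
qed

text \<open>Iterating q -> X^2 (q - q') from q = 1 lists all derivatives of exp(-1/t) extended by
  zero, the family expected by \<open>Ck_compose_family\<close>.\<close>

lemma Ck_flat: "Ck n r \<Longrightarrow> Ck n (\<lambda>x. flat 1 (r x))"
  using Ck_compose_family[of "\<lambda>k. flat (((\<lambda>q. [:0,0,1:] * (q - pderiv q)) ^^ k) 1)" n r 0] flat_has_derivative
  by simp

text \<open>The squared norm is a polynomial in the coordinates, so the composition is smooth at the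
  origin too.\<close>

definition rbump :: "real \<Rightarrow> R3 \<Rightarrow> real" where
  "rbump e x = flat 1 (e\<^sup>2 - x \<bullet> x)"

lemma smooth_rbump: "smooth (rbump e)"
proof -
  have "Ck n (\<lambda>x::R3. e\<^sup>2 + (-1) * (\<Sum>i\<in>UNIV. x $ i * x $ i))" for n
    by (intro Ck_add Ck_const Ck_mult Ck_sum Ck_proj) auto
  then have "Ck n (\<lambda>x. flat 1 (e\<^sup>2 + (-1) * (\<Sum>i\<in>UNIV. (x::R3) $ i * x $ i)))" for n by (rule Ck_flat)
  then show ?thesis by (simp add: smooth_def rbump_def[abs_def] inner_vec_def)
qed

lemma rbump_nonneg: "rbump e x \<ge> 0"
  by (simp add: rbump_def flat_def)

lemma rbump_pos_iff: "e > 0 \<Longrightarrow> rbump e x > 0 \<longleftrightarrow> norm x < e"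
proof -
  assume e: "e > 0"
  have "rbump e x > 0 \<longleftrightarrow> (norm x)\<^sup>2 < e\<^sup>2"
    by (simp add: rbump_def flat_def power2_norm_eq_inner)
  also have "\<dots> \<longleftrightarrow> norm x < e"
    using e power_strict_mono[of "norm x" e 2] power2_less_imp_less[of "norm x" e] by auto
  finally show ?thesis .
qed

section \<open>Test functions and compactly supported C^1 functions\<close>

lemma tsupport_subset: "closed K \<Longrightarrow> (\<And>x. x \<notin> K \<Longrightarrow> g x = 0) \<Longrightarrow> tsupport g \<subseteq> K"
  unfolding tsupport_def by (rule closure_minimal) auto

lemma not_in_tsupport: "x \<notin> tsupport g \<Longrightarrow> g x = 0"
  using closure_subset[of "{x. g x \<noteq> 0}"] by (auto simp: tsupport_def)

lemma test_funI:
  assumes "smooth g" "compact K" "K \<subseteq> U" "\<And>x. x \<notin> K \<Longrightarrow> g x = 0"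
  shows "test_fun U g"
proof -
  have "tsupport g \<subseteq> K" by (rule tsupport_subset) (use assms in \<open>auto intro: compact_imp_closed\<close>)
  moreover have "closed (tsupport g)" by (simp add: tsupport_def)
  ultimately show ?thesis using assms(1-3) compact_Int_closed[of K "tsupport g"]
    by (auto simp: test_fun_def Int_absorb1)
qed

lemma test_fun_smooth: "test_fun U g \<Longrightarrow> smooth g"
  by (simp add: test_fun_def)

lemma smooth_Ck: "smooth g \<Longrightarrow> Ck k g"
  by (simp add: smooth_def)

lemma smooth_partial: "smooth g \<Longrightarrow> smooth (partial i g)"
  unfolding smooth_def by (metis Ck.simps(2))

lemma smooth_continuous: "smooth g \<Longrightarrow> continuous_on UNIV g"
  by (metis Ck.simps(1) smooth_def)

lemma smooth_has_derivative: "smooth g \<Longrightarrow> (g has_derivative (\<lambda>v. gr g x \<bullet> v)) (at x)"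
  using Ck_Suc_has_derivative smooth_Ck by blast

lemma smooth_add: "smooth g \<Longrightarrow> smooth h \<Longrightarrow> smooth (\<lambda>x. g x + h x)"
  by (auto simp: smooth_def intro: Ck_add)

lemma smooth_mult: "smooth g \<Longrightarrow> smooth h \<Longrightarrow> smooth (\<lambda>x. g x * h x)"
  by (auto simp: smooth_def intro: Ck_mult)

lemma smooth_const: "smooth (\<lambda>x. c)"
  by (auto simp: smooth_def intro: Ck_const)

lemma smooth_affine: "smooth g \<Longrightarrow> smooth (\<lambda>x. g (c *\<^sub>R x + a))"
  by (auto simp: smooth_def intro: Ck_affine)

definition C1 :: "(R3 \<Rightarrow> real) \<Rightarrow> bool" where
  "C1 g \<longleftrightarrow> (\<forall>x. (g has_derivative (\<lambda>v. gr g x \<bullet> v)) (at x)) \<and> continuous_on UNIV (gr g)"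

text \<open>The compactly supported \<open>C\<^sup>1\<close> functions with support inside \<open>U\<close>: unlike the smooth ones of
  \<open>test_fun\<close>, they are closed under composition with \<open>C\<^sup>1\<close> functions vanishing at the origin.\<close>
definition C1c :: "R3 set \<Rightarrow> (R3 \<Rightarrow> real) \<Rightarrow> bool" where
  "C1c U g \<longleftrightarrow> C1 g \<and> (\<exists>K. compact K \<and> K \<subseteq> U \<and> (\<forall>x. x \<notin> K \<longrightarrow> g x = 0))"

lemma C1I:
  assumes "\<And>x. (g has_derivative (\<lambda>v. w x \<bullet> v)) (at x)" "continuous_on UNIV w"
  shows "C1 g" "gr g = w"
proof -
  show eq: "gr g = w" using gr_eqI[OF assms(1)] by auto
  show "C1 g" using assms by (simp add: C1_def eq)
qed

lemma C1_continuous: "C1 g \<Longrightarrow> continuous_on UNIV g"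
  unfolding C1_def by (meson continuous_at_imp_continuous_on has_derivative_continuous)

lemma C1_derivative: "C1 g \<Longrightarrow> (g has_derivative (\<lambda>v. gr g x \<bullet> v)) (at x)"
  by (simp add: C1_def)

lemma C1_gr_continuous: "C1 g \<Longrightarrow> continuous_on UNIV (gr g)"
  by (simp add: C1_def)

lemma smooth_C1: "smooth g \<Longrightarrow> C1 g"
  unfolding C1_def
  using smooth_has_derivative smooth_continuous[OF smooth_partial]
  by (auto intro!: continuous_on_vec_lambda simp: gr_def[abs_def])

lemma test_fun_C1c: "test_fun U g \<Longrightarrow> C1c U g"
  unfolding C1c_def test_fun_def using smooth_C1 not_in_tsupport by blast

lemma C1c_C1: "C1c U g \<Longrightarrow> C1 g"
  by (simp add: C1c_def)

lemma gr_zero_outside: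
  assumes "closed K" "\<And>x. x \<notin> K \<Longrightarrow> g x = 0" "x \<notin> K"
  shows "gr g x = 0"
proof (rule gr_eqI)
  have "((\<lambda>_. 0) has_derivative (\<lambda>v. 0 \<bullet> v)) (at x)" by simp
  then show "(g has_derivative (\<lambda>v. 0 \<bullet> v)) (at x)"
    by (rule has_derivative_transform_within_open[where s="- K"]) (use assms in auto)
qed

lemma C1c_compact:
  assumes "C1c U g"
  obtains K where "compact K" "K \<subseteq> U" "\<And>x. x \<notin> K \<Longrightarrow> g x = 0" "\<And>x. x \<notin> K \<Longrightarrow> gr g x = 0"
proof -
  obtain K where K: "compact K" "K \<subseteq> U" "\<And>x. x \<notin> K \<Longrightarrow> g x = 0" using assms by (auto simp: C1c_def)
  moreover have "gr g x = 0" if "x \<notin> K" for x using gr_zero_outside[of K g x] K that compact_imp_closed by blast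
  ultimately show ?thesis using that by blast
qed

lemma test_fun_mono: "test_fun U g \<Longrightarrow> U \<subseteq> U' \<Longrightarrow> test_fun U' g"
  by (auto simp: test_fun_def)

lemma test_fun_add: assumes "test_fun U g" "test_fun U h" shows "test_fun U (\<lambda>x. g x + h x)"
  using assms
  by (intro test_funI[of _ "tsupport g \<union> tsupport h"])
    (auto simp: test_fun_def smooth_add not_in_tsupport compact_Un)

lemma test_fun_cmult: assumes "test_fun U g" shows "test_fun U (\<lambda>x. c * g x)"
  using assms
  by (intro test_funI[of _ "tsupport g"])
    (auto simp: test_fun_def smooth_mult smooth_const not_in_tsupport)

lemma test_fun_mult: assumes "test_fun U g" "smooth h" shows "test_fun U (\<lambda>x. h x * g x)"
  using assms
  by (intro test_funI[of _ "tsupport g"])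
    (auto simp: test_fun_def smooth_mult not_in_tsupport)

lemma test_fun_partial: assumes "test_fun U g" shows "test_fun U (partial i g)"
proof -
  have cl: "closed (tsupport g)" by (simp add: tsupport_def)
  have "partial i g x = 0" if "x \<notin> tsupport g" for x
    using gr_zero_outside[OF cl _ that, of g] not_in_tsupport[of _ g] gr_nth[of g x i] by simp
  then show ?thesis using assms by (intro test_funI[of _ "tsupport g"]) (auto simp: test_fun_def smooth_partial)
qed

lemma gr_add: "C1 g \<Longrightarrow> C1 h \<Longrightarrow> gr (\<lambda>x. g x + h x) = (\<lambda>x. gr g x + gr h x)"
  using has_derivative_add[OF C1_derivative C1_derivative, of g h]
  by (intro ext gr_eqI) (simp add: inner_add_left)

lemma gr_cmult: "C1 g \<Longrightarrow> gr (\<lambda>x. c * g x) = (\<lambda>x. c *\<^sub>R gr g x)"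
  using has_derivative_mult_right[OF C1_derivative, of g]
  by (intro ext gr_eqI) simp

lemma gr_mult: "C1 g \<Longrightarrow> C1 h \<Longrightarrow> gr (\<lambda>x. g x * h x) = (\<lambda>x. g x *\<^sub>R gr h x + h x *\<^sub>R gr g x)"
  using has_derivative_mult[OF C1_derivative C1_derivative, of g h]
  by (intro ext gr_eqI) (simp add: inner_add_left algebra_simps)

lemma C1_mult: assumes "C1 g" "C1 h" shows "C1 (\<lambda>x. g x * h x)"
proof (rule C1I(1)[where w="\<lambda>x. g x *\<^sub>R gr h x + h x *\<^sub>R gr g x"])
  show "((\<lambda>x. g x * h x) has_derivative (\<lambda>v. (g x *\<^sub>R gr h x + h x *\<^sub>R gr g x) \<bullet> v)) (at x)" for x
    using has_derivative_mult[OF C1_derivative C1_derivative, of g h] assms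
    by (simp add: inner_add_left algebra_simps)
qed (use assms in \<open>auto intro!: continuous_intros C1_continuous C1_gr_continuous\<close>)

lemma continuous_compact_support_bounded:
  fixes g :: "'a::euclidean_space \<Rightarrow> 'b::{real_normed_vector, second_countable_topology}"
  assumes "continuous_on UNIV g" "compact K" "\<And>x. x \<notin> K \<Longrightarrow> g x = 0"
  obtains B where "B > 0" "\<And>x. norm (g x) \<le> B"
proof -
  have "compact (g ` K)" using assms by (meson compact_continuous_image continuous_on_subset subset_UNIV)
  then obtain B where B: "B > 0" "\<And>x. x \<in> K \<Longrightarrow> norm (g x) \<le> B"
    using compact_imp_bounded bounded_pos by (metis imageI)
  have "norm (g x) \<le> B" for x by (cases "x \<in> K") (use B assms(3) in auto)
  with B that show ?thesis by blast
qed

lemma L2sq_compact_support_finite: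
  fixes g :: "'a::euclidean_space \<Rightarrow> 'b::{real_normed_vector, second_countable_topology}"
  assumes "continuous_on UNIV g" "compact K" "\<And>x. x \<notin> K \<Longrightarrow> g x = 0"
  shows "L2sq g < \<infinity>"
proof -
  obtain B where B: "B > 0" "\<And>x. norm (g x) \<le> B" using continuous_compact_support_bounded[OF assms] by blast
  have "L2sq g \<le> (NNINT x. ennreal (B\<^sup>2) * indicator K x)"
    unfolding L2sq_def
    using B assms(3) by (intro nn_integral_mono) (auto simp: indicator_def intro!: ennreal_leI power_mono)
  also have "\<dots> = ennreal (B\<^sup>2) * emeasure lborel K"
    using assms(2) by (intro nn_integral_cmult_indicator) (auto intro: borel_compact)
  also have "\<dots> < \<infinity>" using emeasure_compact_finite[OF assms(2)] by (simp add: ennreal_mult_less_top)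
  finally show ?thesis .
qed

lemma integrable_compact_support:
  fixes g :: "'a::euclidean_space \<Rightarrow> 'b::{banach,second_countable_topology}"
  assumes "continuous_on UNIV g" "compact K" "\<And>x. x \<notin> K \<Longrightarrow> g x = 0"
  shows "integrable lborel g"
proof -
  have "integrable lborel (\<lambda>x. indicator K x *\<^sub>R g x)"
    using assms by (intro borel_integrable_compact) (auto intro: continuous_on_subset)
  moreover have "(\<lambda>x. indicator K x *\<^sub>R g x) = g" using assms(3) by (auto simp: indicator_def)
  ultimately show ?thesis by simp
qed

lemma C1_measurable [measurable_dest]: "C1 g \<Longrightarrow> borel_fun g"
  by (intro borel_measurable_continuous_onI C1_continuous)

lemma C1_gr_measurable [measurable_dest]: "C1 g \<Longrightarrow> borel_fun (gr g)"
  by (intro borel_measurable_continuous_onI C1_gr_continuous)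

lemma C1c_L2:
  assumes "C1c U g"
  shows "L2sq g < \<infinity>" "L2sq (gr g) < \<infinity>"
proof -
  obtain K where K: "compact K" "\<And>x. x \<notin> K \<Longrightarrow> g x = 0" "\<And>x. x \<notin> K \<Longrightarrow> gr g x = 0"
    using C1c_compact[OF assms] by metis
  note C = C1c_C1[OF assms]
  show "L2sq g < \<infinity>" by (rule L2sq_compact_support_finite[OF C1_continuous[OF C] K(1,2)])
  show "L2sq (gr g) < \<infinity>" by (rule L2sq_compact_support_finite[OF C1_gr_continuous[OF C] K(1,3)])
qed

section \<open>Translation and mollification\<close>

lemma lborel_distr_add_right: "distr lborel borel (\<lambda>x. x + a) = (lborel :: 'a::euclidean_space measure)"
proof -
  have "(\<lambda>x. x + a) = (+) a" by (auto simp: add.commute)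
  then show ?thesis using lborel_distr_plus[of a] by simp
qed

lemma lborel_distr_reflect: "distr lborel borel (\<lambda>x. a - x) = (lborel :: 'a::euclidean_space measure)"
  using lborel_affine[of "-1" a] by (simp add: density_1)

lemma nn_integral_translate:
  fixes f :: "'a::euclidean_space \<Rightarrow> ennreal"
  assumes [measurable]: "borel_fun f"
  shows "(NNINT x. f (x + a)) = (NNINT x. f x)"
  by (subst (2) lborel_distr_add_right[of a, symmetric]) (simp add: nn_integral_distr)

lemma integral_translate:
  fixes f :: "'a::euclidean_space \<Rightarrow> real"
  assumes [measurable]: "borel_fun f"
  shows "(LBINT x. f (x + a)) = (LBINT x. f x)"
  by (subst (2) lborel_distr_add_right[of a, symmetric]) (simp add: integral_distr)

lemma nn_integral_reflect:
  fixes f :: "'a::euclidean_space \<Rightarrow> ennreal"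
  assumes [measurable]: "borel_fun f"
  shows "(NNINT x. f (a - x)) = (NNINT x. f x)"
  by (subst (2) lborel_distr_reflect[of a, symmetric]) (simp add: nn_integral_distr)

lemma integral_reflect_euclidean:
  fixes f :: "'a::euclidean_space \<Rightarrow> real"
  assumes [measurable]: "borel_fun f"
  shows "(LBINT x. f (a - x)) = (LBINT x. f x)"
  by (subst (2) lborel_distr_reflect[of a, symmetric]) (simp add: integral_distr)

lemma L2sq_translate:
  assumes [measurable]: "borel_fun f"
  shows "L2sq (\<lambda>x. f (x + a)) = L2sq f"
  unfolding L2sq_def using nn_integral_translate[of "\<lambda>x. ennreal ((norm (f x))\<^sup>2)" a] by simp

lemma L2sq_reflect:
  assumes [measurable]: "borel_fun f"
  shows "L2sq (\<lambda>x. f (a - x)) = L2sq f"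
  unfolding L2sq_def using nn_integral_reflect[of "\<lambda>x. ennreal ((norm (f x))\<^sup>2)" a] by simp

section \<open>Continuity of translations in L^1 and L^2\<close>

lemma uniformly_continuous_compact_support:
  fixes g :: "'a::euclidean_space \<Rightarrow> 'b::{real_normed_vector, second_countable_topology}"
  assumes "continuous_on UNIV g" "compact K" "\<And>x. x \<notin> K \<Longrightarrow> g x = 0" "e > 0"
  obtains d where "d > 0" "\<And>x y. dist x y < d \<Longrightarrow> norm (g x - g y) < e"
proof -
  obtain R where R: "\<And>x. x \<in> K \<Longrightarrow> norm x \<le> R" using assms(2) compact_imp_bounded bounded_iff by metis
  have "uniformly_continuous_on (cball 0 (R+1)) g"
    by (intro compact_uniformly_continuous continuous_on_subset[OF assms(1)]) auto
  then obtain d where d: "d > 0" "\<And>x y. x \<in> cball 0 (R+1) \<Longrightarrow> y \<in> cball 0 (R+1) \<Longrightarrow> dist y x < d \<Longrightarrow> dist (g y) (g x) < e"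
    using \<open>e > 0\<close> unfolding uniformly_continuous_on_def by metis
  show ?thesis
  proof (rule that[of "min d 1"])
    fix x y :: 'a assume xy: "dist x y < min d 1"
    have tri: "norm x \<le> norm y + dist x y" "norm y \<le> norm x + dist x y"
      by (metis dist_norm norm_triangle_sub) (metis dist_commute dist_norm norm_triangle_sub)
    show "norm (g x - g y) < e"
    proof (cases "norm x \<le> R + 1 \<and> norm y \<le> R + 1")
      case True
      then show ?thesis using d(2)[of y x] xy by (simp add: dist_norm)
    next
      case False
      then have "norm x > R" "norm y > R" using tri xy by auto
      then have "x \<notin> K" "y \<notin> K" using R leD by blast+
      then show ?thesis using assms(3,4) by simp
    qed
  qed (use d in auto)
qed

definition L1_translation_continuous :: "('a::euclidean_space \<Rightarrow> real) \<Rightarrow> bool" where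
  "L1_translation_continuous s \<longleftrightarrow> (\<forall>e>0. \<exists>d>0. \<forall>y. norm y < d \<longrightarrow> (NNINT x. ennreal \<bar>s (x + y) - s x\<bar>) \<le> ennreal e)"

lemma L1_translation_continuous_compact_support:
  fixes g :: "'a::euclidean_space \<Rightarrow> real"
  assumes g: "continuous_on UNIV g" "compact K" "\<And>x. x \<notin> K \<Longrightarrow> g x = 0"
  shows "L1_translation_continuous g"
  unfolding L1_translation_continuous_def
proof (intro allI impI)
  fix e :: real assume e: "e > 0"
  define K' where "K' = {a + b | a b. a \<in> K \<and> b \<in> cball (0::'a) 1}"
  have K': "compact K'" unfolding K'_def by (rule compact_sums[OF g(2) compact_cball])
  define m where "m = measure lborel K'"
  have m0: "m \<ge> 0" by (simp add: m_def)
  have emK: "emeasure lborel K' = ennreal m"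
    unfolding m_def using emeasure_compact_finite[OF K'] by (intro emeasure_eq_ennreal_measure) simp
  obtain d where d: "d > 0" "\<And>x y. dist x y < d \<Longrightarrow> norm (g x - g y) < e / (m + 1)"
    by (rule uniformly_continuous_compact_support[OF g, of "e / (m + 1)"]) (use e m0 in auto)
  have "(NNINT x. ennreal \<bar>g (x + y) - g x\<bar>) \<le> ennreal e" if y: "norm y < min d 1" for y
  proof -
    have "(NNINT x. ennreal \<bar>g (x + y) - g x\<bar>) \<le> (NNINT x. ennreal (e / (m + 1)) * indicator K' x)"
    proof (rule nn_integral_mono)
      fix x
      show "ennreal \<bar>g (x + y) - g x\<bar> \<le> ennreal (e / (m + 1)) * indicator K' x"
      proof (cases "x \<in> K'")
        case True
        have "dist (x + y) x < d" using y by (simp add: dist_norm)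
        from d(2)[OF this] show ?thesis using True by (auto intro!: ennreal_leI)
      next
        case False
        have "x \<notin> K" using False unfolding K'_def by (metis (mono_tags, lifting) add_0_right centre_in_cball mem_Collect_eq zero_le_one)
        moreover have "x + y \<notin> K"
        proof
          assume "x + y \<in> K"
          moreover have "- y \<in> cball 0 1" using y by simp
          ultimately have "(x + y) + - y \<in> K'" unfolding K'_def by blast
          then show False using False by simp
        qed
        ultimately show ?thesis using g(3) by simp
      qed
    qed
    also have "\<dots> = ennreal (e / (m + 1)) * emeasure lborel K'"
      using K' by (intro nn_integral_cmult_indicator) (auto intro: borel_compact)
    also have "\<dots> = ennreal (e / (m + 1) * m)" unfolding emK using e m0 by (subst ennreal_mult) auto
    also have "\<dots> \<le> ennreal e" using e m0 by (intro ennreal_leI) (simp add: field_simps)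
    finally show ?thesis .
  qed
  then show "\<exists>d>0. \<forall>y. norm y < d \<longrightarrow> (NNINT x. ennreal \<bar>g (x + y) - g x\<bar>) \<le> ennreal e"
    using d(1) by (intro exI[of _ "min d 1"]) auto
qed

lemma ennreal_abs_diff3:
  fixes a b c d :: real
  shows "ennreal \<bar>a - d\<bar> \<le> ennreal \<bar>a - b\<bar> + ennreal \<bar>b - c\<bar> + ennreal \<bar>c - d\<bar>"
  by (simp flip: ennreal_plus add: ennreal_leI)

text \<open>A three-epsilon argument: the error s - g keeps its L^1 norm under translation, so the
  property passes to L^1 limits.\<close>

lemma L1_translation_continuous_approx:
  fixes s :: "'a::euclidean_space \<Rightarrow> real"
  assumes [measurable]: "borel_fun s"
    and ap: "\<And>e. e > (0::real) \<Longrightarrow> \<exists>g. borel_fun g \<and> L1_translation_continuous g \<and> (NNINT x. ennreal \<bar>s x - g x\<bar>) \<le> ennreal e"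
  shows "L1_translation_continuous s"
  unfolding L1_translation_continuous_def
proof (intro allI impI)
  fix e :: real assume e: "e > 0"
  obtain g where g [measurable]: "borel_fun g" and gt: "L1_translation_continuous g"
    and sg: "(NNINT x. ennreal \<bar>s x - g x\<bar>) \<le> ennreal (e/3)" using ap[of "e/3"] e by auto
  obtain d where d: "d > 0" "\<And>y. norm y < d \<Longrightarrow> (NNINT x. ennreal \<bar>g (x + y) - g x\<bar>) \<le> ennreal (e/3)"
    using gt[unfolded L1_translation_continuous_def, rule_format, of "e/3"] e by auto
  have "(NNINT x. ennreal \<bar>s (x + y) - s x\<bar>) \<le> ennreal e" if "norm y < d" for y
  proof -
    have "(NNINT x. ennreal \<bar>s (x + y) - s x\<bar>) \<le>
      (NNINT x. ennreal \<bar>s (x + y) - g (x + y)\<bar> + ennreal \<bar>g (x + y) - g x\<bar> + ennreal \<bar>g x - s x\<bar>)"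
      by (intro nn_integral_mono ennreal_abs_diff3)
    also have "\<dots> = (NNINT x. ennreal \<bar>s (x + y) - g (x + y)\<bar>) + (NNINT x. ennreal \<bar>g (x + y) - g x\<bar>)
        + (NNINT x. ennreal \<bar>s x - g x\<bar>)"
      by (simp add: nn_integral_add abs_minus_commute[of "g _" "s _"])
    also have "(NNINT x. ennreal \<bar>s (x + y) - g (x + y)\<bar>) = (NNINT x. ennreal \<bar>s x - g x\<bar>)"
      using nn_integral_translate[of "\<lambda>x. ennreal \<bar>s x - g x\<bar>" y] by simp
    also have "(NNINT x. ennreal \<bar>s x - g x\<bar>) + (NNINT x. ennreal \<bar>g (x + y) - g x\<bar>)
        + (NNINT x. ennreal \<bar>s x - g x\<bar>) \<le> ennreal (e/3) + ennreal (e/3) + ennreal (e/3)"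
      by (intro add_mono sg d that)
    also have "\<dots> = ennreal e" using e by (simp flip: ennreal_plus)
    finally show ?thesis .
  qed
  then show "\<exists>d>0. \<forall>y. norm y < d \<longrightarrow> (NNINT x. ennreal \<bar>s (x + y) - s x\<bar>) \<le> ennreal e" using d(1) by blast
qed

lemma L1_translation_continuous_limit:
  fixes s :: "'a::euclidean_space \<Rightarrow> real"
  assumes [measurable]: "borel_fun s" "\<And>i. borel_fun (g i)"
    and "\<And>i::nat. L1_translation_continuous (g i)" "integrable lborel w"
    "\<And>i x. \<bar>g i x\<bar> \<le> w x" "\<And>x. (\<lambda>i. g i x) \<longlonglongrightarrow> s x"
  shows "L1_translation_continuous s"
proof (rule L1_translation_continuous_approx)
  fix e :: real assume e: "e > 0"
  have [measurable]: "borel_fun w" using assms(4) by auto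
  have "(\<lambda>i. (NNINT x. ennreal (norm (s x - g i x)))) \<longlonglongrightarrow> 0"
  proof (rule nn_integral_dominated_convergence_norm)
    show "(NNINT x. ennreal (w x)) < \<infinity>"
    proof -
      have "(NNINT x. ennreal (w x)) \<le> (NNINT x. ennreal (norm (w x)))"
        by (intro nn_integral_mono ennreal_leI) simp
      also have "\<dots> < \<infinity>" using assms(4) by (simp add: integrable_iff_bounded)
      finally show ?thesis .
    qed
    show "AE x in lborel. norm (g i x) \<le> w x" for i using assms(5) by simp
    show "AE x in lborel. (\<lambda>i. g i x) \<longlonglongrightarrow> s x" using assms(6) by simp
  qed simp_all
  then have "\<forall>\<^sub>F i in sequentially. (NNINT x. ennreal (norm (s x - g i x))) < ennreal e"
    by (rule order_tendstoD) (use e in simp)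
  then obtain i where "(NNINT x. ennreal (norm (s x - g i x))) < ennreal e"
    using eventually_happens'[OF sequentially_bot] by blast
  then show "\<exists>g. borel_fun g \<and> L1_translation_continuous g \<and> (NNINT x. ennreal \<bar>s x - g x\<bar>) \<le> ennreal e"
    using assms(2,3) by (intro exI[of _ "g i"]) (simp add: less_imp_le)
qed simp

text \<open>Outer regularity gives an open U around K with U - K of small measure. The tent function
  g below is 1 on K, vanishes outside U and has compact support, so it differs from the indicator by
  at most the indicator of U - K.\<close>

lemma L1_translation_continuous_compact:
  fixes K :: "'a::euclidean_space set"
  assumes K: "compact K"
  shows "L1_translation_continuous (indicator K)"
proof (cases "K = {}")
  case True
  then show ?thesis by (auto simp: L1_translation_continuous_def intro: exI[of _ 1])
next
  case False
  show ?thesis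
  proof (rule L1_translation_continuous_approx)
    show "borel_fun (indicator K)" by (rule borel_measurable_indicator) (use borel_compact[OF K] in simp)
    fix e :: real assume e: "e > 0"
    have KB [measurable]: "K \<in> sets borel" using K by (auto intro: borel_compact)
    obtain U where U: "open U" "K \<subseteq> U" "emeasure lborel (U - K) < e"
      by (rule outer_regular_lborel[OF KB e])
    obtain d where d: "d > 0" "(\<Union>x\<in>K. ball x d) \<subseteq> U"
      using compact_subset_open_imp_ball_epsilon_subset[OF K U(1,2)] by blast
    define g where "g x = max 0 (1 - infdist x K / d)" for x :: 'a
    have cont: "continuous_on UNIV g" unfolding g_def by (intro continuous_intros) (use d in auto)
    have supp: "g x = 0" if "x \<notin> {x. infdist x K \<le> d}" for x using that d by (auto simp: g_def field_simps)
    have "compact {x. infdist x K \<le> d}" using K d False by (intro compact_infdist_le) auto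
    from L1_translation_continuous_compact_support[OF cont this supp]
    have gt: "L1_translation_continuous g" .
    have UB [measurable]: "U \<in> sets borel" using U by simp
    have "(NNINT x. ennreal \<bar>indicator K x - g x\<bar>) \<le> (NNINT x. indicator (U - K) x)"
    proof (rule nn_integral_mono)
      fix x
      show "ennreal \<bar>indicator K x - g x\<bar> \<le> indicator (U - K) x"
      proof (cases "x \<in> K")
        case True then show ?thesis by (simp add: g_def)
      next
        case nK: False
        show ?thesis
        proof (cases "x \<in> U")
          case True
          have "g x \<le> 1" "g x \<ge> 0" using d by (auto simp: g_def infdist_nonneg)
          then show ?thesis using nK True by simp
        next
          case xU: False
          have "infdist x K \<ge> d"
          proof (rule ccontr)
            assume "\<not> ?thesis"
            moreover obtain k where "k \<in> K" "infdist x K = dist x k"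
              using infdist_attains_inf[OF compact_imp_closed[OF K] False] by blast
            ultimately have "k \<in> K" "x \<in> ball k d" by (simp_all add: dist_commute)
            then have "x \<in> (\<Union>x\<in>K. ball x d)" by blast
            then show False using d xU by blast
          qed
          then have "g x = 0" using d by (auto simp: g_def field_simps)
          then show ?thesis using nK xU by simp
        qed
      qed
    qed
    also have "\<dots> = emeasure lborel (U - K)" by simp
    finally have "(NNINT x. ennreal \<bar>indicator K x - g x\<bar>) \<le> ennreal e" using U(3) by simp
    then show "\<exists>g. borel_fun g \<and> L1_translation_continuous g \<and> (NNINT x. ennreal \<bar>indicator K x - g x\<bar>) \<le> ennreal e"
      using gt cont borel_measurable_continuous_onI by blast
  qed
qed

text \<open>Intersecting with balls makes the set bounded, so that a closed inner approximation is
  compact; dominated convergence then removes the balls.\<close>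

lemma L1_translation_continuous_indicator:
  fixes A :: "'a::euclidean_space set"
  assumes A [measurable]: "A \<in> sets borel" and fin: "emeasure lborel A < \<infinity>"
  shows "L1_translation_continuous (indicator A)"
proof -
  have AB [measurable]: "A \<inter> cball 0 (real n) \<in> sets borel" for n by simp
  have bdd: "L1_translation_continuous (indicator (A \<inter> cball 0 (real n)))" for n
  proof (rule L1_translation_continuous_approx)
    fix e :: real assume e: "e > 0"
    obtain T where T: "closed T" "T \<subseteq> A \<inter> cball 0 (real n)" "emeasure lebesgue ((A \<inter> cball 0 (real n)) - T) < ennreal e"
      by (rule sets_lebesgue_inner_closed[of "A \<inter> cball 0 (real n)" e]) (use e in simp_all)
    have [measurable]: "T \<in> sets borel" using T by simp
    have "compact T" using T bounded_cball[of 0 "real n"] bounded_subset by (auto simp: compact_eq_bounded_closed)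
    have "(NNINT x. ennreal \<bar>indicator (A \<inter> cball 0 (real n)) x - indicator T x\<bar>)
       = (NNINT x. indicator ((A \<inter> cball 0 (real n)) - T) x)"
      using T(2) by (intro nn_integral_cong) (auto simp: indicator_def)
    also have "\<dots> = emeasure lborel ((A \<inter> cball 0 (real n)) - T)" by (subst nn_integral_indicator) auto
    also have "\<dots> = emeasure lebesgue ((A \<inter> cball 0 (real n)) - T)" by (simp add: emeasure_completion)
    finally have "(NNINT x. ennreal \<bar>indicator (A \<inter> cball 0 (real n)) x - indicator T x\<bar>) \<le> ennreal e"
      using T(3) by simp
    then show "\<exists>g. borel_fun g \<and> L1_translation_continuous g \<and>
        (NNINT x. ennreal \<bar>indicator (A \<inter> cball 0 (real n)) x - g x\<bar>) \<le> ennreal e"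
      using L1_translation_continuous_compact[OF \<open>compact T\<close>] by (intro exI[of _ "indicator T"]) auto
  qed (rule borel_measurable_indicator[OF AB])
  show ?thesis
  proof (rule L1_translation_continuous_limit[where g="\<lambda>n. indicator (A \<inter> cball 0 (real n))" and w="indicator A"])
    show "integrable lborel (indicator A :: 'a \<Rightarrow> real)" using fin A by (simp add: integrable_indicator_iff)
    show "(\<lambda>i. indicator (A \<inter> cball 0 (real i)) x) \<longlonglongrightarrow> (indicator A x :: real)" for x
    proof (rule tendsto_eventually)
      obtain N :: nat where "norm x \<le> real N" using real_arch_simple by blast
      then show "\<forall>\<^sub>F i in sequentially. indicator (A \<inter> cball 0 (real i)) x = (indicator A x :: real)"
        by (intro eventually_sequentiallyI[of N]) (auto simp: indicator_def)
    qed
    show "L1_translation_continuous (indicator (A \<inter> cball 0 (real i)))" for i by (rule bdd)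
    show "\<bar>indicator (A \<inter> cball 0 (real i)) x\<bar> \<le> (indicator A x :: real)" for i x by (simp add: indicator_def)
  qed simp_all
qed

lemma integrable_L1_translation_continuous:
  fixes f :: "'a::euclidean_space \<Rightarrow> real"
  assumes "integrable lborel f"
  shows "L1_translation_continuous f"
  using assms
proof (induction rule: integrable_induct)
  case (base A c)
  have "L1_translation_continuous (indicator A)"
    using base by (intro L1_translation_continuous_indicator) auto
  show ?case unfolding L1_translation_continuous_def
  proof (intro allI impI)
    fix e :: real assume e: "e > 0"
    obtain d where d: "d > 0" "\<And>y. norm y < d \<Longrightarrow> (NNINT x. ennreal \<bar>indicator A (x + y) - indicator A x\<bar>) \<le> ennreal (e / (\<bar>c\<bar> + 1))"
      using \<open>L1_translation_continuous (indicator A)\<close>[unfolded L1_translation_continuous_def, rule_format, of "e / (\<bar>c\<bar> + 1)"] e by auto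
    have [measurable]: "A \<in> sets borel" using base by simp
    have "(NNINT x. ennreal \<bar>indicator A (x + y) *\<^sub>R c - indicator A x *\<^sub>R c\<bar>) \<le> ennreal e" if "norm y < d" for y
    proof -
      have "(NNINT x. ennreal \<bar>indicator A (x + y) *\<^sub>R c - indicator A x *\<^sub>R c\<bar>)
        = (NNINT x. ennreal \<bar>c\<bar> * ennreal \<bar>indicator A (x + y) - indicator A x\<bar>)"
        by (intro nn_integral_cong) (simp add: ennreal_mult[symmetric] abs_mult[symmetric] algebra_simps)
      also have "\<dots> = ennreal \<bar>c\<bar> * (NNINT x. ennreal \<bar>indicator A (x + y) - indicator A x\<bar>)"
        by (rule nn_integral_cmult) measurable
      also have "\<dots> \<le> ennreal \<bar>c\<bar> * ennreal (e / (\<bar>c\<bar> + 1))" by (intro mult_left_mono d that) simp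
      also have "\<dots> = ennreal (\<bar>c\<bar> * (e / (\<bar>c\<bar> + 1)))" using e by (subst ennreal_mult) auto
      also have "\<dots> \<le> ennreal e" using e by (intro ennreal_leI) (simp add: field_simps)
      finally show ?thesis .
    qed
    then show "\<exists>d>0. \<forall>y. norm y < d \<longrightarrow> (NNINT x. ennreal \<bar>indicator A (x + y) *\<^sub>R c - indicator A x *\<^sub>R c\<bar>) \<le> ennreal e"
      using d(1) by blast
  qed
next
  case (add f g)
  have [measurable]: "borel_fun f" "borel_fun g" using add.hyps by auto
  show ?case unfolding L1_translation_continuous_def
  proof (intro allI impI)
    fix e :: real assume e: "e > 0"
    obtain d1 where d1: "d1 > 0" "\<And>y. norm y < d1 \<Longrightarrow> (NNINT x. ennreal \<bar>f (x + y) - f x\<bar>) \<le> ennreal (e/2)"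
      using add.IH(1)[unfolded L1_translation_continuous_def, rule_format, of "e/2"] e by auto
    obtain d2 where d2: "d2 > 0" "\<And>y. norm y < d2 \<Longrightarrow> (NNINT x. ennreal \<bar>g (x + y) - g x\<bar>) \<le> ennreal (e/2)"
      using add.IH(2)[unfolded L1_translation_continuous_def, rule_format, of "e/2"] e by auto
    have "(NNINT x. ennreal \<bar>f (x + y) + g (x + y) - (f x + g x)\<bar>) \<le> ennreal e" if "norm y < min d1 d2" for y
    proof -
      have "(NNINT x. ennreal \<bar>f (x + y) + g (x + y) - (f x + g x)\<bar>)
        \<le> (NNINT x. ennreal \<bar>f (x + y) - f x\<bar> + ennreal \<bar>g (x + y) - g x\<bar>)"
        by (intro nn_integral_mono) (simp flip: ennreal_plus add: ennreal_leI)
      also have "\<dots> = (NNINT x. ennreal \<bar>f (x + y) - f x\<bar>) + (NNINT x. ennreal \<bar>g (x + y) - g x\<bar>)"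
        by (rule nn_integral_add) measurable
      also have "\<dots> \<le> ennreal (e/2) + ennreal (e/2)" using that by (intro add_mono d1 d2) auto
      also have "\<dots> = ennreal e" using e by (simp flip: ennreal_plus)
      finally show ?thesis .
    qed
    then show "\<exists>d>0. \<forall>y. norm y < d \<longrightarrow> (NNINT x. ennreal \<bar>f (x + y) + g (x + y) - (f x + g x)\<bar>) \<le> ennreal e"
      using d1(1) d2(1) by (intro exI[of _ "min d1 d2"]) auto
  qed
next
  case (lim f s)
  show ?case
    by (rule L1_translation_continuous_limit[where g=s and w="\<lambda>x. 2 * \<bar>f x\<bar>"])
      (use lim in \<open>simp_all add: borel_measurable_integrable\<close>)
qed

text \<open>Transfers continuity of translations from L^1 to L^2 through the signed square u |u|,
  which is integrable when u is square integrable; the plain square would forget the sign. The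
  factor 2 is for a and b of opposite sign.\<close>

lemma sq_diff_le_abs: "(a - b)\<^sup>2 \<le> 2 * \<bar>a * \<bar>a\<bar> - b * \<bar>b\<bar>\<bar>" for a b :: real
proof -
  have pos: "(a - b)\<^sup>2 \<le> 2 * \<bar>a * a - b * b\<bar>" if "a \<ge> 0" "b \<ge> 0" for a b :: real
  proof -
    have "(a - b)\<^sup>2 = \<bar>a - b\<bar> * \<bar>a - b\<bar>" by (simp add: power2_eq_square)
    also have "\<dots> \<le> \<bar>a - b\<bar> * (a + b)" using that by (intro mult_left_mono) auto
    also have "\<dots> = \<bar>a * a - b * b\<bar>" using that by (simp add: square_diff_square_factored abs_mult mult.commute)
    also have "\<dots> \<le> 2 * \<bar>a * a - b * b\<bar>" by simp
    finally show ?thesis .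
  qed
  have mixed: "(a - b)\<^sup>2 \<le> 2 * \<bar>a * a + b * b\<bar>" for a b :: real
    using sum_squares_ge_zero[of "a + b" 0] sum_squares_ge_zero[of a b]
    by (simp add: power2_eq_square algebra_simps)
  show ?thesis
    using pos[of a b] pos[of "-a" "-b"] mixed[of a b]
    by (cases "a \<ge> 0"; cases "b \<ge> 0") (auto simp: power2_commute abs_minus_commute[of "b * b"] algebra_simps)
qed

lemma L2_translation_continuous:
  fixes u :: "'a::euclidean_space \<Rightarrow> real"
  assumes [measurable]: "borel_fun u" and fin: "L2sq u < \<infinity>" and e: "e > 0"
  shows "\<exists>d>0. \<forall>y. norm y < d \<longrightarrow> L2sq (\<lambda>x. u (x + y) - u x) \<le> ennreal e"
proof -
  define s where "s x = u x * \<bar>u x\<bar>" for x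
  have [measurable]: "borel_fun s" unfolding s_def by measurable
  have "integrable lborel (\<lambda>x. (norm (u x))\<^sup>2)" using fin by (simp only: integrable_iff_L2sq[OF assms(1)])
  then have "integrable lborel s"
    by (rule Bochner_Integration.integrable_bound) (auto simp: s_def abs_mult power2_eq_square)
  then obtain d where d: "d > 0" "\<And>y. norm y < d \<Longrightarrow> (NNINT x. ennreal \<bar>s (x + y) - s x\<bar>) \<le> ennreal (e/2)"
    using integrable_L1_translation_continuous[unfolded L1_translation_continuous_def, rule_format, of s "e/2"] e by auto
  have "L2sq (\<lambda>x. u (x + y) - u x) \<le> ennreal e" if "norm y < d" for y
  proof -
    have "L2sq (\<lambda>x. u (x + y) - u x) \<le> (NNINT x. 2 * ennreal \<bar>s (x + y) - s x\<bar>)"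
      unfolding L2sq_def s_def
    proof (rule nn_integral_mono)
      fix x
      have "ennreal ((norm (u (x + y) - u x))\<^sup>2) \<le> ennreal (2 * \<bar>u (x + y) * \<bar>u (x + y)\<bar> - u x * \<bar>u x\<bar>\<bar>)"
        using sq_diff_le_abs[of "u (x + y)" "u x"] by (simp add: ennreal_leI)
      then show "ennreal ((norm (u (x + y) - u x))\<^sup>2) \<le> 2 * ennreal \<bar>u (x + y) * \<bar>u (x + y)\<bar> - u x * \<bar>u x\<bar>\<bar>"
        by (simp add: ennreal_mult)
    qed
    also have "\<dots> = 2 * (NNINT x. ennreal \<bar>s (x + y) - s x\<bar>)" by (rule nn_integral_cmult) measurable
    also have "\<dots> \<le> 2 * ennreal (e/2)" by (intro mult_left_mono d that) simp
    also have "\<dots> = ennreal e" using e by (simp add: ennreal_mult[symmetric] flip: ennreal_numeral)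
    finally show ?thesis .
  qed
  then show ?thesis using d(1) by blast
qed

section \<open>Convolution of square-integrable functions with test functions\<close>

definition conv :: "(R3 \<Rightarrow> real) \<Rightarrow> (R3 \<Rightarrow> real) \<Rightarrow> R3 \<Rightarrow> real" where
  "conv u g x = (LBINT y. u y * g (x - y))"

lemma test_fun_C1: "test_fun U g \<Longrightarrow> C1 g"
  by (simp add: test_fun_def smooth_C1)

lemma test_fun_measurable: "test_fun U g \<Longrightarrow> borel_fun g"
  by (rule C1_measurable[OF test_fun_C1])

lemma test_fun_gr_measurable: "test_fun U g \<Longrightarrow> borel_fun (gr g)"
  by (rule C1_gr_measurable[OF test_fun_C1])

lemma test_fun_L2: "test_fun U g \<Longrightarrow> L2sq g < \<infinity>" "test_fun U g \<Longrightarrow> L2sq (gr g) < \<infinity>"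
  by (erule C1c_L2[OF test_fun_C1c])+

lemma borel_measurable_vec_nth [measurable (raw)]:
  fixes f :: "'a \<Rightarrow> real ^ 'n::finite"
  assumes [measurable]: "f \<in> borel_measurable M"
  shows "(\<lambda>x. f x $ i) \<in> borel_measurable M"
proof -
  have "(\<lambda>x. f x \<bullet> axis i 1) \<in> borel_measurable M" by measurable
  then show ?thesis by (simp add: inner_axis)
qed

lemma conv_integrable:
  fixes u g :: "R3 \<Rightarrow> real"
  assumes [measurable]: "borel_fun u" and u: "L2sq u < \<infinity>"
    and [measurable]: "borel_fun g" and g: "L2sq g < \<infinity>"
  shows "integrable lborel (\<lambda>y. u y * g (x - y))"
  using L2_inner_integrable[of u "\<lambda>y. g (x - y)"] u g by (simp add: L2sq_reflect)

lemma conv_bound: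
  assumes [measurable]: "borel_fun u" and u: "L2sq u < \<infinity>"
    and [measurable]: "borel_fun g" and g: "L2sq g < \<infinity>"
  shows "(conv u g x)\<^sup>2 \<le> enn2real (L2sq u) * enn2real (L2sq g)"
  using L2_inner_bound[of u "\<lambda>y. g (x - y)"] u g by (simp add: L2sq_reflect conv_def)

lemma conv_diff_right:
  assumes [measurable]: "borel_fun u" and u: "L2sq u < \<infinity>"
    and [measurable]: "borel_fun g" and g: "L2sq g < \<infinity>"
    and [measurable]: "borel_fun h" and h: "L2sq h < \<infinity>"
  shows "conv u g x - conv u h x = conv u (\<lambda>z. g z - h z) x"
  unfolding conv_def right_diff_distrib
  by (rule Bochner_Integration.integral_diff[symmetric]) (rule conv_integrable[OF assms(1-4)] conv_integrable[OF assms(1,2,5,6)])+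

lemma conv_diff_left:
  assumes [measurable]: "borel_fun u" and u: "L2sq u < \<infinity>"
    and [measurable]: "borel_fun v" and v: "L2sq v < \<infinity>"
    and [measurable]: "borel_fun h" and h: "L2sq h < \<infinity>"
  shows "conv u h x - conv v h x = conv (\<lambda>z. u z - v z) h x"
  unfolding conv_def left_diff_distrib
  by (rule Bochner_Integration.integral_diff[symmetric]) (rule conv_integrable[OF assms(1,2,5,6)] conv_integrable[OF assms(3-6)])+

text \<open>The gradient is uniformly continuous, so one d serves all base points; this uniformity
  is what allows the remainder of the expansion to be integrated.\<close>

lemma C1c_uniformly_differentiable:
  assumes g: "C1c U g" and e: "e > 0"
  obtains d where "d > 0" "\<And>z h. norm h < d \<Longrightarrow> \<bar>g (z + h) - g z - gr g z \<bullet> h\<bar> \<le> e * norm h"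
proof -
  obtain K where K: "compact K" "\<And>x. x \<notin> K \<Longrightarrow> gr g x = 0" using C1c_compact[OF g] by metis
  note C = C1c_C1[OF g]
  obtain d where d: "d > 0" "\<And>x y. dist x y < d \<Longrightarrow> norm (gr g x - gr g y) < e"
    by (rule uniformly_continuous_compact_support[OF C1_gr_continuous[OF C] K e]) blast+
  have "\<bar>g (z + h) - g z - gr g z \<bullet> h\<bar> \<le> e * norm h" if h: "norm h < d" for z h
  proof -
    have "norm (g (z + h) - g z - gr g z \<bullet> (z + h - z)) \<le> norm (z + h - z) * e"
    proof (rule differentiable_bound_linearization[where S="ball z d" and f'="\<lambda>x v. gr g x \<bullet> v"])
      show "z + t *\<^sub>R (z + h - z) \<in> ball z d" if "t \<in> {0..1}" for t
      proof -
        have "norm (t *\<^sub>R h) \<le> norm h" using that by (simp add: mult_left_le_one_le)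
        then show ?thesis using h by (simp add: dist_norm)
      qed
      show "(g has_derivative (\<bullet>) (gr g x)) (at x within ball z d)" for x
        using C1_derivative[OF C] by (rule has_derivative_at_withinI)
      show "onorm ((\<bullet>) (gr g x) - (\<bullet>) (gr g z)) \<le> e" if "x \<in> ball z d" for x
      proof (rule onorm_le)
        fix v
        have "norm (((\<bullet>) (gr g x) - (\<bullet>) (gr g z)) v) = \<bar>(gr g x - gr g z) \<bullet> v\<bar>"
          by (simp add: inner_diff_left)
        also have "\<dots> \<le> norm (gr g x - gr g z) * norm v" by (rule Cauchy_Schwarz_ineq2)
        also have "\<dots> \<le> e * norm v"
          using d(2)[of x z] that by (intro mult_right_mono) (auto simp: dist_commute)
        finally show "norm (((\<bullet>) (gr g x) - (\<bullet>) (gr g z)) v) \<le> e * norm v" .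
      qed
      show "z \<in> ball z d" using d by simp
    qed
    then show ?thesis by (simp add: mult.commute)
  qed
  with d(1) that show ?thesis by blast
qed

text \<open>The first-order remainder of \<open>conv u g\<close> at x is \<open>conv u r x\<close>,
  where r is the remainder of g. By Cauchy-Schwarz it suffices that r is of size c * norm h in sup
  norm and lives on a fixed compact set.\<close>

lemma conv_has_derivative:
  assumes [measurable]: "borel_fun u" and u: "L2sq u < \<infinity>" and g: "C1c U g"
  shows "(conv u g has_derivative (\<lambda>v. (\<chi> i. conv u (partial i g) x) \<bullet> v)) (at x)"
  unfolding has_derivative_at_alt
proof (intro conjI allI impI)
  show "bounded_linear ((\<bullet>) (\<chi> i. conv u (partial i g) x))" by (rule bounded_linear_inner_right)
  fix e :: real assume e: "e > 0"
  obtain K where K: "compact K" "\<And>x. x \<notin> K \<Longrightarrow> g x = 0" "\<And>x. x \<notin> K \<Longrightarrow> gr g x = 0"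
    using C1c_compact[OF g] by metis
  note C = C1c_C1[OF g]
  note gm [measurable] = C1_measurable[OF C] C1_gr_measurable[OF C]
  have pm [measurable]: "borel_fun (partial i g)" for i
  proof -
    have "borel_fun (\<lambda>x. gr g x $ i)" by (rule borel_measurable_vec_nth) measurable
    then show ?thesis by simp
  qed
  have pfin: "L2sq (partial i g) < \<infinity>" for i
  proof -
    have "L2sq (partial i g) \<le> L2sq (gr g)"
      by (rule L2sq_mono) (metis component_le_norm_cart gr_nth real_norm_def)
    also have "\<dots> < \<infinity>" by (rule C1c_L2[OF g])
    finally show ?thesis .
  qed
  \<comment> \<open>For norm h < 1 the remainder vanishes outside K enlarged by the unit ball,
    whatever h is; m is the volume of that set.\<close>
  define K' where "K' = {a + b | a b. a \<in> K \<and> b \<in> cball (0::R3) 1}"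
  have K': "compact K'" unfolding K'_def by (rule compact_sums[OF K(1) compact_cball])
  define m where "m = measure lborel K'"
  have m0: "m \<ge> 0" by (simp add: m_def)
  have emK: "emeasure lborel K' = ennreal m"
    unfolding m_def using emeasure_compact_finite[OF K'] by (intro emeasure_eq_ennreal_measure) simp
  define A where "A = enn2real (L2sq u) * m"
  have A0: "A \<ge> 0" using m0 by (simp add: A_def)
  \<comment> \<open>Chosen so that A * c^2 <= e^2, where A combines the squared norm of u with the
    volume; adding 1 avoids a zero denominator.\<close>
  define c where "c = e / (A + 1)"
  have c: "c > 0" using e A0 by (simp add: c_def)
  have cA: "A * c\<^sup>2 \<le> e\<^sup>2"
  proof -
    have "A * c\<^sup>2 \<le> (A + 1)\<^sup>2 * c\<^sup>2" using A0 by (intro mult_right_mono) (auto simp: power2_eq_square algebra_simps)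
    also have "\<dots> = ((A + 1) * c)\<^sup>2" by (simp add: power_mult_distrib)
    also have "(A + 1) * c = e" using A0 by (simp add: c_def)
    finally show ?thesis .
  qed
  obtain d where d: "d > 0" "\<And>z h. norm h < d \<Longrightarrow> \<bar>g (z + h) - g z - gr g z \<bullet> h\<bar> \<le> c * norm h"
    using C1c_uniformly_differentiable[OF g c] by blast
  have "norm (conv u g (x + h) - conv u g x - (\<chi> i. conv u (partial i g) x) \<bullet> h) \<le> e * norm h" if h: "norm h < min d 1" for h
  proof -
    define r where "r z = g (z + h) - g z - gr g z \<bullet> h" for z
    have rm [measurable]: "borel_fun r" unfolding r_def by measurable
    have rb: "L2sq r \<le> ennreal ((c * norm h)\<^sup>2 * m)"
    proof -
      have "L2sq r \<le> (NNINT z. ennreal ((c * norm h)\<^sup>2) * indicator K' z)"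
        unfolding L2sq_def
      proof (rule nn_integral_mono)
        fix z
        show "ennreal ((norm (r z))\<^sup>2) \<le> ennreal ((c * norm h)\<^sup>2) * indicator K' z"
        proof (cases "z \<in> K'")
          case True
          have "norm (r z) \<le> c * norm h" using d(2)[of h z] h by (simp add: r_def)
          then have "(norm (r z))\<^sup>2 \<le> (c * norm h)\<^sup>2" by (rule power_mono) simp
          then show ?thesis using True by (simp add: ennreal_leI)
        next
          case False
          have "z \<notin> K"
          proof
            assume "z \<in> K"
            then have "z + 0 \<in> K'" unfolding K'_def by fastforce
            then show False using False by simp
          qed
          moreover have "z + h \<notin> K"
          proof
            assume "z + h \<in> K"
            moreover have "- h \<in> cball 0 1" using h by simp
            ultimately have "(z + h) + - h \<in> K'" unfolding K'_def by blast
            then show False using False by simp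
          qed
          ultimately show ?thesis using K by (simp add: r_def)
        qed
      qed
      also have "\<dots> = ennreal ((c * norm h)\<^sup>2) * emeasure lborel K'"
        using borel_compact[OF K'] by (intro nn_integral_cmult_indicator) simp
      also have "\<dots> = ennreal ((c * norm h)\<^sup>2 * m)" unfolding emK using m0 by (subst ennreal_mult) auto
      finally show ?thesis .
    qed
    have rfin: "L2sq r < \<infinity>" by (rule le_less_trans[OF rb]) simp
    have i1: "integrable lborel (\<lambda>y. u y * g (x + h - y))" and i2: "integrable lborel (\<lambda>y. u y * g (x - y))"
      by (rule conv_integrable[OF assms(1) u gm(1) C1c_L2(1)[OF g]])+
    have i3: "integrable lborel (\<lambda>y. u y * partial i g (x - y))" for i
      by (rule conv_integrable[OF assms(1) u pm pfin])
    have "(\<chi> i. conv u (partial i g) x) \<bullet> h = (\<Sum>i\<in>UNIV. conv u (partial i g) x * h $ i)"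
      by (simp add: inner_vec_def)
    also have "\<dots> = (LBINT y. (\<Sum>i\<in>UNIV. u y * partial i g (x - y) * h $ i))"
      unfolding conv_def by (subst Bochner_Integration.integral_sum) (auto intro!: i3)
    also have "\<dots> = (LBINT y. u y * (gr g (x - y) \<bullet> h))"
      by (simp add: inner_vec_def sum_distrib_left mult.assoc)
    finally have eq1: "(\<chi> i. conv u (partial i g) x) \<bullet> h = (LBINT y. u y * (gr g (x - y) \<bullet> h))" .
    have i4: "integrable lborel (\<lambda>y. u y * (gr g (x - y) \<bullet> h))"
    proof -
      have "integrable lborel (\<lambda>y. \<Sum>i\<in>UNIV. u y * partial i g (x - y) * h $ i)"
        by (intro Bochner_Integration.integrable_sum integrable_mult_left i3)
      then show ?thesis by (simp add: inner_vec_def sum_distrib_left mult.assoc)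
    qed
    have "conv u g (x + h) - conv u g x - (\<chi> i. conv u (partial i g) x) \<bullet> h = conv u r x"
      unfolding eq1 unfolding conv_def r_def
      by (subst Bochner_Integration.integral_diff[OF i1 i2, symmetric], subst Bochner_Integration.integral_diff[symmetric])
        (use i1 i2 i4 in \<open>auto simp: algebra_simps intro!: Bochner_Integration.integral_cong\<close>)
    moreover have "(conv u r x)\<^sup>2 \<le> (e * norm h)\<^sup>2"
    proof -
      have "(conv u r x)\<^sup>2 \<le> enn2real (L2sq u) * enn2real (L2sq r)" by (rule conv_bound[OF assms(1) u rm rfin])
      also have "enn2real (L2sq r) \<le> (c * norm h)\<^sup>2 * m"
        using enn2real_mono[OF rb] m0 by simp
      also have "enn2real (L2sq u) * ((c * norm h)\<^sup>2 * m) = A * c\<^sup>2 * (norm h)\<^sup>2"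
        by (simp add: A_def power_mult_distrib)
      also have "\<dots> \<le> e\<^sup>2 * (norm h)\<^sup>2" by (intro mult_right_mono cA) simp
      finally show ?thesis by (simp add: power_mult_distrib mult_left_mono)
    qed
    then have "\<bar>conv u r x\<bar> \<le> e * norm h" using e by (intro power2_le_imp_le[of "\<bar>conv u r x\<bar>"]) auto
    ultimately show ?thesis by simp
  qed
  from this[of "y - x" for y]
  show "\<exists>d>0. \<forall>y. norm (y - x) < d \<longrightarrow> norm (conv u g y - conv u g x - (\<chi> i. conv u (partial i g) x) \<bullet> (y - x)) \<le> e * norm (y - x)"
    using d(1) by (intro exI[of _ "min d 1"]) simp
qed

text \<open>All derivatives fall on g, whose partial derivatives are again test functions; hence the
  induction on the order keeps g arbitrary.\<close>

lemma smooth_conv: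
  assumes u: "borel_fun u" "L2sq u < \<infinity>"
  shows "test_fun UNIV g \<Longrightarrow> smooth (conv u g)"
proof -
  have "test_fun UNIV g \<Longrightarrow> Ck k (conv u g)" for k
  proof (induction k arbitrary: g)
    case 0
    show ?case using conv_has_derivative[OF u test_fun_C1c[OF 0]]
      by (auto intro!: continuous_at_imp_continuous_on has_derivative_continuous)
  next
    case (Suc k)
    show ?case
    proof (rule Ck_SucI[OF conv_has_derivative[OF u test_fun_C1c[OF Suc.prems]]])
      show "Ck k (\<lambda>x. (\<chi> i. conv u (partial i g) x) $ i)" for i
        using Suc.IH[OF test_fun_partial[OF Suc.prems], of i] by simp
    qed
  qed
  then show "test_fun UNIV g \<Longrightarrow> smooth (conv u g)" by (simp add: smooth_def)
qed

lemma partial_conv: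
  assumes u: "borel_fun u" "L2sq u < \<infinity>" and g: "test_fun UNIV g"
  shows "partial i (conv u g) x = conv u (partial i g) x"
  using gr_eqI[OF conv_has_derivative[OF u test_fun_C1c[OF g], of x]] gr_nth[of "conv u g" x i] by simp

lemma conv_zero:
  assumes "AE y in lborel. y \<notin> A \<longrightarrow> u y = 0" "\<And>y. y \<in> A \<Longrightarrow> g (x - y) = 0"
  shows "conv u g x = 0"
proof -
  have "AE y in lborel. u y * g (x - y) = 0" using assms(1) by eventually_elim (use assms(2) in auto)
  then show ?thesis unfolding conv_def by (rule integral_eq_zero_AE)
qed

section \<open>Mollifiers\<close>

definition moll :: "real \<Rightarrow> R3 \<Rightarrow> real" where
  "moll e x = rbump e x / (LBINT x. rbump e x)"

lemma rbump_zero: "e > 0 \<Longrightarrow> x \<notin> cball 0 e \<Longrightarrow> rbump e x = 0"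
  using rbump_pos_iff[of e x] rbump_nonneg[of e x] by auto

lemma rbump_test: "e > 0 \<Longrightarrow> test_fun UNIV (rbump e)"
  by (rule test_funI[OF smooth_rbump compact_cball[of 0 e]]) (auto intro!: rbump_zero)

lemma rbump_integral_pos: assumes "e > 0" shows "(LBINT x. rbump e x) > 0"
proof -
  have int: "integrable lborel (rbump e)"
    by (rule integrable_compact_support[OF smooth_continuous[OF smooth_rbump] compact_cball]) (rule rbump_zero[OF assms])
  have "(LBINT x. rbump e x) \<noteq> 0"
  proof
    assume "(LBINT x. rbump e x) = 0"
    then have "AE x in lborel. rbump e x = 0"
      using integral_nonneg_eq_0_iff_AE[OF int] rbump_nonneg by auto
    then have "AE x in lborel. x \<notin> ball (0::R3) e"
      by eventually_elim (use rbump_pos_iff[OF assms] in force)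
    then have "emeasure lborel (ball (0::R3) e) = 0"
      using AE_iff_null_sets[of "ball (0::R3) e" lborel] by auto
    then show False using emeasure_lborel_ball_finite assms content_ball_pos[of e "0::R3"]
      by (simp add: measure_def)
  qed
  moreover have "(LBINT x. rbump e x) \<ge> 0" by (intro integral_nonneg_AE) (simp add: rbump_nonneg)
  ultimately show ?thesis by linarith
qed

lemma moll_nonneg: "e > 0 \<Longrightarrow> moll e x \<ge> 0"
  using rbump_nonneg rbump_integral_pos[of e] by (simp add: moll_def)

lemma moll_zero: "e > 0 \<Longrightarrow> norm x > e \<Longrightarrow> moll e x = 0"
  by (simp add: moll_def rbump_zero)

lemma moll_test: "e > 0 \<Longrightarrow> test_fun UNIV (moll e)"
  using test_fun_cmult[OF rbump_test, of e "1 / (LBINT x. rbump e x)"] by (simp add: moll_def[abs_def])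

lemma moll_measurable [measurable]: "borel_fun (moll e)"
proof -
  have [measurable]: "borel_fun (rbump e)"
    by (intro borel_measurable_continuous_onI smooth_continuous smooth_rbump)
  show ?thesis unfolding moll_def[abs_def] by measurable
qed

lemma moll_integrable: "e > 0 \<Longrightarrow> integrable lborel (moll e)"
  by (rule integrable_compact_support[OF smooth_continuous compact_cball[of 0 e]])
    (use moll_test[of e] moll_zero[of e] in \<open>auto simp: test_fun_def\<close>)

lemma moll_integral: "e > 0 \<Longrightarrow> (LBINT x. moll e x) = 1"
  using rbump_integral_pos[of e] by (simp add: moll_def)

lemma moll_nn_integral: "e > 0 \<Longrightarrow> (NNINT x. ennreal (moll e x)) = 1"
  by (subst nn_integral_eq_integral) (simp_all add: moll_integrable moll_nonneg moll_integral)

lemma moll_even: "moll e (x - y) = moll e (y - x)"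
  by (simp add: moll_def rbump_def inner_diff_left inner_diff_right inner_commute algebra_simps)

text \<open>The mollified function is an average of translates over the ball of radius e. The
  weighted Cauchy-Schwarz inequality (Jensen) moves the square inside the average, and Fubini then
  leaves an average of translation errors, each at most S.\<close>

lemma conv_moll_bound:
  assumes um [measurable]: "borel_fun u" and u: "L2sq u < \<infinity>" and e: "e > 0"
    and S: "\<And>y. norm y \<le> e \<Longrightarrow> L2sq (\<lambda>x. u (x + y) - u x) \<le> S"
  shows "L2sq (\<lambda>x. conv u (moll e) x - u x) \<le> S"
proof -
  have mfin: "L2sq (moll e) < \<infinity>" by (rule test_fun_L2[OF moll_test[OF e]])
  have pt: "ennreal ((norm (conv u (moll e) x - u x))\<^sup>2) \<le> (NNINT y. ennreal ((norm (u (x + y) - u x))\<^sup>2) * ennreal (moll e y))" for x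
  proof -
    have i1: "integrable lborel (\<lambda>y. u y * moll e (x - y))" by (rule conv_integrable[OF um u moll_measurable mfin])
    have "integrable lborel (\<lambda>y. u x * moll e (x - y))"
    proof -
      have "integrable (distr lborel borel (\<lambda>y. x - y)) (moll e)"
        unfolding lborel_distr_reflect by (rule moll_integrable[OF e])
      then show ?thesis by (intro integrable_mult_right) (simp add: integrable_distr_eq)
    qed
    note i2 = this
    have "u x = (LBINT y. u x * moll e (x - y))"
      using integral_reflect_euclidean[OF moll_measurable, of e x] by (simp add: moll_integral[OF e])
    then have "conv u (moll e) x - u x = (LBINT y. u y * moll e (x - y)) - (LBINT y. u x * moll e (x - y))"
      by (simp add: conv_def)
    also have "\<dots> = (LBINT y. (u y - u x) * moll e (x - y))"
      by (subst Bochner_Integration.integral_diff[OF i1 i2, symmetric]) (simp add: algebra_simps)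
    finally have eq: "conv u (moll e) x - u x = (LBINT y. (u y - u x) * moll e (x - y))" .
    have i3: "integrable lborel (\<lambda>y. (u y - u x) * moll e (x - y))"
      using Bochner_Integration.integrable_diff[OF i1 i2] by (simp add: algebra_simps)
    have "ennreal (norm (conv u (moll e) x - u x)) \<le> (NNINT y. ennreal (norm ((u y - u x) * moll e (x - y))))"
      unfolding eq by (rule integral_norm_bound_ennreal[OF i3])
    \<comment> \<open>The weight is split as a product of two square roots, so that the second
      Cauchy-Schwarz factor is its total mass 1.\<close>
    also have "\<dots> = (NNINT y. ennreal (\<bar>u y - u x\<bar> * sqrt (moll e (x - y))) * ennreal (sqrt (moll e (x - y))))"
    proof (rule nn_integral_cong)
      fix y
      have "norm ((u y - u x) * moll e (x - y)) = \<bar>u y - u x\<bar> * sqrt (moll e (x - y)) * sqrt (moll e (x - y))"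
        using moll_nonneg[OF e, of "x - y"] by (simp add: abs_mult mult.assoc)
      then show "ennreal (norm ((u y - u x) * moll e (x - y))) = ennreal (\<bar>u y - u x\<bar> * sqrt (moll e (x - y))) * ennreal (sqrt (moll e (x - y)))"
        using moll_nonneg[OF e, of "x - y"] by (simp add: ennreal_mult)
    qed
    finally have le: "ennreal (norm (conv u (moll e) x - u x)) \<le> (NNINT y. ennreal (\<bar>u y - u x\<bar> * sqrt (moll e (x - y))) * ennreal (sqrt (moll e (x - y))))" .
    have "ennreal ((norm (conv u (moll e) x - u x))\<^sup>2) = (ennreal (norm (conv u (moll e) x - u x)))\<^sup>2" by (simp add: ennreal_power)
    also have "\<dots> \<le> (NNINT y. ennreal (\<bar>u y - u x\<bar> * sqrt (moll e (x - y))) * ennreal (sqrt (moll e (x - y))))\<^sup>2"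
      by (rule power_mono[OF le]) simp
    also have "\<dots> \<le> (NNINT y. (ennreal (\<bar>u y - u x\<bar> * sqrt (moll e (x - y))))\<^sup>2) * (NNINT y. (ennreal (sqrt (moll e (x - y))))\<^sup>2)"
      by (rule Cauchy_Schwarz_nn_integral) measurable
    also have "(NNINT y. (ennreal (sqrt (moll e (x - y))))\<^sup>2) = (NNINT y. ennreal (moll e (x - y)))"
      by (intro nn_integral_cong) (simp add: ennreal_power moll_nonneg[OF e])
    also have "\<dots> = 1" using nn_integral_reflect[of "\<lambda>y. ennreal (moll e y)" x] by (simp add: moll_nn_integral[OF e])
    also have "(NNINT y. (ennreal (\<bar>u y - u x\<bar> * sqrt (moll e (x - y))))\<^sup>2) = (NNINT y. ennreal ((norm (u y - u x))\<^sup>2) * ennreal (moll e (y - x)))"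
      by (intro nn_integral_cong)
        (simp add: ennreal_power power_mult_distrib moll_nonneg[OF e] ennreal_mult moll_even[of e x])
    also have "\<dots> = (NNINT y. ennreal ((norm (u (x + y) - u x))\<^sup>2) * ennreal (moll e y))"
      using nn_integral_translate[of "\<lambda>y. ennreal ((norm (u y - u x))\<^sup>2) * ennreal (moll e (y - x))" x]
      by (simp add: add.commute)
    finally show ?thesis by simp
  qed
  have "L2sq (\<lambda>x. conv u (moll e) x - u x) \<le> (NNINT x. (NNINT y. ennreal ((norm (u (x + y) - u x))\<^sup>2) * ennreal (moll e y)))"
    unfolding L2sq_def by (intro nn_integral_mono pt)
  also have "\<dots> = (NNINT y. (NNINT x. ennreal ((norm (u (x + y) - u x))\<^sup>2) * ennreal (moll e y)))"
    by (rule lborel_pair.Fubini') measurable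
  also have "\<dots> = (NNINT y. L2sq (\<lambda>x. u (x + y) - u x) * ennreal (moll e y))"
    unfolding L2sq_def by (intro nn_integral_cong nn_integral_multc) measurable
  also have "\<dots> \<le> (NNINT y. S * ennreal (moll e y))"
  proof (rule nn_integral_mono)
    fix y
    show "L2sq (\<lambda>x. u (x + y) - u x) * ennreal (moll e y) \<le> S * ennreal (moll e y)"
      by (cases "norm y \<le> e") (auto intro!: mult_right_mono S simp: moll_zero[OF e])
  qed
  also have "\<dots> = S" by (subst nn_integral_cmult) (simp_all add: moll_nn_integral[OF e])
  finally show ?thesis .
qed

lemma conv_measurable:
  assumes "borel_fun u" "L2sq u < \<infinity>" "test_fun UNIV g"
  shows "borel_fun (conv u g)"
  by (rule C1_measurable[OF smooth_C1[OF smooth_conv[OF assms]]])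

lemma conv_moll_tendsto:
  assumes um [measurable]: "borel_fun u" and u: "L2sq u < \<infinity>" and e: "e > 0"
  shows "\<exists>d>0. \<forall>r. 0 < r \<and> r < d \<longrightarrow> L2sq (\<lambda>x. conv u (moll r) x - u x) \<le> ennreal e"
proof -
  obtain d where d: "d > 0" "\<And>y. norm y < d \<Longrightarrow> L2sq (\<lambda>x. u (x + y) - u x) \<le> ennreal e"
    using L2_translation_continuous[OF um u e] by blast
  have "L2sq (\<lambda>x. conv u (moll r) x - u x) \<le> ennreal e" if "0 < r" "r < d" for r
    by (rule conv_moll_bound[OF um u that(1)]) (rule d(2), use that in linarith)
  then show ?thesis using d(1) by blast
qed

section \<open>Weak gradients\<close>

text \<open>The integration by parts rule alone, for the Borel measure on the whole space;
  integrability is supplied by square integrability wherever the relation is used.\<close>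

definition wk :: "(R3 \<Rightarrow> real) \<Rightarrow> (R3 \<Rightarrow> R3) \<Rightarrow> bool" where
  "wk u G \<longleftrightarrow> (\<forall>\<phi> i. test_fun UNIV \<phi> \<longrightarrow>
     (LBINT x. u x * partial i \<phi> x) = - (LBINT x. G x $ i * \<phi> x))"

text \<open>For \<open>U = UNIV\<close> this is \<open>u \<in> H\<^sup>1\<close> with gradient \<open>G\<close>, and for open \<open>U\<close> it is \<open>u \<in> H\<^sub>0\<^sup>1(U)\<close>.\<close>

definition appr :: "R3 set \<Rightarrow> (R3 \<Rightarrow> real) \<Rightarrow> (R3 \<Rightarrow> R3) \<Rightarrow> bool" where
  "appr U u G \<longleftrightarrow> borel_fun u \<and> borel_fun G \<and>
     (\<forall>e>0. \<exists>\<phi>. test_fun U \<phi> \<and> L2sq (\<lambda>x. u x - \<phi> x) \<le> ennreal e \<and> L2sq (\<lambda>x. G x - gr \<phi> x) \<le> ennreal e)"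

lemma L2sq_vec_components:
  fixes G :: "R3 \<Rightarrow> R3"
  assumes [measurable]: "borel_fun G"
  shows "L2sq G = (\<Sum>i\<in>UNIV. L2sq (\<lambda>x. G x $ i))"
proof -
  have "ennreal ((norm (G x))\<^sup>2) = (\<Sum>i\<in>UNIV. ennreal ((norm (G x $ i))\<^sup>2))" for x
  proof -
    have "(norm (G x))\<^sup>2 = (\<Sum>i\<in>UNIV. (norm (G x $ i))\<^sup>2)"
      unfolding power2_norm_eq_inner by (simp only: inner_vec_def)
    then show ?thesis by (simp only: sum_ennreal[OF zero_le_power2])
  qed
  then have "L2sq G = (NNINT x. (\<Sum>i\<in>UNIV. ennreal ((norm (G x $ i))\<^sup>2)))"
    unfolding L2sq_def by (rule nn_integral_cong)
  then show ?thesis by (simp only: L2sq_def) (rule nn_integral_sum, measurable)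
qed

lemma L2sq_component_le: "L2sq (\<lambda>x. G x $ i) \<le> L2sq (G :: R3 \<Rightarrow> R3)"
  by (rule L2sq_mono) (simp add: component_le_norm_cart)

lemma L2sq_component_finite: "L2sq (G :: R3 \<Rightarrow> R3) < \<infinity> \<Longrightarrow> L2sq (\<lambda>x. G x $ i) < \<infinity>"
  using L2sq_component_le le_less_trans by blast

lemma ennreal_tendsto_0I:
  fixes a :: "nat \<Rightarrow> ennreal"
  assumes "\<And>e::real. e > 0 \<Longrightarrow> eventually (\<lambda>n. a n \<le> ennreal e) sequentially"
  shows "a \<longlonglongrightarrow> 0"
proof (rule order_tendstoI)
  fix y :: ennreal assume "0 < y"
  then obtain b where b: "0 < b" "b < y" using dense by blast
  have "b < top" using b(2) by (rule order_less_le_trans) simp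
  then have e: "enn2real b > 0" "ennreal (enn2real b) < y" using b by (auto simp: enn2real_positive_iff)
  show "\<forall>\<^sub>F n in sequentially. a n < y"
    using assms[OF e(1)] by eventually_elim (rule le_less_trans[OF _ e(2)])
qed simp

lemma ennreal_tendsto_0D:
  fixes a :: "nat \<Rightarrow> ennreal"
  assumes "a \<longlonglongrightarrow> 0" "(e::real) > 0"
  shows "eventually (\<lambda>n. a n \<le> ennreal e) sequentially"
proof -
  have "eventually (\<lambda>n. a n < ennreal e) sequentially" by (rule order_tendstoD[OF assms(1)]) (use assms(2) in simp)
  then show ?thesis by eventually_elim simp
qed

lemma eventually_inverse_Suc_le:
  assumes "(e::real) > 0"
  shows "eventually (\<lambda>n. 1 / real (Suc n) \<le> e) sequentially"
proof -
  have "eventually (\<lambda>n. 1 / real (Suc n) < e) sequentially"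
    using LIMSEQ_inverse_real_of_nat[THEN order_tendstoD(2), OF assms] by (simp add: inverse_eq_divide)
  then show ?thesis by eventually_elim simp
qed

lemma apprD:
  assumes "appr U u G"
  shows "borel_fun u" "borel_fun G"
  using assms by (auto simp: appr_def)

lemma appr_seq:
  assumes A: "appr U u G"
  obtains \<phi> where "\<And>n::nat. test_fun U (\<phi> n)" "L2lim \<phi> u" "L2lim (\<lambda>n. gr (\<phi> n)) G"
proof -
  have "\<forall>n. \<exists>\<phi>. test_fun U \<phi> \<and> L2sq (\<lambda>x. u x - \<phi> x) \<le> ennreal (1 / real (Suc n)) \<and> L2sq (\<lambda>x. G x - gr \<phi> x) \<le> ennreal (1 / real (Suc n))"
    using A unfolding appr_def by simp
  from choice[OF this] obtain \<phi> where
    \<phi>: "\<forall>n. test_fun U (\<phi> n) \<and> L2sq (\<lambda>x. u x - \<phi> n x) \<le> ennreal (1 / real (Suc n)) \<and> L2sq (\<lambda>x. G x - gr (\<phi> n) x) \<le> ennreal (1 / real (Suc n))"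
    by blast
  have "L2lim \<phi> u" unfolding L2lim_def
  proof (rule ennreal_tendsto_0I)
    fix e :: real assume "e > 0"
    from eventually_inverse_Suc_le[OF this] show "\<forall>\<^sub>F n in sequentially. L2sq (\<lambda>x. \<phi> n x - u x) \<le> ennreal e"
    proof eventually_elim
      case (elim n)
      have "L2sq (\<lambda>x. \<phi> n x - u x) \<le> ennreal (1 / real (Suc n))" using \<phi> by (simp only: L2sq_commute[of "\<phi> n"])
      also have "\<dots> \<le> ennreal e" by (rule ennreal_leI[OF elim])
      finally show ?case .
    qed
  qed
  moreover have "L2lim (\<lambda>n. gr (\<phi> n)) G" unfolding L2lim_def
  proof (rule ennreal_tendsto_0I)
    fix e :: real assume "e > 0"
    from eventually_inverse_Suc_le[OF this] show "\<forall>\<^sub>F n in sequentially. L2sq (\<lambda>x. gr (\<phi> n) x - G x) \<le> ennreal e"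
    proof eventually_elim
      case (elim n)
      have "L2sq (\<lambda>x. gr (\<phi> n) x - G x) \<le> ennreal (1 / real (Suc n))" using \<phi> by (simp only: L2sq_commute[of "gr (\<phi> n)"])
      also have "\<dots> \<le> ennreal e" by (rule ennreal_leI[OF elim])
      finally show ?case .
    qed
  qed
  ultimately show ?thesis using that[of \<phi>] \<phi> by blast
qed

lemma ennreal_two_halves: "e > 0 \<Longrightarrow> 2 * ennreal (e/4) + 2 * ennreal (e/4) = ennreal e"
  by (simp add: ennreal_mult'[symmetric] ennreal_plus[symmetric] del: ennreal_plus ennreal_numeral flip: ennreal_numeral)

text \<open>The relation is closed in L^2. Later members are found by approximating with pairs
  already known to belong.\<close>

lemma appr_limit:
  assumes [measurable]: "borel_fun u" "borel_fun G"
    and ap: "\<And>e::real. e > 0 \<Longrightarrow> \<exists>v H. appr U v H \<and> L2sq (\<lambda>x. u x - v x) \<le> ennreal e \<and> L2sq (\<lambda>x. G x - H x) \<le> ennreal e"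
  shows "appr U u G"
  unfolding appr_def
proof (intro conjI allI impI)
  fix e :: real assume e: "e > 0"
  obtain v H where v: "appr U v H" "L2sq (\<lambda>x. u x - v x) \<le> ennreal (e/4)" "L2sq (\<lambda>x. G x - H x) \<le> ennreal (e/4)"
    using ap[of "e/4"] e by auto
  note [measurable] = apprD[OF v(1)]
  obtain \<phi> where \<phi>: "test_fun U \<phi>" "L2sq (\<lambda>x. v x - \<phi> x) \<le> ennreal (e/4)" "L2sq (\<lambda>x. H x - gr \<phi> x) \<le> ennreal (e/4)"
    using v(1)[unfolded appr_def, THEN conjunct2, THEN conjunct2, rule_format, of "e/4"] e by auto
  note [measurable] = test_fun_measurable[OF \<phi>(1)] test_fun_gr_measurable[OF \<phi>(1)]
  have "L2sq (\<lambda>x. u x - \<phi> x) \<le> 2 * L2sq (\<lambda>x. u x - v x) + 2 * L2sq (\<lambda>x. v x - \<phi> x)"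
    by (rule L2sq_triangle) measurable
  also have "\<dots> \<le> 2 * ennreal (e/4) + 2 * ennreal (e/4)" by (intro add_mono mult_left_mono v \<phi>) auto
  finally have 1: "L2sq (\<lambda>x. u x - \<phi> x) \<le> ennreal e" unfolding ennreal_two_halves[OF e] .
  have "L2sq (\<lambda>x. G x - gr \<phi> x) \<le> 2 * L2sq (\<lambda>x. G x - H x) + 2 * L2sq (\<lambda>x. H x - gr \<phi> x)"
    by (rule L2sq_triangle) measurable
  also have "\<dots> \<le> 2 * ennreal (e/4) + 2 * ennreal (e/4)" by (intro add_mono mult_left_mono v \<phi>) auto
  finally have 2: "L2sq (\<lambda>x. G x - gr \<phi> x) \<le> ennreal e" unfolding ennreal_two_halves[OF e] .
  show "\<exists>\<phi>. test_fun U \<phi> \<and> L2sq (\<lambda>x. u x - \<phi> x) \<le> ennreal e \<and> L2sq (\<lambda>x. G x - gr \<phi> x) \<le> ennreal e"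
    using \<phi>(1) 1 2 by blast
qed measurable

lemma appr_limit_seq:
  assumes m: "borel_fun u" "borel_fun G"
    and ap: "\<And>n. appr U (v n) (H n)" "L2lim v u" "L2lim H G"
  shows "appr U u G"
proof (rule appr_limit[OF m])
  fix e :: real assume e: "e > 0"
  have "eventually (\<lambda>n. L2sq (\<lambda>x. v n x - u x) \<le> ennreal e \<and> L2sq (\<lambda>x. H n x - G x) \<le> ennreal e) sequentially"
    using ap(2,3) unfolding L2lim_def by (intro eventually_conj ennreal_tendsto_0D e)
  from eventually_happens'[OF sequentially_bot this] obtain n where
    "L2sq (\<lambda>x. v n x - u x) \<le> ennreal e" "L2sq (\<lambda>x. H n x - G x) \<le> ennreal e" by blast
  then show "\<exists>v H. appr U v H \<and> L2sq (\<lambda>x. u x - v x) \<le> ennreal e \<and> L2sq (\<lambda>x. G x - H x) \<le> ennreal e"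
    using ap(1)[of n] L2sq_commute[of u "v n"] L2sq_commute[of G "H n"] by metis
qed

lemma appr_test_fun: "test_fun U \<phi> \<Longrightarrow> appr U \<phi> (gr \<phi>)"
  unfolding appr_def by (auto simp: test_fun_measurable test_fun_gr_measurable intro!: exI[of _ \<phi>])

lemma appr_from_test_seq:
  assumes m: "borel_fun u" "borel_fun G"
    and ap: "\<And>n. test_fun U (\<phi> n)" "L2lim \<phi> u" "L2lim (\<lambda>n. gr (\<phi> n)) G"
  shows "appr U u G"
  by (rule appr_limit_seq[OF m appr_test_fun[OF ap(1)] ap(2,3)])

lemma appr_L2:
  assumes A: "appr U u G"
  shows "L2sq u < \<infinity>" "L2sq G < \<infinity>"
proof -
  obtain \<phi> where \<phi>: "test_fun U \<phi>" "L2sq (\<lambda>x. u x - \<phi> x) \<le> ennreal 1" "L2sq (\<lambda>x. G x - gr \<phi> x) \<le> ennreal 1"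
    using A[unfolded appr_def, THEN conjunct2, THEN conjunct2, rule_format, of 1] by auto
  show "L2sq u < \<infinity>"
    by (rule L2sq_finite_from_approx[OF apprD(1)[OF A] test_fun_measurable[OF \<phi>(1)] _ test_fun_L2(1)[OF \<phi>(1)]])
      (rule le_less_trans[OF \<phi>(2)], simp)
  show "L2sq G < \<infinity>"
    by (rule L2sq_finite_from_approx[OF apprD(2)[OF A] test_fun_gr_measurable[OF \<phi>(1)] _ test_fun_L2(2)[OF \<phi>(1)]])
      (rule le_less_trans[OF \<phi>(3)], simp)
qed

lemma appr_cong_AE:
  assumes A: "appr U u G" and m: "borel_fun v" "borel_fun H"
    and ae: "AE x in lborel. u x = v x" "AE x in lborel. G x = H x"
  shows "appr U v H"
proof (rule appr_limit[OF m])
  fix e :: real assume "e > 0"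
  have "L2sq (\<lambda>x. v x - u x) = L2sq (\<lambda>x::R3. 0::real)" by (rule L2sq_cong_AE) (use ae(1) in auto)
  moreover have "L2sq (\<lambda>x. H x - G x) = L2sq (\<lambda>x::R3. 0::R3)" by (rule L2sq_cong_AE) (use ae(2) in auto)
  ultimately show "\<exists>va Ha. appr U va Ha \<and> L2sq (\<lambda>x. v x - va x) \<le> ennreal e \<and> L2sq (\<lambda>x. H x - Ha x) \<le> ennreal e"
    using A by (intro exI[of _ u] exI[of _ G]) simp
qed

lemma appr_mono: "appr U u G \<Longrightarrow> U \<subseteq> U' \<Longrightarrow> appr U' u G"
  unfolding appr_def by (meson test_fun_mono)

lemma appr_add:
  assumes A: "appr U u G" and B: "appr U v H"
  shows "appr U (\<lambda>x. u x + v x) (\<lambda>x. G x + H x)"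
proof -
  obtain \<phi> where \<phi>: "\<And>n::nat. test_fun U (\<phi> n)" "L2lim \<phi> u" "L2lim (\<lambda>n. gr (\<phi> n)) G"
    using appr_seq[OF A] by blast
  obtain \<psi> where \<psi>: "\<And>n::nat. test_fun U (\<psi> n)" "L2lim \<psi> v" "L2lim (\<lambda>n. gr (\<psi> n)) H"
    using appr_seq[OF B] by blast
  note [measurable] = apprD[OF A] apprD[OF B] test_fun_measurable[OF \<phi>(1)] test_fun_gr_measurable[OF \<phi>(1)]
    test_fun_measurable[OF \<psi>(1)] test_fun_gr_measurable[OF \<psi>(1)]
  show ?thesis
  proof (rule appr_from_test_seq[where \<phi>="\<lambda>n x. \<phi> n x + \<psi> n x"])
    show "test_fun U (\<lambda>x. \<phi> n x + \<psi> n x)" for n by (rule test_fun_add[OF \<phi>(1) \<psi>(1)])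
    show "L2lim (\<lambda>n x. \<phi> n x + \<psi> n x) (\<lambda>x. u x + v x)" by (intro L2lim_add \<phi> \<psi>) measurable
    have "gr (\<lambda>x. \<phi> n x + \<psi> n x) = (\<lambda>x. gr (\<phi> n) x + gr (\<psi> n) x)" for n
      by (rule gr_add[OF test_fun_C1[OF \<phi>(1)] test_fun_C1[OF \<psi>(1)]])
    moreover have "L2lim (\<lambda>n x. gr (\<phi> n) x + gr (\<psi> n) x) (\<lambda>x. G x + H x)" by (intro L2lim_add \<phi> \<psi>) measurable
    ultimately show "L2lim (\<lambda>n. gr (\<lambda>x. \<phi> n x + \<psi> n x)) (\<lambda>x. G x + H x)" by simp
  qed measurable
qed

lemma appr_cmult:
  assumes A: "appr U u G"
  shows "appr U (\<lambda>x. c * u x) (\<lambda>x. c *\<^sub>R G x)"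
proof -
  obtain \<phi> where \<phi>: "\<And>n::nat. test_fun U (\<phi> n)" "L2lim \<phi> u" "L2lim (\<lambda>n. gr (\<phi> n)) G"
    using appr_seq[OF A] by blast
  note m [measurable] = apprD[OF A] test_fun_measurable[OF \<phi>(1)] test_fun_gr_measurable[OF \<phi>(1)]
  show ?thesis
  proof (rule appr_from_test_seq[where \<phi>="\<lambda>n x. c * \<phi> n x"])
    show "test_fun U (\<lambda>x. c * \<phi> n x)" for n by (rule test_fun_cmult[OF \<phi>(1)])
    show "L2lim (\<lambda>n x. c * \<phi> n x) (\<lambda>x. c * u x)" using L2lim_scaleR[OF m(3,1) \<phi>(2), of c] by simp
    have "gr (\<lambda>x. c * \<phi> n x) = (\<lambda>x. c *\<^sub>R gr (\<phi> n) x)" for n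
      by (rule gr_cmult[OF test_fun_C1[OF \<phi>(1)]])
    then show "L2lim (\<lambda>n. gr (\<lambda>x. c * \<phi> n x)) (\<lambda>x. c *\<^sub>R G x)" using L2lim_scaleR[OF m(4,2) \<phi>(3), of c] by simp
  qed measurable
qed

lemma appr_diff:
  assumes A: "appr U u G" and B: "appr U v H"
  shows "appr U (\<lambda>x. u x - v x) (\<lambda>x. G x - H x)"
  using appr_add[OF A appr_cmult[OF B, of "-1"]] by simp

lemma appr_translate:
  assumes A: "appr UNIV u G"
  shows "appr UNIV (\<lambda>x. u (x + a)) (\<lambda>x. G (x + a))"
proof -
  obtain \<phi> where \<phi>: "\<And>n::nat. test_fun UNIV (\<phi> n)" "L2lim \<phi> u" "L2lim (\<lambda>n. gr (\<phi> n)) G"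
    using appr_seq[OF A] by blast
  note m [measurable] = apprD[OF A] test_fun_measurable[OF \<phi>(1)] test_fun_gr_measurable[OF \<phi>(1)]
  show ?thesis
  proof (rule appr_from_test_seq[where \<phi>="\<lambda>n x. \<phi> n (x + a)"])
    show "test_fun UNIV (\<lambda>x. \<phi> n (x + a))" for n
    proof (rule test_funI)
      show "smooth (\<lambda>x. \<phi> n (x + a))" using smooth_affine[OF test_fun_smooth[OF \<phi>(1)], of n 1 a] by simp
      show "compact ((+) (- a) ` tsupport (\<phi> n))" by (rule compact_translation) (use \<phi>(1)[of n] in \<open>simp add: test_fun_def\<close>)
      show "\<phi> n (x + a) = 0" if "x \<notin> (+) (- a) ` tsupport (\<phi> n)" for x
      proof (rule not_in_tsupport)
        show "x + a \<notin> tsupport (\<phi> n)"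
        proof
          assume "x + a \<in> tsupport (\<phi> n)"
          then have "- a + (x + a) \<in> (+) (- a) ` tsupport (\<phi> n)" by (rule imageI)
          then show False using that by simp
        qed
      qed
    qed simp
    show "L2lim (\<lambda>n x. \<phi> n (x + a)) (\<lambda>x. u (x + a))"
    proof -
      have "L2sq (\<lambda>x. \<phi> n (x + a) - u (x + a)) = L2sq (\<lambda>x. \<phi> n x - u x)" for n
        using L2sq_translate[of "\<lambda>x. \<phi> n x - u x" a] by simp
      then show ?thesis using \<phi>(2) by (simp add: L2lim_def)
    qed
    show "L2lim (\<lambda>n. gr (\<lambda>x. \<phi> n (x + a))) (\<lambda>x. G (x + a))"
    proof -
      have "gr (\<lambda>x. \<phi> n (x + a)) = (\<lambda>x. gr (\<phi> n) (x + a))" for n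
      proof
        fix x
        have "\<phi> n differentiable at (1 *\<^sub>R x + a)"
          using C1_derivative[OF test_fun_C1[OF \<phi>(1)]] by (rule differentiableI)
        from gr_affine[OF this] show "gr (\<lambda>x. \<phi> n (x + a)) x = gr (\<phi> n) (x + a)" by simp
      qed
      moreover have "L2sq (\<lambda>x. gr (\<phi> n) (x + a) - G (x + a)) = L2sq (\<lambda>x. gr (\<phi> n) x - G x)" for n
        using L2sq_translate[of "\<lambda>x. gr (\<phi> n) x - G x" a] by simp
      ultimately show ?thesis using \<phi>(3) by (simp add: L2lim_def)
    qed
  qed measurable
qed

text \<open>By translation invariance the difference quotient in direction i has integral zero, and
  it approximates the partial derivative uniformly on a fixed compact set.\<close>

lemma integral_partial_zero:
  assumes h: "C1c U h"
  shows "(LBINT x. partial i h x) = 0"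
proof -
  obtain K where K: "compact K" "\<And>x. x \<notin> K \<Longrightarrow> h x = 0" "\<And>x. x \<notin> K \<Longrightarrow> gr h x = 0"
    using C1c_compact[OF h] by metis
  note C = C1c_C1[OF h]
  note gm [measurable] = C1_measurable[OF C]
  have pc: "continuous_on UNIV (partial i h)"
    using continuous_on_component[OF C1_gr_continuous[OF C], of i] by simp
  have pz: "partial i h x = 0" if "x \<notin> K" for x using K(3)[OF that] gr_nth[of h x i] by simp
  have int_p: "integrable lborel (partial i h)" by (rule integrable_compact_support[OF pc K(1) pz])
  have int_h: "integrable lborel h" by (rule integrable_compact_support[OF C1_continuous[OF C] K(1,2)])
  define K' where "K' = {a + b | a b. a \<in> K \<and> b \<in> cball (0::R3) 1}"
  have K': "compact K'" unfolding K'_def by (rule compact_sums[OF K(1) compact_cball])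
  define m where "m = measure lborel K'"
  have intK: "integrable lborel (indicator K' :: R3 \<Rightarrow> real)"
    using borel_compact[OF K'] emeasure_compact_finite[OF K'] by (simp add: integrable_indicator_iff)
  have m0: "m \<ge> 0" by (simp add: m_def)
  have le: "\<bar>(LBINT x. partial i h x)\<bar> \<le> e * m" if e: "e > 0" for e
  proof -
    obtain d where d: "d > 0" "\<And>z v. norm v < d \<Longrightarrow> \<bar>h (z + v) - h z - gr h z \<bullet> v\<bar> \<le> e * norm v"
      using C1c_uniformly_differentiable[OF h e] by blast
    \<comment> \<open>A step below d for the expansion and at most 1, so that the difference
      quotient lives on the enlarged set K'. The factor t cancels at the end, leaving the bound e *
      m for arbitrary e.\<close>
    define t where "t = min d 1 / 2"
    define v where "v = t *\<^sub>R (axis i 1 :: R3)"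
    have t: "t > 0" "t < d" "t \<le> 1" using d(1) by (auto simp: t_def)
    have nv: "norm v = t" using t by (simp add: v_def norm_axis_1)
    have int_t: "integrable lborel (\<lambda>z. h (z + v))"
    proof -
      have "integrable (distr lborel borel (\<lambda>z. z + v)) h" unfolding lborel_distr_add_right by (rule int_h)
      then show ?thesis by (simp add: integrable_distr_eq)
    qed
    have int_tp: "integrable lborel (\<lambda>z. t * partial i h z)" using int_p by simp
    have "(LBINT z. t * partial i h z) = (LBINT z. h (z + v)) - (LBINT z. h z) - (LBINT z. h (z + v) - h z - t * partial i h z)"
      by (subst Bochner_Integration.integral_diff[OF Bochner_Integration.integrable_diff[OF int_t int_h] int_tp])
        (simp add: Bochner_Integration.integral_diff[OF int_t int_h])
    then have eq: "t * (LBINT z. partial i h z) = - (LBINT z. h (z + v) - h z - t * partial i h z)"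
      by (simp add: integral_translate)
    have "norm (LBINT z. h (z + v) - h z - t * partial i h z) \<le> (LBINT z. e * t * indicator K' z)"
    proof (rule order_trans[OF integral_norm_bound integral_mono])
      show "integrable lborel (\<lambda>z. norm (h (z + v) - h z - t * partial i h z))"
        by (intro integrable_norm Bochner_Integration.integrable_diff int_t int_h int_tp)
      show "integrable lborel (\<lambda>z. e * t * indicator K' z)" using intK by simp
      fix z
      show "norm (h (z + v) - h z - t * partial i h z) \<le> e * t * indicator K' z"
      proof (cases "z \<in> K'")
        case True
        have "gr h z \<bullet> v = t * partial i h z" by (simp add: v_def inner_axis)
        then show ?thesis using d(2)[of v z] True t by (simp add: nv)
      next
        case False
        have "z \<notin> K"
        proof
          assume "z \<in> K"
          then have "z + 0 \<in> K'" unfolding K'_def by fastforce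
          then show False using False by simp
        qed
        moreover have "z + v \<notin> K"
        proof
          assume "z + v \<in> K"
          moreover have "- v \<in> cball 0 1" using nv t by simp
          ultimately have "(z + v) + - v \<in> K'" unfolding K'_def by blast
          then show False using False by simp
        qed
        ultimately show ?thesis using K pz False by simp
      qed
    qed
    also have "\<dots> = e * t * m" using borel_compact[OF K'] by (simp add: m_def)
    finally have le1: "norm (LBINT z. h (z + v) - h z - t * partial i h z) \<le> e * t * m" .
    have "t * \<bar>(LBINT x. partial i h x)\<bar> \<le> t * (e * m)"
    proof -
      have "t * \<bar>(LBINT x. partial i h x)\<bar> = \<bar>t * (LBINT x. partial i h x)\<bar>" using t by (simp add: abs_mult)
      also have "\<dots> = norm (LBINT z. h (z + v) - h z - t * partial i h z)" unfolding eq by simp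
      also note le1
      finally show ?thesis by (simp only: mult_ac)
    qed
    then show ?thesis using t(1) by (simp only: mult_le_cancel_left_pos)
  qed
  have "\<bar>(LBINT x. partial i h x)\<bar> \<le> r" if r: "r > 0" for r :: real
  proof -
    have "\<bar>(LBINT x. partial i h x)\<bar> \<le> r / (m + 1) * m" by (rule le) (use r m0 in simp)
    also have "\<dots> \<le> r" using r m0 by (simp add: field_simps)
    finally show ?thesis .
  qed
  then show ?thesis using field_le_epsilon[of "\<bar>(LBINT x. partial i h x)\<bar>" 0] by simp
qed

lemma C1c_mult:
  assumes "C1c U g" "C1 h"
  shows "C1c U (\<lambda>x. g x * h x)"
proof -
  obtain K where K: "compact K" "K \<subseteq> U" "\<forall>x. x \<notin> K \<longrightarrow> g x = 0" using assms(1) unfolding C1c_def by blast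
  then have "\<forall>x. x \<notin> K \<longrightarrow> g x * h x = 0" by simp
  with K(1,2) C1_mult[OF C1c_C1[OF assms(1)] assms(2)] show ?thesis unfolding C1c_def by blast
qed

lemma continuous_product_integrable:
  fixes g h :: "R3 \<Rightarrow> real"
  assumes "continuous_on UNIV g" "continuous_on UNIV h" "compact K" "\<And>x. x \<notin> K \<Longrightarrow> g x = 0"
  shows "integrable lborel (\<lambda>x. g x * h x)"
  by (rule integrable_compact_support[OF continuous_on_mult[OF assms(1,2)] assms(3)]) (use assms(4) in simp)

text \<open>Integration by parts: the product of g with a test function has compact support, so its
  partial derivatives integrate to zero.\<close>

lemma C1c_wk:
  assumes g: "C1c U g"
  shows "wk g (gr g)"
  unfolding wk_def
proof (intro allI impI)
  fix \<phi> :: "R3 \<Rightarrow> real" and i assume \<phi>: "test_fun UNIV \<phi>"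
  obtain K where K: "compact K" "\<And>x. x \<notin> K \<Longrightarrow> g x = 0" "\<And>x. x \<notin> K \<Longrightarrow> gr g x = 0"
    using C1c_compact[OF g] by metis
  note C = C1c_C1[OF g] and C' = test_fun_C1[OF \<phi>]
  have p: "partial i (\<lambda>x. g x * \<phi> x) = (\<lambda>x. g x * partial i \<phi> x + partial i g x * \<phi> x)"
  proof
    fix x
    show "partial i (\<lambda>x. g x * \<phi> x) x = g x * partial i \<phi> x + partial i g x * \<phi> x"
      unfolding gr_nth[symmetric] gr_mult[OF C C'] by (simp add: mult.commute)
  qed
  have i1: "integrable lborel (\<lambda>x. g x * partial i \<phi> x)"
    by (rule continuous_product_integrable[OF C1_continuous[OF C] _ K(1,2)])
      (use continuous_on_component[OF C1_gr_continuous[OF C'], of i] in simp)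
  have i2: "integrable lborel (\<lambda>x. partial i g x * \<phi> x)"
  proof (rule continuous_product_integrable[OF _ C1_continuous[OF C'] K(1)])
    show "continuous_on UNIV (partial i g)" using continuous_on_component[OF C1_gr_continuous[OF C], of i] by simp
    show "partial i g x = 0" if "x \<notin> K" for x using K(3)[OF that] gr_nth[of g x i] by simp
  qed
  have "(LBINT x. g x * partial i \<phi> x) + (LBINT x. partial i g x * \<phi> x) = 0"
    using integral_partial_zero[OF C1c_mult[OF g C'], of i] unfolding p
    by (simp add: Bochner_Integration.integral_add[OF i1 i2])
  then show "(LBINT x. g x * partial i \<phi> x) = - (LBINT x. gr g x $ i * \<phi> x)" by simp
qed

lemma test_fun_partial_measurable: "test_fun U \<phi> \<Longrightarrow> borel_fun (partial i \<phi>)"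
  by (rule test_fun_measurable[OF test_fun_partial])

lemma L2lim_component:
  assumes "L2lim F (G :: R3 \<Rightarrow> R3)"
  shows "L2lim (\<lambda>n x. F n x $ i) (\<lambda>x. G x $ i)"
  unfolding L2lim_def
proof (rule ennreal_tendsto_0I)
  fix e :: real assume "e > 0"
  from ennreal_tendsto_0D[OF assms[unfolded L2lim_def] this]
  show "\<forall>\<^sub>F n in sequentially. L2sq (\<lambda>x. F n x $ i - G x $ i) \<le> ennreal e"
  proof eventually_elim
    case (elim n)
    have "L2sq (\<lambda>x. F n x $ i - G x $ i) \<le> L2sq (\<lambda>x. F n x - G x)"
      using L2sq_component_le[of "\<lambda>x. F n x - G x" i] by simp
    then show ?case using elim by (rule order_trans)
  qed
qed

lemma appr_wk:
  assumes A: "appr U u G"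
  shows "wk u G"
  unfolding wk_def
proof (intro allI impI)
  fix \<psi> :: "R3 \<Rightarrow> real" and i assume \<psi>: "test_fun UNIV \<psi>"
  obtain \<phi> where \<phi>: "\<And>n::nat. test_fun U (\<phi> n)" "L2lim \<phi> u" "L2lim (\<lambda>n. gr (\<phi> n)) G"
    using appr_seq[OF A] by blast
  note m = apprD[OF A] and f = appr_L2[OF A]
  have 1: "(\<lambda>n. (LBINT x. \<phi> n x \<bullet> partial i \<psi> x)) \<longlonglongrightarrow> (LBINT x. u x \<bullet> partial i \<psi> x)"
    by (rule L2lim_inner[OF test_fun_measurable[OF \<phi>(1)] m(1) test_fun_partial_measurable[OF \<psi>] \<phi>(2) test_fun_L2(1)[OF \<phi>(1)] f(1)
      test_fun_L2(1)[OF test_fun_partial[OF \<psi>]]])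
  have 2: "(\<lambda>n. (LBINT x. gr (\<phi> n) x $ i \<bullet> \<psi> x)) \<longlonglongrightarrow> (LBINT x. G x $ i \<bullet> \<psi> x)"
  proof (rule L2lim_inner[OF _ _ test_fun_measurable[OF \<psi>] L2lim_component[OF \<phi>(3)] _ _ test_fun_L2(1)[OF \<psi>]])
    show "borel_fun (\<lambda>x. gr (\<phi> n) x $ i)" for n
      by (rule borel_measurable_vec_nth[OF test_fun_gr_measurable[OF \<phi>(1)]])
    show "borel_fun (\<lambda>x. G x $ i)" by (rule borel_measurable_vec_nth[OF m(2)])
    show "L2sq (\<lambda>x. gr (\<phi> n) x $ i) < \<infinity>" for n by (rule L2sq_component_finite[OF test_fun_L2(2)[OF \<phi>(1)]])
    show "L2sq (\<lambda>x. G x $ i) < \<infinity>" by (rule L2sq_component_finite[OF f(2)])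
  qed
  have eq: "(LBINT x. \<phi> n x \<bullet> partial i \<psi> x) = - (LBINT x. gr (\<phi> n) x $ i \<bullet> \<psi> x)" for n
    using C1c_wk[OF test_fun_C1c[OF \<phi>(1)], of n] \<psi> unfolding wk_def by simp
  have "(\<lambda>n. (LBINT x. \<phi> n x \<bullet> partial i \<psi> x)) \<longlonglongrightarrow> - (LBINT x. G x $ i \<bullet> \<psi> x)"
    unfolding eq by (rule tendsto_minus[OF 2])
  from LIMSEQ_unique[OF 1 this] show "(LBINT x. u x * partial i \<psi> x) = - (LBINT x. G x $ i * \<psi> x)" by simp
qed

section \<open>Mollification of weak gradients\<close>

lemma test_fun_reflect:
  assumes "test_fun UNIV g"
  shows "test_fun UNIV (\<lambda>y. g (x - y))" "partial i (\<lambda>y. g (x - y)) y = - partial i g (x - y)"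
proof -
  show "test_fun UNIV (\<lambda>y. g (x - y))"
  proof (rule test_funI)
    show "smooth (\<lambda>y. g (x - y))" using smooth_affine[OF test_fun_smooth[OF assms], of "-1" x] by simp
    show "compact ((\<lambda>z. x - z) ` tsupport g)"
      by (rule compact_continuous_image) (use assms in \<open>auto simp: test_fun_def intro!: continuous_intros\<close>)
    show "g (x - y) = 0" if "y \<notin> (\<lambda>z. x - z) ` tsupport g" for y
    proof (rule not_in_tsupport)
      show "x - y \<notin> tsupport g"
      proof
        assume "x - y \<in> tsupport g"
        then have "x - (x - y) \<in> (\<lambda>z. x - z) ` tsupport g" by (rule imageI)
        then show False using that by simp
      qed
    qed
  qed simp
  have "g differentiable at ((-1) *\<^sub>R y + x)"
    using C1_derivative[OF test_fun_C1[OF assms]] by (rule differentiableI)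
  from gr_affine[OF this] have "gr (\<lambda>y. g (x - y)) y = - gr g (x - y)" by simp
  then show "partial i (\<lambda>y. g (x - y)) y = - partial i g (x - y)"
    by (metis gr_nth vector_uminus_component)
qed

text \<open>The reflected translate y -> g (x - y) is a legitimate test function; inserting it shows
  that mollification commutes with the weak gradient.\<close>

lemma wk_partial_conv:
  assumes w: "wk u G" and u: "borel_fun u" "L2sq u < \<infinity>" and g: "test_fun UNIV g"
  shows "partial i (conv u g) x = conv (\<lambda>y. G y $ i) g x"
proof -
  have "partial i (conv u g) x = (LBINT y. u y * partial i g (x - y))"
    unfolding partial_conv[OF u g] conv_def ..
  also have "\<dots> = - (LBINT y. u y * partial i (\<lambda>y. g (x - y)) y)"
    by (simp add: test_fun_reflect(2)[OF g])
  also have "\<dots> = (LBINT y. G y $ i * g (x - y))"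
    using w test_fun_reflect(1)[OF g, of x] unfolding wk_def by simp
  finally show ?thesis by (simp add: conv_def)
qed

lemma L2sq_vec_le:
  fixes G :: "R3 \<Rightarrow> R3"
  assumes m: "borel_fun G" and "\<And>i. L2sq (\<lambda>x. G x $ i) \<le> ennreal e" "e \<ge> 0"
  shows "L2sq G \<le> ennreal (3 * e)"
proof -
  have "L2sq G \<le> (\<Sum>i\<in>(UNIV::3 set). ennreal e)" unfolding L2sq_vec_components[OF m] by (intro sum_mono assms)
  also have "\<dots> = ennreal (3 * e)" using assms(3) by (simp add: ennreal_mult)
  finally show ?thesis .
qed

lemma wk_moll_gr:
  assumes w: "wk u G" and u: "borel_fun u" "L2sq u < \<infinity>"
    and G: "borel_fun G" "L2sq G < \<infinity>" and e: "e > 0"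
  shows "\<exists>d>0. \<forall>r. 0 < r \<and> r < d \<longrightarrow> L2sq (\<lambda>x. gr (conv u (moll r)) x - G x) \<le> ennreal e"
proof -
  have "\<exists>d>0. \<forall>r. 0 < r \<and> r < d \<longrightarrow> L2sq (\<lambda>x. conv (\<lambda>y. G y $ i) (moll r) x - G x $ i) \<le> ennreal (e/3)" for i
    by (rule conv_moll_tendsto[OF borel_measurable_vec_nth[OF G(1)] L2sq_component_finite[OF G(2)]]) (use e in simp)
  then have "\<forall>i. \<exists>d>0. \<forall>r. 0 < r \<and> r < d \<longrightarrow> L2sq (\<lambda>x. conv (\<lambda>y. G y $ i) (moll r) x - G x $ i) \<le> ennreal (e/3)" by blast
  from choice[OF this] obtain d where d: "\<forall>i. d i > 0 \<and> (\<forall>r. 0 < r \<and> r < d i \<longrightarrow> L2sq (\<lambda>x. conv (\<lambda>y. G y $ i) (moll r) x - G x $ i) \<le> ennreal (e/3))"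
    by blast
  have "L2sq (\<lambda>x. gr (conv u (moll r)) x - G x) \<le> ennreal e" if r: "0 < r" "r < Min (range d)" for r
  proof -
    note mt = moll_test[OF r(1)]
    have m: "borel_fun (\<lambda>x. gr (conv u (moll r)) x - G x)"
      by (rule borel_measurable_diff[OF C1_gr_measurable[OF smooth_C1[OF smooth_conv[OF u mt]]] G(1)])
    have "L2sq (\<lambda>x. (gr (conv u (moll r)) x - G x) $ i) \<le> ennreal (e/3)" for i
    proof -
      have "r < d i" using r(2) by simp
      then show ?thesis using d r(1) by (simp add: wk_partial_conv[OF w u mt])
    qed
    from L2sq_vec_le[OF m this] show ?thesis using e by simp
  qed
  moreover have "Min (range d) > 0" using d by (subst Min_gr_iff) auto
  ultimately show ?thesis by blast
qed

text \<open>A mollification radius below the distance from K to the complement of U keeps the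
  support of the convolution inside U, so the mollified functions are test functions in U converging
  together with their gradients.\<close>

lemma wk_compact_support_appr:
  assumes w: "wk u G" and u: "borel_fun u" "L2sq u < \<infinity>"
    and G: "borel_fun G" "L2sq G < \<infinity>"
    and K: "compact K" "K \<subseteq> U" "open U" "AE x in lborel. x \<notin> K \<longrightarrow> u x = 0"
  shows "appr U u G"
proof (rule appr_limit[OF u(1) G(1)])
  fix e :: real assume e: "e > 0"
  obtain d1 where d1: "d1 > 0" "\<And>r. 0 < r \<Longrightarrow> r < d1 \<Longrightarrow> L2sq (\<lambda>x. conv u (moll r) x - u x) \<le> ennreal e"
    using conv_moll_tendsto[OF u e] by blast
  obtain d2 where d2: "d2 > 0" "\<And>r. 0 < r \<Longrightarrow> r < d2 \<Longrightarrow> L2sq (\<lambda>x. gr (conv u (moll r)) x - G x) \<le> ennreal e"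
    using wk_moll_gr[OF w u G e] by blast
  obtain d3 where d3: "d3 > 0" "(\<Union>x\<in>K. ball x d3) \<subseteq> U"
    using compact_subset_open_imp_ball_epsilon_subset[OF K(1,3,2)] by blast
  define r where "r = min d1 (min d2 d3) / 2"
  have r: "0 < r" "r < d1" "r < d2" "r < d3" using d1(1) d2(1) d3(1) by (auto simp: r_def)
  note mt = moll_test[OF r(1)]
  have "test_fun U (conv u (moll r))"
  proof (rule test_funI[OF smooth_conv[OF u mt]])
    show "compact {a + b | a b. a \<in> K \<and> b \<in> cball (0::R3) r}" by (rule compact_sums[OF K(1) compact_cball])
    show "{a + b | a b. a \<in> K \<and> b \<in> cball (0::R3) r} \<subseteq> U"
    proof
      fix x assume "x \<in> {a + b | a b. a \<in> K \<and> b \<in> cball (0::R3) r}"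
      then obtain a b where "x = a + b" "a \<in> K" "norm b \<le> r" by auto
      then have "x \<in> ball a d3" using r by (simp add: dist_norm)
      then show "x \<in> U" using \<open>a \<in> K\<close> d3(2) by blast
    qed
    show "conv u (moll r) x = 0" if x: "x \<notin> {a + b | a b. a \<in> K \<and> b \<in> cball (0::R3) r}" for x
    proof (rule conv_zero[OF K(4)])
      fix y assume "y \<in> K"
      show "moll r (x - y) = 0"
      proof (rule moll_zero[OF r(1)], rule ccontr)
        assume "\<not> norm (x - y) > r"
        then have "x - y \<in> cball 0 r" by simp
        then have "y + (x - y) \<in> {a + b | a b. a \<in> K \<and> b \<in> cball (0::R3) r}" using \<open>y \<in> K\<close> by blast
        then show False using x by simp
      qed
    qed
  qed
  from appr_test_fun[OF this] show "\<exists>v H. appr U v H \<and> L2sq (\<lambda>x. u x - v x) \<le> ennreal e \<and> L2sq (\<lambda>x. G x - H x) \<le> ennreal e"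
    using d1(2)[OF r(1,2)] d2(2)[OF r(1,3)] L2sq_commute[of u "conv u (moll r)"] L2sq_commute[of G "gr (conv u (moll r))"]
    by metis
qed

lemma C1c_appr:
  assumes g: "C1c U g" and U: "open U"
  shows "appr U g (gr g)"
proof -
  obtain K where K: "compact K" "K \<subseteq> U" "\<And>x. x \<notin> K \<Longrightarrow> g x = 0" using C1c_compact[OF g] by metis
  note C = C1c_C1[OF g]
  show ?thesis
    by (rule wk_compact_support_appr[OF C1c_wk[OF g] C1_measurable[OF C] C1c_L2(1)[OF g] C1_gr_measurable[OF C] C1c_L2(2)[OF g] K(1,2) U])
      (use K(3) in simp)
qed

text \<open>For each component of the difference, every mollification vanishes because both
  gradients give the same integral against the reflected mollifier; the mollifications converge to
  the component itself.\<close>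

lemma wk_unique:
  assumes w: "wk u G" "wk u H"
    and G: "borel_fun G" "L2sq G < \<infinity>" and H: "borel_fun H" "L2sq H < \<infinity>"
  shows "AE x in lborel. G x = H x"
proof -
  have "AE x in lborel. G x $ i - H x $ i = 0" for i
  proof -
    define v where "v x = G x $ i - H x $ i" for x
    have vm [measurable]: "borel_fun v"
      unfolding v_def using G(1) H(1) by (intro borel_measurable_diff borel_measurable_vec_nth)
    have Gi: "borel_fun (\<lambda>x. G x $ i)" "L2sq (\<lambda>x. G x $ i) < \<infinity>"
      and Hi: "borel_fun (\<lambda>x. H x $ i)" "L2sq (\<lambda>x. H x $ i) < \<infinity>"
      using G H borel_measurable_vec_nth L2sq_component_finite by blast+
    have vf: "L2sq v < \<infinity>" unfolding v_def by (rule L2sq_finite_diff[OF Gi(1) Hi(1) Gi(2) Hi(2)])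
    have z: "conv v (moll r) x = 0" if r: "r > 0" for r x
    proof -
      note mt = moll_test[OF r]
      have "conv (\<lambda>x. G x $ i) (moll r) x - conv (\<lambda>x. H x $ i) (moll r) x = conv v (moll r) x"
        unfolding v_def by (rule conv_diff_left[OF Gi Hi moll_measurable test_fun_L2(1)[OF mt]])
      moreover have "(LBINT y. u y * partial i (\<lambda>y. moll r (x - y)) y) = - conv (\<lambda>x. G x $ i) (moll r) x"
          "(LBINT y. u y * partial i (\<lambda>y. moll r (x - y)) y) = - conv (\<lambda>x. H x $ i) (moll r) x"
        using w test_fun_reflect(1)[OF mt, of x] unfolding wk_def conv_def by blast+
      ultimately show ?thesis by simp
    qed
    have "L2sq v \<le> ennreal e" if e: "e > 0" for e
    proof -
      obtain d where d: "d > 0" "\<And>r. 0 < r \<Longrightarrow> r < d \<Longrightarrow> L2sq (\<lambda>x. conv v (moll r) x - v x) \<le> ennreal e"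
        using conv_moll_tendsto[OF vm vf e] by blast
      from d(2)[of "d/2"] show ?thesis using d(1) by (simp add: z)
    qed
    then have "L2sq v = 0" by (metis ennreal_le_epsilon add.left_neutral le_zero_eq)
    from L2sq_eq_0_AE[OF vm this] show ?thesis unfolding v_def .
  qed
  then have "AE x in lborel. \<forall>i. G x $ i - H x $ i = 0" by (simp add: AE_all_countable)
  then show ?thesis by eventually_elim (simp add: vec_eq_iff)
qed

section \<open>The Sobolev inequality\<close>

definition T3 :: "real \<Rightarrow> real \<Rightarrow> real \<Rightarrow> R3" where
  "T3 x y z = x *\<^sub>R axis 1 1 + y *\<^sub>R axis 2 1 + z *\<^sub>R axis 3 1"

lemma T3_nth [simp]: "T3 x y z $ 1 = x" "T3 x y z $ 2 = y" "T3 x y z $ 3 = z"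
  by (simp_all add: T3_def axis_def)

lemma T3_components: "T3 (v $ 1) (v $ 2) (v $ 3) = v"
  by (simp add: vec_eq_iff forall_3)

lemma T3_measurable [measurable (raw)]:
  assumes [measurable]: "f \<in> borel_measurable M" "g \<in> borel_measurable M" "h \<in> borel_measurable M"
  shows "(\<lambda>x. T3 (f x) (g x) (h x)) \<in> borel_measurable M"
  unfolding T3_def by measurable

lemma prod_Basis_vec: "(\<Prod>b\<in>Basis. (w::R3) \<bullet> b) = (\<Prod>i\<in>UNIV. w $ i)"
proof -
  have B: "(Basis :: R3 set) = (\<lambda>i. axis i 1) ` UNIV" by (auto simp: Basis_vec_def)
  have "inj (\<lambda>i::3. axis i (1::real))" by (auto simp: inj_def axis_eq_axis)
  then show ?thesis unfolding B by (subst prod.reindex) (simp_all add: inner_axis)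
qed

text \<open>Both measures give boxes the product of their side lengths, which determines
  \<open>lborel\<close>. This opens the way to Fubini along the three coordinate axes.\<close>

lemma lborel_T3: "lborel = distr (lborel \<Otimes>\<^sub>M (lborel \<Otimes>\<^sub>M lborel)) borel (\<lambda>(x, y, z). T3 x y z)"
proof (rule lborel_eqI)
  fix l u :: R3 assume lu: "\<And>b. b \<in> Basis \<Longrightarrow> l \<bullet> b \<le> u \<bullet> b"
  have le: "l $ i \<le> u $ i" for i using lu[of "axis i 1"] by (simp add: inner_axis axis_in_Basis_iff)
  have [measurable]: "(\<lambda>(x, y, z). T3 x y z) \<in> (lborel \<Otimes>\<^sub>M (lborel \<Otimes>\<^sub>M lborel)) \<rightarrow>\<^sub>M borel"
    by (simp add: case_prod_beta' cong: measurable_cong_sets)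
  have pre: "(\<lambda>(x, y, z). T3 x y z) -` box l u \<inter> space (lborel \<Otimes>\<^sub>M (lborel \<Otimes>\<^sub>M lborel))
      = {l $ 1 <..< u $ 1} \<times> ({l $ 2 <..< u $ 2} \<times> {l $ 3 <..< u $ 3})"
    by (auto simp: space_pair_measure mem_box_cart forall_3)
  have "emeasure (distr (lborel \<Otimes>\<^sub>M (lborel \<Otimes>\<^sub>M lborel)) borel (\<lambda>(x, y, z). T3 x y z)) (box l u)
     = emeasure (lborel \<Otimes>\<^sub>M (lborel \<Otimes>\<^sub>M lborel)) ({l $ 1 <..< u $ 1} \<times> ({l $ 2 <..< u $ 2} \<times> {l $ 3 <..< u $ 3}))"
    by (subst emeasure_distr) (simp_all add: pre)
  also have "\<dots> = emeasure lborel {l $ 1 <..< u $ 1} * (emeasure lborel {l $ 2 <..< u $ 2} * emeasure lborel {l $ 3 <..< u $ 3})"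
    by (subst sigma_finite_measure.emeasure_pair_measure_Times)
      (auto simp: lborel.emeasure_pair_measure_Times lborel_pair.sigma_finite_measure_axioms
        intro!: sigma_finite_pair_measure sigma_finite_lborel)
  also have "\<dots> = ennreal ((u $ 1 - l $ 1) * ((u $ 2 - l $ 2) * (u $ 3 - l $ 3)))"
    using le by (simp add: ennreal_mult)
  also have "(u $ 1 - l $ 1) * ((u $ 2 - l $ 2) * (u $ 3 - l $ 3)) = (\<Prod>b\<in>Basis. (u - l) \<bullet> b)"
    unfolding prod_Basis_vec UNIV_3 by simp
  finally show "emeasure (distr (lborel \<Otimes>\<^sub>M (lborel \<Otimes>\<^sub>M lborel)) borel (\<lambda>(x, y, z). T3 x y z)) (box l u) = ennreal (\<Prod>b\<in>Basis. (u - l) \<bullet> b)" .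
qed simp

lemma nn_integral_T3:
  fixes f :: "R3 \<Rightarrow> ennreal"
  assumes [measurable]: "borel_fun f"
  shows "(NNINT v. f v) = (NNINT x. (NNINT y. (NNINT z. f (T3 x y z))))"
proof -
  have [measurable]: "(\<lambda>(x, y, z). T3 x y z) \<in> (lborel \<Otimes>\<^sub>M (lborel \<Otimes>\<^sub>M lborel)) \<rightarrow>\<^sub>M borel"
    by (simp add: case_prod_beta' cong: measurable_cong_sets)
  have "(NNINT v. f v) = (\<integral>\<^sup>+p. f ((\<lambda>(x, y, z). T3 x y z) p) \<partial>(lborel \<Otimes>\<^sub>M (lborel \<Otimes>\<^sub>M lborel)))"
    by (subst lborel_T3, subst nn_integral_distr) simp_all
  also have "\<dots> = (\<integral>\<^sup>+x. \<integral>\<^sup>+q. f (T3 x (fst q) (snd q)) \<partial>(lborel \<Otimes>\<^sub>M lborel) \<partial>lborel)"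
  proof -
    have "(\<lambda>p. f (T3 (fst p) (fst (snd p)) (snd (snd p)))) \<in> borel_measurable (lborel \<Otimes>\<^sub>M (lborel \<Otimes>\<^sub>M lborel))" by measurable
    from sigma_finite_measure.nn_integral_fst[OF lborel_pair.sigma_finite_measure_axioms this]
    show ?thesis by (simp add: case_prod_beta')
  qed
  also have "\<dots> = (NNINT x. (NNINT y. (NNINT z. f (T3 x y z))))"
    by (intro nn_integral_cong, subst lborel.nn_integral_fst[symmetric]) auto
  finally show ?thesis .
qed

text \<open>A square root on \<open>ennreal\<close> including infinity, so that Cauchy-Schwarz can
  be applied to line integrals before they are known to be finite.\<close>

definition esqrt :: "ennreal \<Rightarrow> ennreal" where
  "esqrt a = (if a = top then top else ennreal (sqrt (enn2real a)))"

lemma esqrt_sq: "(esqrt a)\<^sup>2 = a"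
  by (cases a) (auto simp: esqrt_def ennreal_power)

lemma esqrt_measurable [measurable]: "borel_fun esqrt"
  unfolding esqrt_def[abs_def] by measurable

text \<open>The convention 0 * top = 0 has to be treated apart: a zero factor forces h = 0, an
  infinite one with nonzero partner makes the right side infinite, and otherwise all values are
  real.\<close>

lemma le_esqrt_mult:
  assumes "h\<^sup>2 \<le> a * b"
  shows "h \<le> esqrt a * esqrt b"
proof (cases "a = 0 \<or> b = 0")
  case True
  then have "h\<^sup>2 = 0" using assms by (auto simp: le_zero_eq)
  then show ?thesis by simp
next
  case nz: False
  show ?thesis
  proof (cases "a = top \<or> b = top")
    case True
    have "esqrt a \<noteq> 0" "esqrt b \<noteq> 0" using nz esqrt_sq[of a] esqrt_sq[of b] by auto
    moreover have "esqrt a = top \<or> esqrt b = top" using True by (auto simp: esqrt_def)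
    ultimately have "esqrt a * esqrt b = top" by (auto simp: ennreal_mult_eq_top_iff)
    then show ?thesis by simp
  next
    case False
    then obtain x y where x: "a = ennreal x" "x \<ge> 0" and y: "b = ennreal y" "y \<ge> 0" by (metis ennreal_cases)
    have "h \<noteq> top"
    proof
      assume "h = top"
      then have "top \<le> ennreal x * ennreal y" using assms x y by simp
      then show False by (simp add: ennreal_mult[symmetric] x(2) y(2) top_unique)
    qed
    then obtain z where z: "h = ennreal z" "z \<ge> 0" by (metis ennreal_cases)
    have "z\<^sup>2 \<le> x * y" using assms x y z by (simp add: ennreal_power ennreal_mult[symmetric])
    then have "z \<le> sqrt x * sqrt y" by (metis real_le_rsqrt real_sqrt_mult)
    then show ?thesis using x y z by (simp add: esqrt_def ennreal_mult[symmetric] ennreal_leI)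
  qed
qed

lemma Cauchy_Schwarz_ennreal:
  assumes [measurable]: "h \<in> borel_measurable M" "a \<in> borel_measurable M" "b \<in> borel_measurable M"
    and le: "\<And>x. (h x)\<^sup>2 \<le> a x * (b x :: ennreal)"
  shows "(\<integral>\<^sup>+x. h x \<partial>M)\<^sup>2 \<le> (\<integral>\<^sup>+x. a x \<partial>M) * (\<integral>\<^sup>+x. b x \<partial>M)"
proof -
  have "(\<integral>\<^sup>+x. h x \<partial>M) \<le> (\<integral>\<^sup>+x. esqrt (a x) * esqrt (b x) \<partial>M)"
    by (intro nn_integral_mono le_esqrt_mult le)
  then have "(\<integral>\<^sup>+x. h x \<partial>M)\<^sup>2 \<le> (\<integral>\<^sup>+x. esqrt (a x) * esqrt (b x) \<partial>M)\<^sup>2" by (rule power_mono) simp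
  also have "\<dots> \<le> (\<integral>\<^sup>+x. (esqrt (a x))\<^sup>2 \<partial>M) * (\<integral>\<^sup>+x. (esqrt (b x))\<^sup>2 \<partial>M)"
    by (rule Cauchy_Schwarz_nn_integral) measurable
  finally show ?thesis by (simp only: esqrt_sq)
qed

text \<open>Cauchy-Schwarz twice. For fixed x it is applied in (y, z) to g1 against the product g2
  g3: the first factor is independent of x and the second separates into a z-integral times a
  y-integral. Then it is applied in x to these two functions.\<close>

lemma Loomis_Whitney:
  fixes h :: "real \<Rightarrow> real \<Rightarrow> real \<Rightarrow> ennreal" and g1 g2 g3 :: "real \<Rightarrow> real \<Rightarrow> ennreal"
  assumes [measurable]: "borel_fun (\<lambda>(x, y, z). h x y z)" "borel_fun (\<lambda>(y, z). g1 y z)"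
    "borel_fun (\<lambda>(x, z). g2 x z)" "borel_fun (\<lambda>(x, y). g3 x y)"
    and le: "\<And>x y z. (h x y z)\<^sup>2 \<le> g1 y z * g2 x z * g3 x y"
  shows "(NNINT x. (NNINT y. (NNINT z. h x y z)))\<^sup>2 \<le>
     (NNINT y. (NNINT z. g1 y z)) * (NNINT x. (NNINT z. g2 x z)) * (NNINT x. (NNINT y. g3 x y))"
proof -
  define G1 where "G1 = (NNINT y. (NNINT z. g1 y z))"
  have hm [measurable]: "borel_fun (\<lambda>p. h (fst p) (fst (snd p)) (snd (snd p)))" using assms(1) by (simp add: case_prod_beta')
  have g1m [measurable]: "borel_fun (\<lambda>p. g1 (fst p) (snd p))" using assms(2) by (simp add: case_prod_beta')
  have g2m [measurable]: "borel_fun (\<lambda>p. g2 (fst p) (snd p))" using assms(3) by (simp add: case_prod_beta')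
  have g3m [measurable]: "borel_fun (\<lambda>p. g3 (fst p) (snd p))" using assms(4) by (simp add: case_prod_beta')
  have g1p [measurable]: "(\<lambda>p. g1 (fst p) (snd p)) \<in> borel_measurable (lborel \<Otimes>\<^sub>M lborel)" using g1m by (simp add: lborel_prod)
  have g2p [measurable]: "(\<lambda>p. g2 (fst p) (snd p)) \<in> borel_measurable (lborel \<Otimes>\<^sub>M lborel)" using g2m by (simp add: lborel_prod)
  have g3p [measurable]: "(\<lambda>p. g3 (fst p) (snd p)) \<in> borel_measurable (lborel \<Otimes>\<^sub>M lborel)" using g3m by (simp add: lborel_prod)
  have hx [measurable]: "(\<lambda>q. h x (fst q) (snd q)) \<in> borel_measurable (lborel \<Otimes>\<^sub>M lborel)" for x
    using measurable_compose[OF _ hm, of "\<lambda>q. (x, q)" "lborel"] by (simp add: lborel_prod)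
  have hp: "(\<lambda>p. h (fst p) (fst (snd p)) (snd (snd p))) \<in> borel_measurable (lborel \<Otimes>\<^sub>M (lborel \<Otimes>\<^sub>M lborel))"
    using hm by (simp add: lborel_prod)
  define I where "I x = (\<integral>\<^sup>+q. h x (fst q) (snd q) \<partial>(lborel \<Otimes>\<^sub>M lborel))" for x
  have Im [measurable]: "I \<in> borel_measurable lborel"
    unfolding I_def[abs_def]
    by (rule sigma_finite_measure.borel_measurable_nn_integral[OF lborel_pair.sigma_finite_measure_axioms]) (use hp in \<open>simp add: case_prod_beta'\<close>)
  have I_eq: "(NNINT y. (NNINT z. h x y z)) = I x" for x
    unfolding I_def by (subst lborel.nn_integral_fst[symmetric]) simp_all
  define A2 where "A2 x = (NNINT z. g2 x z)" for x
  define A3 where "A3 x = (NNINT y. g3 x y)" for x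
  have A2m [measurable]: "A2 \<in> borel_measurable lborel"
    unfolding A2_def[abs_def] by (rule lborel.borel_measurable_nn_integral) (use g2p in \<open>simp add: case_prod_beta'\<close>)
  have A3m [measurable]: "A3 \<in> borel_measurable lborel"
    unfolding A3_def[abs_def] by (rule lborel.borel_measurable_nn_integral) (use g3p in \<open>simp add: case_prod_beta'\<close>)
  have g2x [measurable]: "borel_fun (\<lambda>z. g2 x z)" for x
    using measurable_compose[OF _ g2m, of "\<lambda>z. (x, z)" borel] by simp
  have g3x [measurable]: "borel_fun (\<lambda>z. g3 x z)" for x
    using measurable_compose[OF _ g3m, of "\<lambda>z. (x, z)" borel] by simp
  have I_le: "(I x)\<^sup>2 \<le> (G1 * A2 x) * A3 x" for x
  proof -
    have "(I x)\<^sup>2 \<le> (\<integral>\<^sup>+q. g1 (fst q) (snd q) \<partial>(lborel \<Otimes>\<^sub>M lborel)) * (\<integral>\<^sup>+q. g2 x (snd q) * g3 x (fst q) \<partial>(lborel \<Otimes>\<^sub>M lborel))"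
      unfolding I_def using le[of x] by (intro Cauchy_Schwarz_ennreal) (simp_all add: mult.assoc)
    also have "(\<integral>\<^sup>+q. g1 (fst q) (snd q) \<partial>(lborel \<Otimes>\<^sub>M lborel)) = G1"
      unfolding G1_def by (subst lborel.nn_integral_fst[symmetric]) simp_all
    also have "(\<integral>\<^sup>+q. g2 x (snd q) * g3 x (fst q) \<partial>(lborel \<Otimes>\<^sub>M lborel)) = (NNINT y. (NNINT z. g2 x z * g3 x y))"
      by (subst lborel.nn_integral_fst[symmetric]) simp_all
    also have "\<dots> = A2 x * A3 x"
      unfolding A2_def A3_def by (simp add: nn_integral_multc nn_integral_cmult)
    finally show ?thesis by (simp add: mult.assoc)
  qed
  have "(NNINT x. I x)\<^sup>2 \<le> (NNINT x. G1 * A2 x) * (NNINT x. A3 x)"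
    by (rule Cauchy_Schwarz_ennreal) (simp_all add: I_le)
  also have "(NNINT x. G1 * A2 x) = G1 * (NNINT x. A2 x)" by (rule nn_integral_cmult) measurable
  finally show ?thesis unfolding I_eq G1_def A2_def A3_def .
qed

section \<open>The Gagliardo-Nirenberg and Sobolev inequalities\<close>

lemma line_bound:
  fixes p p' :: "real \<Rightarrow> real"
  assumes d: "\<And>s. (p has_real_derivative p' s) (at s)" and c: "continuous_on UNIV p'"
    and z: "\<And>s. \<bar>s\<bar> > R \<Longrightarrow> p s = 0"
  shows "ennreal \<bar>p t\<bar> \<le> (NNINT s. ennreal \<bar>p' s\<bar>)"
proof -
  define a where "a = - \<bar>R\<bar> - \<bar>t\<bar> - 1"
  have a: "a \<le> t" "\<bar>a\<bar> > R" by (auto simp: a_def)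
  have ci: "isCont p' s" for s using c by (simp add: continuous_on_eq_continuous_at)
  have hb: "has_bochner_integral lborel (\<lambda>s. p' s * indicator {a..t} s) (p t - p a)"
    by (rule has_bochner_integral_FTC_Icc_real[OF a(1)]) (use d ci in auto)
  then have eq: "(LBINT s. p' s * indicator {a..t} s) = p t" and int: "integrable lborel (\<lambda>s. p' s * indicator {a..t} s)"
    using z[OF a(2)] by (auto simp: has_bochner_integral_iff)
  have "ennreal \<bar>p t\<bar> \<le> (NNINT s. ennreal (norm (p' s * indicator {a..t} s)))"
    using integral_norm_bound_ennreal[OF int] eq by simp
  also have "\<dots> \<le> (NNINT s. ennreal \<bar>p' s\<bar>)"
    by (intro nn_integral_mono ennreal_leI) (simp add: indicator_def)
  finally show ?thesis .
qed

lemma axis_line_bound: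
  assumes C: "C1 g" and K: "compact K" "\<And>x. x \<notin> K \<Longrightarrow> g x = 0"
  shows "ennreal \<bar>g (w + t *\<^sub>R axis i 1)\<bar> \<le> (NNINT s. ennreal \<bar>partial i g (w + s *\<^sub>R axis i 1)\<bar>)"
proof -
  obtain B where B: "\<And>x. x \<in> K \<Longrightarrow> norm x \<le> B" using K(1) compact_imp_bounded bounded_iff by metis
  have pc: "continuous_on UNIV (partial i g)"
    using continuous_on_component[OF C1_gr_continuous[OF C], of i] by simp
  show ?thesis
  proof (rule line_bound[where p="\<lambda>s. g (w + s *\<^sub>R axis i 1)" and R="B + norm w"])
    fix s
    have "((\<lambda>s. w + s *\<^sub>R axis i (1::real)) has_derivative (\<lambda>r. r *\<^sub>R axis i 1)) (at s)" by (auto intro!: derivative_eq_intros)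
    from has_derivative_compose[OF this C1_derivative[OF C]]
    have "((\<lambda>s. g (w + s *\<^sub>R axis i 1)) has_derivative (\<lambda>r. gr g (w + s *\<^sub>R axis i 1) \<bullet> (r *\<^sub>R axis i 1))) (at s)" .
    then show "((\<lambda>s. g (w + s *\<^sub>R axis i 1)) has_real_derivative partial i g (w + s *\<^sub>R axis i 1)) (at s)"
      by (simp add: has_field_derivative_def inner_axis mult.commute[of _ "partial i g _"])
  next
    show "continuous_on UNIV (\<lambda>s. partial i g (w + s *\<^sub>R axis i 1))"
      by (rule continuous_on_compose2[OF pc]) (auto intro!: continuous_intros)
  next
    fix s assume s: "\<bar>s\<bar> > B + norm w"
    show "g (w + s *\<^sub>R axis i 1) = 0"
    proof (rule K(2), rule notI)
      assume "w + s *\<^sub>R axis i 1 \<in> K"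
      then have "norm (w + s *\<^sub>R axis i (1::real)) \<le> B" by (rule B)
      moreover have "norm (s *\<^sub>R axis i (1::real) :: R3) \<le> norm (w + s *\<^sub>R axis i 1) + norm w"
        using norm_triangle_ineq4[of "w + s *\<^sub>R axis i 1" w] by simp
      ultimately show False using s by simp
    qed
  qed
qed

lemma partial_measurable: "C1 g \<Longrightarrow> borel_fun (partial i g)"
  using borel_measurable_vec_nth[OF C1_gr_measurable, of g i] by simp

lemma ennreal_cube: "c \<ge> 0 \<Longrightarrow> ennreal (c ^ 3) = ennreal c * ennreal c * ennreal c"
  by (simp add: power3_eq_cube ennreal_mult)

lemma ennreal_linear_combination:
  "a \<ge> 0 \<Longrightarrow> b \<ge> 0 \<Longrightarrow> c \<ge> 0 \<Longrightarrow> d \<ge> 0 \<Longrightarrow> ennreal (a * b + c * d) = ennreal a * ennreal b + ennreal c * ennreal d"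
  by (simp add: ennreal_mult)

text \<open>Along each axis |g| is at most the integral of |partial i g| over the line, a function
  of the other two coordinates, so |g|^3 is at most the product of three such functions. The
  auxiliary h stands for |g|^(3/2) and is introduced through its square to stay clear of fractional
  powers.\<close>

lemma Gagliardo_Nirenberg:
  assumes g: "C1c U g" and h [measurable]: "borel_fun h" and hg: "\<And>x. (h x)\<^sup>2 \<le> \<bar>g x\<bar> ^ 3"
  shows "(NNINT x. ennreal (h x))\<^sup>2 \<le> (\<Prod>i\<in>UNIV. (NNINT x. ennreal \<bar>partial i g x\<bar>))"
proof -
  obtain K where K: "compact K" "\<And>x. x \<notin> K \<Longrightarrow> g x = 0" using C1c_compact[OF g] by metis
  note C = C1c_C1[OF g]
  have pm [measurable]: "borel_fun (partial i g)" for i by (rule partial_measurable[OF C])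
  define g1 where "g1 y z = (NNINT s. ennreal \<bar>partial 1 g (T3 s y z)\<bar>)" for y z
  define g2 where "g2 x z = (NNINT s. ennreal \<bar>partial 2 g (T3 x s z)\<bar>)" for x z
  define g3 where "g3 x y = (NNINT s. ennreal \<bar>partial 3 g (T3 x y s)\<bar>)" for x y
  have b1: "ennreal \<bar>g (T3 x y z)\<bar> \<le> g1 y z" for x y z
    using axis_line_bound[OF C K, of "T3 0 y z" x 1] by (simp add: g1_def T3_def add_ac)
  have b2: "ennreal \<bar>g (T3 x y z)\<bar> \<le> g2 x z" for x y z
    using axis_line_bound[OF C K, of "T3 x 0 z" y 2] by (simp add: g2_def T3_def add_ac)
  have b3: "ennreal \<bar>g (T3 x y z)\<bar> \<le> g3 x y" for x y z
    using axis_line_bound[OF C K, of "T3 x y 0" z 3] by (simp add: g3_def T3_def add_ac)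
  have g1m: "(\<lambda>(y, z). g1 y z) \<in> borel_measurable (lborel \<Otimes>\<^sub>M lborel)"
    unfolding g1_def by measurable
  have g2m: "(\<lambda>(y, z). g2 y z) \<in> borel_measurable (lborel \<Otimes>\<^sub>M lborel)"
    unfolding g2_def by measurable
  have g3m: "(\<lambda>(y, z). g3 y z) \<in> borel_measurable (lborel \<Otimes>\<^sub>M lborel)"
    unfolding g3_def by measurable
  have "(\<lambda>(x, y, z). ennreal (h (T3 x y z))) \<in> borel_measurable (lborel \<Otimes>\<^sub>M (lborel \<Otimes>\<^sub>M lborel))"
    by measurable
  then have hm: "borel_fun (\<lambda>(x, y, z). ennreal (h (T3 x y z)))"
    by (simp add: lborel_prod)
  have "(NNINT x. ennreal (h x)) = (NNINT x. (NNINT y. (NNINT z. ennreal (h (T3 x y z)))))"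
    by (rule nn_integral_T3) measurable
  also have "\<dots>\<^sup>2 \<le> (NNINT y. (NNINT z. g1 y z)) * (NNINT x. (NNINT z. g2 x z)) * (NNINT x. (NNINT y. g3 x y))"
  proof (rule Loomis_Whitney[OF hm])
    show "borel_fun (\<lambda>(y, z). g1 y z)" "borel_fun (\<lambda>(y, z). g2 y z)" "borel_fun (\<lambda>(y, z). g3 y z)"
      using g1m g2m g3m by (simp_all add: lborel_prod)
    fix x y z
    have "(ennreal (h (T3 x y z)))\<^sup>2 \<le> (ennreal \<bar>h (T3 x y z)\<bar>)\<^sup>2" by (intro power_mono ennreal_leI) auto
    also have "\<dots> = ennreal ((h (T3 x y z))\<^sup>2)" by (simp add: ennreal_power)
    also have "\<dots> \<le> ennreal (\<bar>g (T3 x y z)\<bar> ^ 3)" by (intro ennreal_leI hg)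
    also have "\<dots> = ennreal \<bar>g (T3 x y z)\<bar> * ennreal \<bar>g (T3 x y z)\<bar> * ennreal \<bar>g (T3 x y z)\<bar>"
      by (rule ennreal_cube) simp
    also have "\<dots> \<le> g1 y z * g2 x z * g3 x y" by (intro mult_mono b1 b2 b3) auto
    finally show "(ennreal (h (T3 x y z)))\<^sup>2 \<le> g1 y z * g2 x z * g3 x y" .
  qed
  also have "(NNINT x. (NNINT y. g3 x y)) = (NNINT x. ennreal \<bar>partial 3 g x\<bar>)"
    unfolding g3_def by (rule nn_integral_T3[symmetric]) measurable
  also have "(NNINT x. (NNINT z. g2 x z)) = (NNINT x. ennreal \<bar>partial 2 g x\<bar>)"
  proof -
    have "(NNINT x. (NNINT z. g2 x z)) = (NNINT x. (NNINT s. (NNINT z. ennreal \<bar>partial 2 g (T3 x s z)\<bar>)))"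
      unfolding g2_def by (intro nn_integral_cong lborel_pair.Fubini') measurable
    also have "\<dots> = (NNINT x. ennreal \<bar>partial 2 g x\<bar>)" by (rule nn_integral_T3[symmetric]) measurable
    finally show ?thesis .
  qed
  also have "(NNINT y. (NNINT z. g1 y z)) = (NNINT x. ennreal \<bar>partial 1 g x\<bar>)"
  proof -
    have "(NNINT y. (NNINT z. g1 y z)) = (NNINT y. (NNINT s. (NNINT z. ennreal \<bar>partial 1 g (T3 s y z)\<bar>)))"
      unfolding g1_def by (intro nn_integral_cong lborel_pair.Fubini') measurable
    also have "\<dots> = (NNINT s. (NNINT y. (NNINT z. ennreal \<bar>partial 1 g (T3 s y z)\<bar>)))"
      by (rule lborel_pair.Fubini') measurable
    also have "\<dots> = (NNINT x. ennreal \<bar>partial 1 g x\<bar>)" by (rule nn_integral_T3[symmetric]) measurable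
    finally show ?thesis .
  qed
  finally show ?thesis unfolding UNIV_3 by (simp add: mult_ac)
qed

text \<open>The preceding inequality is applied to g^4, since |g^4|^(3/2) = g^6. With A = int g^6
  and D the squared gradient norm, Cauchy-Schwarz on 4 g^3 partial i g bounds the square of each
  factor by 16 A D, so A^4 <= (16 A D)^3; this is the origin of 4096 = 16^3.\<close>

lemma Sobolev_C1c:
  assumes g: "C1c U g"
  shows "(NNINT x. ennreal (\<bar>g x\<bar> ^ 6)) \<le> ennreal (4096 * (enn2real (L2sq (gr g))) ^ 3)"
proof -
  obtain K where K: "compact K" "\<And>x. x \<notin> K \<Longrightarrow> g x = 0" using C1c_compact[OF g] by metis
  note C = C1c_C1[OF g]
  note [measurable] = C1_measurable[OF C] C1_gr_measurable[OF C]
  define p2 where "p2 x = g x * g x" for x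
  define p4 where "p4 x = p2 x * p2 x" for x
  have c2: "C1c U p2" unfolding p2_def by (rule C1c_mult[OF g C])
  have c4: "C1c U p4" unfolding p4_def by (rule C1c_mult[OF c2 C1c_C1[OF c2]])
  have gr4: "gr p4 x = (4 * g x ^ 3) *\<^sub>R gr g x" for x
  proof -
    have "gr p4 x = p2 x *\<^sub>R gr p2 x + p2 x *\<^sub>R gr p2 x"
      using gr_mult[OF C1c_C1[OF c2] C1c_C1[OF c2]] by (simp add: p4_def[abs_def])
    moreover have "gr p2 x = g x *\<^sub>R gr g x + g x *\<^sub>R gr g x"
      using gr_mult[OF C C] by (simp add: p2_def[abs_def])
    ultimately have "gr p4 x = (p2 x * g x) *\<^sub>R gr g x + (p2 x * g x) *\<^sub>R gr g x + ((p2 x * g x) *\<^sub>R gr g x + (p2 x * g x) *\<^sub>R gr g x)"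
      by (simp add: scaleR_add_right)
    then show ?thesis by (simp add: p2_def power3_eq_cube flip: scaleR_add_left)
  qed
  define A where "A = (LBINT x. \<bar>g x\<bar> ^ 6)"
  define D where "D = enn2real (L2sq (gr g))"
  have int6: "integrable lborel (\<lambda>x. \<bar>g x\<bar> ^ 6)"
    by (rule integrable_compact_support[OF _ K(1)]) (use K(2) C1_continuous[OF C] in \<open>auto intro!: continuous_intros\<close>)
  have A: "(NNINT x. ennreal (\<bar>g x\<bar> ^ 6)) = ennreal A"
    unfolding A_def by (rule nn_integral_eq_integral[OF int6]) simp
  have A0: "A \<ge> 0" unfolding A_def by simp
  have Dfin: "L2sq (gr g) = ennreal D" using C1c_L2(2)[OF g] by (simp add: D_def)
  have D0: "D \<ge> 0" by (simp add: D_def)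
  have Ii: "(NNINT x. ennreal \<bar>partial i p4 x\<bar>)\<^sup>2 \<le> ennreal (16 * A * D)" for i
  proof -
    have "(NNINT x. ennreal \<bar>partial i p4 x\<bar>)\<^sup>2 \<le> (NNINT x. ennreal 16 * ennreal (\<bar>g x\<bar> ^ 6)) * L2sq (gr g)"
      unfolding L2sq_def
    proof (rule Cauchy_Schwarz_ennreal)
      show "(\<lambda>x. ennreal \<bar>partial i p4 x\<bar>) \<in> borel_measurable lborel"
        using partial_measurable[OF C1c_C1[OF c4], of i] by simp
      fix x
      have "partial i p4 x = 4 * g x ^ 3 * partial i g x" using gr_nth[of p4 x i] by (simp add: gr4)
      then have "\<bar>partial i p4 x\<bar>\<^sup>2 = 16 * \<bar>g x\<bar> ^ 6 * (partial i g x)\<^sup>2"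
        by (simp add: power_mult_distrib flip: power_mult)
      also have "\<dots> \<le> 16 * \<bar>g x\<bar> ^ 6 * (norm (gr g x))\<^sup>2"
      proof (rule mult_left_mono)
        have "\<bar>partial i g x\<bar> \<le> norm (gr g x)" using component_le_norm_cart[of "gr g x" i] by simp
        then show "(partial i g x)\<^sup>2 \<le> (norm (gr g x))\<^sup>2" by (simp add: abs_le_square_iff[symmetric])
      qed simp
      finally have "ennreal (\<bar>partial i p4 x\<bar>\<^sup>2) \<le> ennreal (16 * \<bar>g x\<bar> ^ 6 * (norm (gr g x))\<^sup>2)" by (rule ennreal_leI)
      then show "(ennreal \<bar>partial i p4 x\<bar>)\<^sup>2 \<le> ennreal 16 * ennreal (\<bar>g x\<bar> ^ 6) * ennreal ((norm (gr g x))\<^sup>2)"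
        by (simp only: ennreal_power abs_ge_zero ennreal_mult zero_le_power2 zero_le_power mult_nonneg_nonneg zero_le_numeral)
    qed measurable
    also have "(NNINT x. ennreal 16 * ennreal (\<bar>g x\<bar> ^ 6)) = ennreal 16 * ennreal A"
      unfolding A[symmetric] by (rule nn_integral_cmult) measurable
    finally show ?thesis using A0 D0 by (simp only: Dfin ennreal_mult mult_nonneg_nonneg zero_le_numeral)
  qed
  have "(ennreal A)\<^sup>2 \<le> (\<Prod>i\<in>UNIV. (NNINT x. ennreal \<bar>partial i p4 x\<bar>))"
    unfolding A[symmetric]
  proof (rule Gagliardo_Nirenberg[OF c4])
    fix x
    have "p4 x = g x ^ 4" by (simp add: p4_def p2_def power4_eq_xxxx)
    then have "\<bar>p4 x\<bar> ^ 3 = \<bar>g x\<bar> ^ 12" by (simp add: power_abs flip: power_mult)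
    then show "(\<bar>g x\<bar> ^ 6)\<^sup>2 \<le> \<bar>p4 x\<bar> ^ 3" by (simp flip: power_mult)
  qed measurable
  then have "((ennreal A)\<^sup>2)\<^sup>2 \<le> (\<Prod>i\<in>UNIV. (NNINT x. ennreal \<bar>partial i p4 x\<bar>))\<^sup>2"
    by (rule power_mono) simp
  also have "\<dots> = (\<Prod>i\<in>UNIV. (NNINT x. ennreal \<bar>partial i p4 x\<bar>)\<^sup>2)" by (simp add: prod_power_distrib)
  also have "\<dots> \<le> (\<Prod>i\<in>(UNIV::3 set). ennreal (16 * A * D))" unfolding UNIV_3 by (simp, intro mult_mono Ii) simp_all
  also have "\<dots> = ennreal ((16 * A * D) ^ 3)" using A0 D0 by (simp add: ennreal_power)
  finally have "((ennreal A)\<^sup>2)\<^sup>2 \<le> ennreal ((16 * A * D) ^ 3)" .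
  moreover have "((ennreal A)\<^sup>2)\<^sup>2 = ennreal (A ^ 4)" using A0 by (simp add: ennreal_power flip: power_mult)
  ultimately have "A ^ 4 \<le> (16 * A * D) ^ 3" using A0 D0 by simp
  then have "A ^ 3 * A \<le> A ^ 3 * (4096 * D ^ 3)" by (simp add: power_mult_distrib power_numeral_reduce mult_ac)
  \<comment> \<open>A is finite because g is continuous with compact support, so A^3 may be
    cancelled when it is nonzero.\<close>
  then have "A \<le> 4096 * D ^ 3"
    using A0 D0 by (cases "A = 0") (simp_all add: mult_le_cancel_left_pos)
  then show ?thesis unfolding A D_def by (rule ennreal_leI)
qed

text \<open>Density of test functions, with Fatou on the left along an almost everywhere convergent
  subsequence and convergence of gradient norms on the right.\<close>

lemma Sobolev:
  assumes A: "appr U u G"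
  shows "(NNINT x. ennreal (\<bar>u x\<bar> ^ 6)) \<le> ennreal (4096 * (enn2real (L2sq G)) ^ 3)"
proof -
  obtain \<phi> where \<phi>: "\<And>n::nat. test_fun U (\<phi> n)" "L2lim \<phi> u" "L2lim (\<lambda>n. gr (\<phi> n)) G"
    using appr_seq[OF A] by blast
  note m = apprD[OF A] and f = appr_L2[OF A]
  obtain r where r: "strict_mono r" and ae: "AE x in lborel. (\<lambda>k. \<phi> (r k) x) \<longlonglongrightarrow> u x"
    using L2lim_AE_subseq[OF test_fun_measurable[OF \<phi>(1)] m(1) \<phi>(2)] by blast
  have lim: "(\<lambda>k. ennreal (4096 * (enn2real (L2sq (gr (\<phi> (r k))))) ^ 3)) \<longlonglongrightarrow> ennreal (4096 * (enn2real (L2sq G)) ^ 3)"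
  proof (rule tendsto_ennrealI)
    have "(\<lambda>k. enn2real (L2sq (gr (\<phi> (r k))))) \<longlonglongrightarrow> enn2real (L2sq G)"
      by (rule L2lim_norm[OF test_fun_gr_measurable[OF \<phi>(1)] m(2) L2lim_subseq[OF \<phi>(3) r] f(2) test_fun_L2(2)[OF \<phi>(1)]])
    then show "(\<lambda>k. 4096 * (enn2real (L2sq (gr (\<phi> (r k))))) ^ 3) \<longlonglongrightarrow> 4096 * (enn2real (L2sq G)) ^ 3"
      by (intro tendsto_mult tendsto_const tendsto_power)
  qed
  have "(NNINT x. ennreal (\<bar>u x\<bar> ^ 6)) = (NNINT x. liminf (\<lambda>k. ennreal (\<bar>\<phi> (r k) x\<bar> ^ 6)))"
  proof (rule nn_integral_cong_AE)
    show "AE x in lborel. ennreal (\<bar>u x\<bar> ^ 6) = liminf (\<lambda>k. ennreal (\<bar>\<phi> (r k) x\<bar> ^ 6))"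
      using ae
    proof eventually_elim
      case (elim x)
      have "(\<lambda>k. \<bar>\<phi> (r k) x\<bar> ^ 6) \<longlonglongrightarrow> \<bar>u x\<bar> ^ 6" by (intro tendsto_intros elim)
      from lim_imp_Liminf[OF _ tendsto_ennrealI[OF this]] show ?case by simp
    qed
  qed
  also have "\<dots> \<le> liminf (\<lambda>k. (NNINT x. ennreal (\<bar>\<phi> (r k) x\<bar> ^ 6)))"
  proof (rule nn_integral_liminf)
    show "(\<lambda>x. ennreal (\<bar>\<phi> (r k) x\<bar> ^ 6)) \<in> borel_measurable lborel" for k
      using test_fun_measurable[OF \<phi>(1), of "r k"] by simp
  qed
  also have "\<dots> \<le> liminf (\<lambda>k. ennreal (4096 * (enn2real (L2sq (gr (\<phi> (r k))))) ^ 3))"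
    by (intro Liminf_mono always_eventually allI Sobolev_C1c[OF test_fun_C1c[OF \<phi>(1)]])
  also have "\<dots> = ennreal (4096 * (enn2real (L2sq G)) ^ 3)"
    by (rule lim_imp_Liminf[OF _ lim]) simp
  finally show ?thesis .
qed

text \<open>Plays the role of Hoelder's inequality with exponents 3/2 and 3. The threshold b = t
  sqrt a decides which of the two terms suffices alone; the parameter t stays free.\<close>

lemma weak_Young:
  fixes a b t :: real
  assumes "a \<ge> 0" "b \<ge> 0" "t > 0"
  shows "a * b \<le> t * a powr (3/2) + b ^ 3 / t\<^sup>2"
proof (cases "b \<le> t * sqrt a")
  case True
  have "a powr (3/2) = a * sqrt a"
  proof (cases "a = 0")
    case False
    then have "a powr (3/2) = a powr 1 * a powr (1/2)" by (subst powr_add[symmetric]) simp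
    then show ?thesis using assms by (simp add: powr_half_sqrt)
  qed simp
  moreover have "a * b \<le> a * (t * sqrt a)" using True assms by (intro mult_left_mono) auto
  moreover have "b ^ 3 / t\<^sup>2 \<ge> 0" using assms by simp
  ultimately show ?thesis by (simp add: mult_ac)
next
  case False
  then have "sqrt a \<le> b / t" using assms by (simp add: field_simps)
  then have "(sqrt a)\<^sup>2 \<le> (b / t)\<^sup>2" by (rule power_mono) (use assms in simp)
  then have "a \<le> b\<^sup>2 / t\<^sup>2" using assms by (simp add: power_divide)
  then have "a * b \<le> b\<^sup>2 / t\<^sup>2 * b" using assms by (intro mult_right_mono) auto
  also have "\<dots> = b ^ 3 / t\<^sup>2" by (simp add: power3_eq_cube power2_eq_square)
  also have "\<dots> \<le> t * a powr (3/2) + b ^ 3 / t\<^sup>2" using assms by simp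
  finally show ?thesis .
qed

text \<open>The bound is linear in the squared gradient norm, while \<tau> trades the L^(3/2) size
  of the weight against a fixed constant. A weight small in L^(3/2) thus has a small form once
  \<tau> is taken large.\<close>

lemma weighted_Sobolev:
  assumes A: "appr U u G" and f [measurable]: "borel_fun f" and \<tau>: "\<tau> > 0"
  shows "(NNINT x. ennreal (\<bar>f x\<bar> * (u x)\<^sup>2)) \<le>
     L2sq G * (ennreal \<tau> * (NNINT x. ennreal (\<bar>f x\<bar> powr (3/2))) + ennreal (4096 / \<tau>\<^sup>2))"
proof -
  note [measurable] = apprD[OF A]
  define D where "D = enn2real (L2sq G)"
  have D: "L2sq G = ennreal D" "D \<ge> 0" using appr_L2(2)[OF A] by (simp_all add: D_def)
  have S: "(NNINT x. ennreal (\<bar>u x\<bar> ^ 6)) \<le> ennreal (4096 * D ^ 3)" unfolding D_def by (rule Sobolev[OF A])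
  define F where "F = (NNINT x. ennreal (\<bar>f x\<bar> powr (3/2)))"
  show ?thesis unfolding F_def[symmetric]
  proof (cases "D = 0")
    case True
    then have "(NNINT x. ennreal (\<bar>u x\<bar> ^ 6)) = 0" using S by simp
    then have "AE x in lborel. ennreal (\<bar>u x\<bar> ^ 6) = 0" by (subst (asm) nn_integral_0_iff_AE) measurable
    then have "AE x in lborel. ennreal (\<bar>f x\<bar> * (u x)\<^sup>2) = 0" by eventually_elim (simp add: ennreal_eq_0_iff)
    then have "(NNINT x. ennreal (\<bar>f x\<bar> * (u x)\<^sup>2)) = 0" by (subst nn_integral_0_iff_AE) measurable
    then show "(NNINT x. ennreal (\<bar>f x\<bar> * (u x)\<^sup>2)) \<le> L2sq G * (ennreal \<tau> * F + ennreal (4096 / \<tau>\<^sup>2))" by simp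
  next
    case False
    then have Dp: "D > 0" using D by simp
    \<comment> \<open>Scaling t with D makes both terms of the Young bound proportional to D: D^3 /
      t^2 becomes D / \<tau>^2.\<close>
    define t where "t = D * \<tau>"
    have t: "t > 0" using Dp \<tau> by (simp add: t_def)
    have "(NNINT x. ennreal (\<bar>f x\<bar> * (u x)\<^sup>2)) \<le>
      (NNINT x. ennreal t * ennreal (\<bar>f x\<bar> powr (3/2)) + ennreal (1 / t\<^sup>2) * ennreal (\<bar>u x\<bar> ^ 6))"
    proof (rule nn_integral_mono)
      fix x
      have "\<bar>f x\<bar> * (u x)\<^sup>2 \<le> t * \<bar>f x\<bar> powr (3/2) + ((u x)\<^sup>2) ^ 3 / t\<^sup>2" by (rule weak_Young) (use t in auto)
      also have "((u x)\<^sup>2) ^ 3 = \<bar>u x\<bar> ^ 6" by (simp flip: power_mult)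
      finally have "ennreal (\<bar>f x\<bar> * (u x)\<^sup>2) \<le> ennreal (t * \<bar>f x\<bar> powr (3/2) + 1 / t\<^sup>2 * \<bar>u x\<bar> ^ 6)"
        by (intro ennreal_leI) simp
      also have "\<dots> = ennreal t * ennreal (\<bar>f x\<bar> powr (3/2)) + ennreal (1 / t\<^sup>2) * ennreal (\<bar>u x\<bar> ^ 6)"
        by (rule ennreal_linear_combination) (use t in auto)
      finally show "ennreal (\<bar>f x\<bar> * (u x)\<^sup>2) \<le> ennreal t * ennreal (\<bar>f x\<bar> powr (3/2)) + ennreal (1 / t\<^sup>2) * ennreal (\<bar>u x\<bar> ^ 6)" .
    qed
    also have "\<dots> = ennreal t * F + ennreal (1 / t\<^sup>2) * (NNINT x. ennreal (\<bar>u x\<bar> ^ 6))"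
      unfolding F_def by (subst nn_integral_add) (simp_all add: nn_integral_cmult)
    also have "\<dots> \<le> ennreal t * F + ennreal (1 / t\<^sup>2) * ennreal (4096 * D ^ 3)"
      by (intro add_left_mono mult_left_mono S) simp
    also have "ennreal (1 / t\<^sup>2) * ennreal (4096 * D ^ 3) = ennreal (D * (4096 / \<tau>\<^sup>2))"
      using Dp \<tau> by (subst ennreal_mult[symmetric]) (auto simp: t_def power_mult_distrib power2_eq_square power3_eq_cube)
    also have "\<dots> = ennreal D * ennreal (4096 / \<tau>\<^sup>2)" using Dp by (intro ennreal_mult) auto
    also have "ennreal t = ennreal D * ennreal \<tau>" unfolding t_def using Dp \<tau> by (intro ennreal_mult) auto
    finally show "(NNINT x. ennreal (\<bar>f x\<bar> * (u x)\<^sup>2)) \<le> L2sq G * (ennreal \<tau> * F + ennreal (4096 / \<tau>\<^sup>2))"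
      unfolding D(1) by (simp add: distrib_left mult.assoc)
  qed
qed

section \<open>Weak compactness and the Rellich theorem\<close>

lemma convergent_offset_real: "convergent (\<lambda>n. f (n + k)) \<Longrightarrow> convergent (f :: nat \<Rightarrow> real)"
  unfolding convergent_def using LIMSEQ_offset by blast

text \<open>Cantor's diagonal argument; convergence of the i-th sequence is only guaranteed along a
  tail of the diagonal, whence the final shift of indices.\<close>

lemma bounded_sequences_common_subseq:
  fixes f :: "nat \<Rightarrow> nat \<Rightarrow> real"
  assumes b: "\<And>i n. \<bar>f i n\<bar> \<le> B i"
  obtains r where "strict_mono r" "\<And>i. convergent (\<lambda>n. f i (r n))"
proof -
  interpret subseqs "\<lambda>i s. convergent (\<lambda>n. f i (s n))"
  proof
    fix i and s :: "nat \<Rightarrow> nat" assume "strict_mono s"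
    have "bounded (range (\<lambda>n. f i (s n)))" unfolding bounded_iff using b by (intro exI[of _ "B i"]) auto
    then obtain l r where "strict_mono r" "((\<lambda>n. f i (s n)) \<circ> r) \<longlonglongrightarrow> l"
      using bounded_imp_convergent_subsequence by blast
    then show "\<exists>r'. strict_mono r' \<and> convergent (\<lambda>n. f i ((s \<circ> r') n))"
      by (auto simp: comp_def convergent_def)
  qed
  have "convergent (\<lambda>n. f i (diagseq n))" for i
  proof -
    have "convergent (\<lambda>n. f i ((diagseq \<circ> (+) (Suc i)) n))"
    proof (rule diagseq_holds)
      fix r s :: "nat \<Rightarrow> nat" and n assume "strict_mono r" "convergent (\<lambda>m. f n (s m))"
      then show "convergent (\<lambda>m. f n ((s \<circ> r) m))"
        using convergent_subseq_convergent[of "\<lambda>m. f n (s m)" r] by (simp add: comp_def)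
    qed
    then have "convergent (\<lambda>n. f i (diagseq (n + Suc i)))" by (simp add: comp_def add.commute)
    then show ?thesis by (rule convergent_offset_real)
  qed
  then show ?thesis using that subseq_diagseq by blast
qed

section \<open>Cut-off functions and density of test functions in H^1\<close>

lemma L2sq_bound_mult:
  fixes f :: "'a::euclidean_space \<Rightarrow> 'b::{real_normed_vector, second_countable_topology}"
    and g :: "'a::euclidean_space \<Rightarrow> 'c::{real_normed_vector, second_countable_topology}"
  assumes [measurable]: "borel_fun g" and "\<And>x. norm (f x) \<le> B * norm (g x)" "B \<ge> 0"
  shows "L2sq f \<le> ennreal (B\<^sup>2) * L2sq g"
proof -
  have "L2sq f \<le> L2sq (\<lambda>x. B *\<^sub>R g x)" by (rule L2sq_mono) (use assms in simp)
  then show ?thesis by (simp add: L2sq_scaleR)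
qed

lemma L2lim_bound_mult:
  fixes f :: "'a::euclidean_space \<Rightarrow> 'b::{real_normed_vector, second_countable_topology}"
    and g :: "'a::euclidean_space \<Rightarrow> 'c::{real_normed_vector, second_countable_topology}"
  assumes m: "\<And>n. borel_fun (G n)" "borel_fun g"
    and le: "\<And>n x. norm (F n x - f x) \<le> B * norm (G n x - g x)" "B \<ge> 0" and lim: "L2lim G g"
  shows "L2lim F f"
  unfolding L2lim_def
proof (rule tendsto_0_ennreal_combination[OF lim[unfolded L2lim_def] tendsto_const, of "ennreal (B\<^sup>2)" 0])
  fix n
  have "L2sq (\<lambda>x. F n x - f x) \<le> ennreal (B\<^sup>2) * L2sq (\<lambda>x. G n x - g x)"
    by (rule L2sq_bound_mult[OF borel_measurable_diff[OF m] le])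
  then show "L2sq (\<lambda>x. F n x - f x) \<le> ennreal (B\<^sup>2) * L2sq (\<lambda>x. G n x - g x) + 0 * 0" by simp
qed auto

text \<open>A mollified indicator serves as cut-off. The gradient bound is the L^1 norm of the
  gradient of the mollifier and hence depends on h only; this uniformity in a and r is used when the
  radius tends to infinity.\<close>

lemma conv_moll_ball:
  assumes h: "h > 0"
  defines "\<eta> \<equiv> \<lambda>a r. conv (indicator (ball a (r + h))) (moll h)"
  shows "test_fun UNIV (\<eta> a r)" "\<And>x. 0 \<le> \<eta> a r x" "\<And>x. \<eta> a r x \<le> 1"
    "\<And>x. x \<in> cball a r \<Longrightarrow> \<eta> a r x = 1" "\<And>x. x \<notin> cball a (r + 2 * h) \<Longrightarrow> \<eta> a r x = 0"
    "\<exists>C\<ge>0. \<forall>a r x. norm (gr (\<eta> a r) x) \<le> C"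
proof -
  have um: "borel_fun (indicator (ball a s) :: R3 \<Rightarrow> real)" for a s
    by (rule borel_measurable_indicator) simp
  have uf: "L2sq (indicator (ball a s) :: R3 \<Rightarrow> real) < \<infinity>" for a s
  proof -
    have "L2sq (indicator (ball a s) :: R3 \<Rightarrow> real) = (NNINT x. indicator (ball a s) x)"
      unfolding L2sq_def by (intro nn_integral_cong) (simp add: indicator_def)
    also have "\<dots> = emeasure lborel (ball a s)" by simp
    also have "\<dots> < \<infinity>" by (rule emeasure_lborel_ball_finite)
    finally show ?thesis .
  qed
  note mt = moll_test[OF h]
  have mi: "integrable lborel (\<lambda>y. moll h (x - y))" for x
  proof -
    have "integrable (distr lborel borel (\<lambda>y. x - y)) (moll h)"
      unfolding lborel_distr_reflect by (rule moll_integrable[OF h])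
    then show ?thesis by (simp add: integrable_distr_eq)
  qed
  have m1: "(LBINT y. moll h (x - y)) = 1" for x
    using integral_reflect_euclidean[OF moll_measurable, of h x] moll_integral[OF h] by simp
  have ci: "integrable lborel (\<lambda>y. indicator (ball a s) y * moll h (x - y))" for a s x
    by (rule conv_integrable[OF um uf moll_measurable test_fun_L2(1)[OF mt]])
  show pos: "0 \<le> \<eta> a r x" for a r x
    unfolding \<eta>_def conv_def using moll_nonneg[OF h] by (intro integral_nonneg_AE) auto
  show "\<eta> a r x \<le> 1" for x
  proof -
    have "\<eta> a r x \<le> (LBINT y. moll h (x - y))"
      unfolding \<eta>_def conv_def using moll_nonneg[OF h] by (intro integral_mono[OF ci mi]) (simp add: indicator_def)
    then show ?thesis using m1 by simp
  qed
  have mz: "moll h z = 0" if "norm z \<ge> h" for z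
    using rbump_pos_iff[OF h, of z] rbump_nonneg[of h z] that by (simp add: moll_def)
  show "\<eta> a r x = 1" if x: "x \<in> cball a r" for x
  proof -
    have "indicator (ball a (r + h)) y * moll h (x - y) = moll h (x - y)" for y
    proof (cases "norm (x - y) \<ge> h")
      case False
      have "dist a y \<le> dist a x + dist x y" by (rule dist_triangle)
      then have "dist a y < r + h" using x False by (simp add: dist_norm)
      then show ?thesis by simp
    qed (simp add: mz)
    then show ?thesis unfolding \<eta>_def conv_def by (simp only: m1)
  qed
  show zero: "\<eta> a r x = 0" if x: "x \<notin> cball a (r + 2 * h)" for a r x
    unfolding \<eta>_def
  proof (rule conv_zero[where A="ball a (r + h)"])
    show "AE y in lborel. y \<notin> ball a (r + h) \<longrightarrow> indicator (ball a (r + h)) y = (0::real)" by simp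
    fix y assume y: "y \<in> ball a (r + h)"
    have "dist a x \<le> dist a y + dist x y" by (metis dist_commute dist_triangle)
    then have "norm (x - y) \<ge> h" using x y by (simp add: dist_norm)
    then show "moll h (x - y) = 0" by (rule mz)
  qed
  show "test_fun UNIV (\<eta> a r)"
  proof (rule test_funI[of _ "cball a (r + 2 * h)"])
    show "smooth (\<eta> a r)" unfolding \<eta>_def by (rule smooth_conv[OF um uf mt])
    show "\<eta> a r x = 0" if "x \<notin> cball a (r + 2 * h)" for x by (rule zero[OF that])
  qed auto
  define c where "c i = (LBINT z. \<bar>partial i (moll h) z\<bar>)" for i
  have pmm: "borel_fun (partial i (moll h))" for i by (rule test_fun_partial_measurable[OF mt])
  have pint: "integrable lborel (\<lambda>z. \<bar>partial i (moll h) z\<bar>)" for i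
  proof -
    have tp: "test_fun UNIV (partial i (moll h))" by (rule test_fun_partial[OF mt])
    have "integrable lborel (partial i (moll h))"
      by (rule integrable_compact_support[of _ "tsupport (partial i (moll h))"])
        (use tp in \<open>auto simp: test_fun_def smooth_continuous not_in_tsupport\<close>)
    then show ?thesis by simp
  qed
  have pr: "integrable lborel (\<lambda>y. \<bar>partial i (moll h) (x - y)\<bar>)" for i x
  proof -
    have "integrable (distr lborel borel (\<lambda>y. x - y)) (\<lambda>z. \<bar>partial i (moll h) z\<bar>)"
      unfolding lborel_distr_reflect by (rule pint)
    then show ?thesis using pmm by (simp add: integrable_distr_eq)
  qed
  have "norm (gr (\<eta> a r) x) \<le> (\<Sum>i\<in>UNIV. c i)" for a r x
  proof -
    have "norm (gr (\<eta> a r) x) \<le> (\<Sum>i\<in>UNIV. \<bar>gr (\<eta> a r) x $ i\<bar>)" by (rule norm_le_l1_cart)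
    also have "\<dots> \<le> (\<Sum>i\<in>UNIV. c i)"
    proof (rule sum_mono)
      fix i :: 3
      have "gr (\<eta> a r) x $ i = conv (indicator (ball a (r + h))) (partial i (moll h)) x"
        unfolding \<eta>_def by (simp add: partial_conv[OF um uf mt])
      also have "\<bar>\<dots>\<bar> \<le> (LBINT y. \<bar>indicator (ball a (r + h)) y * partial i (moll h) (x - y)\<bar>)"
        unfolding conv_def using integral_norm_bound[of lborel "\<lambda>y. indicator (ball a (r + h)) y * partial i (moll h) (x - y)"] by simp
      also have "\<dots> \<le> (LBINT y. \<bar>partial i (moll h) (x - y)\<bar>)"
      proof (rule integral_mono[OF _ pr])
        show "integrable lborel (\<lambda>y. \<bar>indicator (ball a (r + h)) y * partial i (moll h) (x - y)\<bar>)"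
          by (rule integrable_abs[OF conv_integrable[OF um uf pmm test_fun_L2(1)[OF test_fun_partial[OF mt]]]])
      qed (simp add: indicator_def)
      also have "\<dots> = c i" unfolding c_def
        by (rule integral_reflect_euclidean[of "\<lambda>z. \<bar>partial i (moll h) z\<bar>" x]) (use pmm in simp)
      finally show "\<bar>gr (\<eta> a r) x $ i\<bar> \<le> c i" .
    qed
    finally show ?thesis .
  qed
  moreover have "(\<Sum>i\<in>UNIV. c i) \<ge> 0" by (intro sum_nonneg) (simp add: c_def)
  ultimately show "\<exists>C\<ge>0. \<forall>a r x. norm (gr (\<eta> a r) x) \<le> C" by blast
qed

lemma wk_mult:
  assumes w: "wk u G" and u: "borel_fun u" "L2sq u < \<infinity>"
    and G: "borel_fun G" "L2sq G < \<infinity>" and \<eta>: "test_fun UNIV \<eta>"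
  shows "wk (\<lambda>x. \<eta> x * u x) (\<lambda>x. \<eta> x *\<^sub>R G x + u x *\<^sub>R gr \<eta> x)"
  unfolding wk_def
proof (intro allI impI)
  fix \<phi> :: "R3 \<Rightarrow> real" and i assume \<phi>: "test_fun UNIV \<phi>"
  note S = test_fun_smooth[OF \<eta>]
  have t1: "test_fun UNIV (\<lambda>x. \<eta> x * \<phi> x)" by (rule test_fun_mult[OF \<phi> S])
  have t2: "test_fun UNIV (\<lambda>x. partial i \<eta> x * \<phi> x)" by (rule test_fun_mult[OF \<phi> smooth_partial[OF S]])
  have p: "partial i (\<lambda>x. \<eta> x * \<phi> x) x = \<eta> x * partial i \<phi> x + partial i \<eta> x * \<phi> x" for x
    unfolding gr_nth[symmetric] gr_mult[OF test_fun_C1[OF \<eta>] test_fun_C1[OF \<phi>]] by (simp add: mult.commute)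
  have i1: "integrable lborel (\<lambda>x. u x * partial i (\<lambda>x. \<eta> x * \<phi> x) x)"
    using L2_inner_integrable[OF u(1) test_fun_partial_measurable[OF t1] u(2) test_fun_L2(1)[OF test_fun_partial[OF t1]]] by simp
  have i2: "integrable lborel (\<lambda>x. u x * (partial i \<eta> x * \<phi> x))"
    using L2_inner_integrable[OF u(1) test_fun_measurable[OF t2] u(2) test_fun_L2(1)[OF t2]] by simp
  have i3: "integrable lborel (\<lambda>x. G x $ i * (\<eta> x * \<phi> x))"
    using L2_inner_integrable[OF borel_measurable_vec_nth[OF G(1)] test_fun_measurable[OF t1] L2sq_component_finite[OF G(2)] test_fun_L2(1)[OF t1]] by simp
  have "(LBINT x. \<eta> x * u x * partial i \<phi> x) = (LBINT x. u x * partial i (\<lambda>x. \<eta> x * \<phi> x) x - u x * (partial i \<eta> x * \<phi> x))"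
    by (rule Bochner_Integration.integral_cong) (simp_all add: p algebra_simps)
  also have "\<dots> = (LBINT x. u x * partial i (\<lambda>x. \<eta> x * \<phi> x) x) - (LBINT x. u x * (partial i \<eta> x * \<phi> x))"
    by (rule Bochner_Integration.integral_diff[OF i1 i2])
  also have "(LBINT x. u x * partial i (\<lambda>x. \<eta> x * \<phi> x) x) = - (LBINT x. G x $ i * (\<eta> x * \<phi> x))"
    using w t1 unfolding wk_def by blast
  also have "- (LBINT x. G x $ i * (\<eta> x * \<phi> x)) - (LBINT x. u x * (partial i \<eta> x * \<phi> x))
     = - (LBINT x. G x $ i * (\<eta> x * \<phi> x) + u x * (partial i \<eta> x * \<phi> x))"
    by (simp add: Bochner_Integration.integral_add[OF i3 i2])
  also have "(LBINT x. G x $ i * (\<eta> x * \<phi> x) + u x * (partial i \<eta> x * \<phi> x))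
     = (LBINT x. (\<eta> x *\<^sub>R G x + u x *\<^sub>R gr \<eta> x) $ i * \<phi> x)"
    by (rule Bochner_Integration.integral_cong) (simp_all add: algebra_simps)
  finally show "(LBINT x. \<eta> x * u x * partial i \<phi> x) = - (LBINT x. (\<eta> x *\<^sub>R G x + u x *\<^sub>R gr \<eta> x) $ i * \<phi> x)" .
qed

lemma gr_const_near:
  assumes "open S" "x \<in> S" "\<And>y. y \<in> S \<Longrightarrow> g y = c"
  shows "gr g x = 0"
proof (rule gr_eqI)
  have "((\<lambda>_. c) has_derivative (\<lambda>v. 0 \<bullet> v)) (at x)" by simp
  then show "(g has_derivative (\<lambda>v. 0 \<bullet> v)) (at x)"
    by (rule has_derivative_transform_within_open[where s=S]) (use assms in auto)
qed

text \<open>On the whole space the weak definition of H^1 agrees with the closure of test functions: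
  multiply by cut-offs of growing radius, then mollify the compactly supported products.\<close>

lemma wk_appr:
  assumes w: "wk u G" and u: "borel_fun u" "L2sq u < \<infinity>"
    and G: "borel_fun G" "L2sq G < \<infinity>"
  shows "appr UNIV u G"
proof -
  define \<eta> where "\<eta> n = conv (indicator (ball 0 (real n + 1))) (moll 1)" for n :: nat
  note cut = conv_moll_ball[OF zero_less_one]
  have t: "test_fun UNIV (\<eta> n)" and c0: "0 \<le> \<eta> n x" and c1: "\<eta> n x \<le> 1" for n x
    unfolding \<eta>_def using cut(1-3)[of 0 "real n"] by simp_all
  have one: "\<eta> n x = 1" if "norm x \<le> real n" for n x
    unfolding \<eta>_def using cut(4)[of x 0 "real n"] that by simp
  have zero: "\<eta> n x = 0" if "x \<notin> cball 0 (real n + 2)" for n x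
    unfolding \<eta>_def using cut(5)[of x 0 "real n"] that by simp
  obtain C where C: "C \<ge> 0" "\<And>n x. norm (gr (\<eta> n) x) \<le> C"
    using cut(6) unfolding \<eta>_def by blast
  note m [measurable] = test_fun_measurable[OF t] test_fun_gr_measurable[OF t] u(1) G(1)
  define H where "H n x = \<eta> n x *\<^sub>R G x + u x *\<^sub>R gr (\<eta> n) x" for n x
  have absle: "\<bar>\<eta> n x\<bar> \<le> 1" for n x using c0[of n x] c1[of n x] by simp
  have lim1: "(\<lambda>n. \<eta> n x) \<longlonglongrightarrow> 1" for x
  proof (rule tendsto_eventually)
    obtain N :: nat where "norm x \<le> real N" using real_arch_simple by blast
    then show "\<forall>\<^sub>F n in sequentially. \<eta> n x = 1" by (intro eventually_sequentiallyI[of N] one) linarith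
  qed
  have l1: "L2lim (\<lambda>n x. \<eta> n x * u x) u"
    using L2lim_mult_bounded[of "\<lambda>n. u" u \<eta> "\<lambda>_. 1" 1] u(2) absle lim1 by simp
  have l2: "L2lim (\<lambda>n x. \<eta> n x *\<^sub>R G x) G"
    using L2lim_mult_bounded[of "\<lambda>n. G" G \<eta> "\<lambda>_. 1" 1] G(2) absle lim1 by simp
  \<comment> \<open>The gradient of the n-th cut-off vanishes for norm x < n and is bounded by C, so
    this term is at most C |u| on the exterior region.\<close>
  have l3: "L2lim (\<lambda>n x. u x *\<^sub>R gr (\<eta> n) x) (\<lambda>x. 0)"
  proof (rule L2lim_bound_mult[where G="\<lambda>n x. indicator {x. norm x \<ge> real n} x * u x" and g="\<lambda>x. 0" and B=C])
    show "borel_fun (\<lambda>x. indicator {x. norm x \<ge> real n} x * u x)" for n by measurable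
    show "norm (u x *\<^sub>R gr (\<eta> n) x - 0) \<le> C * norm (indicator {x. norm x \<ge> real n} x * u x - 0)" for n x
    proof (cases "norm x \<ge> real n")
      case True
      then show ?thesis using mult_left_mono[OF C(2)[of n x] abs_ge_zero[of "u x"]] by (simp add: mult.commute)
    next
      case False
      have "gr (\<eta> n) x = 0"
        by (rule gr_const_near[of "ball 0 (real n)" x "\<eta> n" 1]) (use False one in auto)
      then show ?thesis using C(1) by simp
    qed
    have "(\<lambda>n. indicator {x. norm x \<ge> real n} x) \<longlonglongrightarrow> (0::real)" for x :: R3
    proof (rule tendsto_eventually)
      obtain N :: nat where "norm x < real N" using reals_Archimedean2 by blast
      then show "\<forall>\<^sub>F n in sequentially. indicator {x. norm x \<ge> real n} x = (0::real)"
        by (intro eventually_sequentiallyI[of N]) (auto simp: indicator_def)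
    qed
    then show "L2lim (\<lambda>n x. indicator {x. norm x \<ge> real n} x * u x) (\<lambda>x. 0)"
      using L2lim_mult_bounded[of "\<lambda>n. u" u "\<lambda>n. indicator {x. norm x \<ge> real n}" "\<lambda>_. 0" 1] u(2) by simp
  qed (use C in simp_all)
  have l4: "L2lim H G"
    unfolding H_def using L2lim_add[OF _ _ _ _ l2 l3] by simp
  have Hm [measurable]: "borel_fun (H n)" for n unfolding H_def by measurable
  have Hf: "L2sq (H n) < \<infinity>" for n
    unfolding H_def
  proof (rule L2sq_finite_add)
    have "L2sq (\<lambda>x. \<eta> n x *\<^sub>R G x) \<le> ennreal (1\<^sup>2) * L2sq G"
      by (rule L2sq_bound_mult) (use absle in \<open>auto intro!: mult_left_le_one_le\<close>)
    then show "L2sq (\<lambda>x. \<eta> n x *\<^sub>R G x) < \<infinity>" using G(2) by simp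
    have "L2sq (\<lambda>x. u x *\<^sub>R gr (\<eta> n) x) \<le> ennreal (C\<^sup>2) * L2sq u"
    proof (rule L2sq_bound_mult)
      show "norm (u x *\<^sub>R gr (\<eta> n) x) \<le> C * norm (u x)" for x
        using mult_left_mono[OF C(2)[of n x] abs_ge_zero[of "u x"]] by (simp add: mult.commute)
    qed (use C in simp_all)
    also have "\<dots> < \<infinity>" using u(2) by (simp add: ennreal_mult_less_top)
    finally show "L2sq (\<lambda>x. u x *\<^sub>R gr (\<eta> n) x) < \<infinity>" .
  qed measurable
  have "appr UNIV (\<lambda>x. \<eta> n x * u x) (H n)" for n
  proof (rule wk_compact_support_appr[OF _ _ _ Hm Hf compact_cball[of 0 "real n + 2"]])
    show "wk (\<lambda>x. \<eta> n x * u x) (H n)" unfolding H_def by (rule wk_mult[OF w u G t])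
    have "L2sq (\<lambda>x. \<eta> n x * u x) \<le> ennreal (1\<^sup>2) * L2sq u"
      by (rule L2sq_bound_mult) (use absle in \<open>auto simp: abs_mult intro!: mult_left_le_one_le\<close>)
    then show "L2sq (\<lambda>x. \<eta> n x * u x) < \<infinity>" using u(2) by simp
    show "AE x in lborel. x \<notin> cball 0 (real n + 2) \<longrightarrow> \<eta> n x * u x = 0" using zero by simp
  qed auto
  from appr_limit_seq[OF u(1) G(1) this l1 l4] show ?thesis .
qed

lemma appr_mult_smooth:
  assumes A: "appr U u G" and \<eta>: "smooth \<eta>" and B: "B \<ge> 0" "\<And>x. \<bar>\<eta> x\<bar> \<le> B" "\<And>x. norm (gr \<eta> x) \<le> B"
  shows "appr U (\<lambda>x. \<eta> x * u x) (\<lambda>x. \<eta> x *\<^sub>R G x + u x *\<^sub>R gr \<eta> x)"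
proof -
  obtain \<phi> where \<phi>: "\<And>n::nat. test_fun U (\<phi> n)" "L2lim \<phi> u" "L2lim (\<lambda>n. gr (\<phi> n)) G"
    using appr_seq[OF A] by blast
  note m [measurable] = apprD[OF A] test_fun_measurable[OF \<phi>(1)] test_fun_gr_measurable[OF \<phi>(1)]
    C1_measurable[OF smooth_C1[OF \<eta>]] C1_gr_measurable[OF smooth_C1[OF \<eta>]]
  show ?thesis
  proof (rule appr_from_test_seq[where \<phi>="\<lambda>n x. \<eta> x * \<phi> n x"])
    show "test_fun U (\<lambda>x. \<eta> x * \<phi> n x)" for n by (rule test_fun_mult[OF \<phi>(1) \<eta>])
    show "L2lim (\<lambda>n x. \<eta> x * \<phi> n x) (\<lambda>x. \<eta> x * u x)"
      by (rule L2lim_bound_mult[OF m(3,1) _ B(1) \<phi>(2)])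
        (use B(2) in \<open>simp add: right_diff_distrib[symmetric] abs_mult mult_right_mono\<close>)
    have g: "gr (\<lambda>x. \<eta> x * \<phi> n x) = (\<lambda>x. \<eta> x *\<^sub>R gr (\<phi> n) x + \<phi> n x *\<^sub>R gr \<eta> x)" for n
      by (rule gr_mult[OF smooth_C1[OF \<eta>] test_fun_C1[OF \<phi>(1)]])
    show "L2lim (\<lambda>n. gr (\<lambda>x. \<eta> x * \<phi> n x)) (\<lambda>x. \<eta> x *\<^sub>R G x + u x *\<^sub>R gr \<eta> x)"
      unfolding g
    proof (rule L2lim_add)
      show "L2lim (\<lambda>n x. \<eta> x *\<^sub>R gr (\<phi> n) x) (\<lambda>x. \<eta> x *\<^sub>R G x)"
        by (rule L2lim_bound_mult[OF m(4,2) _ B(1) \<phi>(3)])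
          (use B(2) in \<open>simp add: scaleR_diff_right[symmetric] mult_right_mono\<close>)
      show "L2lim (\<lambda>n x. \<phi> n x *\<^sub>R gr \<eta> x) (\<lambda>x. u x *\<^sub>R gr \<eta> x)"
        by (rule L2lim_bound_mult[OF m(3,1) _ B(1) \<phi>(2)])
          (use B(3) in \<open>simp add: scaleR_diff_left[symmetric] mult.commute[of "\<bar>_\<bar>"] mult_right_mono\<close>)
    qed measurable
  qed measurable
qed

text \<open>Integrate the derivative along the segment from x to x + y, apply Cauchy-Schwarz in the
  segment parameter and exchange the integrals; each translate of the gradient has the same
  norm.\<close>

lemma translation_estimate_C1c:
  assumes g: "C1c U g"
  shows "L2sq (\<lambda>x. g (x + y) - g x) \<le> ennreal ((norm y)\<^sup>2) * L2sq (gr g)"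
proof -
  note C = C1c_C1[OF g]
  note [measurable] = C1_measurable[OF C] C1_gr_measurable[OF C]
  have pt: "ennreal ((norm (g (x + y) - g x))\<^sup>2) \<le> (\<integral>\<^sup>+t. ennreal ((norm y)\<^sup>2) * ennreal ((norm (gr g (x + t *\<^sub>R y)))\<^sup>2) * indicator {0..1} t \<partial>(lborel :: real measure))" for x
  proof -
    define p where "p t = g (x + t *\<^sub>R y)" for t
    define p' where "p' t = gr g (x + t *\<^sub>R y) \<bullet> y" for t
    have d: "(p has_real_derivative p' t) (at t)" for t
    proof -
      have "((\<lambda>t. x + t *\<^sub>R y) has_derivative (\<lambda>r. r *\<^sub>R y)) (at t)" by (auto intro!: derivative_eq_intros)
      from has_derivative_compose[OF this C1_derivative[OF C]]
      show ?thesis unfolding p_def p'_def by (simp add: has_field_derivative_def mult_commute_abs)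
    qed
    have pc: "continuous_on UNIV p'" unfolding p'_def
      by (intro continuous_intros continuous_on_compose2[OF C1_gr_continuous[OF C]]) auto
    then have [measurable]: "borel_fun p'" by (rule borel_measurable_continuous_onI)
    have hb: "has_bochner_integral lborel (\<lambda>t. p' t * indicator {0..1} t) (p 1 - p 0)"
      by (rule has_bochner_integral_FTC_Icc_real) (use d pc in \<open>auto simp: continuous_on_eq_continuous_at\<close>)
    then have int: "integrable lborel (\<lambda>t. p' t * indicator {0..1} t)" and eq: "(LBINT t. p' t * indicator {0..1} t) = g (x + y) - g x"
      by (auto simp: has_bochner_integral_iff p_def)
    have "ennreal (norm (g (x + y) - g x)) \<le> (NNINT t. ennreal (norm (p' t * indicator {0..1} t)))"
      using integral_norm_bound_ennreal[OF int] eq by simp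
    then have "(ennreal (norm (g (x + y) - g x)))\<^sup>2 \<le> (NNINT t. ennreal (norm (p' t * indicator {0..1} t)))\<^sup>2"
      by (rule power_mono) simp
    also have "\<dots> \<le> (NNINT t. ennreal ((norm y)\<^sup>2) * ennreal ((norm (gr g (x + t *\<^sub>R y)))\<^sup>2) * indicator {0..1} t) * (\<integral>\<^sup>+t. indicator {0..1} t \<partial>(lborel :: real measure))"
    proof (rule Cauchy_Schwarz_ennreal)
      fix t :: real
      show "(ennreal (norm (p' t * indicator {0..1} t)))\<^sup>2 \<le> ennreal ((norm y)\<^sup>2) * ennreal ((norm (gr g (x + t *\<^sub>R y)))\<^sup>2) * indicator {0..1} t * indicator {0..1} t"
      proof (cases "t \<in> {0..1}")
        case True
        have "\<bar>p' t\<bar> \<le> norm (gr g (x + t *\<^sub>R y)) * norm y" unfolding p'_def by (rule Cauchy_Schwarz_ineq2)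
        then have "\<bar>p' t\<bar>\<^sup>2 \<le> (norm (gr g (x + t *\<^sub>R y)) * norm y)\<^sup>2" by (rule power_mono) simp
        then show ?thesis using True
          by (simp add: ennreal_power ennreal_mult[symmetric] power_mult_distrib mult.commute ennreal_leI)
      qed simp
    qed measurable
    finally show ?thesis by (simp add: ennreal_power)
  qed
  have "L2sq (\<lambda>x. g (x + y) - g x) \<le> (\<integral>\<^sup>+x. \<integral>\<^sup>+t. ennreal ((norm y)\<^sup>2) * ennreal ((norm (gr g (x + t *\<^sub>R y)))\<^sup>2) * indicator {0..1} t \<partial>(lborel :: real measure) \<partial>lborel)"
    unfolding L2sq_def by (intro nn_integral_mono pt)
  also have "\<dots> = (\<integral>\<^sup>+t. (NNINT x. ennreal ((norm y)\<^sup>2) * ennreal ((norm (gr g (x + t *\<^sub>R y)))\<^sup>2) * indicator {0..1} t) \<partial>(lborel :: real measure))"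
    by (rule lborel_pair.Fubini') measurable
  also have "\<dots> = (\<integral>\<^sup>+t. (ennreal ((norm y)\<^sup>2) * L2sq (gr g)) * indicator {0..1} t \<partial>(lborel :: real measure))"
  proof (rule nn_integral_cong)
    fix t :: real
    have "(NNINT x. ennreal ((norm y)\<^sup>2) * ennreal ((norm (gr g (x + t *\<^sub>R y)))\<^sup>2) * indicator {0..1} t)
      = ennreal ((norm y)\<^sup>2) * L2sq (\<lambda>x. gr g (x + t *\<^sub>R y)) * indicator {0..1} t"
      unfolding L2sq_def by (subst nn_integral_multc) (simp_all add: nn_integral_cmult)
    then show "(NNINT x. ennreal ((norm y)\<^sup>2) * ennreal ((norm (gr g (x + t *\<^sub>R y)))\<^sup>2) * indicator {0..1} t)
      = (ennreal ((norm y)\<^sup>2) * L2sq (gr g)) * indicator {0..1} t"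
      by (simp add: L2sq_translate)
  qed
  also have "\<dots> = ennreal ((norm y)\<^sup>2) * L2sq (gr g)"
    by (subst nn_integral_cmult_indicator) auto
  finally show ?thesis .
qed

lemma translation_estimate:
  assumes A: "appr U u G"
  shows "L2sq (\<lambda>x. u (x + y) - u x) \<le> ennreal ((norm y)\<^sup>2) * L2sq G"
proof -
  obtain \<phi> where \<phi>: "\<And>n::nat. test_fun U (\<phi> n)" "L2lim \<phi> u" "L2lim (\<lambda>n. gr (\<phi> n)) G"
    using appr_seq[OF A] by blast
  note m [measurable] = apprD[OF A] test_fun_measurable[OF \<phi>(1)] test_fun_gr_measurable[OF \<phi>(1)] and f = appr_L2[OF A]
  have tr: "L2lim (\<lambda>n x. \<phi> n (x + y)) (\<lambda>x. u (x + y))"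
  proof -
    have "L2sq (\<lambda>x. \<phi> n (x + y) - u (x + y)) = L2sq (\<lambda>x. \<phi> n x - u x)" for n
      using L2sq_translate[of "\<lambda>x. \<phi> n x - u x" y] by simp
    then show ?thesis using \<phi>(2) by (simp add: L2lim_def)
  qed
  have l1: "L2lim (\<lambda>n x. \<phi> n (x + y) - \<phi> n x) (\<lambda>x. u (x + y) - u x)"
    using L2lim_add[OF _ _ _ _ tr L2lim_scaleR[OF _ _ \<phi>(2), of "-1"]] by simp
  have fu: "L2sq (\<lambda>x. u (x + y) - u x) < \<infinity>"
    by (rule L2sq_finite_diff) (use f L2sq_translate[OF m(1)] in simp_all)
  have f\<phi>: "L2sq (\<lambda>x. \<phi> n (x + y) - \<phi> n x) < \<infinity>" for n
    by (rule L2sq_finite_diff) (use test_fun_L2(1)[OF \<phi>(1)] L2sq_translate[OF m(3)] in simp_all)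
  have "(\<lambda>n. enn2real (L2sq (\<lambda>x. \<phi> n (x + y) - \<phi> n x))) \<longlonglongrightarrow> enn2real (L2sq (\<lambda>x. u (x + y) - u x))"
    by (rule L2lim_norm[OF _ _ l1 fu f\<phi>]) measurable
  moreover have "(\<lambda>n. (norm y)\<^sup>2 * enn2real (L2sq (gr (\<phi> n)))) \<longlonglongrightarrow> (norm y)\<^sup>2 * enn2real (L2sq G)"
    by (intro tendsto_mult tendsto_const L2lim_norm[OF m(4,2) \<phi>(3) f(2) test_fun_L2(2)[OF \<phi>(1)]])
  moreover have "enn2real (L2sq (\<lambda>x. \<phi> n (x + y) - \<phi> n x)) \<le> (norm y)\<^sup>2 * enn2real (L2sq (gr (\<phi> n)))" for n
  proof -
    have "L2sq (\<lambda>x. \<phi> n (x + y) - \<phi> n x) \<le> ennreal ((norm y)\<^sup>2) * L2sq (gr (\<phi> n))"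
      by (rule translation_estimate_C1c[OF test_fun_C1c[OF \<phi>(1)]])
    then have "enn2real (L2sq (\<lambda>x. \<phi> n (x + y) - \<phi> n x)) \<le> enn2real (ennreal ((norm y)\<^sup>2) * L2sq (gr (\<phi> n)))"
      using test_fun_L2(2)[OF \<phi>(1), of n] by (intro enn2real_mono) (simp_all add: ennreal_mult_less_top)
    then show ?thesis by (simp add: enn2real_mult)
  qed
  ultimately have "enn2real (L2sq (\<lambda>x. u (x + y) - u x)) \<le> (norm y)\<^sup>2 * enn2real (L2sq G)"
    by (intro LIMSEQ_le[of _ _ "\<lambda>n. (norm y)\<^sup>2 * enn2real (L2sq (gr (\<phi> n)))"]) auto
  then have "ennreal (enn2real (L2sq (\<lambda>x. u (x + y) - u x))) \<le> ennreal ((norm y)\<^sup>2 * enn2real (L2sq G))" by (rule ennreal_leI)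
  then show ?thesis using fu f by (simp add: ennreal_mult)
qed

lemma conv_moll_estimate:
  assumes A: "appr U u G" and e: "e > 0"
  shows "L2sq (\<lambda>x. conv u (moll e) x - u x) \<le> ennreal (e\<^sup>2) * L2sq G"
proof (rule conv_moll_bound[OF apprD(1)[OF A] appr_L2(1)[OF A] e])
  fix y :: R3 assume y: "norm y \<le> e"
  have "L2sq (\<lambda>x. u (x + y) - u x) \<le> ennreal ((norm y)\<^sup>2) * L2sq G" by (rule translation_estimate[OF A])
  also have "\<dots> \<le> ennreal (e\<^sup>2) * L2sq G" using y by (intro mult_right_mono ennreal_leI power_mono) auto
  finally show "L2sq (\<lambda>x. u (x + y) - u x) \<le> ennreal (e\<^sup>2) * L2sq G" .
qed

section \<open>Weak lower semicontinuity of the gradient norm\<close>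

lemma L2sq_parallelogram:
  fixes f g :: "'a::euclidean_space \<Rightarrow> 'b::euclidean_space"
  assumes [measurable]: "borel_fun f" "borel_fun g"
  shows "L2sq (\<lambda>x. f x - g x) + L2sq (\<lambda>x. f x + g x) = 2 * L2sq f + 2 * L2sq g"
proof -
  have "L2sq (\<lambda>x. f x - g x) + L2sq (\<lambda>x. f x + g x) = (NNINT x. ennreal ((norm (f x - g x))\<^sup>2) + ennreal ((norm (f x + g x))\<^sup>2))"
    unfolding L2sq_def by (rule nn_integral_add[symmetric]) measurable
  also have "\<dots> = (NNINT x. 2 * ennreal ((norm (f x))\<^sup>2) + 2 * ennreal ((norm (g x))\<^sup>2))"
  proof (rule nn_integral_cong)
    fix x
    have "(norm (f x - g x))\<^sup>2 + (norm (f x + g x))\<^sup>2 = 2 * (norm (f x))\<^sup>2 + 2 * (norm (g x))\<^sup>2"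
      by (simp add: power2_norm_eq_inner inner_add_left inner_add_right inner_diff_left inner_diff_right)
    then have "ennreal ((norm (f x - g x))\<^sup>2 + (norm (f x + g x))\<^sup>2) = ennreal (2 * (norm (f x))\<^sup>2 + 2 * (norm (g x))\<^sup>2)" by simp
    then show "ennreal ((norm (f x - g x))\<^sup>2) + ennreal ((norm (f x + g x))\<^sup>2) = 2 * ennreal ((norm (f x))\<^sup>2) + 2 * ennreal ((norm (g x))\<^sup>2)"
      by (subst (asm) ennreal_linear_combination) (simp_all add: ennreal_plus)
  qed
  also have "\<dots> = 2 * L2sq f + 2 * L2sq g"
    unfolding L2sq_def by (subst nn_integral_add) (simp_all add: nn_integral_cmult)
  finally show ?thesis .
qed

lemma enn2real_parallelogram:
  fixes f g :: "'a::euclidean_space \<Rightarrow> 'b::euclidean_space"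
  assumes m: "borel_fun f" "borel_fun g" and fin: "L2sq f < \<infinity>" "L2sq g < \<infinity>"
  shows "enn2real (L2sq (\<lambda>x. f x - g x)) + enn2real (L2sq (\<lambda>x. f x + g x)) = 2 * enn2real (L2sq f) + 2 * enn2real (L2sq g)"
proof -
  have 1: "L2sq (\<lambda>x. f x - g x) < \<infinity>" by (rule L2sq_finite_diff[OF m fin])
  have 2: "L2sq (\<lambda>x. f x + g x) < \<infinity>" by (rule L2sq_finite_add[OF m fin])
  have "enn2real (L2sq (\<lambda>x. f x - g x) + L2sq (\<lambda>x. f x + g x)) = enn2real (2 * L2sq f + 2 * L2sq g)"
    by (simp only: L2sq_parallelogram[OF m])
  then show ?thesis using 1 2 fin by (simp add: enn2real_plus ennreal_mult_less_top enn2real_mult)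
qed

lemma L2sq_half_le:
  assumes [measurable]: "borel_fun f" "borel_fun g"
    and le: "L2sq f \<le> ennreal c" "L2sq g \<le> ennreal c" and c: "c \<ge> 0"
  shows "L2sq (\<lambda>x. (1/2) *\<^sub>R f x + (1/2) *\<^sub>R g x) \<le> ennreal c"
proof -
  have "L2sq (\<lambda>x. (1/2) *\<^sub>R f x + (1/2) *\<^sub>R g x) \<le> 2 * L2sq (\<lambda>x. (1/2) *\<^sub>R f x) + 2 * L2sq (\<lambda>x. (1/2) *\<^sub>R g x)"
    by (rule L2sq_add) measurable
  also have "\<dots> = 2 * (ennreal ((1/2)\<^sup>2) * L2sq f) + 2 * (ennreal ((1/2)\<^sup>2) * L2sq g)"
    by (simp only: L2sq_scaleR assms(1,2))
  also have "\<dots> \<le> 2 * (ennreal ((1/2)\<^sup>2) * ennreal c) + 2 * (ennreal ((1/2)\<^sup>2) * ennreal c)"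
    by (intro add_mono mult_left_mono le) auto
  also have "\<dots> = ennreal c"
    using c by (simp add: ennreal_mult[symmetric] ennreal_plus[symmetric] power2_eq_square del: ennreal_plus ennreal_numeral flip: ennreal_numeral)
  finally show ?thesis .
qed

text \<open>In place of a weak limit of the gradients, pairs with nearly minimal gradient norm are
  selected among those L^2-close to v. They are Cauchy in the gradient as well, and their limit is
  the gradient of v with norm still at most C.\<close>

lemma weak_lower_semicontinuity:
  assumes A: "\<And>n. appr UNIV (u n) (G n)" and lim: "L2lim u v" and vm [measurable]: "borel_fun v"
    and G: "\<And>n. L2sq (G n) \<le> ennreal C" and C: "C \<ge> 0"
  obtains H where "appr UNIV v H" "L2sq H \<le> ennreal C"
proof -
  \<comment> \<open>These sets contain members of the given sequence, are closed under midpoints and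
    shrink as N grows. Hence the infima d N of the squared gradient norms are nondecreasing and at
    most C, and they converge.\<close>
  define S where "S N = {(w, W). appr UNIV w W \<and> L2sq W \<le> ennreal C \<and> L2sq (\<lambda>x. w x - v x) \<le> ennreal (1 / real (Suc N))}" for N
  define V where "V N = (\<lambda>p. enn2real (L2sq (snd p))) ` S N" for N
  define d where "d N = Inf (V N)" for N
  have S_ne: "S N \<noteq> {}" for N
  proof -
    have "1 / real (Suc N) > 0" by simp
    from ennreal_tendsto_0D[OF lim[unfolded L2lim_def] this]
    have "\<forall>\<^sub>F n in sequentially. L2sq (\<lambda>x. u n x - v x) \<le> ennreal (1 / real (Suc N))" .
    from eventually_happens'[OF sequentially_bot this] obtain n where "L2sq (\<lambda>x. u n x - v x) \<le> ennreal (1 / real (Suc N))" by blast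
    then have "(u n, G n) \<in> S N" using A G by (simp add: S_def)
    then show ?thesis by blast
  qed
  have S_anti: "S M \<subseteq> S N" if "N \<le> M" for N M
  proof -
    have "ennreal (1 / real (Suc M)) \<le> ennreal (1 / real (Suc N))" using that by (intro ennreal_leI) (simp add: field_simps)
    then show ?thesis unfolding S_def by (auto intro: order_trans)
  qed
  have V_ne: "V N \<noteq> {}" for N using S_ne by (simp add: V_def)
  have V_bdd: "bdd_below (V N)" for N unfolding V_def by (intro bdd_belowI[of _ 0]) auto
  have V_le: "y \<le> C" if yV: "y \<in> V N" for y N
  proof -
    obtain p where "p \<in> S N" "y = enn2real (L2sq (snd p))" using yV unfolding V_def by blast
    then have "L2sq (snd p) \<le> ennreal C" by (auto simp: S_def)
    then have "enn2real (L2sq (snd p)) \<le> enn2real (ennreal C)" by (rule enn2real_mono) simp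
    then show ?thesis using C \<open>y = _\<close> by simp
  qed
  have d_mono: "d N \<le> d M" if "N \<le> M" for N M
    unfolding d_def using S_anti[OF that] by (intro cInf_superset_mono V_ne V_bdd) (auto simp: V_def)
  have d_le: "d N \<le> C" for N
  proof -
    obtain y where "y \<in> V N" using V_ne by blast
    then show ?thesis unfolding d_def using cInf_lower[OF _ V_bdd] V_le by (meson order_trans)
  qed
  have "convergent d"
  proof (rule Bseq_mono_convergent)
    have "\<bar>d n\<bar> \<le> \<bar>d 0\<bar> + \<bar>C\<bar>" for n using d_le[of n] d_mono[of 0 n] by simp
    then show "Bseq d" by (intro BseqI'[of d "\<bar>d 0\<bar> + \<bar>C\<bar>"]) simp
  qed (use d_mono in blast)
  then have dC: "Cauchy d" by (rule convergent_Cauchy)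
  have "\<exists>p. p \<in> S N \<and> enn2real (L2sq (snd p)) < d N + 1 / real (Suc N)" for N
  proof -
    have "Inf (V N) < d N + 1 / real (Suc N)" by (simp add: d_def)
    then obtain y where "y \<in> V N" "y < d N + 1 / real (Suc N)" using cInf_lessD[OF V_ne] by blast
    then show ?thesis unfolding V_def by blast
  qed
  then obtain p where p: "\<And>N. p N \<in> S N" "\<And>N. enn2real (L2sq (snd (p N))) < d N + 1 / real (Suc N)" by metis
  define w where "w N = fst (p N)" for N
  define W where "W N = snd (p N)" for N
  have wW: "appr UNIV (w N) (W N)" "L2sq (W N) \<le> ennreal C" "L2sq (\<lambda>x. w N x - v x) \<le> ennreal (1 / real (Suc N))" for N
    using p(1)[of N] by (auto simp: S_def w_def W_def)
  note [measurable] = apprD[OF wW(1)]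
  have Wf: "L2sq (W N) < \<infinity>" for N using wW(2)[of N] by (rule le_less_trans) simp
  \<comment> \<open>For N <= M the midpoint of the two selected pairs lies in S N, so the sum of the
    gradients has squared norm at least 4 d N; the parallelogram law turns this into smallness of
    the difference.\<close>
  have key: "enn2real (L2sq (\<lambda>x. W N x - W M x)) \<le> 2 * (d M - d N) + 4 / real (Suc N)" if NM: "N \<le> M" for N M
  proof -
    define z where "z x = (1/2) * w N x + (1/2) * w M x" for x
    define Z where "Z x = (1/2) *\<^sub>R W N x + (1/2) *\<^sub>R W M x" for x
    have "(z, Z) \<in> S N"
    proof -
      have "appr UNIV z Z" unfolding z_def Z_def by (intro appr_add appr_cmult wW)
      moreover have "L2sq Z \<le> ennreal C" unfolding Z_def by (intro L2sq_half_le wW C) measurable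
      moreover have "L2sq (\<lambda>x. z x - v x) \<le> ennreal (1 / real (Suc N))"
      proof -
        have "p M \<in> S N" using p(1)[of M] S_anti[OF NM] by blast
        then have "L2sq (\<lambda>x. w M x - v x) \<le> ennreal (1 / real (Suc N))" by (auto simp: S_def w_def)
        then have "L2sq (\<lambda>x. (1/2) *\<^sub>R (w N x - v x) + (1/2) *\<^sub>R (w M x - v x)) \<le> ennreal (1 / real (Suc N))"
          by (intro L2sq_half_le wW(3)) simp_all
        moreover have "(1/2) *\<^sub>R (w N x - v x) + (1/2) *\<^sub>R (w M x - v x) = z x - v x" for x by (simp add: z_def field_simps)
        ultimately show ?thesis by simp
      qed
      ultimately show ?thesis by (simp add: S_def)
    qed
    then have "enn2real (L2sq Z) \<in> V N" unfolding V_def by force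
    then have "d N \<le> enn2real (L2sq Z)" unfolding d_def by (intro cInf_lower V_bdd)
    also have "L2sq Z = ennreal ((1/2)\<^sup>2) * L2sq (\<lambda>x. W N x + W M x)"
      unfolding Z_def by (subst L2sq_scaleR[symmetric]) (simp_all add: scaleR_add_right)
    finally have "4 * d N \<le> enn2real (L2sq (\<lambda>x. W N x + W M x))"
      by (simp add: enn2real_mult power2_eq_square)
    moreover have "enn2real (L2sq (\<lambda>x. W N x - W M x)) + enn2real (L2sq (\<lambda>x. W N x + W M x)) = 2 * enn2real (L2sq (W N)) + 2 * enn2real (L2sq (W M))"
      by (rule enn2real_parallelogram) (use Wf in simp_all)
    moreover have "enn2real (L2sq (W N)) < d N + 1 / real (Suc N)" "enn2real (L2sq (W M)) < d M + 1 / real (Suc M)"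
      using p(2) by (simp_all add: W_def)
    moreover have "1 / real (Suc M) \<le> 1 / real (Suc N)" using NM by (simp add: field_simps)
    ultimately show ?thesis by simp
  qed
  have "\<exists>N. \<forall>m\<ge>N. \<forall>n\<ge>N. L2sq (\<lambda>x. W m x - W n x) \<le> ennreal e" if e: "e > 0" for e :: real
  proof -
    obtain N1 where N1: "\<And>m n. m \<ge> N1 \<Longrightarrow> n \<ge> N1 \<Longrightarrow> \<bar>d m - d n\<bar> < e/4"
      using CauchyD[OF dC, of "e/4"] e by auto
    obtain N2 where N2: "\<And>n. n \<ge> N2 \<Longrightarrow> 1 / real (Suc n) \<le> e/8"
      using eventually_inverse_Suc_le[of "e/8"] e by (auto simp: eventually_sequentially)
    have main: "L2sq (\<lambda>x. W n x - W m x) \<le> ennreal e" if "n \<ge> max N1 N2" "n \<le> m" for m n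
    proof -
      have "enn2real (L2sq (\<lambda>x. W n x - W m x)) \<le> 2 * (d m - d n) + 4 / real (Suc n)" by (rule key[OF that(2)])
      also have "\<dots> \<le> e"
      proof -
        have "\<bar>d m - d n\<bar> < e/4" using N1[of m n] that by auto
        then have "2 * (d m - d n) \<le> e/2" by argo
        moreover have "4 * (1 / real (Suc n)) \<le> 4 * (e/8)" using N2[of n] that by (intro mult_left_mono) auto
        then have "4 / real (Suc n) \<le> e/2" by simp
        ultimately have "2 * (d m - d n) + 4 / real (Suc n) \<le> e/2 + e/2" by (rule add_mono)
        then show ?thesis by simp
      qed
      finally have "ennreal (enn2real (L2sq (\<lambda>x. W n x - W m x))) \<le> ennreal e" by (rule ennreal_leI)
      moreover have "L2sq (\<lambda>x. W n x - W m x) < \<infinity>" by (rule L2sq_finite_diff) (use Wf in simp_all)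
      ultimately show ?thesis by simp
    qed
    have "L2sq (\<lambda>x. W m x - W n x) \<le> ennreal e" if "m \<ge> max N1 N2" "n \<ge> max N1 N2" for m n
    proof (cases "m \<le> n")
      case True then show ?thesis using main[of m n] that by blast
    next
      case False
      then show ?thesis using main[of n m] that L2sq_commute[of "W m" "W n"] by simp
    qed
    then show ?thesis by blast
  qed
  from L2_complete[of W, OF _ this] obtain H where Hm [measurable]: "borel_fun H" and WH: "L2lim W H" by auto
  have wv: "L2lim w v" unfolding L2lim_def
  proof (rule ennreal_tendsto_0I)
    fix e :: real assume "e > 0"
    from eventually_inverse_Suc_le[OF this] show "\<forall>\<^sub>F n in sequentially. L2sq (\<lambda>x. w n x - v x) \<le> ennreal e"
      by eventually_elim (rule order_trans[OF wW(3) ennreal_leI])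
  qed
  have ap: "appr UNIV v H" by (rule appr_limit_seq[OF vm Hm wW(1) wv WH])
  have "(\<lambda>n. enn2real (L2sq (W n))) \<longlonglongrightarrow> enn2real (L2sq H)"
    by (rule L2lim_norm[OF _ Hm WH appr_L2(2)[OF ap] Wf]) simp
  moreover have "enn2real (L2sq (W n)) \<le> C" for n using enn2real_mono[OF wW(2)[of n]] C by simp
  ultimately have "enn2real (L2sq H) \<le> C" by (intro LIMSEQ_le_const2) auto
  then have "ennreal (enn2real (L2sq H)) \<le> ennreal C" by (rule ennreal_leI)
  then show ?thesis using that[OF ap] appr_L2(2)[OF ap] by simp
qed

section \<open>Compactness in L^2\<close>

lemma conv_translate:
  "conv u g (x + h) = conv u (\<lambda>z. g (z + h)) x"
  unfolding conv_def by (simp add: algebra_simps)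

lemma L2sq_split:
  assumes [measurable]: "borel_fun f" "A \<in> sets borel"
  shows "L2sq f = (NNINT x. ennreal ((norm (f x))\<^sup>2) * indicator A x) + (NNINT x. ennreal ((norm (f x))\<^sup>2) * indicator (- A) x)"
  unfolding L2sq_def by (subst nn_integral_add[symmetric]) (auto simp: indicator_def intro!: nn_integral_cong)

text \<open>At a fixed scale the mollified functions are uniformly bounded and equicontinuous, so
  convergence at a dense set of points spreads to all points. The gradient bound makes the
  mollification error uniform in n, and the tightness hypothesis disposes of the exterior of a
  ball.\<close>

lemma Rellich:
  assumes A: "\<And>n. appr UNIV (u n) (G n)" and C: "C \<ge> 0"
    and uC: "\<And>n. L2sq (u n) \<le> ennreal C" and GC: "\<And>n. L2sq (G n) \<le> ennreal C"
    and tight: "\<And>e. e > 0 \<Longrightarrow> \<exists>R N. \<forall>n\<ge>N. (NNINT x. ennreal ((norm (u n x))\<^sup>2) * indicator (- cball 0 R) x) \<le> ennreal e"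
  obtains r v where "strict_mono (r :: nat \<Rightarrow> nat)" "borel_fun v" "L2lim (\<lambda>n. u (r n)) v"
proof -
  note um [measurable] = apprD(1)[OF A]
  note uf = appr_L2(1)[OF A]
  define k where "k j = 1 / real (Suc j)" for j :: nat
  have k: "k j > 0" for j by (simp add: k_def)
  note mt = moll_test[OF k]
  note mf = test_fun_L2(1)[OF mt]
  define B where "B j = sqrt (C * enn2real (L2sq (moll (k j))))" for j
  have cb: "\<bar>conv (u n) (moll (k j)) x\<bar> \<le> B j" for n j x
  proof -
    have "(conv (u n) (moll (k j)) x)\<^sup>2 \<le> enn2real (L2sq (u n)) * enn2real (L2sq (moll (k j)))"
      by (rule conv_bound[OF um uf moll_measurable mf])
    also have "\<dots> \<le> C * enn2real (L2sq (moll (k j)))"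
      using enn2real_mono[OF uC[of n]] C by (intro mult_right_mono) auto
    finally have "sqrt ((conv (u n) (moll (k j)) x)\<^sup>2) \<le> B j" unfolding B_def by (rule real_sqrt_le_mono)
    then show ?thesis by simp
  qed
  obtain D :: "R3 set" where D: "countable D" "\<And>X. open X \<Longrightarrow> X \<noteq> {} \<Longrightarrow> \<exists>d\<in>D. d \<in> X"
    using countable_dense_exists[where 'a=R3] by blast
  have D_ne: "D \<noteq> {}" using D(2)[OF open_UNIV] by auto
  define q where "q i = from_nat_into D i" for i
  have q: "\<exists>i. q i \<in> X" if "open X" "X \<noteq> {}" for X
  proof -
    obtain d where "d \<in> D" "d \<in> X" using D(2)[OF \<open>open X\<close> \<open>X \<noteq> {}\<close>] by blast
    then have "q (to_nat_on D d) = d" unfolding q_def using D(1) by simp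
    then show ?thesis using \<open>d \<in> X\<close> by metis
  qed
  \<comment> \<open>One index codes a scale together with a dense point, so a single diagonal
    subsequence works for all scales.\<close>
  define F where "F i n = conv (u n) (moll (k (fst (prod_decode i)))) (q (snd (prod_decode i)))" for i n
  have "\<bar>F i n\<bar> \<le> B (fst (prod_decode i))" for i n unfolding F_def by (rule cb)
  from bounded_sequences_common_subseq[of F "\<lambda>i. B (fst (prod_decode i))", OF this]
  obtain r where r: "strict_mono r" and conv_r: "\<And>i. convergent (\<lambda>n. F i (r n))" by blast
  have cq: "convergent (\<lambda>n. conv (u (r n)) (moll (k j)) (q i))" for i j
    using conv_r[of "prod_encode (j, i)"] by (simp add: F_def)
  \<comment> \<open>Equicontinuity comes from continuity of translations applied to the mollifier, a
    fixed function; u n enters only through its norm, hence the uniformity in n.\<close>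
  have equi: "\<exists>\<delta>>0. \<forall>n x h. norm h < \<delta> \<longrightarrow> \<bar>conv (u n) (moll (k j)) (x + h) - conv (u n) (moll (k j)) x\<bar> \<le> e" if e: "e > 0" for j e
  proof -
    have "e\<^sup>2 / (C + 1) > 0" using e C by simp
    then obtain \<delta> where \<delta>: "\<delta> > 0" "\<And>h. norm h < \<delta> \<Longrightarrow> L2sq (\<lambda>z. moll (k j) (z + h) - moll (k j) z) \<le> ennreal (e\<^sup>2 / (C + 1))"
      using L2_translation_continuous[OF moll_measurable mf, of "e\<^sup>2 / (C + 1)"] by blast
    have "\<bar>conv (u n) (moll (k j)) (x + h) - conv (u n) (moll (k j)) x\<bar> \<le> e" if h: "norm h < \<delta>" for n x h
    proof -
      have tm [measurable]: "borel_fun (\<lambda>z. moll (k j) (z + h))" by measurable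
      have tf: "L2sq (\<lambda>z. moll (k j) (z + h)) < \<infinity>" using mf by (simp add: L2sq_translate)
      have "conv (u n) (moll (k j)) (x + h) - conv (u n) (moll (k j)) x = conv (u n) (\<lambda>z. moll (k j) (z + h) - moll (k j) z) x"
        unfolding conv_translate by (rule conv_diff_right[OF um uf tm tf moll_measurable mf])
      moreover have "(conv (u n) (\<lambda>z. moll (k j) (z + h) - moll (k j) z) x)\<^sup>2 \<le> e\<^sup>2"
      proof -
        have "(conv (u n) (\<lambda>z. moll (k j) (z + h) - moll (k j) z) x)\<^sup>2 \<le> enn2real (L2sq (u n)) * enn2real (L2sq (\<lambda>z. moll (k j) (z + h) - moll (k j) z))"
          by (rule conv_bound[OF um uf _ L2sq_finite_diff[OF tm moll_measurable tf mf]]) measurable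
        also have "\<dots> \<le> C * (e\<^sup>2 / (C + 1))"
          using enn2real_mono[OF uC[of n]] enn2real_mono[OF \<delta>(2)[OF h]] C by (intro mult_mono) auto
        also have "\<dots> \<le> e\<^sup>2" using C by (simp add: field_simps)
        finally show ?thesis .
      qed
      ultimately have "(conv (u n) (moll (k j)) (x + h) - conv (u n) (moll (k j)) x)\<^sup>2 \<le> e\<^sup>2" by simp
      then show ?thesis using e abs_le_square_iff[of "conv (u n) (moll (k j)) (x + h) - conv (u n) (moll (k j)) x" e] by simp
    qed
    then show ?thesis using \<delta>(1) by blast
  qed
  have cx: "convergent (\<lambda>n. conv (u (r n)) (moll (k j)) x)" for x j
  proof (rule Cauchy_convergent, rule CauchyI)
    fix e :: real assume e: "e > 0"
    obtain \<delta> where \<delta>: "\<delta> > 0" "\<And>n x h. norm h < \<delta> \<Longrightarrow> \<bar>conv (u n) (moll (k j)) (x + h) - conv (u n) (moll (k j)) x\<bar> \<le> e/4"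
      using equi[of "e/4" j] e by auto
    obtain i where i: "q i \<in> ball x \<delta>" using q[of "ball x \<delta>"] \<delta>(1) by auto
    then have h: "norm (x - q i) < \<delta>" by (simp add: dist_norm)
    have near: "\<bar>conv (u n) (moll (k j)) x - conv (u n) (moll (k j)) (q i)\<bar> \<le> e/4" for n
      using \<delta>(2)[OF h, of n "q i"] by simp
    obtain M where M: "\<And>m n. m \<ge> M \<Longrightarrow> n \<ge> M \<Longrightarrow> \<bar>conv (u (r m)) (moll (k j)) (q i) - conv (u (r n)) (moll (k j)) (q i)\<bar> < e/4"
      using CauchyD[OF convergent_Cauchy[OF cq[of j i]], of "e/4"] e by auto
    have "norm (conv (u (r m)) (moll (k j)) x - conv (u (r n)) (moll (k j)) x) < e" if "m \<ge> M" "n \<ge> M" for m n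
      using near[of "r m"] near[of "r n"] M[OF that] e unfolding real_norm_def by argo
    then show "\<exists>M. \<forall>m\<ge>M. \<forall>n\<ge>M. norm (conv (u (r m)) (moll (k j)) x - conv (u (r n)) (moll (k j)) x) < e" by blast
  qed
  define V where "V j x = lim (\<lambda>n. conv (u (r n)) (moll (k j)) x)" for j x
  have Vl: "(\<lambda>n. conv (u (r n)) (moll (k j)) x) \<longlonglongrightarrow> V j x" for j x
    using cx unfolding V_def by (simp add: convergent_LIMSEQ_iff)
  have cm [measurable]: "borel_fun (conv (u n) (moll (k j)))" for n j by (rule conv_measurable[OF um uf mt])
  have Vm [measurable]: "borel_fun (V j)" for j unfolding V_def[abs_def] by measurable
  have Vb: "\<bar>V j x\<bar> \<le> B j" for j x
    by (rule Lim_bounded[OF tendsto_rabs[OF Vl], of 0]) (use cb in simp)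
  \<comment> \<open>On a ball the constant bound B j is an admissible majorant, so pointwise
    convergence improves to L^2 convergence at each scale.\<close>
  have ball: "(\<lambda>n. (NNINT x. ennreal ((norm (conv (u (r n)) (moll (k j)) x - V j x))\<^sup>2) * indicator (cball 0 R) x)) \<longlonglongrightarrow> 0" for j R
  proof -
    have [measurable]: "cball (0::R3) R \<in> sets borel" by simp
    have "(\<lambda>n. (NNINT x. ennreal ((norm (conv (u (r n)) (moll (k j)) x - V j x))\<^sup>2) * indicator (cball 0 R) x)) \<longlonglongrightarrow> (\<integral>\<^sup>+x. 0 \<partial>(lborel :: R3 measure))"
    proof (rule nn_integral_dominated_convergence)
      show "(NNINT x. ennreal ((2 * B j)\<^sup>2) * indicator (cball (0::R3) R) x) < \<infinity>"
        using emeasure_lborel_cball_finite[of "0::R3" R] by (subst nn_integral_cmult_indicator) (simp_all add: ennreal_mult_less_top)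
      show "AE x in lborel. ennreal ((norm (conv (u (r n)) (moll (k j)) x - V j x))\<^sup>2) * indicator (cball 0 R) x
          \<le> ennreal ((2 * B j)\<^sup>2) * indicator (cball (0::R3) R) x" for n
      proof (rule AE_I2, rule mult_right_mono, rule ennreal_leI, rule power_mono)
        fix x show "norm (conv (u (r n)) (moll (k j)) x - V j x) \<le> 2 * B j"
          using cb[of "r n" j x] Vb[of j x] unfolding real_norm_def by linarith
      qed auto
      show "AE x in lborel. (\<lambda>n. ennreal ((norm (conv (u (r n)) (moll (k j)) x - V j x))\<^sup>2) * indicator (cball 0 R) x) \<longlonglongrightarrow> 0"
      proof (rule AE_I2)
        fix x
        have "(\<lambda>n. (norm (conv (u (r n)) (moll (k j)) x - V j x))\<^sup>2 * indicator (cball 0 R) x) \<longlonglongrightarrow> (norm (V j x - V j x))\<^sup>2 * indicator (cball 0 R) x"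
          by (intro tendsto_intros Vl)
        from tendsto_ennrealI[OF this] show "(\<lambda>n. ennreal ((norm (conv (u (r n)) (moll (k j)) x - V j x))\<^sup>2) * indicator (cball 0 R) x) \<longlonglongrightarrow> 0"
          by (simp add: ennreal_mult ennreal_indicator)
      qed
    qed measurable
    then show ?thesis by simp
  qed
  have "\<exists>N. \<forall>m\<ge>N. \<forall>n\<ge>N. L2sq (\<lambda>x. u (r m) x - u (r n) x) \<le> ennreal e" if e: "e > 0" for e :: real
  proof -
    obtain R N1 where N1: "\<And>n. n \<ge> N1 \<Longrightarrow> (NNINT x. ennreal ((norm (u n x))\<^sup>2) * indicator (- cball 0 R) x) \<le> ennreal (e/16)"
      using tight[of "e/16"] e by auto
    have "e / (16 * (4 * C + 1)) > 0" using e C by simp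
    \<comment> \<open>The scale is fixed before the indices: a difference of two members has squared
      gradient norm at most 4 C, so mollification at scale k j changes it by at most (k j)^2 * 4 C
      <= e/16 in squared norm.\<close>
    from eventually_happens'[OF sequentially_bot eventually_inverse_Suc_le[OF this]]
    obtain j where j: "k j \<le> e / (16 * (4 * C + 1))" unfolding k_def by blast
    have k1: "k j \<le> 1" by (simp add: k_def)
    have kC: "(k j)\<^sup>2 * (4 * C) \<le> e / 16"
    proof -
      have "(k j)\<^sup>2 \<le> k j" using k1 k[of j] by (simp add: power2_eq_square mult_left_le)
      then have "(k j)\<^sup>2 * (4 * C) \<le> k j * (4 * C)" using C by (intro mult_right_mono) auto
      also have "\<dots> \<le> k j * (4 * C + 1)" using k[of j] by (intro mult_left_mono) auto
      also have "\<dots> \<le> e / (16 * (4 * C + 1)) * (4 * C + 1)" using j C by (intro mult_right_mono) auto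
      also have "\<dots> = e / 16"
      proof -
        have "e / (16 * K) * K = e / 16" if "K \<noteq> 0" for K :: real using that by simp
        moreover have "4 * C + 1 \<noteq> 0" using C by simp
        ultimately show ?thesis .
      qed
      finally show ?thesis .
    qed
    have "\<forall>\<^sub>F n in sequentially. (NNINT x. ennreal ((norm (conv (u (r n)) (moll (k j)) x - V j x))\<^sup>2) * indicator (cball 0 R) x) \<le> ennreal (e/32)"
      by (rule ennreal_tendsto_0D[OF ball]) (use e in simp)
    then obtain N2 where N2: "\<And>n. n \<ge> N2 \<Longrightarrow> (NNINT x. ennreal ((norm (conv (u (r n)) (moll (k j)) x - V j x))\<^sup>2) * indicator (cball 0 R) x) \<le> ennreal (e/32)"
      by (auto simp: eventually_sequentially)
    have "L2sq (\<lambda>x. u (r m) x - u (r n) x) \<le> ennreal e" if "m \<ge> max N1 N2" "n \<ge> max N1 N2" for m n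
    proof -
      define w where "w x = u (r m) x - u (r n) x" for x
      define W where "W x = G (r m) x - G (r n) x" for x
      have wA: "appr UNIV w W" unfolding w_def W_def by (rule appr_diff[OF A A])
      note [measurable] = apprD[OF wA]
      have W4: "L2sq W \<le> ennreal (4 * C)"
      proof -
        have "L2sq W \<le> 2 * L2sq (G (r m)) + 2 * L2sq (G (r n))" unfolding W_def by (rule L2sq_diff[OF apprD(2)[OF A] apprD(2)[OF A]])
        also have "\<dots> \<le> 2 * ennreal C + 2 * ennreal C" by (intro add_mono mult_left_mono GC) auto
        also have "\<dots> = ennreal (4 * C)" using ennreal_two_halves[of "4 * C"] C by (cases "C = 0") simp_all
        finally show ?thesis .
      qed
      have cw [measurable]: "borel_fun (conv w (moll (k j)))" by (rule conv_measurable[OF apprD(1)[OF wA] appr_L2(1)[OF wA] mt])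
      have c_eq: "conv w (moll (k j)) x = conv (u (r m)) (moll (k j)) x - conv (u (r n)) (moll (k j)) x" for x
        unfolding w_def by (rule conv_diff_left[OF um uf um uf moll_measurable mf, symmetric])
      have [measurable]: "cball (0::R3) R \<in> sets borel" by simp
      have p1: "(NNINT x. ennreal ((norm (w x))\<^sup>2) * indicator (- cball 0 R) x) \<le> ennreal (e/4)"
      proof -
        have "(NNINT x. ennreal ((norm (w x))\<^sup>2) * indicator (- cball 0 R) x) = L2sq (\<lambda>x. indicator (- cball 0 R) x * u (r m) x - indicator (- cball 0 R) x * u (r n) x)"
          unfolding L2sq_def by (intro nn_integral_cong) (simp add: w_def indicator_def)
        also have "\<dots> \<le> 2 * L2sq (\<lambda>x. indicator (- cball 0 R) x * u (r m) x) + 2 * L2sq (\<lambda>x. indicator (- cball 0 R) x * u (r n) x)"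
          by (rule L2sq_diff) measurable
        also have "\<dots> \<le> 2 * ennreal ((e/4)/4) + 2 * ennreal ((e/4)/4)"
        proof (intro add_mono mult_left_mono)
          have id: "L2sq (\<lambda>x. indicator (- cball 0 R) x * u n x) = (NNINT x. ennreal ((norm (u n x))\<^sup>2) * indicator (- cball 0 R) x)" for n
            unfolding L2sq_def by (intro nn_integral_cong) (simp add: indicator_def)
          have "r m \<ge> N1" "r n \<ge> N1" using that seq_suble[OF r, of m] seq_suble[OF r, of n] by auto
          then show "L2sq (\<lambda>x. indicator (- cball 0 R) x * u (r m) x) \<le> ennreal ((e/4)/4)" "L2sq (\<lambda>x. indicator (- cball 0 R) x * u (r n) x) \<le> ennreal ((e/4)/4)"
            unfolding id using N1 by simp_all
        qed auto
        also have "\<dots> = ennreal (e/4)" by (rule ennreal_two_halves) (use e in simp)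
        finally show ?thesis .
      qed
      have p2: "L2sq (\<lambda>x. conv w (moll (k j)) x - w x) \<le> ennreal (e/16)"
      proof -
        have "L2sq (\<lambda>x. conv w (moll (k j)) x - w x) \<le> ennreal ((k j)\<^sup>2) * L2sq W" by (rule conv_moll_estimate[OF wA k])
        also have "\<dots> \<le> ennreal ((k j)\<^sup>2) * ennreal (4 * C)" by (intro mult_left_mono W4) simp
        also have "\<dots> = ennreal ((k j)\<^sup>2 * (4 * C))" using C by (simp add: ennreal_mult)
        also have "\<dots> \<le> ennreal (e/16)" by (rule ennreal_leI[OF kC])
        finally show ?thesis .
      qed
      have p3: "L2sq (\<lambda>x. indicator (cball 0 R) x * conv w (moll (k j)) x) \<le> ennreal (e/8)"
      proof -
        have "L2sq (\<lambda>x. indicator (cball 0 R) x * conv w (moll (k j)) x) =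
          L2sq (\<lambda>x. indicator (cball 0 R) x * (conv (u (r m)) (moll (k j)) x - V j x) - indicator (cball 0 R) x * (conv (u (r n)) (moll (k j)) x - V j x))"
          by (simp add: c_eq algebra_simps)
        also have "\<dots> \<le> 2 * L2sq (\<lambda>x. indicator (cball 0 R) x * (conv (u (r m)) (moll (k j)) x - V j x)) + 2 * L2sq (\<lambda>x. indicator (cball 0 R) x * (conv (u (r n)) (moll (k j)) x - V j x))"
          by (rule L2sq_diff) measurable
        also have "\<dots> \<le> 2 * ennreal ((e/8)/4) + 2 * ennreal ((e/8)/4)"
        proof (intro add_mono mult_left_mono)
          have id: "L2sq (\<lambda>x. indicator (cball 0 R) x * (conv (u (r n)) (moll (k j)) x - V j x)) = (NNINT x. ennreal ((norm (conv (u (r n)) (moll (k j)) x - V j x))\<^sup>2) * indicator (cball 0 R) x)" for n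
            unfolding L2sq_def by (intro nn_integral_cong) (simp add: indicator_def)
          show "L2sq (\<lambda>x. indicator (cball 0 R) x * (conv (u (r m)) (moll (k j)) x - V j x)) \<le> ennreal ((e/8)/4)"
            "L2sq (\<lambda>x. indicator (cball 0 R) x * (conv (u (r n)) (moll (k j)) x - V j x)) \<le> ennreal ((e/8)/4)"
            unfolding id using N2[of m] N2[of n] that by simp_all
        qed auto
        also have "\<dots> = ennreal (e/8)" by (rule ennreal_two_halves) (use e in simp)
        finally show ?thesis .
      qed
      have p4: "(NNINT x. ennreal ((norm (w x))\<^sup>2) * indicator (cball 0 R) x) \<le> ennreal (e/2)"
      proof -
        have "(NNINT x. ennreal ((norm (w x))\<^sup>2) * indicator (cball 0 R) x) = L2sq (\<lambda>x. indicator (cball 0 R) x * conv w (moll (k j)) x - indicator (cball 0 R) x * (conv w (moll (k j)) x - w x))"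
          unfolding L2sq_def by (intro nn_integral_cong) (simp add: indicator_def)
        also have "\<dots> \<le> 2 * L2sq (\<lambda>x. indicator (cball 0 R) x * conv w (moll (k j)) x) + 2 * L2sq (\<lambda>x. indicator (cball 0 R) x * (conv w (moll (k j)) x - w x))"
          by (rule L2sq_diff) measurable
        also have "L2sq (\<lambda>x. indicator (cball 0 R) x * (conv w (moll (k j)) x - w x)) \<le> L2sq (\<lambda>x. conv w (moll (k j)) x - w x)"
          by (rule L2sq_mono) (simp add: indicator_def)
        also have "2 * L2sq (\<lambda>x. indicator (cball 0 R) x * conv w (moll (k j)) x) + 2 * L2sq (\<lambda>x. conv w (moll (k j)) x - w x) \<le> 2 * ennreal ((e/2)/4) + 2 * ennreal ((e/2)/4)"
        proof (intro add_mono mult_left_mono)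
          show "L2sq (\<lambda>x. indicator (cball 0 R) x * conv w (moll (k j)) x) \<le> ennreal (e/2/4)" using p3 by simp
          show "L2sq (\<lambda>x. conv w (moll (k j)) x - w x) \<le> ennreal (e/2/4)"
            by (rule order_trans[OF p2 ennreal_leI]) (use e in simp)
        qed auto
        also have "\<dots> = ennreal (e/2)" by (rule ennreal_two_halves) (use e in simp)
        finally show ?thesis by (simp add: add_left_mono mult_left_mono)
      qed
      have "L2sq w = (NNINT x. ennreal ((norm (w x))\<^sup>2) * indicator (cball 0 R) x) + (NNINT x. ennreal ((norm (w x))\<^sup>2) * indicator (- cball 0 R) x)"
        by (rule L2sq_split) measurable
      also have "\<dots> \<le> ennreal (e/2) + ennreal (e/4)" by (intro add_mono p1 p4)
      also have "\<dots> \<le> ennreal e" using e by (simp flip: ennreal_plus add: ennreal_leI)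
      finally show ?thesis unfolding w_def .
    qed
    then show ?thesis by blast
  qed
  from L2_complete[of "\<lambda>n. u (r n)", OF um this] obtain v where "borel_fun v" "L2lim (\<lambda>n. u (r n)) v" by auto
  with r that show ?thesis by blast
qed

section \<open>Functions vanishing outside a smooth domain\<close>

lemma L2_translation_continuous_vec:
  fixes G :: "R3 \<Rightarrow> R3"
  assumes m: "borel_fun G" and f: "L2sq G < \<infinity>" and e: "e > 0"
  shows "\<exists>d>0. \<forall>y. norm y < d \<longrightarrow> L2sq (\<lambda>x. G (x + y) - G x) \<le> ennreal e"
proof -
  have "\<forall>i. \<exists>d>0. \<forall>y. norm y < d \<longrightarrow> L2sq (\<lambda>x. G (x + y) $ i - G x $ i) \<le> ennreal (e/3)"
    by (intro allI L2_translation_continuous[OF borel_measurable_vec_nth[OF m] L2sq_component_finite[OF f]]) (use e in simp)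
  from choice[OF this] obtain d where d: "\<forall>i. d i > 0 \<and> (\<forall>y. norm y < d i \<longrightarrow> L2sq (\<lambda>x. G (x + y) $ i - G x $ i) \<le> ennreal (e/3))"
    by blast
  have "L2sq (\<lambda>x. G (x + y) - G x) \<le> ennreal e" if y: "norm y < Min (range d)" for y
  proof -
    have gm: "borel_fun (\<lambda>x. G (x + y) - G x)" using m by measurable
    have "L2sq (\<lambda>x. (G (x + y) - G x) $ i) \<le> ennreal (e/3)" for i
    proof -
      have "norm y < d i" using y by simp
      then show ?thesis using d by simp
    qed
    from L2sq_vec_le[OF gm this] show ?thesis using e by simp
  qed
  moreover have "Min (range d) > 0" using d by (subst Min_gr_iff) auto
  ultimately show ?thesis by blast
qed

lemma AE_translate_zero:
  fixes w :: "R3 \<Rightarrow> real"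
  assumes [measurable]: "borel_fun w" "A \<in> sets borel"
    and ae: "AE x in lborel. x \<notin> A \<longrightarrow> w x = 0"
  shows "AE x in lborel. x + a \<notin> A \<longrightarrow> w (x + a) = 0"
proof -
  have "AE x in distr lborel borel (\<lambda>x. x + a). x \<notin> A \<longrightarrow> w x = 0" unfolding lborel_distr_add_right by (rule ae)
  then show ?thesis by (subst (asm) AE_distr_iff) measurable
qed

text \<open>Along \<open>- \<nabla>\<rho>(x\<^sub>0)\<close> a neighbourhood of the boundary point \<open>x\<^sub>0\<close> is translated into the interior of
  \<open>\<Omega>\<close>; this replaces the trace theorem.\<close>

definition pushes_in :: "R3 set \<Rightarrow> R3 \<Rightarrow> real \<Rightarrow> bool" where
  "pushes_in \<Omega> x0 s \<longleftrightarrow> s > 0 \<and> (\<exists>v t0. t0 > 0 \<and> (\<forall>x\<in>closure \<Omega> \<inter> cball x0 (3 * s). \<forall>t. 0 < t \<and> t < t0 \<longrightarrow> x - t *\<^sub>R v \<in> \<Omega>))"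

text \<open>The direction is g, the gradient of the defining function at x0. By continuity the
  derivative of \<rho> along g stays positive near x0, so \<rho> strictly decreases along -g,
  starting from a value at most zero on the closure.\<close>

lemma smooth_domain_pushes_in:
  assumes "smooth_bounded_domain \<Omega>" and x0: "x0 \<in> frontier \<Omega>"
  shows "\<exists>s. pushes_in \<Omega> x0 s"
proof -
  obtain \<rho> where \<rho>: "smooth \<rho>" "\<Omega> = {x. \<rho> x < 0}" and nz: "\<forall>x\<in>frontier \<Omega>. frechet_derivative \<rho> (at x) \<noteq> (\<lambda>v. 0)"
    using assms(1) unfolding smooth_bounded_domain_def by blast
  note C = smooth_C1[OF \<rho>(1)]
  define g where "g = gr \<rho> x0"
  have "frechet_derivative \<rho> (at x0) = (\<lambda>v. gr \<rho> x0 \<bullet> v)"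
    using frechet_derivative_at[OF C1_derivative[OF C, of x0]] by simp
  then have g0: "g \<noteq> 0" using nz x0 unfolding g_def by force
  have cont: "continuous_on UNIV (\<lambda>x. gr \<rho> x \<bullet> g)" by (intro continuous_intros C1_gr_continuous C)
  have "open ((\<lambda>x. gr \<rho> x \<bullet> g) -` {0<..})" by (rule open_vimage[OF open_greaterThan cont])
  moreover have "x0 \<in> (\<lambda>x. gr \<rho> x \<bullet> g) -` {0<..}" using g0 by (simp add: g_def)
  ultimately obtain b where b: "b > 0" "ball x0 b \<subseteq> (\<lambda>x. gr \<rho> x \<bullet> g) -` {0<..}" using openE by blast
  \<comment> \<open>Both choices spend half of the radius b: the ball of radius 3 s has radius b/2,
    and t0 * norm g = b/2, so the whole segment stays in the ball where the derivative is
    positive.\<close>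
  define s where "s = b / 6"
  define t0 where "t0 = b / (2 * norm g)"
  have t0: "t0 > 0" using b g0 by (simp add: t0_def)
  have closure_le: "\<rho> x \<le> 0" if "x \<in> closure \<Omega>" for x
  proof -
    have "closed {x. \<rho> x \<le> 0}"
      by (rule closed_Collect_le) (auto intro: smooth_continuous[OF \<rho>(1)])
    then have "closure \<Omega> \<subseteq> {x. \<rho> x \<le> 0}" by (intro closure_minimal) (auto simp: \<rho>(2))
    then show ?thesis using that by blast
  qed
  have "x - t *\<^sub>R g \<in> \<Omega>" if x: "x \<in> closure \<Omega> \<inter> cball x0 (3 * s)" and t: "0 < t" "t < t0" for x t
  proof -
    define p where "p r = \<rho> (x - r *\<^sub>R g)" for r
    have d: "(p has_real_derivative (- (gr \<rho> (x - r *\<^sub>R g) \<bullet> g))) (at r)" for r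
    proof -
      have "((\<lambda>r. x - r *\<^sub>R g) has_derivative (\<lambda>r. - (r *\<^sub>R g))) (at r)" by (auto intro!: derivative_eq_intros)
      from has_derivative_compose[OF this C1_derivative[OF C]]
      show ?thesis unfolding p_def has_field_derivative_def
        by (rule has_derivative_eq_rhs) (simp add: fun_eq_iff)
    qed
    have "p t < p 0"
    proof (rule DERIV_neg_imp_decreasing[OF t(1)])
      fix r assume r: "0 \<le> r" "r \<le> t"
      have "r * norm g \<le> t * norm g" using r by (intro mult_right_mono) auto
      also have "\<dots> < t0 * norm g" using t g0 by (intro mult_strict_right_mono) auto
      also have "\<dots> = b / 2" using g0 by (simp add: t0_def)
      finally have "norm (r *\<^sub>R g) < b / 2" using r by simp
      moreover have "dist x0 (x - r *\<^sub>R g) \<le> dist x0 x + norm (r *\<^sub>R g)"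
        using dist_triangle[of x0 "x - r *\<^sub>R g" x] by (simp add: dist_norm)
      moreover have "dist x0 x \<le> b / 2" using x by (simp add: s_def)
      ultimately have "x - r *\<^sub>R g \<in> ball x0 b" by simp
      then have "gr \<rho> (x - r *\<^sub>R g) \<bullet> g > 0" using b(2) by blast
      then show "\<exists>y. (p has_real_derivative y) (at r) \<and> y < 0" using d[of r] by (intro exI[of _ "- (gr \<rho> (x - r *\<^sub>R g) \<bullet> g)"]) simp
    qed
    moreover have "p 0 \<le> 0" using closure_le[of x] x by (simp add: p_def)
    ultimately show ?thesis unfolding \<rho>(2) p_def by simp
  qed
  then have "pushes_in \<Omega> x0 s" unfolding pushes_in_def using b t0
    by (intro conjI exI[of _ g] exI[of _ t0]) (auto simp: s_def)
  then show ?thesis ..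
qed

text \<open>After a small inward translation the function vanishes off a compact subset of \<Omega>
  and can be mollified there; continuity of translations for w and for G makes the error
  small.\<close>

lemma appr_local_piece:
  assumes A: "appr UNIV w G" and \<Omega>: "open \<Omega>" "bounded \<Omega>" and p: "pushes_in \<Omega> x0 s"
    and z: "AE x in lborel. x \<notin> closure \<Omega> \<inter> cball x0 (3 * s) \<longrightarrow> w x = 0"
  shows "appr \<Omega> w G"
proof (rule appr_limit[OF apprD[OF A]])
  fix e :: real assume e: "e > 0"
  note m = apprD[OF A] and f = appr_L2[OF A]
  define B where "B = closure \<Omega> \<inter> cball x0 (3 * s)"
  have B: "compact B" unfolding B_def using \<Omega>(2) by (intro compact_Int_closed) (auto simp: compact_closure)
  have Bm: "B \<in> sets borel" using B borel_compact by blast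
  obtain v t0 where t0: "t0 > 0" and push: "\<And>x t. x \<in> B \<Longrightarrow> 0 < t \<Longrightarrow> t < t0 \<Longrightarrow> x - t *\<^sub>R v \<in> \<Omega>"
    using p unfolding pushes_in_def B_def by blast
  obtain d1 where d1: "d1 > 0" "\<And>y. norm y < d1 \<Longrightarrow> L2sq (\<lambda>x. w (x + y) - w x) \<le> ennreal e"
    using L2_translation_continuous[OF m(1) f(1) e] by blast
  obtain d2 where d2: "d2 > 0" "\<And>y. norm y < d2 \<Longrightarrow> L2sq (\<lambda>x. G (x + y) - G x) \<le> ennreal e"
    using L2_translation_continuous_vec[OF m(2) f(2) e] by blast
  \<comment> \<open>Ensures norm (t v) < min d1 d2; adding 1 covers v = 0.\<close>
  define q where "q = min d1 d2 / (norm v + 1)"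
  define t where "t = min t0 q / 2"
  have P: "norm v + 1 > 0" by (simp add: add_nonneg_pos)
  have q: "q > 0" unfolding q_def using d1(1) d2(1) P by (intro divide_pos_pos) auto
  have mp: "min t0 q > 0" using q t0 by simp
  have tm: "t < min t0 q"
  proof -
    have "z / 2 < z" if "z > 0" for z :: real using that by simp
    from this[OF mp] show ?thesis unfolding t_def .
  qed
  have t: "0 < t" "t < t0" using mp tm by (simp_all add: t_def)
  have "t < q" using tm by simp
  then have "t * (norm v + 1) < min d1 d2" unfolding q_def using P by (simp only: pos_less_divide_eq)
  moreover have "norm (t *\<^sub>R v) \<le> t * (norm v + 1)" using t by simp
  ultimately have tv: "norm (t *\<^sub>R v) < d1" "norm (t *\<^sub>R v) < d2" by auto
  have At: "appr UNIV (\<lambda>x. w (x + t *\<^sub>R v)) (\<lambda>x. G (x + t *\<^sub>R v))" by (rule appr_translate[OF A])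
  have "appr \<Omega> (\<lambda>x. w (x + t *\<^sub>R v)) (\<lambda>x. G (x + t *\<^sub>R v))"
  proof (rule wk_compact_support_appr[OF appr_wk[OF At] apprD(1)[OF At] appr_L2(1)[OF At] apprD(2)[OF At] appr_L2(2)[OF At]])
    show "compact ((\<lambda>x. x - t *\<^sub>R v) ` B)" by (rule compact_continuous_image[OF _ B]) (intro continuous_intros)
    show "(\<lambda>x. x - t *\<^sub>R v) ` B \<subseteq> \<Omega>" using push t by blast
    show "open \<Omega>" by fact
    have "AE x in lborel. x \<notin> B \<longrightarrow> w x = 0" using z unfolding B_def .
    from AE_translate_zero[OF m(1) Bm this, of "t *\<^sub>R v"]
    show "AE x in lborel. x \<notin> (\<lambda>x. x - t *\<^sub>R v) ` B \<longrightarrow> w (x + t *\<^sub>R v) = 0"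
    proof eventually_elim
      case (elim x)
      show ?case
      proof
        assume x: "x \<notin> (\<lambda>x. x - t *\<^sub>R v) ` B"
        have "x + t *\<^sub>R v \<notin> B"
        proof
          assume "x + t *\<^sub>R v \<in> B"
          then have "x + t *\<^sub>R v - t *\<^sub>R v \<in> (\<lambda>x. x - t *\<^sub>R v) ` B" by (rule imageI)
          then show False using x by simp
        qed
        then show "w (x + t *\<^sub>R v) = 0" using elim by blast
      qed
    qed
  qed
  then show "\<exists>va H. appr \<Omega> va H \<and> L2sq (\<lambda>x. w x - va x) \<le> ennreal e \<and> L2sq (\<lambda>x. G x - H x) \<le> ennreal e"
    using d1(2)[OF tv(1)] d2(2)[OF tv(2)] L2sq_commute[of w "\<lambda>x. w (x + t *\<^sub>R v)"] L2sq_commute[of G "\<lambda>x. G (x + t *\<^sub>R v)"]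
    by (intro exI[of _ "\<lambda>x. w (x + t *\<^sub>R v)"] exI[of _ "\<lambda>x. G (x + t *\<^sub>R v)"]) simp
qed

text \<open>A partition of unity built one ball at a time. A cut-off around one centre splits w into
  a local piece and a remainder, and the remainder vanishes on that ball. The closed set S records
  where the function may still live, so its boundary part is covered by the balls left; with none
  left, S meets the closure in a compact subset of \<Omega>.\<close>

lemma appr_cover_induct:
  assumes F: "finite F" and \<Omega>: "open \<Omega>" "bounded \<Omega>" and good: "\<And>x. x \<in> F \<Longrightarrow> pushes_in \<Omega> x (s x)"
  shows "appr UNIV w G \<Longrightarrow> closed S \<Longrightarrow> S \<inter> frontier \<Omega> \<subseteq> (\<Union>x\<in>F. ball x (s x)) \<Longrightarrow>
    AE x in lborel. x \<notin> S \<inter> closure \<Omega> \<longrightarrow> w x = 0 \<Longrightarrow> appr \<Omega> w G"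
  using F good
proof (induction F arbitrary: w G S rule: finite_induct)
  case empty
  note A = empty(1)
  show ?case
  proof (rule wk_compact_support_appr[OF appr_wk[OF A] apprD(1)[OF A] appr_L2(1)[OF A] apprD(2)[OF A] appr_L2(2)[OF A]])
    have "compact (closure \<Omega> \<inter> S)" using \<Omega>(2) empty(2) by (intro compact_Int_closed) (auto simp: compact_closure)
    then show "compact (S \<inter> closure \<Omega>)" by (simp add: Int_commute)
    show "S \<inter> closure \<Omega> \<subseteq> \<Omega>"
    proof
      fix x assume x: "x \<in> S \<inter> closure \<Omega>"
      then have "x \<notin> frontier \<Omega>" using empty(3) by auto
      then show "x \<in> \<Omega>" using x \<Omega>(1) by (simp add: frontier_def interior_open)
    qed
    show "open \<Omega>" by fact
    show "AE x in lborel. x \<notin> S \<inter> closure \<Omega> \<longrightarrow> w x = 0" by (rule empty(4))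
  qed
next
  case (insert y F)
  note A = insert.prems(1)
  have py: "pushes_in \<Omega> y (s y)" using insert.prems(5) by simp
  then have sy: "s y > 0" by (simp add: pushes_in_def)
  \<comment> \<open>Both the radius and the mollification width are s y: the cut-off is 1 on the
    ball of radius s y and vanishes beyond 3 * s y, the radius in \<open>pushes_in\<close>.\<close>
  define \<eta> where "\<eta> = conv (indicator (ball y (s y + s y))) (moll (s y))"
  note cut = conv_moll_ball[OF sy]
  have t: "test_fun UNIV \<eta>" and e0: "\<And>x. 0 \<le> \<eta> x" and e1: "\<And>x. \<eta> x \<le> 1"
    unfolding \<eta>_def using cut(1-3)[of y "s y"] by simp_all
  have one: "\<eta> x = 1" if "x \<in> cball y (s y)" for x
    unfolding \<eta>_def using cut(4)[of x y "s y"] that by simp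
  have zero: "\<eta> x = 0" if "x \<notin> cball y (3 * s y)" for x
    unfolding \<eta>_def using cut(5)[of x y "s y"] that by simp
  obtain C where C: "C \<ge> 0" "\<And>x. norm (gr \<eta> x) \<le> C" using cut(6) unfolding \<eta>_def by blast
  have A1: "appr UNIV (\<lambda>x. \<eta> x * w x) (\<lambda>x. \<eta> x *\<^sub>R G x + w x *\<^sub>R gr \<eta> x)"
  proof (rule appr_mult_smooth[OF A test_fun_smooth[OF t], of "C + 1"])
    show "\<bar>\<eta> x\<bar> \<le> C + 1" for x using e0[of x] e1[of x] C(1) by simp
    show "norm (gr \<eta> x) \<le> C + 1" for x using C(2)[of x] by simp
  qed (use C in simp)
  have z1: "AE x in lborel. x \<notin> closure \<Omega> \<inter> cball y (3 * s y) \<longrightarrow> \<eta> x * w x = 0"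
    using insert.prems(4) by eventually_elim (use zero in auto)
  have B1: "appr \<Omega> (\<lambda>x. \<eta> x * w x) (\<lambda>x. \<eta> x *\<^sub>R G x + w x *\<^sub>R gr \<eta> x)"
    by (rule appr_local_piece[OF A1 \<Omega> py z1])
  have A2: "appr UNIV (\<lambda>x. w x - \<eta> x * w x) (\<lambda>x. G x - (\<eta> x *\<^sub>R G x + w x *\<^sub>R gr \<eta> x))"
    by (rule appr_diff[OF A A1])
  have B2: "appr \<Omega> (\<lambda>x. w x - \<eta> x * w x) (\<lambda>x. G x - (\<eta> x *\<^sub>R G x + w x *\<^sub>R gr \<eta> x))"
  proof (rule insert.IH[OF A2])
    show "closed (S - ball y (s y))" using insert.prems(2) by (simp add: closed_Diff)
    show "(S - ball y (s y)) \<inter> frontier \<Omega> \<subseteq> (\<Union>x\<in>F. ball x (s x))" using insert.prems(3) by auto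
    show "AE x in lborel. x \<notin> (S - ball y (s y)) \<inter> closure \<Omega> \<longrightarrow> w x - \<eta> x * w x = 0"
      using insert.prems(4)
    proof eventually_elim
      case (elim x)
      show ?case
      proof
        assume "x \<notin> (S - ball y (s y)) \<inter> closure \<Omega>"
        then consider "x \<notin> S \<inter> closure \<Omega>" | "x \<in> ball y (s y)" by blast
        then show "w x - \<eta> x * w x = 0" using elim one[of x] by cases auto
      qed
    qed
    show "pushes_in \<Omega> x (s x)" if "x \<in> F" for x using insert.prems(5) that by simp
  qed
  show ?case using appr_add[OF B1 B2] by simp
qed

text \<open>The passage to H_0^1: the limit function is known only to vanish almost everywhere off
  the closure. Compactness of the boundary leaves finitely many neighbourhoods in which it has to be
  pushed inward.\<close>

lemma appr_smooth_domain:
  assumes D: "smooth_bounded_domain \<Omega>" and A: "appr UNIV w G"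
    and z: "AE x in lborel. x \<notin> closure \<Omega> \<longrightarrow> w x = 0"
  shows "appr \<Omega> w G"
proof -
  have \<Omega>: "open \<Omega>" "bounded \<Omega>" using D by (auto simp: smooth_bounded_domain_def)
  have "\<forall>x\<in>frontier \<Omega>. \<exists>s. pushes_in \<Omega> x s" using smooth_domain_pushes_in[OF D] by blast
  from bchoice[OF this] obtain s where s: "\<forall>x\<in>frontier \<Omega>. pushes_in \<Omega> x (s x)" by blast
  have cF: "compact (frontier \<Omega>)" using \<Omega>(2) by (rule compact_frontier_bounded)
  have cov: "frontier \<Omega> \<subseteq> (\<Union>x\<in>frontier \<Omega>. ball x (s x))"
  proof
    fix x assume "x \<in> frontier \<Omega>"
    then have "x \<in> ball x (s x)" using s by (simp add: pushes_in_def)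
    then show "x \<in> (\<Union>x\<in>frontier \<Omega>. ball x (s x))" using \<open>x \<in> frontier \<Omega>\<close> by blast
  qed
  obtain F where F: "F \<subseteq> frontier \<Omega>" "finite F" "frontier \<Omega> \<subseteq> (\<Union>x\<in>F. ball x (s x))"
    by (rule compactE_image[OF cF _ cov]) auto
  show ?thesis
    by (rule appr_cover_induct[OF F(2) \<Omega> _ A closed_UNIV]) (use F s z in auto)
qed

lemma C1c_zero:
  assumes g: "C1c U g" and x: "x \<notin> U"
  shows "g x = 0 \<and> gr g x = 0"
proof (rule C1c_compact[OF g])
  fix K assume "K \<subseteq> U" and z: "\<And>x. x \<notin> K \<Longrightarrow> g x = 0" "\<And>x. x \<notin> K \<Longrightarrow> gr g x = 0"
  then have "x \<notin> K" using x by blast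
  from z[OF this] show ?thesis by blast
qed

lemma appr_zero_outside:
  assumes A: "appr U u G"
  shows "AE x in lborel. x \<notin> U \<longrightarrow> u x = 0" "AE x in lborel. x \<notin> U \<longrightarrow> G x = 0"
proof -
  obtain \<phi> where \<phi>: "\<And>n::nat. test_fun U (\<phi> n)" "L2lim \<phi> u" "L2lim (\<lambda>n. gr (\<phi> n)) G"
    using appr_seq[OF A] by blast
  have z: "\<phi> n x = 0" "gr (\<phi> n) x = 0" if "x \<notin> U" for n x
    using C1c_zero[OF test_fun_C1c[OF \<phi>(1)] that] by blast+
  obtain r where r: "AE x in lborel. (\<lambda>k. \<phi> (r k) x) \<longlonglongrightarrow> u x"
    using L2lim_AE_subseq[OF test_fun_measurable[OF \<phi>(1)] apprD(1)[OF A] \<phi>(2)] by blast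
  show "AE x in lborel. x \<notin> U \<longrightarrow> u x = 0"
    using r
  proof eventually_elim
    case (elim x)
    show ?case
    proof
      assume "x \<notin> U"
      then have "(\<lambda>k. 0) \<longlonglongrightarrow> u x" using elim z(1) by simp
      then show "u x = 0" by (simp add: LIMSEQ_const_iff)
    qed
  qed
  obtain r' where r': "AE x in lborel. (\<lambda>k. gr (\<phi> (r' k)) x) \<longlonglongrightarrow> G x"
    using L2lim_AE_subseq[OF test_fun_gr_measurable[OF \<phi>(1)] apprD(2)[OF A] \<phi>(3)] by blast
  show "AE x in lborel. x \<notin> U \<longrightarrow> G x = 0"
    using r'
  proof eventually_elim
    case (elim x)
    show ?case
    proof
      assume "x \<notin> U"
      then have "(\<lambda>k. 0) \<longlonglongrightarrow> G x" using elim z(2) by simp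
      then show "G x = 0" by (simp add: LIMSEQ_const_iff)
    qed
  qed
qed

section \<open>The weighted quadratic form\<close>

lemma L2sq_Fatou:
  assumes m [measurable]: "\<And>k. borel_fun (F k)" and ae: "AE x in lborel. (\<lambda>k. F k x) \<longlonglongrightarrow> f x"
    and le: "\<And>k. L2sq (F k) \<le> ennreal (c k)" and lim: "c \<longlonglongrightarrow> d"
  shows "L2sq f \<le> ennreal d"
proof -
  have "L2sq f = (NNINT x. liminf (\<lambda>k. ennreal ((norm (F k x))\<^sup>2)))"
    unfolding L2sq_def
  proof (rule nn_integral_cong_AE)
    show "AE x in lborel. ennreal ((norm (f x))\<^sup>2) = liminf (\<lambda>k. ennreal ((norm (F k x))\<^sup>2))"
      using ae
    proof eventually_elim
      case (elim x)
      have "(\<lambda>k. (norm (F k x))\<^sup>2) \<longlonglongrightarrow> (norm (f x))\<^sup>2" by (intro tendsto_intros elim)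
      from lim_imp_Liminf[OF _ tendsto_ennrealI[OF this]] show ?case by simp
    qed
  qed
  also have "\<dots> \<le> liminf (\<lambda>k. L2sq (F k))" unfolding L2sq_def by (rule nn_integral_liminf) measurable
  also have "\<dots> \<le> liminf (\<lambda>k. ennreal (c k))" by (intro Liminf_mono always_eventually allI le)
  also have "\<dots> = ennreal d" by (rule lim_imp_Liminf[OF _ tendsto_ennrealI[OF lim]]) simp
  finally show ?thesis .
qed

text \<open>Reduces limits of inner products in which both factors vary to limits of squared
  norms.\<close>

lemma inner_polarization:
  fixes F G :: "'a::euclidean_space \<Rightarrow> 'b::euclidean_space"
  assumes m [measurable]: "borel_fun F" "borel_fun G" and fin: "L2sq F < \<infinity>" "L2sq G < \<infinity>"
  shows "(LBINT x. F x \<bullet> G x) = (enn2real (L2sq (\<lambda>x. F x + G x)) - enn2real (L2sq (\<lambda>x. F x - G x))) / 4"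
proof -
  have p: "L2sq (\<lambda>x. F x + G x) < \<infinity>" by (rule L2sq_finite_add[OF m fin])
  have n: "L2sq (\<lambda>x. F x - G x) < \<infinity>" by (rule L2sq_finite_diff[OF m fin])
  have ip: "integrable lborel (\<lambda>x. (norm (F x + G x))\<^sup>2)" using p by (subst integrable_iff_L2sq) simp_all
  have im: "integrable lborel (\<lambda>x. (norm (F x - G x))\<^sup>2)" using n by (subst integrable_iff_L2sq) simp_all
  have "4 * (LBINT x. F x \<bullet> G x) = (LBINT x. (norm (F x + G x))\<^sup>2 - (norm (F x - G x))\<^sup>2)"
    unfolding integral_mult_right_zero[symmetric]
    by (rule Bochner_Integration.integral_cong)
      (simp_all add: power2_norm_eq_inner inner_add_left inner_add_right inner_diff_left inner_diff_right inner_commute)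
  also have "\<dots> = enn2real (L2sq (\<lambda>x. F x + G x)) - enn2real (L2sq (\<lambda>x. F x - G x))"
    by (subst Bochner_Integration.integral_diff[OF ip im]) (simp add: integral_eq_L2sq)
  finally show ?thesis by simp
qed

lemma L2lim_diff:
  assumes [measurable]: "\<And>n. borel_fun (F n)" "\<And>n. borel_fun (G n)"
     "borel_fun f" "borel_fun g"
    and "L2lim F f" "L2lim G g"
  shows "L2lim (\<lambda>n x. F n x - G n x) (\<lambda>x. f x - g x)"
  using L2lim_add[OF _ _ _ _ assms(5) L2lim_scaleR[OF _ _ assms(6), of "-1"]] by simp

lemma L2lim_inner2:
  fixes f g :: "'a::euclidean_space \<Rightarrow> 'b::euclidean_space"
  assumes m [measurable]: "\<And>n. borel_fun (F n)" "\<And>n. borel_fun (G n)"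
     "borel_fun f" "borel_fun g"
    and lim: "L2lim F f" "L2lim G g" and fin: "\<And>n. L2sq (F n) < \<infinity>" "\<And>n. L2sq (G n) < \<infinity>" "L2sq f < \<infinity>" "L2sq g < \<infinity>"
  shows "(\<lambda>n. (LBINT x. F n x \<bullet> G n x)) \<longlonglongrightarrow> (LBINT x. f x \<bullet> g x)"
  unfolding inner_polarization[OF m(1,2) fin(1,2)] inner_polarization[OF m(3,4) fin(3,4)]
proof (intro tendsto_divide tendsto_diff tendsto_const)
  show "(\<lambda>n. enn2real (L2sq (\<lambda>x. F n x + G n x))) \<longlonglongrightarrow> enn2real (L2sq (\<lambda>x. f x + g x))"
    by (rule L2lim_norm[OF _ _ L2lim_add[OF m lim] L2sq_finite_add[OF m(3,4) fin(3,4)] L2sq_finite_add[OF m(1,2) fin(1,2)]]) measurable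
  show "(\<lambda>n. enn2real (L2sq (\<lambda>x. F n x - G n x))) \<longlonglongrightarrow> enn2real (L2sq (\<lambda>x. f x - g x))"
    by (rule L2lim_norm[OF _ _ L2lim_diff[OF m lim] L2sq_finite_diff[OF m(3,4) fin(3,4)] L2sq_finite_diff[OF m(1,2) fin(1,2)]]) measurable
qed simp

text \<open>Its squared L^2 norm is the form with weight |f|. The sign of f is reinserted later as a
  bounded factor, so convergence of weighted forms becomes convergence in L^2.\<close>

definition sq_weight :: "(R3 \<Rightarrow> real) \<Rightarrow> (R3 \<Rightarrow> real) \<Rightarrow> R3 \<Rightarrow> real" where
  "sq_weight f u x = sqrt \<bar>f x\<bar> * u x"

lemma sq_weight_measurable [measurable]:
  "borel_fun f \<Longrightarrow> borel_fun u \<Longrightarrow> borel_fun (sq_weight f u)"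
  unfolding sq_weight_def[abs_def] by measurable

lemma L2sq_sq_weight: "L2sq (sq_weight f u) = (NNINT x. ennreal (\<bar>f x\<bar> * (u x)\<^sup>2))"
  unfolding L2sq_def sq_weight_def by (simp add: power_mult_distrib)

lemma sq_weight_bound:
  assumes f: "borel_fun f" "(NNINT x. ennreal (\<bar>f x\<bar> powr (3/2))) < \<infinity>"
  obtains K where "K < \<infinity>" "\<And>U u G. appr U u G \<Longrightarrow> L2sq (sq_weight f u) \<le> K * L2sq G"
proof
  define K where "K = ennreal 1 * (NNINT x. ennreal (\<bar>f x\<bar> powr (3/2))) + ennreal (4096 / 1\<^sup>2)"
  show "K < \<infinity>" using f(2) by (simp add: K_def)
  show "L2sq (sq_weight f u) \<le> K * L2sq G" if "appr U u G" for U u G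
    unfolding L2sq_sq_weight K_def mult.commute[of _ "L2sq G"] by (rule weighted_Sobolev[OF that f(1)]) simp
qed

lemma sq_weight_finite:
  assumes f: "borel_fun f" "(NNINT x. ennreal (\<bar>f x\<bar> powr (3/2))) < \<infinity>" and A: "appr U u G"
  shows "L2sq (sq_weight f u) < \<infinity>"
proof -
  obtain K where K: "K < \<infinity>" "\<And>U u G. appr U u G \<Longrightarrow> L2sq (sq_weight f u) \<le> K * L2sq G"
    using sq_weight_bound[OF f] by blast
  have "L2sq (sq_weight f u) \<le> K * L2sq G" by (rule K(2)[OF A])
  also have "\<dots> < \<infinity>" using K(1) appr_L2(2)[OF A] by (simp add: ennreal_mult_less_top)
  finally show ?thesis .
qed

lemma sq_weight_L2lim:
  assumes f: "borel_fun f" "(NNINT x. ennreal (\<bar>f x\<bar> powr (3/2))) < \<infinity>"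
    and A: "\<And>n. appr U (u n) (G n)" "appr U v H" "L2lim G H"
  shows "L2lim (\<lambda>n. sq_weight f (u n)) (sq_weight f v)"
proof -
  obtain K where K: "K < \<infinity>" "\<And>U u G. appr U u G \<Longrightarrow> L2sq (sq_weight f u) \<le> K * L2sq G"
    using sq_weight_bound[OF f] by blast
  show ?thesis
    unfolding L2lim_def
  proof (rule tendsto_0_ennreal_combination[OF A(3)[unfolded L2lim_def] tendsto_const, of K 0])
    fix n
    have "L2sq (sq_weight f (\<lambda>x. u n x - v x)) \<le> K * L2sq (\<lambda>x. G n x - H x)" by (rule K(2)[OF appr_diff[OF A(1,2)]])
    then show "L2sq (\<lambda>x. sq_weight f (u n) x - sq_weight f v x) \<le> K * L2sq (\<lambda>x. G n x - H x) + 0 * 0"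
      by (simp add: sq_weight_def[abs_def] right_diff_distrib)
  qed (use K in auto)
qed

lemma weight_product: "f x * u x * w x = (sgn (f x) * sq_weight f u x) \<bullet> sq_weight f w x"
proof -
  have "sgn (f x) * sqrt \<bar>f x\<bar> * sqrt \<bar>f x\<bar> = f x" by (simp add: mult.assoc sgn_mult_abs)
  moreover have "(sgn (f x) * (sqrt \<bar>f x\<bar> * u x)) * (sqrt \<bar>f x\<bar> * w x) = sgn (f x) * sqrt \<bar>f x\<bar> * sqrt \<bar>f x\<bar> * u x * w x"
    by (simp only: mult_ac)
  ultimately show ?thesis by (simp only: sq_weight_def inner_real_def)
qed

lemma L2sq_bounded_factor:
  assumes m: "borel_fun f" and c: "\<And>x. \<bar>c x\<bar> \<le> C" and fin: "L2sq f < \<infinity>"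
  shows "L2sq (\<lambda>x. c x *\<^sub>R f x) < \<infinity>"
proof -
  have "L2sq (\<lambda>x. c x *\<^sub>R f x) \<le> ennreal (C\<^sup>2) * L2sq f"
    by (rule L2sq_bound_mult[OF m]) (use c order_trans[OF abs_ge_zero c] in \<open>auto intro!: mult_right_mono\<close>)
  also have "\<dots> < \<infinity>" using fin by (simp add: ennreal_mult_less_top)
  finally show ?thesis .
qed

lemma weighted_integrable:
  assumes f: "borel_fun f" "(NNINT x. ennreal (\<bar>f x\<bar> powr (3/2))) < \<infinity>"
    and A: "appr U u G" "appr U w W"
  shows "integrable lborel (\<lambda>x. f x * u x * w x)"
proof -
  have "integrable lborel (\<lambda>x. (sgn (f x) *\<^sub>R sq_weight f u x) \<bullet> sq_weight f w x)"
  proof (rule L2_inner_integrable)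
    show "L2sq (\<lambda>x. sgn (f x) *\<^sub>R sq_weight f u x) < \<infinity>"
      by (rule L2sq_bounded_factor[where C=1]) (use sq_weight_finite[OF f A(1)] f apprD(1)[OF A(1)] in \<open>auto simp: abs_sgn_eq\<close>)
  qed (use sq_weight_finite[OF f A(2)] f apprD(1)[OF A(1)] apprD(1)[OF A(2)] in measurable)
  then show ?thesis by (simp only: weight_product real_scaleR_def)
qed

text \<open>The quadratic form with weight \<open>f\<close> is a bounded perturbation of the \<open>L\<^sup>2\<close> product of
  \<open>sqrt \<bar>f\<bar> u\<close> and \<open>sqrt \<bar>f\<bar> w\<close>, so convergence of gradients suffices for it.\<close>

lemma weighted_tendsto:
  assumes f: "borel_fun f" "(NNINT x. ennreal (\<bar>f x\<bar> powr (3/2))) < \<infinity>"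
    and c: "borel_fun c" "\<And>x. \<bar>c x\<bar> \<le> C"
    and A: "\<And>n. appr U (u n) (G n)" "appr U v H" "L2lim (\<lambda>n. sq_weight f (u n)) (sq_weight f v)"
    and B: "\<And>n. appr U (u' n) (G' n)" "appr U v' H'" "L2lim (\<lambda>n. sq_weight f (u' n)) (sq_weight f v')"
  shows "(\<lambda>n. (LBINT x. c x * (f x * u n x * u' n x))) \<longlonglongrightarrow> (LBINT x. c x * (f x * v x * v' x))"
proof -
  have e: "c x * (f x * u x * w x) = ((c x * sgn (f x)) *\<^sub>R sq_weight f u x) \<bullet> sq_weight f w x" for u w x
    unfolding weight_product by (simp add: mult.assoc)
  have cs: "\<bar>c x * sgn (f x)\<bar> \<le> C" for x
  proof -
    have "\<bar>c x\<bar> * \<bar>sgn (f x)\<bar> \<le> \<bar>c x\<bar> * 1" by (intro mult_left_mono) (auto simp: abs_sgn_eq)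
    then show ?thesis using c(2)[of x] by (simp add: abs_mult)
  qed
  have m: "borel_fun (\<lambda>x. c x * sgn (f x))" using c f by measurable
  have wm: "borel_fun (sq_weight f (u n))" "borel_fun (sq_weight f (u' n))"
    "borel_fun (sq_weight f v)" "borel_fun (sq_weight f v')" for n
    using f apprD(1)[OF A(1)] apprD(1)[OF B(1)] apprD(1)[OF A(2)] apprD(1)[OF B(2)] by measurable
  note fa = sq_weight_finite[OF f]
  show ?thesis
    unfolding e
  proof (rule L2lim_inner2[OF _ wm(2) _ wm(4) L2lim_mult_bounded[OF wm(1,3) m m A(3) fa[OF A(2)] cs] B(3) _ fa[OF B(1)] _ fa[OF B(2)]])
    show "L2sq (\<lambda>x. (c x * sgn (f x)) *\<^sub>R sq_weight f (u n) x) < \<infinity>" for n by (rule L2sq_bounded_factor[OF wm(1) cs fa[OF A(1)]])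
    show "L2sq (\<lambda>x. (c x * sgn (f x)) *\<^sub>R sq_weight f v x) < \<infinity>" by (rule L2sq_bounded_factor[OF wm(3) cs fa[OF A(2)]])
    show "borel_fun (\<lambda>x. (c x * sgn (f x)) *\<^sub>R sq_weight f (u n) x)" for n using m wm by measurable
    show "borel_fun (\<lambda>x. (c x * sgn (f x)) *\<^sub>R sq_weight f v x)" using m wm by measurable
  qed simp
qed

section \<open>Admissible test functions with denominator v + e\<close>

lemma C1_compose:
  assumes g: "C1 g" and h: "\<And>x. (h has_real_derivative h' (g x)) (at (g x))" and c: "continuous_on UNIV (\<lambda>x. h' (g x))"
  shows "C1 (\<lambda>x. h (g x))" "gr (\<lambda>x. h (g x)) = (\<lambda>x. h' (g x) *\<^sub>R gr g x)"
proof -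
  have d: "((\<lambda>x. h (g x)) has_derivative (\<lambda>v. (h' (g x) *\<^sub>R gr g x) \<bullet> v)) (at x)" for x
    using has_derivative_compose[OF C1_derivative[OF g] h[unfolded has_field_derivative_def]] by simp
  have "continuous_on UNIV (\<lambda>x. h' (g x) *\<^sub>R gr g x)" by (intro continuous_on_scaleR c C1_gr_continuous g)
  from C1I[OF d this] show "C1 (\<lambda>x. h (g x))" "gr (\<lambda>x. h (g x)) = (\<lambda>x. h' (g x) *\<^sub>R gr g x)" by blast+
qed

lemma C1c_compose:
  assumes g: "C1c U g" and h: "\<And>t. (h has_real_derivative h' t) (at t)" and c: "continuous_on UNIV h'" and h0: "h 0 = 0"
  shows "C1c U (\<lambda>x. h (g x))" "gr (\<lambda>x. h (g x)) = (\<lambda>x. h' (g x) *\<^sub>R gr g x)"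
proof -
  have c': "continuous_on UNIV (\<lambda>x. h' (g x))"
    by (rule continuous_on_compose2[OF c C1_continuous[OF C1c_C1[OF g]]]) simp
  note C = C1_compose[OF C1c_C1[OF g] h c']
  obtain K where K: "compact K" "K \<subseteq> U" "\<forall>x. x \<notin> K \<longrightarrow> g x = 0" using g unfolding C1c_def by blast
  then have "\<forall>x. x \<notin> K \<longrightarrow> h (g x) = 0" using h0 by simp
  then show "C1c U (\<lambda>x. h (g x))" using C(1) K(1,2) unfolding C1c_def by blast
  show "gr (\<lambda>x. h (g x)) = (\<lambda>x. h' (g x) *\<^sub>R gr g x)" by (rule C(2))
qed

text \<open>A \<open>C\<^sup>1\<close> substitute for \<open>max t (- e/2)\<close>: composed with the test functions approximating \<open>v \<ge> 0\<close>,
  it keeps the denominator \<open>v + e\<close> away from zero.\<close>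

definition clip :: "real \<Rightarrow> real \<Rightarrow> real" where
  "clip e t = t * (e / (e - 2 * min 0 t))"

definition clip' :: "real \<Rightarrow> real \<Rightarrow> real" where
  "clip' e t = (e / (e - 2 * min 0 t))\<^sup>2"

lemma clip_pos_denom: "e > 0 \<Longrightarrow> e - 2 * min 0 t > (0::real)"
  by (simp add: min_def)

lemma clip_deriv:
  assumes e: "e > 0"
  shows "(clip e has_real_derivative clip' e t) (at t)"
proof -
  consider "t > 0" | "t = 0" | "t < 0" by linarith
  then show ?thesis
  proof cases
    case 1
    have "((\<lambda>t. t) has_real_derivative 1) (at t)" by simp
    moreover have "eventually (\<lambda>s. s \<in> {0<..}) (nhds t)" using 1 by (intro eventually_nhds_in_open) auto
    then have "eventually (\<lambda>s. s = clip e s) (nhds t)" by eventually_elim (use e in \<open>simp add: clip_def\<close>)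
    ultimately have "(clip e has_real_derivative 1) (at t)" using DERIV_cong_ev[of t t "\<lambda>t. t" "clip e" 1 1] by simp
    then show ?thesis using 1 e by (simp add: clip'_def)
  next
    case 2
    \<comment> \<open>At the junction the function is z times a continuous factor, which is exactly
      Caratheodory's form of differentiability; the slope is the value 1 of the factor.\<close>
    have "isCont (\<lambda>z. e / (e - 2 * min 0 z)) 0" using e by (intro continuous_intros) auto
    then have "(clip e has_real_derivative 1) (at 0)"
      unfolding CARAT_DERIV using e by (intro exI[of _ "\<lambda>z. e / (e - 2 * min 0 z)"]) (auto simp: clip_def)
    then show ?thesis using 2 e by (simp add: clip'_def)
  next
    case 3
    have p: "e - 2 * t > 0" using 3 e by simp
    have "((\<lambda>t. t * (e / (e - 2 * t))) has_real_derivative (e / (e - 2 * t))\<^sup>2) (at t)"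
      using p by (auto intro!: derivative_eq_intros simp: field_simps power2_eq_square)
    moreover have "eventually (\<lambda>s. s \<in> {..<0}) (nhds t)" using 3 by (intro eventually_nhds_in_open) auto
    then have "eventually (\<lambda>s. s * (e / (e - 2 * s)) = clip e s) (nhds t)" by eventually_elim (simp add: clip_def min_def)
    ultimately have "(clip e has_real_derivative (e / (e - 2 * t))\<^sup>2) (at t)"
      using DERIV_cong_ev[of t t "\<lambda>t. t * (e / (e - 2 * t))" "clip e"] by simp
    then show ?thesis using 3 by (simp add: clip'_def min_def)
  qed
qed

lemma clip'_continuous: "e > 0 \<Longrightarrow> continuous_on UNIV (clip' e)"
  unfolding clip'_def[abs_def] by (intro continuous_intros) (simp add: clip_pos_denom less_imp_neq[symmetric])

lemma clip'_bounds: "e > 0 \<Longrightarrow> \<bar>clip' e t\<bar> \<le> 1"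
proof -
  assume e: "e > 0"
  have "e / (e - 2 * min 0 t) \<le> 1" using clip_pos_denom[OF e, of t] by (simp add: field_simps)
  moreover have "0 \<le> e / (e - 2 * min 0 t)" using e clip_pos_denom[OF e, of t] by simp
  ultimately show ?thesis by (simp add: clip'_def power_le_one)
qed

lemma clip_nonneg: "e > 0 \<Longrightarrow> t \<ge> 0 \<Longrightarrow> clip e t = t" "e > 0 \<Longrightarrow> t \<ge> 0 \<Longrightarrow> clip' e t = 1"
  by (simp_all add: clip_def clip'_def)

lemma clip_lower: "e > 0 \<Longrightarrow> clip e t \<ge> - e / 2"
proof (cases "t \<ge> 0")
  case True
  assume "e > 0"
  with True show ?thesis by (simp add: clip_nonneg)
next
  case False
  assume e: "e > 0"
  have "e - 2 * t > 0" using False e by simp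
  moreover have "- e * e \<le> 0" using e by simp
  ultimately show ?thesis using False e by (simp add: clip_def min_def field_simps)
qed

lemma clip_Lipschitz: assumes e: "e > 0" shows "\<bar>clip e a - clip e b\<bar> \<le> \<bar>a - b\<bar>"
proof -
  have "norm (clip e a - clip e b) \<le> 1 * norm (a - b)"
    by (rule field_differentiable_bound[of UNIV "clip e" "clip' e" 1 a b])
      (use clip_deriv[OF e] clip'_bounds[OF e] in \<open>auto intro: has_field_derivative_at_within\<close>)
  then show ?thesis by simp
qed

text \<open>Approximation of a nonnegative function whose approximants keep v + e at distance e/2
  from zero. The gradients still converge to H because the slope of the clipping function is 1 on
  [0, infinity), where v takes its values.\<close>

lemma appr_nonneg_approx:
  assumes A: "appr U v H" and v0: "\<And>x. v x \<ge> 0" and e: "e > 0"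
  obtains g where "\<And>n::nat. C1c U (g n)" "\<And>n x. g n x \<ge> - e / 2" "L2lim g v" "L2lim (\<lambda>n. gr (g n)) H"
    "AE x in lborel. (\<lambda>n. g n x) \<longlonglongrightarrow> v x"
proof -
  obtain \<phi> where \<phi>: "\<And>n::nat. test_fun U (\<phi> n)" "L2lim \<phi> v" "L2lim (\<lambda>n. gr (\<phi> n)) H"
    using appr_seq[OF A] by blast
  note m [measurable] = apprD[OF A] test_fun_measurable[OF \<phi>(1)] test_fun_gr_measurable[OF \<phi>(1)]
  obtain r where r: "strict_mono r" and ae: "AE x in lborel. (\<lambda>k. \<phi> (r k) x) \<longlonglongrightarrow> v x"
    using L2lim_AE_subseq[OF m(3,1) \<phi>(2)] by blast
  define g where "g n x = clip e (\<phi> (r n) x)" for n x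
  note cc = C1c_compose[OF test_fun_C1c[OF \<phi>(1)] clip_deriv[OF e] clip'_continuous[OF e]]
  have c0: "clip e 0 = 0" by (simp add: clip_def)
  have g1: "C1c U (g n)" for n unfolding g_def by (rule cc(1)[OF c0])
  have g2: "gr (g n) = (\<lambda>x. clip' e (\<phi> (r n) x) *\<^sub>R gr (\<phi> (r n)) x)" for n unfolding g_def by (rule cc(2)[OF c0])
  have g3: "g n x \<ge> - e / 2" for n x unfolding g_def by (rule clip_lower[OF e])
  have g4: "L2lim g v"
  proof (rule L2lim_bound_mult[where B=1, OF m(3,1) _ _ L2lim_subseq[OF \<phi>(2) r]])
    show "norm (g n x - v x) \<le> 1 * norm (\<phi> (r n) x - v x)" for n x
      using clip_Lipschitz[OF e, of "\<phi> (r n) x" "v x"] by (simp add: g_def clip_nonneg[OF e v0])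
  qed simp
  have [measurable]: "borel_fun (clip' e)" by (rule borel_measurable_continuous_onI[OF clip'_continuous[OF e]])
  have "L2lim (\<lambda>n x. clip' e (\<phi> (r n) x) *\<^sub>R gr (\<phi> (r n)) x) (\<lambda>x. clip' e (v x) *\<^sub>R H x)"
  proof (rule L2lim_mult_bounded[OF m(4,2) _ _ L2lim_subseq[OF \<phi>(3) r] appr_L2(2)[OF A] clip'_bounds[OF e]])
    show "AE x in lborel. (\<lambda>n. clip' e (\<phi> (r n) x)) \<longlonglongrightarrow> clip' e (v x)"
      using ae
    proof eventually_elim
      case (elim x)
      have "isCont (clip' e) (v x)" using clip'_continuous[OF e] by (simp add: continuous_on_eq_continuous_at)
      then show ?case using elim by (rule isCont_tendsto_compose)
    qed
  qed measurable
  then have g5: "L2lim (\<lambda>n. gr (g n)) H" unfolding g2 by (simp add: clip_nonneg[OF e v0])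
  have g6: "AE x in lborel. (\<lambda>n. g n x) \<longlonglongrightarrow> v x"
    using ae
  proof eventually_elim
    case (elim x)
    have "isCont (clip e) (v x)" by (rule DERIV_isCont[OF clip_deriv[OF e]])
    then have "(\<lambda>n. clip e (\<phi> (r n) x)) \<longlonglongrightarrow> clip e (v x)" using elim by (rule isCont_tendsto_compose)
    then show ?case by (simp add: g_def clip_nonneg[OF e v0])
  qed
  show ?thesis by (rule that[OF g1 g3 g4 g5 g6])
qed

lemma C1_inverse_shift:
  assumes g: "C1 g" and pos: "\<And>x. g x + e > 0"
  shows "C1 (\<lambda>x. 1 / (g x + e))" "gr (\<lambda>x. 1 / (g x + e)) = (\<lambda>x. (- (1 / (g x + e)\<^sup>2)) *\<^sub>R gr g x)"
proof -
  have p: "g x + e \<noteq> 0" for x using pos[of x] by simp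
  have d: "((\<lambda>t. 1 / (t + e)) has_real_derivative - (1 / (g x + e)\<^sup>2)) (at (g x))" for x
    using p[of x] by (auto intro!: derivative_eq_intros simp: power2_eq_square)
  have c: "continuous_on UNIV (\<lambda>x. - (1 / (g x + e)\<^sup>2))"
    using p by (intro continuous_intros C1_continuous[OF g]) simp
  show "C1 (\<lambda>x. 1 / (g x + e))" "gr (\<lambda>x. 1 / (g x + e)) = (\<lambda>x. (- (1 / (g x + e)\<^sup>2)) *\<^sub>R gr g x)"
    using C1_compose[OF g d c] by blast+
qed

text \<open>Shows that Picone's test function is admissible in the weak equation. It is approximated
  by the same quotient with v replaced by its clipped C^1 approximants.\<close>

lemma appr_square_quotient:
  assumes \<phi>: "C1c U \<phi>" and A: "appr U v H" and U: "open U" and v0: "\<And>x. v x \<ge> 0" and e: "e > 0"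
  shows "appr U (\<lambda>x. (\<phi> x)\<^sup>2 / (v x + e)) (\<lambda>x. (2 * \<phi> x / (v x + e)) *\<^sub>R gr \<phi> x - (\<phi> x / (v x + e))\<^sup>2 *\<^sub>R H x)"
proof -
  obtain g where g: "\<And>n::nat. C1c U (g n)" "\<And>n x. g n x \<ge> - e / 2" "L2lim g v" "L2lim (\<lambda>n. gr (g n)) H"
    "AE x in lborel. (\<lambda>n. g n x) \<longlonglongrightarrow> v x"
    using appr_nonneg_approx[OF A v0 e] by blast
  note C = C1c_C1[OF \<phi>]
  note [measurable] = apprD[OF A] C1_measurable[OF C] C1_gr_measurable[OF C] C1_measurable[OF C1c_C1[OF g(1)]] C1_gr_measurable[OF C1c_C1[OF g(1)]]
  have p: "g n x + e \<ge> e / 2" for n x using g(2)[of n x] by simp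
  have p0: "g n x + e > 0" for n x using p[of n x] e by linarith
  obtain K where K: "compact K" "\<And>x. x \<notin> K \<Longrightarrow> \<phi> x = 0" using C1c_compact[OF \<phi>] by metis
  obtain B where B: "B > 0" "\<And>x. norm (\<phi> x) \<le> B"
    using continuous_compact_support_bounded[OF C1_continuous[OF C] K] by blast
  \<comment> \<open>The denominators are at least e/2 and \<phi> is bounded, so every coefficient
    below is bounded uniformly in n.\<close>
  have q: "\<bar>\<phi> x / (g n x + e)\<bar> \<le> B / (e/2)" for n x
    unfolding abs_divide using B(2)[of x] p[of n x] p0[of n x] e B(1) by (intro frac_le) auto
  define \<psi> where "\<psi> n x = (\<phi> x * \<phi> x) * (1 / (g n x + e))" for n x
  have psi: "C1c U (\<psi> n)" for n
    unfolding \<psi>_def by (rule C1c_mult[OF C1c_mult[OF \<phi> C] C1_inverse_shift(1)[OF C1c_C1[OF g(1)] p0]])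
  have gpsi: "gr (\<psi> n) x = (2 * (\<phi> x / (g n x + e))) *\<^sub>R gr \<phi> x - (\<phi> x / (g n x + e))\<^sup>2 *\<^sub>R gr (g n) x" for n x
  proof -
    have "gr (\<psi> n) x = (\<phi> x * \<phi> x) *\<^sub>R ((- (1 / (g n x + e)\<^sup>2)) *\<^sub>R gr (g n) x) + (1 / (g n x + e)) *\<^sub>R (\<phi> x *\<^sub>R gr \<phi> x + \<phi> x *\<^sub>R gr \<phi> x)"
      unfolding \<psi>_def[abs_def]
      by (simp only: gr_mult[OF C1_mult[OF C C] C1_inverse_shift(1)[OF C1c_C1[OF g(1)] p0]] gr_mult[OF C C] C1_inverse_shift(2)[OF C1c_C1[OF g(1)] p0])
    also have "\<dots> = (2 * (\<phi> x / (g n x + e))) *\<^sub>R gr \<phi> x - (\<phi> x / (g n x + e))\<^sup>2 *\<^sub>R gr (g n) x"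
      by (simp add: power2_eq_square flip: scaleR_add_left)
    finally show ?thesis .
  qed
  have lim: "AE x in lborel. (\<lambda>n. \<phi> x / (g n x + e)) \<longlonglongrightarrow> \<phi> x / (v x + e)"
    using g(5)
  proof eventually_elim
    case (elim x)
    have "v x + e \<noteq> 0" using v0[of x] e by linarith
    then show ?case by (intro tendsto_intros elim)
  qed
  show ?thesis
  proof (rule appr_limit_seq[OF _ _ C1c_appr[OF psi U]])
    have "L2lim (\<lambda>n x. (\<phi> x / (g n x + e)) *\<^sub>R \<phi> x) (\<lambda>x. (\<phi> x / (v x + e)) *\<^sub>R \<phi> x)"
      by (rule L2lim_mult_bounded[OF _ _ _ _ L2lim_const C1c_L2(1)[OF \<phi>] q lim]) measurable
    then show "L2lim \<psi> (\<lambda>x. (\<phi> x)\<^sup>2 / (v x + e))" by (simp add: \<psi>_def[abs_def] power2_eq_square)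
    have l1: "L2lim (\<lambda>n x. (2 * (\<phi> x / (g n x + e))) *\<^sub>R gr \<phi> x) (\<lambda>x. (2 * (\<phi> x / (v x + e))) *\<^sub>R gr \<phi> x)"
    proof (rule L2lim_mult_bounded[OF _ _ _ _ L2lim_const C1c_L2(2)[OF \<phi>]])
      show "\<bar>2 * (\<phi> x / (g n x + e))\<bar> \<le> 2 * (B / (e/2))" for n x using q[of x n] by simp
      show "AE x in lborel. (\<lambda>n. 2 * (\<phi> x / (g n x + e))) \<longlonglongrightarrow> 2 * (\<phi> x / (v x + e))"
        using lim by eventually_elim (intro tendsto_mult tendsto_const)
    qed measurable
    have l2: "L2lim (\<lambda>n x. (\<phi> x / (g n x + e))\<^sup>2 *\<^sub>R gr (g n) x) (\<lambda>x. (\<phi> x / (v x + e))\<^sup>2 *\<^sub>R H x)"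
    proof (rule L2lim_mult_bounded[OF _ _ _ _ g(4) appr_L2(2)[OF A]])
      show "\<bar>(\<phi> x / (g n x + e))\<^sup>2\<bar> \<le> (B / (e/2))\<^sup>2" for n x
        using power_mono[OF q[of x n], of 2] by (simp only: power2_abs abs_power2 abs_ge_zero)
      show "AE x in lborel. (\<lambda>n. (\<phi> x / (g n x + e))\<^sup>2) \<longlonglongrightarrow> (\<phi> x / (v x + e))\<^sup>2"
        using lim by eventually_elim (rule tendsto_power)
    qed measurable
    have "L2lim (\<lambda>n x. (2 * (\<phi> x / (g n x + e))) *\<^sub>R gr \<phi> x - (\<phi> x / (g n x + e))\<^sup>2 *\<^sub>R gr (g n) x)
       (\<lambda>x. (2 * (\<phi> x / (v x + e))) *\<^sub>R gr \<phi> x - (\<phi> x / (v x + e))\<^sup>2 *\<^sub>R H x)"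
      by (rule L2lim_diff[OF _ _ _ _ l1 l2]) measurable
    then show "L2lim (\<lambda>n. gr (\<psi> n)) (\<lambda>x. (2 * \<phi> x / (v x + e)) *\<^sub>R gr \<phi> x - (\<phi> x / (v x + e))\<^sup>2 *\<^sub>R H x)"
      by (simp add: gpsi[abs_def])
  qed measurable
qed

text \<open>The quotient w / (v + e) may be unbounded, but after composition with arctan its
  gradient has coefficients bounded by multiples of 1/e. This bound carries the convergence of
  gradients.\<close>

lemma appr_arctan_quotient:
  assumes B: "appr U w W" and A: "appr U v H" and U: "open U" and v0: "\<And>x. v x \<ge> 0" and e: "e > 0"
  shows "appr U (\<lambda>x. arctan (w x / (v x + e)))
    (\<lambda>x. (1 / (1 + (w x / (v x + e))\<^sup>2)) *\<^sub>R ((1 / (v x + e)) *\<^sub>R W x - (w x / (v x + e) / (v x + e)) *\<^sub>R H x))"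
proof -
  obtain g where g: "\<And>n::nat. C1c U (g n)" "\<And>n x. g n x \<ge> - e / 2" "L2lim g v" "L2lim (\<lambda>n. gr (g n)) H"
    "AE x in lborel. (\<lambda>n. g n x) \<longlonglongrightarrow> v x"
    using appr_nonneg_approx[OF A v0 e] by blast
  obtain \<phi> where \<phi>: "\<And>n::nat. test_fun U (\<phi> n)" "L2lim \<phi> w" "L2lim (\<lambda>n. gr (\<phi> n)) W"
    using appr_seq[OF B] by blast
  obtain r where r: "strict_mono r" and ae: "AE x in lborel. (\<lambda>k. \<phi> (r k) x) \<longlonglongrightarrow> w x"
    using L2lim_AE_subseq[OF test_fun_measurable[OF \<phi>(1)] apprD(1)[OF B] \<phi>(2)] by blast
  define p where "p n = \<phi> (r n)" for n
  define k where "k n = g (r n)" for n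
  have p1: "C1c U (p n)" for n unfolding p_def by (rule test_fun_C1c[OF \<phi>(1)])
  have pl: "L2lim p w" "L2lim (\<lambda>n. gr (p n)) W" unfolding p_def by (rule L2lim_subseq[OF _ r], rule \<phi>)+
  have kl: "L2lim k v" "L2lim (\<lambda>n. gr (k n)) H" unfolding k_def by (rule L2lim_subseq[OF _ r], rule g)+
  have k1: "C1c U (k n)" for n unfolding k_def by (rule g)
  have kb: "k n x + e \<ge> e / 2" for n x unfolding k_def using g(2)[of "r n" x] by simp
  have k0: "k n x + e > 0" for n x using kb[of n x] e by linarith
  have kae: "AE x in lborel. (\<lambda>n. k n x) \<longlonglongrightarrow> v x"
    using g(5)
  proof eventually_elim
    case (elim x)
    from LIMSEQ_subseq_LIMSEQ[OF this r] show ?case by (simp add: k_def comp_def)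
  qed
  have pae: "AE x in lborel. (\<lambda>n. p n x) \<longlonglongrightarrow> w x" using ae by (simp add: p_def)
  note m [measurable] = apprD[OF A] apprD[OF B] C1_measurable[OF C1c_C1[OF p1]] C1_gr_measurable[OF C1c_C1[OF p1]]
     C1_measurable[OF C1c_C1[OF k1]] C1_gr_measurable[OF C1c_C1[OF k1]]
  define q where "q n x = p n x * (1 / (k n x + e))" for n x
  define Q where "Q x = w x / (v x + e)" for x
  have q1: "C1c U (q n)" for n unfolding q_def by (rule C1c_mult[OF p1 C1_inverse_shift(1)[OF C1c_C1[OF k1] k0]])
  have gq: "gr (q n) x = (1 / (k n x + e)) *\<^sub>R gr (p n) x - (q n x / (k n x + e)) *\<^sub>R gr (k n) x" for n x
  proof -
    have "gr (q n) x = p n x *\<^sub>R ((- (1 / (k n x + e)\<^sup>2)) *\<^sub>R gr (k n) x) + (1 / (k n x + e)) *\<^sub>R gr (p n) x"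
      unfolding q_def[abs_def]
      by (simp only: gr_mult[OF C1c_C1[OF p1] C1_inverse_shift(1)[OF C1c_C1[OF k1] k0]] C1_inverse_shift(2)[OF C1c_C1[OF k1] k0])
    then show ?thesis by (simp add: q_def power2_eq_square)
  qed
  have ac: "continuous_on UNIV (\<lambda>t::real. 1 / (1 + t\<^sup>2))"
    by (intro continuous_intros) (simp add: add_nonneg_eq_0_iff)
  have ad: "(arctan has_real_derivative (1 / (1 + t\<^sup>2))) (at t)" for t using DERIV_arctan[of t] by (simp add: inverse_eq_divide)
  note aq = C1c_compose[OF q1 ad ac arctan_zero_zero]
  have qae: "AE x in lborel. (\<lambda>n. q n x) \<longlonglongrightarrow> Q x"
    using kae pae
  proof eventually_elim
    case (elim x)
    have "v x + e \<noteq> 0" using v0[of x] e by linarith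
    then have "(\<lambda>n. p n x * (1 / (k n x + e))) \<longlonglongrightarrow> w x * (1 / (v x + e))" by (intro tendsto_intros elim)
    then show ?case by (simp add: q_def Q_def)
  qed
  have kinv: "AE x in lborel. (\<lambda>n. 1 / (k n x + e)) \<longlonglongrightarrow> 1 / (v x + e)"
    using kae
  proof eventually_elim
    case (elim x)
    have "v x + e \<noteq> 0" using v0[of x] e by linarith
    then show ?case by (intro tendsto_intros elim)
  qed
  have s0: "1 + t\<^sup>2 \<noteq> (0::real)" for t :: real using zero_le_power2[of t] by linarith
  have kinvb: "1 / (k n x + e) \<le> 2 / e" "0 \<le> 1 / (k n x + e)" for n x
    using frac_le[of 1 1 "e/2" "k n x + e"] kb[of n x] e k0[of n x] by auto
  have a1: "\<bar>1 / (1 + t\<^sup>2)\<bar> \<le> 1" for t :: real by (simp add: divide_le_eq add_pos_nonneg)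
  \<comment> \<open>The decay of the derivative of arctan absorbs the one factor of the quotient
    that multiplies the gradient of v.\<close>
  have a2: "\<bar>t / (1 + t\<^sup>2)\<bar> \<le> 1" for t :: real
  proof -
    have "2 * \<bar>t\<bar> \<le> 1 + t\<^sup>2" using zero_le_power2[of "\<bar>t\<bar> - 1"] by (simp add: power2_diff)
    then have "\<bar>t\<bar> \<le> 1 + t\<^sup>2" using abs_ge_zero[of t] by linarith
    then show ?thesis by (simp add: abs_divide divide_le_eq add_pos_nonneg)
  qed
  have b1: "\<bar>1 / (1 + (q n x)\<^sup>2) * (1 / (k n x + e))\<bar> \<le> 2 / e" for n x
  proof -
    have "\<bar>1 / (1 + (q n x)\<^sup>2) * (1 / (k n x + e))\<bar> \<le> 1 * (2 / e)"
      unfolding abs_mult using kinvb[of n x] by (intro mult_mono a1) auto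
    then show ?thesis by simp
  qed
  have b2: "\<bar>q n x / (1 + (q n x)\<^sup>2) * (1 / (k n x + e))\<bar> \<le> 2 / e" for n x
  proof -
    have "\<bar>q n x / (1 + (q n x)\<^sup>2) * (1 / (k n x + e))\<bar> \<le> 1 * (2 / e)"
      unfolding abs_mult using kinvb[of n x] by (intro mult_mono a2) auto
    then show ?thesis by simp
  qed
  have [measurable]: "borel_fun (q n)" "borel_fun Q" for n unfolding q_def Q_def by measurable
  have l1: "L2lim (\<lambda>n x. (1 / (1 + (q n x)\<^sup>2) * (1 / (k n x + e))) *\<^sub>R gr (p n) x) (\<lambda>x. (1 / (1 + (Q x)\<^sup>2) * (1 / (v x + e))) *\<^sub>R W x)"
  proof (rule L2lim_mult_bounded[OF _ _ _ _ pl(2) appr_L2(2)[OF B] b1])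
    show "AE x in lborel. (\<lambda>n. 1 / (1 + (q n x)\<^sup>2) * (1 / (k n x + e))) \<longlonglongrightarrow> 1 / (1 + (Q x)\<^sup>2) * (1 / (v x + e))"
      using qae kinv
    proof eventually_elim
      case (elim x)
      have "(\<lambda>n. 1 / (1 + (q n x)\<^sup>2)) \<longlonglongrightarrow> 1 / (1 + (Q x)\<^sup>2)"
        by (intro tendsto_divide tendsto_add tendsto_power tendsto_const s0 elim(1))
      from tendsto_mult[OF this elim(2)] show ?case .
    qed
  qed measurable
  have l2: "L2lim (\<lambda>n x. (q n x / (1 + (q n x)\<^sup>2) * (1 / (k n x + e))) *\<^sub>R gr (k n) x) (\<lambda>x. (Q x / (1 + (Q x)\<^sup>2) * (1 / (v x + e))) *\<^sub>R H x)"
  proof (rule L2lim_mult_bounded[OF _ _ _ _ kl(2) appr_L2(2)[OF A] b2])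
    show "AE x in lborel. (\<lambda>n. q n x / (1 + (q n x)\<^sup>2) * (1 / (k n x + e))) \<longlonglongrightarrow> Q x / (1 + (Q x)\<^sup>2) * (1 / (v x + e))"
      using qae kinv
    proof eventually_elim
      case (elim x)
      have "(\<lambda>n. q n x / (1 + (q n x)\<^sup>2)) \<longlonglongrightarrow> Q x / (1 + (Q x)\<^sup>2)"
        by (intro tendsto_divide tendsto_add tendsto_power tendsto_const s0 elim(1))
      from tendsto_mult[OF this elim(2)] show ?case .
    qed
  qed measurable
  have "appr U (\<lambda>x. arctan (Q x)) (\<lambda>x. (1 / (1 + (Q x)\<^sup>2)) *\<^sub>R ((1 / (v x + e)) *\<^sub>R W x - (Q x / (v x + e)) *\<^sub>R H x))"
  proof (rule appr_limit_seq[OF _ _ C1c_appr[OF aq(1) U]])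
    have [measurable]: "borel_fun arctan" by (intro borel_measurable_continuous_onI continuous_intros)
    show "borel_fun (\<lambda>x. arctan (Q x))" by measurable
    have le: "L2lim (\<lambda>n x. (1 / (k n x + e)) *\<^sub>R p n x) (\<lambda>x. (1 / (v x + e)) *\<^sub>R w x)"
      by (rule L2lim_mult_bounded[OF _ _ _ _ pl(1) appr_L2(1)[OF B] _ kinv, where C="2/e"]) (use kinvb in \<open>auto simp: abs_of_nonneg\<close>)
    show "L2lim (\<lambda>n x. arctan (q n x)) (\<lambda>x. arctan (Q x))"
    proof (rule L2lim_bound_mult[where G=q and g=Q and B=1])
      show "norm (arctan (q n x) - arctan (Q x)) \<le> 1 * norm (q n x - Q x)" for n x
        by (rule field_differentiable_bound[of UNIV arctan "\<lambda>t. 1 / (1 + t\<^sup>2)" 1])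
          (use ad a1 in \<open>auto intro: has_field_derivative_at_within simp del: abs_divide\<close>)
      show "L2lim q Q" using le by (simp add: q_def[abs_def] Q_def[abs_def])
    qed measurable
    have eq: "gr (\<lambda>x. arctan (q n x)) = (\<lambda>x. (1 / (1 + (q n x)\<^sup>2) * (1 / (k n x + e))) *\<^sub>R gr (p n) x - (q n x / (1 + (q n x)\<^sup>2) * (1 / (k n x + e))) *\<^sub>R gr (k n) x)" for n
      unfolding aq(2) gq by (simp add: scaleR_diff_right)
    have "L2lim (\<lambda>n. gr (\<lambda>x. arctan (q n x))) (\<lambda>x. (1 / (1 + (Q x)\<^sup>2) * (1 / (v x + e))) *\<^sub>R W x - (Q x / (1 + (Q x)\<^sup>2) * (1 / (v x + e))) *\<^sub>R H x)"
      unfolding eq by (rule L2lim_diff[OF _ _ _ _ l1 l2]) measurable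
    then show "L2lim (\<lambda>n. gr (\<lambda>x. arctan (q n x))) (\<lambda>x. (1 / (1 + (Q x)\<^sup>2)) *\<^sub>R ((1 / (v x + e)) *\<^sub>R W x - (Q x / (v x + e)) *\<^sub>R H x))"
      by (simp add: scaleR_diff_right)
  qed measurable
  then show ?thesis by (simp add: Q_def)
qed

section \<open>Picone's inequality and simplicity of the principal eigenvalue\<close>

text \<open>The function v is positive at every point of the domain and zero at every other point,
  so quotients by v are handled pointwise; the eigenfunction is brought into this form by a change
  on a null set.\<close>

locale weighted_eigenpair =
  fixes \<Omega> :: "R3 set" and v f :: "R3 \<Rightarrow> real" and H :: "R3 \<Rightarrow> R3" and lam :: real
  assumes open_domain: "open \<Omega>"
    and vH: "appr \<Omega> v H" and v_pos: "\<And>x. x \<in> \<Omega> \<Longrightarrow> v x > 0" and v_zero: "\<And>x. x \<notin> \<Omega> \<Longrightarrow> v x = 0"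
    and fm [measurable]: "borel_fun f" and ff: "(NNINT x. ennreal (\<bar>f x\<bar> powr (3/2))) < \<infinity>"
    and eq_test: "\<And>\<phi>. test_fun \<Omega> \<phi> \<Longrightarrow> (LBINT x. H x \<bullet> gr \<phi> x) = lam * (LBINT x. f x * v x * \<phi> x)"
begin

lemma v_nonneg: "v x \<ge> 0"
  using v_pos[of x] v_zero[of x] by (cases "x \<in> \<Omega>") auto

lemma vm [measurable]: "borel_fun v" and Hm [measurable]: "borel_fun H"
  using apprD[OF vH] by auto

lemma dm [measurable]: "\<Omega> \<in> sets borel"
  using open_domain by simp

text \<open>Both sides are continuous under convergence of gradients, the weighted one by the
  Sobolev bound for sqrt |f| u; the equation therefore extends from test functions to their
  closure.\<close>

lemma weak_eq:
  assumes A: "appr \<Omega> \<psi> \<Psi>"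
  shows "(LBINT x. H x \<bullet> \<Psi> x) = lam * (LBINT x. f x * v x * \<psi> x)"
proof -
  obtain \<phi> where \<phi>: "\<And>n::nat. test_fun \<Omega> (\<phi> n)" "L2lim \<phi> \<psi>" "L2lim (\<lambda>n. gr (\<phi> n)) \<Psi>"
    using appr_seq[OF A] by blast
  have "(\<lambda>n. (LBINT x. gr (\<phi> n) x \<bullet> H x)) \<longlonglongrightarrow> (LBINT x. \<Psi> x \<bullet> H x)"
    by (rule L2lim_inner[OF test_fun_gr_measurable[OF \<phi>(1)] apprD(2)[OF A] Hm \<phi>(3) test_fun_L2(2)[OF \<phi>(1)] appr_L2(2)[OF A] appr_L2(2)[OF vH]])
  then have 1: "(\<lambda>n. lam * (LBINT x. f x * v x * \<phi> n x)) \<longlonglongrightarrow> (LBINT x. H x \<bullet> \<Psi> x)"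
    unfolding eq_test[OF \<phi>(1), symmetric] by (simp add: inner_commute)
  have "(\<lambda>n. (LBINT x. 1 * (f x * v x * \<phi> n x))) \<longlonglongrightarrow> (LBINT x. 1 * (f x * v x * \<psi> x))"
    by (rule weighted_tendsto[OF fm ff _ _ vH vH L2lim_const appr_test_fun[OF \<phi>(1)] A sq_weight_L2lim[OF fm ff appr_test_fun[OF \<phi>(1)] A \<phi>(3)], where C=1]) auto
  then have "(\<lambda>n. lam * (LBINT x. f x * v x * \<phi> n x)) \<longlonglongrightarrow> lam * (LBINT x. f x * v x * \<psi> x)"
    by (intro tendsto_mult tendsto_const) simp
  with 1 show ?thesis by (rule LIMSEQ_unique)
qed

text \<open>Pointwise, the square on the left equals |grad \<phi>|^2 minus the product of H with the
  gradient of \<phi>^2 / (v + e). Testing the eigenvalue equation with this quotient evaluates the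
  second term.\<close>

lemma Picone_identity:
  assumes \<phi>: "test_fun \<Omega> \<phi>" and e: "e > 0"
  shows "L2sq (\<lambda>x. gr \<phi> x - (\<phi> x / (v x + e)) *\<^sub>R H x)
    = ennreal (enn2real (L2sq (gr \<phi>)) - lam * (LBINT x. v x / (v x + e) * (f x * \<phi> x * \<phi> x)))"
proof -
  note C = test_fun_C1c[OF \<phi>]
  note [measurable] = test_fun_measurable[OF \<phi>] test_fun_gr_measurable[OF \<phi>]
  define \<Psi> where "\<Psi> x = (2 * \<phi> x / (v x + e)) *\<^sub>R gr \<phi> x - (\<phi> x / (v x + e))\<^sup>2 *\<^sub>R H x" for x
  have A: "appr \<Omega> (\<lambda>x. (\<phi> x)\<^sup>2 / (v x + e)) \<Psi>"
    unfolding \<Psi>_def by (rule appr_square_quotient[OF C vH open_domain v_nonneg e])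
  have i1: "integrable lborel (\<lambda>x. (norm (gr \<phi> x))\<^sup>2)"
    using test_fun_L2(2)[OF \<phi>] by (subst integrable_iff_L2sq) simp_all
  have i2: "integrable lborel (\<lambda>x. H x \<bullet> \<Psi> x)"
    by (rule L2_inner_integrable[OF Hm apprD(2)[OF A] appr_L2(2)[OF vH] appr_L2(2)[OF A]])
  have pt: "(norm (gr \<phi> x - (\<phi> x / (v x + e)) *\<^sub>R H x))\<^sup>2 = (norm (gr \<phi> x))\<^sup>2 - H x \<bullet> \<Psi> x" for x
    unfolding \<Psi>_def power2_norm_eq_inner
    by (simp add: inner_diff_left inner_diff_right inner_commute power2_eq_square)
  have int: "integrable lborel (\<lambda>x. (norm (gr \<phi> x - (\<phi> x / (v x + e)) *\<^sub>R H x))\<^sup>2)"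
    unfolding pt by (rule Bochner_Integration.integrable_diff[OF i1 i2])
  then have fin: "L2sq (\<lambda>x. gr \<phi> x - (\<phi> x / (v x + e)) *\<^sub>R H x) < \<infinity>"
    by (subst (asm) integrable_iff_L2sq) simp_all
  have "L2sq (\<lambda>x. gr \<phi> x - (\<phi> x / (v x + e)) *\<^sub>R H x) = ennreal (LBINT x. (norm (gr \<phi> x - (\<phi> x / (v x + e)) *\<^sub>R H x))\<^sup>2)"
    by (rule L2sq_eq_integral[OF _ fin]) measurable
  also have "(LBINT x. (norm (gr \<phi> x - (\<phi> x / (v x + e)) *\<^sub>R H x))\<^sup>2) = (LBINT x. (norm (gr \<phi> x))\<^sup>2) - (LBINT x. H x \<bullet> \<Psi> x)"
    unfolding pt by (rule Bochner_Integration.integral_diff[OF i1 i2])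
  also have "(LBINT x. (norm (gr \<phi> x))\<^sup>2) = enn2real (L2sq (gr \<phi>))" by (rule integral_eq_L2sq) simp
  also have "(LBINT x. H x \<bullet> \<Psi> x) = lam * (LBINT x. f x * v x * ((\<phi> x)\<^sup>2 / (v x + e)))" by (rule weak_eq[OF A])
  also have "(LBINT x. f x * v x * ((\<phi> x)\<^sup>2 / (v x + e))) = (LBINT x. v x / (v x + e) * (f x * \<phi> x * \<phi> x))"
    by (rule Bochner_Integration.integral_cong) (simp_all add: power2_eq_square)
  finally show ?thesis .
qed

lemma quotient_bound: "e > 0 \<Longrightarrow> \<bar>v x / (v x + e)\<bar> \<le> 1"
  using v_nonneg[of x] by (simp add: divide_le_eq)

text \<open>For general w the factor w / (v + e) has no bound, so the left side is passed to the
  limit by Fatou; the identity becomes an inequality.\<close>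

lemma Picone_shifted:
  assumes A: "appr \<Omega> w W" and e: "e > 0"
  shows "L2sq (\<lambda>x. W x - (w x / (v x + e)) *\<^sub>R H x)
    \<le> ennreal (enn2real (L2sq W) - lam * (LBINT x. v x / (v x + e) * (f x * w x * w x)))"
proof -
  obtain \<phi> where \<phi>: "\<And>n::nat. test_fun \<Omega> (\<phi> n)" "L2lim \<phi> w" "L2lim (\<lambda>n. gr (\<phi> n)) W"
    using appr_seq[OF A] by blast
  note m [measurable] = apprD[OF A] test_fun_measurable[OF \<phi>(1)] test_fun_gr_measurable[OF \<phi>(1)]
  obtain r where r: "strict_mono r" and a1: "AE x in lborel. (\<lambda>k. \<phi> (r k) x) \<longlonglongrightarrow> w x"
    using L2lim_AE_subseq[OF m(3,1) \<phi>(2)] by blast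
  obtain s where s: "strict_mono s" and a2: "AE x in lborel. (\<lambda>k. gr (\<phi> (r (s k))) x) \<longlonglongrightarrow> W x"
    using L2lim_AE_subseq[OF m(4,2) L2lim_subseq[OF \<phi>(3) r]] by blast
  define p where "p k = \<phi> (r (s k))" for k
  have p: "test_fun \<Omega> (p k)" for k unfolding p_def by (rule \<phi>)
  have pg: "L2lim (\<lambda>k. gr (p k)) W" unfolding p_def by (rule L2lim_subseq[OF L2lim_subseq[OF \<phi>(3) r] s])
  have ae: "AE x in lborel. (\<lambda>k. gr (p k) x - (p k x / (v x + e)) *\<^sub>R H x) \<longlonglongrightarrow> W x - (w x / (v x + e)) *\<^sub>R H x"
    using a1 a2
  proof eventually_elim
    case (elim x)
    have "(\<lambda>k. p k x) \<longlonglongrightarrow> w x" using LIMSEQ_subseq_LIMSEQ[OF elim(1) s] by (simp add: p_def comp_def)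
    moreover have "v x + e \<noteq> 0" using v_nonneg[of x] e by linarith
    ultimately show ?case using elim(2) unfolding p_def[symmetric] by (intro tendsto_intros)
  qed
  show ?thesis
  proof (rule L2sq_Fatou[OF _ ae])
    show "borel_fun (\<lambda>x. gr (p k) x - (p k x / (v x + e)) *\<^sub>R H x)" for k
      unfolding p_def by measurable
    show "L2sq (\<lambda>x. gr (p k) x - (p k x / (v x + e)) *\<^sub>R H x)
      \<le> ennreal (enn2real (L2sq (gr (p k))) - lam * (LBINT x. v x / (v x + e) * (f x * p k x * p k x)))" for k
      by (rule eq_refl[OF Picone_identity[OF p e]])
    show "(\<lambda>k. enn2real (L2sq (gr (p k))) - lam * (LBINT x. v x / (v x + e) * (f x * p k x * p k x)))
      \<longlonglongrightarrow> enn2real (L2sq W) - lam * (LBINT x. v x / (v x + e) * (f x * w x * w x))"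
    proof (intro tendsto_diff tendsto_mult tendsto_const)
      show "(\<lambda>k. enn2real (L2sq (gr (p k)))) \<longlonglongrightarrow> enn2real (L2sq W)"
        by (rule L2lim_norm[OF test_fun_gr_measurable[OF p] m(2) pg appr_L2(2)[OF A] test_fun_L2(2)[OF p]])
      note l = sq_weight_L2lim[OF fm ff appr_test_fun[OF p] A pg]
      show "(\<lambda>k. (LBINT x. v x / (v x + e) * (f x * p k x * p k x))) \<longlonglongrightarrow> (LBINT x. v x / (v x + e) * (f x * w x * w x))"
        by (rule weighted_tendsto[OF fm ff _ quotient_bound[OF e] appr_test_fun[OF p] A l appr_test_fun[OF p] A l]) measurable
    qed
  qed
qed

text \<open>Lets e tend to zero: Fatou on the left, dominated convergence on the right with majorant
  |f w^2|, where v / (v + e) tends to 1 inside \<Omega> and w vanishes outside.\<close>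

lemma Picone:
  assumes A: "appr \<Omega> w W"
  shows "L2sq (\<lambda>x. indicator \<Omega> x *\<^sub>R (W x - (w x / v x) *\<^sub>R H x)) \<le> ennreal (enn2real (L2sq W) - lam * (LBINT x. f x * w x * w x))"
proof -
  note m [measurable] = apprD[OF A]
  define e where "e n = 1 / real (Suc n)" for n
  have e: "e n > 0" for n by (simp add: e_def)
  have e0: "e \<longlonglongrightarrow> 0" unfolding e_def[abs_def] using LIMSEQ_inverse_real_of_nat by (simp add: inverse_eq_divide)
  have q: "(\<lambda>n. c / (v x + e n)) \<longlonglongrightarrow> c / v x" if "x \<in> \<Omega>" for x c
  proof -
    have "(\<lambda>n. c / (v x + e n)) \<longlonglongrightarrow> c / (v x + 0)" using v_pos[OF that] by (intro tendsto_intros e0) simp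
    then show ?thesis by simp
  qed
  show ?thesis
  proof (rule L2sq_Fatou[where F="\<lambda>n x. indicator \<Omega> x *\<^sub>R (W x - (w x / (v x + e n)) *\<^sub>R H x)"])
    show "(\<lambda>x. indicator \<Omega> x *\<^sub>R (W x - (w x / (v x + e n)) *\<^sub>R H x)) \<in> borel_measurable borel" for n by measurable
    show "AE x in lborel. (\<lambda>n. indicator \<Omega> x *\<^sub>R (W x - (w x / (v x + e n)) *\<^sub>R H x)) \<longlonglongrightarrow> indicator \<Omega> x *\<^sub>R (W x - (w x / v x) *\<^sub>R H x)"
    proof (rule AE_I2)
      fix x
      show "(\<lambda>n. indicator \<Omega> x *\<^sub>R (W x - (w x / (v x + e n)) *\<^sub>R H x)) \<longlonglongrightarrow> indicator \<Omega> x *\<^sub>R (W x - (w x / v x) *\<^sub>R H x)"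
      proof (cases "x \<in> \<Omega>")
        case True
        show ?thesis by (intro tendsto_scaleR tendsto_diff tendsto_const q[OF True])
      qed simp
    qed
    show "L2sq (\<lambda>x. indicator \<Omega> x *\<^sub>R (W x - (w x / (v x + e n)) *\<^sub>R H x))
       \<le> ennreal (enn2real (L2sq W) - lam * (LBINT x. v x / (v x + e n) * (f x * w x * w x)))" for n
    proof -
      have "L2sq (\<lambda>x. indicator \<Omega> x *\<^sub>R (W x - (w x / (v x + e n)) *\<^sub>R H x)) \<le> L2sq (\<lambda>x. W x - (w x / (v x + e n)) *\<^sub>R H x)"
        by (rule L2sq_mono) (simp add: indicator_def)
      also note Picone_shifted[OF A e]
      finally show ?thesis .
    qed
    show "(\<lambda>n. enn2real (L2sq W) - lam * (LBINT x. v x / (v x + e n) * (f x * w x * w x))) \<longlonglongrightarrow> enn2real (L2sq W) - lam * (LBINT x. f x * w x * w x)"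
    proof (intro tendsto_diff tendsto_mult tendsto_const)
      show "(\<lambda>n. (LBINT x. v x / (v x + e n) * (f x * w x * w x))) \<longlonglongrightarrow> (LBINT x. f x * w x * w x)"
      proof (rule integral_dominated_convergence[where w="\<lambda>x. \<bar>f x * w x * w x\<bar>"])
        show "integrable lborel (\<lambda>x. \<bar>f x * w x * w x\<bar>)" by (rule integrable_abs[OF weighted_integrable[OF fm ff A A]])
        show "AE x in lborel. (\<lambda>n. v x / (v x + e n) * (f x * w x * w x)) \<longlonglongrightarrow> f x * w x * w x"
          using appr_zero_outside(1)[OF A]
        proof eventually_elim
          case (elim x)
          show ?case
          proof (cases "x \<in> \<Omega>")
            case True
            have "(\<lambda>n. v x / (v x + e n) * (f x * w x * w x)) \<longlonglongrightarrow> v x / v x * (f x * w x * w x)"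
              by (intro tendsto_mult tendsto_const q[OF True])
            then show ?thesis using v_pos[OF True] by simp
          qed (use elim in simp)
        qed
        show "AE x in lborel. norm (v x / (v x + e n) * (f x * w x * w x)) \<le> \<bar>f x * w x * w x\<bar>" for n
        proof (rule AE_I2)
          fix x
          have "\<bar>v x / (v x + e n)\<bar> * \<bar>f x * w x * w x\<bar> \<le> 1 * \<bar>f x * w x * w x\<bar>"
            by (rule mult_right_mono[OF quotient_bound[OF e]]) simp
          then show "norm (v x / (v x + e n) * (f x * w x * w x)) \<le> \<bar>f x * w x * w x\<bar>" by (simp add: abs_mult)
        qed
      qed measurable
    qed
  qed
qed

text \<open>The hypothesis makes the right side of Picone's inequality nonpositive, so the
  nonnegative left side is zero.\<close>

lemma minimizer_gradient:
  assumes A: "appr \<Omega> w W" and min: "enn2real (L2sq W) \<le> lam * (LBINT x. f x * w x * w x)"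
  shows "AE x in lborel. x \<in> \<Omega> \<longrightarrow> W x = (w x / v x) *\<^sub>R H x"
proof -
  note [measurable] = apprD[OF A]
  have "L2sq (\<lambda>x. indicator \<Omega> x *\<^sub>R (W x - (w x / v x) *\<^sub>R H x)) \<le> ennreal 0"
    by (rule order_trans[OF Picone[OF A] ennreal_leI]) (use min in simp)
  then have "AE x in lborel. indicator \<Omega> x *\<^sub>R (W x - (w x / v x) *\<^sub>R H x) = 0" by (intro L2sq_eq_0_AE) auto
  then show ?thesis by eventually_elim auto
qed

text \<open>The function is \<eta> times the gradient of log v. Picone's inequality for w = \<eta>
  bounds grad \<eta> - \<eta> grad log v, and grad \<eta> itself is square integrable.\<close>

lemma log_gradient_L2:
  assumes \<eta>: "test_fun \<Omega> \<eta>"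
  shows "L2sq (\<lambda>x. indicator \<Omega> x *\<^sub>R (\<eta> x / v x) *\<^sub>R H x) < \<infinity>"
proof -
  note [measurable] = test_fun_measurable[OF \<eta>] test_fun_gr_measurable[OF \<eta>]
  have f1: "L2sq (\<lambda>x. indicator \<Omega> x *\<^sub>R (gr \<eta> x - (\<eta> x / v x) *\<^sub>R H x)) < \<infinity>"
    by (rule le_less_trans[OF Picone[OF appr_test_fun[OF \<eta>]]]) simp
  have "L2sq (\<lambda>x. indicator \<Omega> x *\<^sub>R gr \<eta> x) \<le> L2sq (gr \<eta>)" by (rule L2sq_mono) (simp add: indicator_def)
  then have f2: "L2sq (\<lambda>x. indicator \<Omega> x *\<^sub>R gr \<eta> x) < \<infinity>" using test_fun_L2(2)[OF \<eta>] by (rule le_less_trans)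
  have "L2sq (\<lambda>x. indicator \<Omega> x *\<^sub>R gr \<eta> x - indicator \<Omega> x *\<^sub>R (gr \<eta> x - (\<eta> x / v x) *\<^sub>R H x)) < \<infinity>"
    by (rule L2sq_finite_diff[OF _ _ f2 f1]) measurable
  then show ?thesis by (simp add: scaleR_diff_right)
qed

text \<open>Along \<open>arctan (w / (v + e))\<close> the factor \<open>e / (v + e)\<close> of the gradient tends to 0, dominated by
  \<open>\<bar>H\<bar> / v\<close>, which Picone's inequality with a test function makes locally square integrable.
  Thus no positive lower bound of \<open>v\<close> on compact sets is needed.\<close>

lemma arctan_quotient_zero_gradient:
  assumes A: "appr \<Omega> w W" and min: "enn2real (L2sq W) \<le> lam * (LBINT x. f x * w x * w x)" and \<eta>: "test_fun \<Omega> \<eta>"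
  shows "(LBINT x. (indicator \<Omega> x * arctan (w x / v x)) * partial i \<eta> x) = 0"
proof -
  note m [measurable] = apprD[OF A]
  have [measurable]: "borel_fun arctan" by (intro borel_measurable_continuous_onI continuous_intros)
  note tp = test_fun_partial[OF \<eta>, of i]
  note [measurable] = test_fun_measurable[OF \<eta>] test_fun_measurable[OF tp]
  define e where "e n = 1 / real (Suc n)" for n
  have e: "e n > 0" for n by (simp add: e_def)
  have e0: "e \<longlonglongrightarrow> 0" unfolding e_def[abs_def] using LIMSEQ_inverse_real_of_nat by (simp add: inverse_eq_divide)
  define z where "z n x = arctan (w x / (v x + e n))" for n x
  define Z where "Z n x = (1 / (1 + (w x / (v x + e n))\<^sup>2)) *\<^sub>R ((1 / (v x + e n)) *\<^sub>R W x - (w x / (v x + e n) / (v x + e n)) *\<^sub>R H x)" for n x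
  have zA: "appr \<Omega> (z n) (Z n)" for n
    unfolding z_def Z_def by (rule appr_arctan_quotient[OF A vH open_domain v_nonneg e])
  note [measurable] = apprD[OF zA]
  have wk: "(LBINT x. z n x * partial i \<eta> x) = - (LBINT x. Z n x $ i * \<eta> x)" for n
    using appr_wk[OF zA] test_fun_mono[OF \<eta> subset_UNIV] unfolding wk_def by blast
  have pint: "integrable lborel (\<lambda>x. \<bar>partial i \<eta> x\<bar>)"
    by (rule integrable_abs, rule integrable_compact_support[of _ "tsupport (partial i \<eta>)"])
      (use tp in \<open>auto simp: test_fun_def smooth_continuous not_in_tsupport\<close>)
  have \<eta>0: "\<eta> x = 0" "partial i \<eta> x = 0" if "x \<notin> \<Omega>" for x
    using C1c_zero[OF test_fun_C1c[OF \<eta>] that] gr_nth[of \<eta> x i] by auto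
  have L: "(\<lambda>n. (LBINT x. z n x * partial i \<eta> x)) \<longlonglongrightarrow> (LBINT x. (indicator \<Omega> x * arctan (w x / v x)) * partial i \<eta> x)"
  proof (rule integral_dominated_convergence[where w="\<lambda>x. (pi/2) * \<bar>partial i \<eta> x\<bar>"])
    show "integrable lborel (\<lambda>x. (pi/2) * \<bar>partial i \<eta> x\<bar>)" using pint by simp
    show "AE x in lborel. (\<lambda>n. z n x * partial i \<eta> x) \<longlonglongrightarrow> indicator \<Omega> x * arctan (w x / v x) * partial i \<eta> x"
    proof (rule AE_I2)
      fix x
      show "(\<lambda>n. z n x * partial i \<eta> x) \<longlonglongrightarrow> indicator \<Omega> x * arctan (w x / v x) * partial i \<eta> x"
      proof (cases "x \<in> \<Omega>")
        case True
        have "(\<lambda>n. w x / (v x + e n)) \<longlonglongrightarrow> w x / (v x + 0)" using v_pos[OF True] by (intro tendsto_intros e0) simp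
        then have "(\<lambda>n. z n x) \<longlonglongrightarrow> arctan (w x / v x)" unfolding z_def by (intro tendsto_arctan) simp
        then show ?thesis using True by (intro tendsto_mult tendsto_const) simp
      qed (simp add: \<eta>0)
    qed
    show "AE x in lborel. norm (z n x * partial i \<eta> x) \<le> (pi/2) * \<bar>partial i \<eta> x\<bar>" for n
    proof (rule AE_I2)
      fix x
      have "\<bar>z n x\<bar> \<le> pi/2" unfolding z_def using arctan_bounded[of "w x / (v x + e n)"] by auto
      then show "norm (z n x * partial i \<eta> x) \<le> (pi/2) * \<bar>partial i \<eta> x\<bar>"
        unfolding real_norm_def abs_mult by (rule mult_right_mono) simp
    qed
  qed measurable
  \<comment> \<open>The common majorant: square integrable by the preceding lemma and supported in
    the support of \<eta>, hence integrable.\<close>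
  define D where "D x = norm (indicator \<Omega> x *\<^sub>R (\<eta> x / v x) *\<^sub>R H x)" for x
  have Dm [measurable]: "borel_fun D" unfolding D_def by measurable
  have Dz: "D x = 0" if "x \<notin> tsupport \<eta>" for x using that by (simp add: D_def not_in_tsupport)
  have Dint: "integrable lborel D"
  proof -
    have "L2sq D = L2sq (\<lambda>x. indicator \<Omega> x *\<^sub>R (\<eta> x / v x) *\<^sub>R H x)" by (simp add: L2sq_def D_def)
    then have Df: "L2sq D < \<infinity>" using log_gradient_L2[OF \<eta>] by simp
    have cs: "compact (tsupport \<eta>)" using \<eta> by (simp add: test_fun_def)
    have [measurable]: "tsupport \<eta> \<in> sets borel" using borel_compact[OF cs] by simp
    have "L2sq (indicator (tsupport \<eta>) :: R3 \<Rightarrow> real) = (NNINT x. indicator (tsupport \<eta>) x)"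
      unfolding L2sq_def by (intro nn_integral_cong) (simp add: indicator_def)
    also have "\<dots> = emeasure lborel (tsupport \<eta>)" by simp
    also have "\<dots> < \<infinity>" using emeasure_compact_finite[OF cs] by simp
    finally have If: "L2sq (indicator (tsupport \<eta>) :: R3 \<Rightarrow> real) < \<infinity>" .
    have eq: "D x \<bullet> indicator (tsupport \<eta>) x = D x" for x by (cases "x \<in> tsupport \<eta>") (simp_all add: Dz)
    have "integrable lborel (\<lambda>x. D x \<bullet> indicator (tsupport \<eta>) x)"
      by (rule L2_inner_integrable[OF Dm _ Df If]) measurable
    then show ?thesis unfolding eq .
  qed
  \<comment> \<open>With W = (w / v) H the two terms of the gradient nearly cancel; what is left of
    1/v - 1/(v + e) is the factor e / (v (v + e)).\<close>
  have Zle: "x \<in> \<Omega> \<Longrightarrow> norm (Z n x) = \<bar>w x\<bar> * e n / ((v x + e n)\<^sup>2 + (w x)\<^sup>2) * norm (H x) / v x" if "W x = (w x / v x) *\<^sub>R H x" for n x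
  proof -
    assume x: "x \<in> \<Omega>"
    define a where "a = v x + e n"
    have a: "a > 0" using v_pos[OF x] e[of n] by (simp add: a_def)
    have vp: "v x > 0" by (rule v_pos[OF x])
    have s: "a\<^sup>2 + (w x)\<^sup>2 > 0" using a by (simp add: add_pos_nonneg)
    have "Z n x = (1 / (1 + (w x / a)\<^sup>2) * (w x / v x / a - w x / a / a)) *\<^sub>R H x"
      unfolding Z_def that a_def[symmetric] by (simp add: scaleR_diff_left scaleR_diff_right right_diff_distrib)
    also have "1 / (1 + (w x / a)\<^sup>2) * (w x / v x / a - w x / a / a) = w x * e n / (a\<^sup>2 + (w x)\<^sup>2) / v x"
    proof -
      have 1: "1 / (1 + (w x / a)\<^sup>2) = a\<^sup>2 / (a\<^sup>2 + (w x)\<^sup>2)" using a s by (simp add: field_simps)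
      have 2: "w x / v x / a - w x / a / a = w x * e n / (a\<^sup>2 * v x)"
        using a vp by (simp add: field_simps power2_eq_square) (simp add: a_def algebra_simps)
      show ?thesis unfolding 1 2 using a by simp
    qed
    finally show "norm (Z n x) = \<bar>w x\<bar> * e n / ((v x + e n)\<^sup>2 + (w x)\<^sup>2) * norm (H x) / v x"
      using vp s e[of n] by (simp add: a_def abs_mult)
  qed
  have R: "(\<lambda>n. (LBINT x. Z n x $ i * \<eta> x)) \<longlonglongrightarrow> (\<integral>x. 0 \<partial>(lborel :: R3 measure))"
  proof (rule integral_dominated_convergence[OF _ _ Dint])
    show "AE x in lborel. norm (Z n x $ i * \<eta> x) \<le> D x" for n
      using minimizer_gradient[OF A min]
    proof eventually_elim
      case (elim x)
      show ?case
      proof (cases "x \<in> \<Omega>")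
        case True
        have vp: "v x > 0" by (rule v_pos[OF True])
        have s: "(v x + e n)\<^sup>2 + (w x)\<^sup>2 > 0" using vp e[of n] by (simp add: add_pos_nonneg)
        \<comment> \<open>By 2 |w| (v + e) <= (v + e)^2 + w^2 the quotient in \<open>Zle\<close> is
          at most 1 uniformly in n, which yields the majorant D.\<close>
        have "\<bar>w x\<bar> * e n \<le> \<bar>w x\<bar> * (v x + e n)" using vp by (intro mult_left_mono) auto
        also have "\<dots> \<le> (v x + e n)\<^sup>2 + (w x)\<^sup>2"
        proof -
          have "0 \<le> (\<bar>w x\<bar> - (v x + e n))\<^sup>2" by simp
          then have "2 * (\<bar>w x\<bar> * (v x + e n)) \<le> (v x + e n)\<^sup>2 + (w x)\<^sup>2" by (simp add: power2_diff algebra_simps)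
          moreover have "0 \<le> \<bar>w x\<bar> * (v x + e n)" using vp e[of n] by simp
          ultimately show ?thesis by linarith
        qed
        finally have le1: "\<bar>w x\<bar> * e n / ((v x + e n)\<^sup>2 + (w x)\<^sup>2) \<le> 1" using s by (simp add: divide_le_eq)
        have "norm (Z n x $ i * \<eta> x) \<le> norm (Z n x) * \<bar>\<eta> x\<bar>" by (simp add: abs_mult mult_right_mono component_le_norm_cart)
        also have "\<dots> = \<bar>w x\<bar> * e n / ((v x + e n)\<^sup>2 + (w x)\<^sup>2) * (norm (H x) / v x * \<bar>\<eta> x\<bar>)"
          using Zle[OF elim[rule_format, OF True] True] by simp
        also have "\<dots> \<le> 1 * (norm (H x) / v x * \<bar>\<eta> x\<bar>)" using le1 vp by (intro mult_right_mono) auto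
        also have "\<dots> = D x" using True vp by (simp add: D_def)
        finally show ?thesis .
      qed (simp add: \<eta>0 D_def)
    qed
    show "AE x in lborel. (\<lambda>n. Z n x $ i * \<eta> x) \<longlonglongrightarrow> 0"
      using minimizer_gradient[OF A min]
    proof eventually_elim
      case (elim x)
      show ?case
      proof (cases "x \<in> \<Omega>")
        case True
        have vp: "v x > 0" by (rule v_pos[OF True])
        have nz: "(v x + 0)\<^sup>2 + (w x)\<^sup>2 \<noteq> 0" using vp by (simp add: add_nonneg_eq_0_iff)
        have "(\<lambda>n. \<bar>w x\<bar> * e n / ((v x + e n)\<^sup>2 + (w x)\<^sup>2) * norm (H x) / v x) \<longlonglongrightarrow> \<bar>w x\<bar> * 0 / ((v x + 0)\<^sup>2 + (w x)\<^sup>2) * norm (H x) / v x"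
          using vp nz by (intro tendsto_intros e0) auto
        then have "(\<lambda>n. norm (Z n x)) \<longlonglongrightarrow> 0" unfolding Zle[OF elim[rule_format, OF True] True] by simp
        then have "(\<lambda>n. Z n x) \<longlonglongrightarrow> 0" by (rule tendsto_norm_zero_cancel)
        then have "(\<lambda>n. Z n x $ i * \<eta> x) \<longlonglongrightarrow> 0 $ i * \<eta> x" by (intro tendsto_mult tendsto_vec_nth tendsto_const)
        then show ?thesis by simp
      qed (simp add: \<eta>0)
    qed
  qed measurable
  have "(\<lambda>n. (LBINT x. z n x * partial i \<eta> x)) \<longlonglongrightarrow> 0"
    unfolding wk using tendsto_minus[OF R] by simp
  with L show ?thesis by (rule LIMSEQ_unique)
qed

end

section \<open>Functions with vanishing weak gradient\<close>

lemma zero_gradient_ball: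
  assumes z: "borel_fun z" "L2sq z < \<infinity>" and U: "open U" "ball x0 (2 * R) \<subseteq> U" "R > 0"
    and zg: "\<And>\<eta> i. test_fun U \<eta> \<Longrightarrow> (LBINT x. z x * partial i \<eta> x) = 0"
  shows "\<exists>c. AE x in lborel. x \<in> ball x0 R \<longrightarrow> z x = c"
proof -
  \<comment> \<open>The double successor makes every radius strictly smaller than R, so mollifiers
    centred in the ball of radius R are supported in the ball of radius 2 R and are
    admissible.\<close>
  define k where "k n = R / real (Suc (Suc n))" for n
  have k: "k n > 0" "k n < R" for n
  proof -
    show "k n > 0" using U(3) by (simp add: k_def)
    have "R / real (Suc (Suc n)) < R / 1" using U(3) by (intro divide_strict_left_mono) auto
    then show "k n < R" by (simp add: k_def)
  qed
  note mt = moll_test[OF k(1)]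
  have const: "\<exists>c. \<forall>x\<in>ball x0 R. conv z (moll (k n)) x = c" for n
  proof -
    have g0: "gr (conv z (moll (k n))) x = 0" if x: "x \<in> ball x0 R" for x
    proof -
      have tU: "test_fun U (\<lambda>y. moll (k n) (x - y))"
      proof (rule test_funI[OF test_fun_smooth[OF test_fun_reflect(1)[OF mt]] compact_cball[of x "k n"]])
        show "cball x (k n) \<subseteq> U"
        proof
          fix y assume "y \<in> cball x (k n)"
          then have "dist x0 y < 2 * R" using x k(2)[of n] dist_triangle[of x0 y x] by simp
          then show "y \<in> U" using U(2) by auto
        qed
        show "moll (k n) (x - y) = 0" if "y \<notin> cball x (k n)" for y
          using that by (intro moll_zero[OF k(1)]) (simp add: dist_norm)
      qed
      have "partial i (conv z (moll (k n))) x = 0" for i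
      proof -
        have "partial i (conv z (moll (k n))) x = (LBINT y. z y * partial i (moll (k n)) (x - y))"
          unfolding partial_conv[OF z mt] conv_def ..
        also have "\<dots> = - (LBINT y. z y * partial i (\<lambda>y. moll (k n) (x - y)) y)"
          by (simp add: test_fun_reflect(2)[OF mt])
        also have "\<dots> = 0" using zg[OF tU, of i] by simp
        finally show ?thesis .
      qed
      then show ?thesis by (simp add: vec_eq_iff)
    qed
    have "\<exists>c. \<forall>x\<in>ball x0 R. conv z (moll (k n)) x = c"
    proof (rule has_derivative_zero_constant[OF convex_ball])
      fix x assume x: "x \<in> ball x0 R"
      have "(conv z (moll (k n)) has_derivative (\<lambda>v. gr (conv z (moll (k n))) x \<bullet> v)) (at x)"
        by (rule C1_derivative[OF smooth_C1[OF smooth_conv[OF z mt]]])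
      then have "(conv z (moll (k n)) has_derivative (\<lambda>v. 0)) (at x)" unfolding g0[OF x] by simp
      then show "(conv z (moll (k n)) has_derivative (\<lambda>v. 0)) (at x within ball x0 R)" by (rule has_derivative_at_withinI)
    qed
    then show ?thesis .
  qed
  then have "\<forall>n. \<exists>c. \<forall>x\<in>ball x0 R. conv z (moll (k n)) x = c" by blast
  from choice[OF this] obtain c where c: "\<forall>n. \<forall>x\<in>ball x0 R. conv z (moll (k n)) x = c n" by blast
  have "L2lim (\<lambda>n. conv z (moll (k n))) z" unfolding L2lim_def
  proof (rule ennreal_tendsto_0I)
    fix e :: real assume e: "e > 0"
    obtain d where d: "d > 0" "\<And>r. 0 < r \<Longrightarrow> r < d \<Longrightarrow> L2sq (\<lambda>x. conv z (moll r) x - z x) \<le> ennreal e"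
      using conv_moll_tendsto[OF z e] by blast
    have "d / (2 * R) > 0" using d(1) U(3) by simp
    from eventually_inverse_Suc_le[OF this]
    show "\<forall>\<^sub>F n in sequentially. L2sq (\<lambda>x. conv z (moll (k n)) x - z x) \<le> ennreal e"
    proof eventually_elim
      case (elim n)
      have "k n = R * (1 / real (Suc (Suc n)))" by (simp add: k_def)
      also have "\<dots> \<le> R * (1 / real (Suc n))" using U(3) by (intro mult_left_mono) (simp_all add: field_simps)
      also have "\<dots> \<le> R * (d / (2 * R))" using elim U(3) by (intro mult_left_mono) auto
      also have "\<dots> = d / 2" using U(3) by simp
      finally show ?case using d(1) by (intro d(2) k(1)) linarith
    qed
  qed
  from L2lim_AE_subseq[OF conv_measurable[OF z mt] z(1) this]
  obtain r where ae: "AE x in lborel. (\<lambda>n. conv z (moll (k (r n))) x) \<longlonglongrightarrow> z x" by blast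
  \<comment> \<open>On the ball the mollified values are numbers c (r n) not depending on x. If
    these diverge, no point of the ball has a convergent sequence and the claim is vacuous, so the
    default value 0 serves.\<close>
  have "\<exists>l. \<forall>x. x \<in> ball x0 R \<and> (\<lambda>n. conv z (moll (k (r n))) x) \<longlonglongrightarrow> z x \<longrightarrow> z x = l"
  proof (cases "convergent (\<lambda>n. c (r n))")
    case True
    then obtain l where "(\<lambda>n. c (r n)) \<longlonglongrightarrow> l" unfolding convergent_def by blast
    then show ?thesis using c LIMSEQ_unique by (intro exI[of _ l]) fastforce
  next
    case False
    then show ?thesis using c unfolding convergent_def by (intro exI[of _ 0]) fastforce
  qed
  then obtain l where "\<And>x. x \<in> ball x0 R \<Longrightarrow> (\<lambda>n. conv z (moll (k (r n))) x) \<longlonglongrightarrow> z x \<Longrightarrow> z x = l" by blast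
  then have "AE x in lborel. x \<in> ball x0 R \<longrightarrow> z x = l" using ae by auto
  then show ?thesis ..
qed

lemma AE_ball_nonempty:
  assumes "open S" "S \<noteq> {}" "AE x in lborel. x \<in> S \<longrightarrow> P x"
  shows "\<exists>x\<in>S. P (x::'a::euclidean_space)"
proof (rule ccontr)
  assume "\<not> ?thesis"
  then have n: "\<And>x. x \<in> S \<Longrightarrow> \<not> P x" by blast
  from assms(3) have "AE x in lborel. x \<notin> S" by eventually_elim (use n in blast)
  then have "S \<in> null_sets lborel" using assms(1) by (subst AE_iff_null_sets) auto
  then have "negligible S" by (simp add: negligible_iff_null_sets null_sets_completionI)
  then show False using open_not_negligible assms(1,2) by blast
qed

text \<open>Overlapping balls share a set of positive measure, so the local constants form a locally
  constant function of the centre; connectedness makes it constant.\<close>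

lemma zero_gradient_constant:
  assumes z: "borel_fun z" "L2sq z < \<infinity>" and U: "open U" "connected U"
    and zg: "\<And>\<eta> i. test_fun U \<eta> \<Longrightarrow> (LBINT x. z x * partial i \<eta> x) = 0"
  shows "\<exists>c. AE x in lborel. x \<in> U \<longrightarrow> z x = c"
proof (cases "U = {}")
  case True
  then show ?thesis by simp
next
  case False
  then obtain a where a: "a \<in> U" by blast
  have "\<forall>x\<in>U. \<exists>R>0. ball x R \<subseteq> U \<and> (\<exists>c. AE y in lborel. y \<in> ball x R \<longrightarrow> z y = c)"
  proof
    fix x assume "x \<in> U"
    then obtain e where e: "e > 0" "ball x e \<subseteq> U" using U(1) openE by blast
    have "\<exists>c. AE y in lborel. y \<in> ball x (e/2) \<longrightarrow> z y = c"
      by (rule zero_gradient_ball[OF z U(1) _ _ zg]) (use e in simp_all)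
    moreover have "ball x (e/2) \<subseteq> U" using e subset_ball[of "e/2" e x] by auto
    ultimately show "\<exists>R>0. ball x R \<subseteq> U \<and> (\<exists>c. AE y in lborel. y \<in> ball x R \<longrightarrow> z y = c)"
      using e(1) by (intro exI[of _ "e/2"]) simp
  qed
  from bchoice[OF this] obtain R where R: "\<forall>x\<in>U. R x > 0 \<and> ball x (R x) \<subseteq> U \<and> (\<exists>c. AE y in lborel. y \<in> ball x (R x) \<longrightarrow> z y = c)" by blast
  then have "\<forall>x\<in>U. \<exists>c. AE y in lborel. y \<in> ball x (R x) \<longrightarrow> z y = c" by blast
  from bchoice[OF this] obtain c where c: "\<forall>x\<in>U. AE y in lborel. y \<in> ball x (R x) \<longrightarrow> z y = c x" by blast
  have same: "c x = c y" if x: "x \<in> U" and y: "y \<in> U" "y \<in> ball x (R x)" for x y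
  proof -
    have ae: "AE t in lborel. t \<in> ball x (R x) \<inter> ball y (R y) \<longrightarrow> c x = c y"
      using c[rule_format, OF x] c[rule_format, OF y(1)] by eventually_elim auto
    have "y \<in> ball x (R x) \<inter> ball y (R y)" using y R by simp
    then have ne: "ball x (R x) \<inter> ball y (R y) \<noteq> {}" by blast
    from AE_ball_nonempty[where P="\<lambda>_. c x = c y", OF open_Int[OF open_ball open_ball] ne ae] show ?thesis by simp
  qed
  have ca: "c x = c a" if "x \<in> U" for x
  proof (rule connected_local_const[OF U(2) that a])
    show "\<forall>x\<in>U. \<forall>\<^sub>F y in at x within U. c x = c y"
    proof
      fix x assume x: "x \<in> U"
      have "\<forall>\<^sub>F y in at x within U. y \<in> U \<and> y \<in> ball x (R x)"
      proof -
        have "R x > 0" using R x by blast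
        then show ?thesis unfolding eventually_at by (intro exI[of _ "R x"]) (simp add: dist_commute)
      qed
      then show "\<forall>\<^sub>F y in at x within U. c x = c y" by eventually_elim (use same[OF x] in blast)
    qed
  qed
  \<comment> \<open>Each ball has its own exceptional null set; Lindeloef reduces them to countably
    many.\<close>
  have "\<exists>F'\<subseteq>(\<lambda>x. ball x (R x)) ` U. countable F' \<and> \<Union>F' = \<Union>((\<lambda>x. ball x (R x)) ` U)"
    by (rule Lindelof[of "(\<lambda>x. ball x (R x)) ` U"]) auto
  then obtain F where F: "F \<subseteq> (\<lambda>x. ball x (R x)) ` U" "countable F" "\<Union>F = \<Union>((\<lambda>x. ball x (R x)) ` U)" by blast
  have "AE y in lborel. \<forall>B\<in>F. y \<in> B \<longrightarrow> z y = c a"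
  proof (rule AE_ball_countable'[OF _ F(2)])
    fix B assume "B \<in> F"
    then obtain x where "x \<in> U" "B = ball x (R x)" using F(1) by blast
    then show "AE y in lborel. y \<in> B \<longrightarrow> z y = c a" using c ca by simp
  qed
  then have "AE y in lborel. y \<in> U \<longrightarrow> z y = c a"
  proof eventually_elim
    case (elim y)
    show ?case
    proof
      assume y: "y \<in> U"
      then have "y \<in> ball y (R y)" using R by simp
      then have "y \<in> \<Union>F" unfolding F(3) using y by blast
      then show "z y = c a" using elim by blast
    qed
  qed
  then show ?thesis ..
qed

text \<open>The function arctan (w / v) is bounded, hence square integrable on the bounded domain,
  and has zero weak gradient. Its constant value c gives the ratio w / v = tan c.\<close>

lemma (in weighted_eigenpair) minimizer_multiple:
  assumes A: "appr \<Omega> w W" and min: "enn2real (L2sq W) \<le> lam * (LBINT x. f x * w x * w x)"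
    and conn: "connected \<Omega>" and bdd: "bounded \<Omega>"
  shows "\<exists>c. AE x in lborel. w x = c * v x"
proof -
  note m [measurable] = apprD[OF A]
  have [measurable]: "borel_fun arctan" by (intro borel_measurable_continuous_onI continuous_intros)
  define z where "z x = indicator \<Omega> x * arctan (w x / v x)" for x
  have zm: "borel_fun z" unfolding z_def by measurable
  have zf: "L2sq z < \<infinity>"
  proof -
    have "L2sq z \<le> (NNINT x. ennreal ((pi/2)\<^sup>2) * indicator \<Omega> x)"
      unfolding L2sq_def
    proof (rule nn_integral_mono)
      fix x
      have "\<bar>arctan (w x / v x)\<bar> \<le> pi/2" using arctan_bounded[of "w x / v x"] by auto
      then have "\<bar>arctan (w x / v x)\<bar>\<^sup>2 \<le> (pi/2)\<^sup>2" by (rule power_mono) simp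
      then show "ennreal ((norm (z x))\<^sup>2) \<le> ennreal ((pi/2)\<^sup>2) * indicator \<Omega> x"
        by (cases "x \<in> \<Omega>") (simp_all add: z_def ennreal_leI)
    qed
    also have "\<dots> = ennreal ((pi/2)\<^sup>2) * emeasure lborel \<Omega>" by (rule nn_integral_cmult_indicator) simp
    also have "\<dots> < \<infinity>" using emeasure_bounded_finite[OF bdd] by (simp add: ennreal_mult_less_top)
    finally show ?thesis .
  qed
  have "(LBINT x. z x * partial i \<eta> x) = 0" if "test_fun \<Omega> \<eta>" for \<eta> i
    unfolding z_def by (rule arctan_quotient_zero_gradient[OF A min that])
  from zero_gradient_constant[OF zm zf open_domain conn this]
  obtain c where c: "AE x in lborel. x \<in> \<Omega> \<longrightarrow> z x = c" by blast
  have "AE x in lborel. w x = tan c * v x"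
    using c appr_zero_outside(1)[OF A]
  proof eventually_elim
    case (elim x)
    show ?case
    proof (cases "x \<in> \<Omega>")
      case True
      then have "arctan (w x / v x) = c" using elim by (simp add: z_def)
      then have "w x / v x = tan c" using tan_arctan[of "w x / v x"] by simp
      then show ?thesis using v_pos[OF True] by (simp add: field_simps)
    next
      case False
      then show ?thesis using elim v_zero by simp
    qed
  qed
  then show ?thesis ..
qed

section \<open>The potential well and subcritical powers\<close>

lemma L2sq_sqrt_mult:
  assumes "\<And>x. g x \<ge> 0"
  shows "L2sq (\<lambda>x. sqrt (g x) * u x) = (NNINT x. ennreal (g x * (u x)\<^sup>2))"
  unfolding L2sq_def using assms by (simp add: power_mult_distrib)

text \<open>The weight is the indicator of S, so the L^(3/2) term is the measure of S: sets of small
  measure carry little mass relative to the gradient.\<close>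

lemma weighted_Sobolev_indicator:
  assumes A: "appr U u G" and S [measurable]: "S \<in> sets borel" and \<tau>: "\<tau> > 0"
  shows "(NNINT x. ennreal ((norm (u x))\<^sup>2) * indicator S x) \<le> L2sq G * (ennreal \<tau> * emeasure lborel S + ennreal (4096 / \<tau>\<^sup>2))"
proof -
  have im: "borel_fun (indicator S :: R3 \<Rightarrow> real)" by (rule borel_measurable_indicator) simp
  have "(NNINT x. ennreal ((norm (u x))\<^sup>2) * indicator S x) = (NNINT x. ennreal (\<bar>indicator S x\<bar> * (u x)\<^sup>2))"
    by (intro nn_integral_cong) (simp add: indicator_def)
  also have "\<dots> \<le> L2sq G * (ennreal \<tau> * (NNINT x. ennreal (\<bar>indicator S x\<bar> powr (3/2))) + ennreal (4096 / \<tau>\<^sup>2))"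
    by (rule weighted_Sobolev[OF A im \<tau>])
  also have "(NNINT x. ennreal (\<bar>indicator S x\<bar> powr (3/2))) = (NNINT x. indicator S x)"
    by (intro nn_integral_cong) (simp add: indicator_def)
  also have "\<dots> = emeasure lborel S" by simp
  finally show ?thesis .
qed

lemma potential_tail:
  fixes V :: "R3 \<Rightarrow> real"
  assumes V: "\<And>x. V x \<ge> 0" "borel_fun V" and c: "c > 0" and u: "borel_fun u"
  shows "(NNINT x. ennreal ((norm (u x))\<^sup>2) * indicator (- {x. V x < c}) x) \<le> ennreal (1 / c) * (NNINT x. ennreal (V x * (u x)\<^sup>2))"
proof -
  have "(NNINT x. ennreal ((norm (u x))\<^sup>2) * indicator (- {x. V x < c}) x) \<le> (NNINT x. ennreal (1 / c) * ennreal (V x * (u x)\<^sup>2))"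
  proof (rule nn_integral_mono)
    fix x
    show "ennreal ((norm (u x))\<^sup>2) * indicator (- {x. V x < c}) x \<le> ennreal (1 / c) * ennreal (V x * (u x)\<^sup>2)"
    proof (cases "V x < c")
      case False
      then have "1 * (u x)\<^sup>2 \<le> V x / c * (u x)\<^sup>2" using c by (intro mult_right_mono) auto
      then have "ennreal ((u x)\<^sup>2) \<le> ennreal (1 / c * (V x * (u x)\<^sup>2))" by (intro ennreal_leI) simp
      also have "\<dots> = ennreal (1 / c) * ennreal (V x * (u x)\<^sup>2)" using c V(1)[of x] by (intro ennreal_mult) auto
      finally show ?thesis using False by simp
    qed simp
  qed
  also have "\<dots> = ennreal (1 / c) * (NNINT x. ennreal (V x * (u x)\<^sup>2))"
    by (rule nn_integral_cmult) (use V u in measurable)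
  finally show ?thesis .
qed

text \<open>On the sublevel set, of finite measure, the Sobolev inequality bounds the mass by the
  gradient; off it u^2 <= V u^2 / c. Hence smallness of gradient and potential terms implies
  smallness in L^2.\<close>

lemma potential_coercive:
  fixes V :: "R3 \<Rightarrow> real"
  assumes V: "\<And>x. V x \<ge> 0" and Vm [measurable]: "borel_fun V" and c: "c > 0" "emeasure lborel {x. V x < c} < \<infinity>"
  obtains C where "C < \<infinity>" "\<And>u G. appr UNIV u G \<Longrightarrow> L2sq u \<le> C * (L2sq G + (NNINT x. ennreal (V x * (u x)\<^sup>2)))"
proof
  define k where "k = ennreal 1 * emeasure lborel {x. V x < c} + ennreal (4096 / 1\<^sup>2)"
  define C where "C = k + ennreal (1 / c)"
  show "C < \<infinity>" using c(2) by (simp add: C_def k_def)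
  fix u :: "R3 \<Rightarrow> real" and G assume A: "appr UNIV u G"
  note [measurable] = apprD[OF A]
  have Sm: "{x. V x < c} \<in> sets borel" by measurable
  have "L2sq u = (NNINT x. ennreal ((norm (u x))\<^sup>2) * indicator {x. V x < c} x) + (NNINT x. ennreal ((norm (u x))\<^sup>2) * indicator (- {x. V x < c}) x)"
    by (rule L2sq_split[OF apprD(1)[OF A] Sm])
  also have "\<dots> \<le> L2sq G * k + ennreal (1 / c) * (NNINT x. ennreal (V x * (u x)\<^sup>2))"
    unfolding k_def by (intro add_mono weighted_Sobolev_indicator[OF A Sm] potential_tail[OF V Vm c(1) apprD(1)[OF A]]) simp
  also have "\<dots> \<le> L2sq G * C + C * (NNINT x. ennreal (V x * (u x)\<^sup>2))"
    unfolding C_def by (intro add_mono mult_left_mono mult_right_mono) auto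
  finally show "L2sq u \<le> C * (L2sq G + (NNINT x. ennreal (V x * (u x)\<^sup>2)))"
    by (simp add: distrib_left mult.commute)
qed

lemma emeasure_outside_ball_small:
  fixes A :: "R3 set"
  assumes A: "A \<in> sets borel" "emeasure lborel A < \<infinity>" and e: "e > 0"
  shows "\<exists>R. emeasure lborel (A - cball 0 R) \<le> ennreal e"
proof -
  have "(\<lambda>n. emeasure lborel (A - cball 0 (real n))) \<longlonglongrightarrow> emeasure lborel (\<Inter>n. A - cball 0 (real n))"
  proof (rule Lim_emeasure_decseq)
    show "range (\<lambda>n. A - cball 0 (real n)) \<subseteq> sets lborel" using A by auto
    show "decseq (\<lambda>n. A - cball 0 (real n))" by (auto simp: decseq_def)
    show "emeasure lborel (A - cball 0 (real n)) \<noteq> \<infinity>" for n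
    proof -
      have "emeasure lborel (A - cball 0 (real n)) \<le> emeasure lborel A" using A by (intro emeasure_mono) auto
      then show ?thesis using A(2) by (auto simp: top_unique)
    qed
  qed
  moreover have "(\<Inter>n. A - cball 0 (real n)) = {}"
  proof -
    have "\<exists>n. x \<in> cball 0 (real n)" for x :: R3 using real_arch_simple[of "norm x"] by simp
    then show ?thesis by blast
  qed
  ultimately have "(\<lambda>n. emeasure lborel (A - cball 0 (real n))) \<longlonglongrightarrow> 0" by (simp only: emeasure_empty)
  from eventually_happens'[OF sequentially_bot ennreal_tendsto_0D[OF this e]] show ?thesis by blast
qed

text \<open>Outside a large ball the sublevel set of V has small measure and carries little mass by
  Sobolev; elsewhere V >= c and the vanishing potential energy dominates.\<close>

lemma potential_tight:
  fixes V :: "R3 \<Rightarrow> real"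
  assumes V: "\<And>x. V x \<ge> 0" and Vm [measurable]: "borel_fun V" and c: "c > 0" "emeasure lborel {x. V x < c} < \<infinity>"
    and A: "\<And>n. appr UNIV (u n) (G n)" and G1: "\<And>n. L2sq (G n) \<le> ennreal 1"
    and Vu: "(\<lambda>n. (NNINT x. ennreal (V x * (u n x)\<^sup>2))) \<longlonglongrightarrow> 0" and e: "e > 0"
  shows "\<exists>R N. \<forall>n\<ge>N. (NNINT x. ennreal ((norm (u n x))\<^sup>2) * indicator (- cball 0 R) x) \<le> ennreal e"
proof -
  \<comment> \<open>Makes the constant term 4096 / \<tau>^2 equal to e/4. The radius then brings the
    measure term to e/4, and the potential term is a third quarter.\<close>
  define \<tau> where "\<tau> = sqrt (4096 * 4 / e)"
  have \<tau>: "\<tau> > 0" "4096 / \<tau>\<^sup>2 = e / 4" using e by (simp_all add: \<tau>_def)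
  define S where "S = {x. V x < c}"
  have Sm: "S \<in> sets borel" unfolding S_def by measurable
  have "e / (4 * \<tau>) > 0" using e \<tau> by simp
  from emeasure_outside_ball_small[OF Sm c(2)[folded S_def] this]
  obtain R where R: "emeasure lborel (S - cball 0 R) \<le> ennreal (e / (4 * \<tau>))" by blast
  have "e * c / 4 > 0" using e c by simp
  from ennreal_tendsto_0D[OF Vu this] obtain N where
    N: "\<And>n. n \<ge> N \<Longrightarrow> (NNINT x. ennreal (V x * (u n x)\<^sup>2)) \<le> ennreal (e * c / 4)" unfolding eventually_sequentially by blast
  have "(NNINT x. ennreal ((norm (u n x))\<^sup>2) * indicator (- cball 0 R) x) \<le> ennreal e" if n: "n \<ge> N" for n
  proof -
    note um [measurable] = apprD(1)[OF A]
    have m1 [measurable]: "S - cball 0 R \<in> sets borel" "- S \<in> sets borel" using Sm by auto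
    have "(NNINT x. ennreal ((norm (u n x))\<^sup>2) * indicator (- cball 0 R) x)
      \<le> (NNINT x. ennreal ((norm (u n x))\<^sup>2) * indicator (S - cball 0 R) x + ennreal ((norm (u n x))\<^sup>2) * indicator (- S) x)"
      by (intro nn_integral_mono) (auto simp: indicator_def)
    also have "\<dots> = (NNINT x. ennreal ((norm (u n x))\<^sup>2) * indicator (S - cball 0 R) x) + (NNINT x. ennreal ((norm (u n x))\<^sup>2) * indicator (- S) x)"
      by (rule nn_integral_add) measurable
    also have "\<dots> \<le> ennreal 1 * (ennreal \<tau> * ennreal (e / (4 * \<tau>)) + ennreal (e / 4)) + ennreal (1 / c) * ennreal (e * c / 4)"
    proof (rule add_mono)
      have "(NNINT x. ennreal ((norm (u n x))\<^sup>2) * indicator (S - cball 0 R) x) \<le> L2sq (G n) * (ennreal \<tau> * emeasure lborel (S - cball 0 R) + ennreal (4096 / \<tau>\<^sup>2))"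
        by (rule weighted_Sobolev_indicator[OF A m1(1) \<tau>(1)])
      also have "\<dots> \<le> ennreal 1 * (ennreal \<tau> * ennreal (e / (4 * \<tau>)) + ennreal (e / 4))"
        unfolding \<tau>(2) by (intro mult_mono add_mono G1 R) auto
      finally show "(NNINT x. ennreal ((norm (u n x))\<^sup>2) * indicator (S - cball 0 R) x) \<le> ennreal 1 * (ennreal \<tau> * ennreal (e / (4 * \<tau>)) + ennreal (e / 4))" .
      have "(NNINT x. ennreal ((norm (u n x))\<^sup>2) * indicator (- S) x) \<le> ennreal (1 / c) * (NNINT x. ennreal (V x * (u n x)\<^sup>2))"
        unfolding S_def by (rule potential_tail[OF V Vm c(1) um])
      also have "\<dots> \<le> ennreal (1 / c) * ennreal (e * c / 4)" by (intro mult_left_mono N n) simp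
      finally show "(NNINT x. ennreal ((norm (u n x))\<^sup>2) * indicator (- S) x) \<le> ennreal (1 / c) * ennreal (e * c / 4)" .
    qed
    also have "\<dots> = ennreal (e / 4 + e / 4 + e / 4)"
    proof -
      have 1: "ennreal \<tau> * ennreal (e / (4 * \<tau>)) = ennreal (e / 4)" using \<tau> e by (subst ennreal_mult[symmetric]) auto
      have 2: "ennreal (1 / c) * ennreal (e * c / 4) = ennreal (e / 4)" using c e by (subst ennreal_mult[symmetric]) auto
      show ?thesis unfolding 1 2 using e by (simp only: ennreal_1 mult_1 ennreal_plus[symmetric] divide_nonneg_pos less_imp_le zero_less_numeral add_nonneg_nonneg)
    qed
    also have "\<dots> \<le> ennreal e" using e by (intro ennreal_leI) simp
    finally show ?thesis .
  qed
  then show ?thesis by blast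
qed

section \<open>Limits of the weighted form and of subcritical powers\<close>

lemma weight_truncation:
  fixes f :: "R3 \<Rightarrow> real"
  assumes f [measurable]: "borel_fun f" and ff: "(NNINT x. ennreal (\<bar>f x\<bar> powr (3/2))) < \<infinity>" and d: "d > 0"
  shows "\<exists>M::nat. (NNINT x. ennreal (\<bar>if \<bar>f x\<bar> \<le> real M then 0 else f x\<bar> powr (3/2))) \<le> ennreal d"
proof -
  have "(\<lambda>n. (NNINT x. ennreal (\<bar>if \<bar>f x\<bar> \<le> real n then 0 else f x\<bar> powr (3/2)))) \<longlonglongrightarrow> (\<integral>\<^sup>+x. 0 \<partial>(lborel :: R3 measure))"
  proof (rule nn_integral_dominated_convergence[OF _ _ _ _ ff])
    show "AE x in lborel. (\<lambda>n. ennreal (\<bar>if \<bar>f x\<bar> \<le> real n then 0 else f x\<bar> powr (3/2))) \<longlonglongrightarrow> 0"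
    proof (rule AE_I2, rule tendsto_eventually)
      fix x
      obtain N :: nat where "\<bar>f x\<bar> \<le> real N" using real_arch_simple by blast
      then show "\<forall>\<^sub>F n in sequentially. ennreal (\<bar>if \<bar>f x\<bar> \<le> real n then 0 else f x\<bar> powr (3/2)) = 0"
        by (intro eventually_sequentiallyI[of N]) simp
    qed
  qed simp_all
  then have "(\<lambda>n. (NNINT x. ennreal (\<bar>if \<bar>f x\<bar> \<le> real n then 0 else f x\<bar> powr (3/2)))) \<longlonglongrightarrow> 0" by simp
  from eventually_happens'[OF sequentially_bot ennreal_tendsto_0D[OF this d]] show ?thesis .
qed

text \<open>Unlike \<open>sq_weight_L2lim\<close>, this uses only L^2 convergence and a bound on the
  gradient differences. The weight is split into a part bounded by M, handled by L^2 convergence,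
  and a remainder small in L^(3/2), handled by Sobolev.\<close>

lemma sq_weight_L2lim_bounded:
  assumes f [measurable]: "borel_fun f" and ff: "(NNINT x. ennreal (\<bar>f x\<bar> powr (3/2))) < \<infinity>"
    and A: "\<And>n. appr UNIV (u n) (G n)" "appr UNIV v H" "L2lim u v"
    and b: "\<And>n. L2sq (\<lambda>x. G n x - H x) \<le> ennreal C" and C: "C > 0"
  shows "L2lim (\<lambda>n. sq_weight f (u n)) (sq_weight f v)"
  unfolding L2lim_def
proof (rule ennreal_tendsto_0I)
  fix e :: real assume e: "e > 0"
  note [measurable] = apprD(1)[OF A(1)] apprD(1)[OF A(2)]
  \<comment> \<open>First \<tau> makes C * 4096 / \<tau>^2 equal to e/4, then the truncation level
    makes the L^(3/2) term e/4; the bounded part contributes the third quarter for large n.\<close>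
  define \<tau> where "\<tau> = sqrt (4096 * 4 * C / e)"
  have \<tau>: "\<tau> > 0" "C * (4096 / \<tau>\<^sup>2) = e / 4" using e C by (simp_all add: \<tau>_def)
  have "e / (4 * \<tau> * C) > 0" using e \<tau> C by simp
  from weight_truncation[OF f ff this] obtain M :: nat where
    M: "(NNINT x. ennreal (\<bar>if \<bar>f x\<bar> \<le> real M then 0 else f x\<bar> powr (3/2))) \<le> ennreal (e / (4 * \<tau> * C))" by blast
  define h where "h x = (if \<bar>f x\<bar> \<le> real M then 0 else f x)" for x
  have hm [measurable]: "borel_fun h" unfolding h_def by measurable
  have "e / (4 * (real M + 1)) > 0" using e by simp
  from ennreal_tendsto_0D[OF A(3)[unfolded L2lim_def] this]
  show "\<forall>\<^sub>F n in sequentially. L2sq (\<lambda>x. sq_weight f (u n) x - sq_weight f v x) \<le> ennreal e"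
  proof eventually_elim
    case (elim n)
    define w where "w x = u n x - v x" for x
    have wA: "appr UNIV w (\<lambda>x. G n x - H x)" unfolding w_def by (rule appr_diff[OF A(1,2)])
    note [measurable] = apprD(1)[OF wA]
    have hb: "(NNINT x. ennreal (\<bar>h x\<bar> * (w x)\<^sup>2)) \<le> ennreal (e / 4 + e / 4)"
    proof -
      have "(NNINT x. ennreal (\<bar>h x\<bar> * (w x)\<^sup>2)) \<le> L2sq (\<lambda>x. G n x - H x) * (ennreal \<tau> * (NNINT x. ennreal (\<bar>h x\<bar> powr (3/2))) + ennreal (4096 / \<tau>\<^sup>2))"
        by (rule weighted_Sobolev[OF wA hm \<tau>(1)])
      also have "\<dots> \<le> ennreal C * (ennreal \<tau> * ennreal (e / (4 * \<tau> * C)) + ennreal (4096 / \<tau>\<^sup>2))"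
        by (intro mult_mono add_mono b M[folded h_def]) auto
      also have "\<dots> = ennreal (C * (\<tau> * (e / (4 * \<tau> * C)) + 4096 / \<tau>\<^sup>2))"
        using C \<tau>(1) e by (simp add: ennreal_mult ennreal_plus del: times_divide_eq_right)
      also have "C * (\<tau> * (e / (4 * \<tau> * C)) + 4096 / \<tau>\<^sup>2) = e / 4 + e / 4"
        using C \<tau> by (simp add: distrib_left)
      finally show ?thesis .
    qed
    have "L2sq (\<lambda>x. sq_weight f (u n) x - sq_weight f v x) = L2sq (sq_weight f w)"
      by (simp add: sq_weight_def[abs_def] w_def right_diff_distrib)
    also have "\<dots> \<le> (NNINT x. ennreal (real M + 1) * ennreal ((norm (w x))\<^sup>2) + ennreal (\<bar>h x\<bar> * (w x)\<^sup>2))"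
      unfolding L2sq_sq_weight
    proof (rule nn_integral_mono)
      fix x
      have "\<bar>f x\<bar> \<le> (real M + 1) + \<bar>h x\<bar>" by (simp add: h_def)
      then have "\<bar>f x\<bar> * (w x)\<^sup>2 \<le> ((real M + 1) + \<bar>h x\<bar>) * (w x)\<^sup>2" by (rule mult_right_mono) simp
      then have "ennreal (\<bar>f x\<bar> * (w x)\<^sup>2) \<le> ennreal ((real M + 1) * (norm (w x))\<^sup>2 + \<bar>h x\<bar> * (w x)\<^sup>2)"
        by (intro ennreal_leI) (simp add: distrib_right)
      also have "\<dots> = ennreal (real M + 1) * ennreal ((norm (w x))\<^sup>2) + ennreal (\<bar>h x\<bar> * (w x)\<^sup>2)"
        using ennreal_linear_combination[of "real M + 1" "(norm (w x))\<^sup>2" "\<bar>h x\<bar>" "(w x)\<^sup>2"] by (simp add: ennreal_mult)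
      finally show "ennreal (\<bar>f x\<bar> * (w x)\<^sup>2) \<le> ennreal (real M + 1) * ennreal ((norm (w x))\<^sup>2) + ennreal (\<bar>h x\<bar> * (w x)\<^sup>2)" .
    qed
    also have "\<dots> = ennreal (real M + 1) * L2sq w + (NNINT x. ennreal (\<bar>h x\<bar> * (w x)\<^sup>2))"
      unfolding L2sq_def by (subst nn_integral_add) (simp_all add: nn_integral_cmult)
    also have "\<dots> \<le> ennreal (real M + 1) * ennreal (e / (4 * (real M + 1))) + ennreal (e / 4 + e / 4)"
      using elim unfolding w_def[symmetric] by (intro add_mono mult_left_mono hb) auto
    also have "ennreal (real M + 1) * ennreal (e / (4 * (real M + 1))) = ennreal (e / 4)"
    proof -
      have "K * (e / (4 * K)) = e / 4" if "K \<noteq> 0" for K :: real using that by simp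
      moreover have "real M + 1 \<noteq> 0" using of_nat_0_le_iff[of M] by linarith
      ultimately have "(real M + 1) * (e / (4 * (real M + 1))) = e / 4" by blast
      then show ?thesis using e by (subst ennreal_mult[symmetric]) auto
    qed
    also have "ennreal (e / 4) + ennreal (e / 4 + e / 4) \<le> ennreal e" using e by (simp flip: ennreal_plus add: ennreal_leI)
    finally show ?case .
  qed
qed

text \<open>Interpolates the subcritical power between the square and the sixth power. If the larger
  number is beyond a threshold K, then p < 6 makes its p-th power at most e times its sixth power.
  Below K the mean value theorem and Young's inequality apply.\<close>

lemma powr_difference:
  fixes p :: real
  assumes p: "4 \<le> p" "p < 6" and e: "e > 0"
  obtains C where "C \<ge> 0" "\<And>x y. x \<ge> 0 \<Longrightarrow> y \<ge> 0 \<Longrightarrow> \<bar>x powr p - y powr p\<bar> \<le> e * (x ^ 6 + y ^ 6) + C * (x - y)\<^sup>2"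
proof -
  \<comment> \<open>The threshold beyond which x^(p - 6) <= e.\<close>
  define K where "K = max 1 ((1/e) powr (1 / (6 - p)))"
  have K: "K \<ge> 1" by (simp add: K_def)
  \<comment> \<open>Squaring x^(p - 1) produces x^(2p - 2) = x^6 x^(2p - 8). As p >= 4, the last
    factor is at most L below the threshold.\<close>
  define L where "L = K powr (2 * p - 8)"
  have L: "L > 0" using K by (simp add: L_def)
  define C where "C = p\<^sup>2 * L / e"
  have C: "C \<ge> 0" using L e by (simp add: C_def)
  have p6: "x powr q = x ^ 6 * x powr (q - 6)" if "x > 0" for x q :: real
    using that powr_add[of x 6 "q - 6"] by (simp add: powr_numeral)
  have main: "x powr p - y powr p \<le> e * x ^ 6 + C * (x - y)\<^sup>2" if xy: "0 \<le> y" "y \<le> x" "0 < x" for x y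
  proof (cases "x \<ge> K")
    case True
    have "1 / e \<le> K powr (6 - p)"
    proof -
      have "((1/e) powr (1 / (6 - p))) powr (6 - p) \<le> K powr (6 - p)"
        by (rule powr_mono2) (use p in \<open>auto simp: K_def\<close>)
      then show ?thesis using p e by (simp add: powr_powr)
    qed
    also have "\<dots> \<le> x powr (6 - p)" using True K p by (intro powr_mono2) auto
    finally have "1 / x powr (6 - p) \<le> e" using e xy by (simp add: field_simps)
    then have "x powr (p - 6) \<le> e" using powr_minus_divide[of x "6 - p"] by simp
    then have "x powr p \<le> x ^ 6 * e" unfolding p6[OF xy(3), of p] by (intro mult_left_mono) auto
    then have "x powr p \<le> e * x ^ 6" by (simp only: mult.commute)
    moreover have "C * (x - y)\<^sup>2 \<ge> 0" using C by simp
    ultimately show ?thesis using powr_ge_zero[of y p] by linarith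
  next
    case False
    have "x powr p - y powr p \<le> p * x powr (p - 1) * (x - y)"
    proof (cases "y = x")
      case False
      then have "y < x" using xy by simp
      have "\<exists>l z. y < z \<and> z < x \<and> DERIV (\<lambda>t. t powr p) z :> l \<and> x powr p - y powr p = (x - y) * l"
      proof (rule MVT[OF \<open>y < x\<close>])
        show "continuous_on {y..x} (\<lambda>t. t powr p)" by (rule continuous_on_powr') (use xy p in \<open>auto intro!: continuous_intros\<close>)
        fix t assume t: "y < t" "t < x"
        then have "DERIV (\<lambda>t. t powr p) t :> p * t powr (p - 1)" using xy by (intro has_real_derivative_powr) simp
        then show "(\<lambda>t. t powr p) differentiable (at t)" by (auto simp: real_differentiable_def)
      qed
      then obtain l z where z: "y < z" "z < x" "DERIV (\<lambda>t. t powr p) z :> l" "x powr p - y powr p = (x - y) * l" by blast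
      have "DERIV (\<lambda>t. t powr p) z :> p * z powr (p - 1)" using xy z by (intro has_real_derivative_powr) simp
      then have l: "l = p * z powr (p - 1)" by (rule DERIV_unique[OF z(3)])
      have "z powr (p - 1) \<le> x powr (p - 1)" using z xy p by (intro powr_mono2) auto
      then have "(x - y) * (p * z powr (p - 1)) \<le> (x - y) * (p * x powr (p - 1))" using z p by (intro mult_left_mono) auto
      then show ?thesis unfolding z(4) l by (simp add: mult_ac)
    qed simp
    also have "\<dots> \<le> e / L * (x powr (p - 1))\<^sup>2 + C * (x - y)\<^sup>2"
    proof -
      \<comment> \<open>Young's inequality with weights e / L and L / e, so that the first term
        becomes e x^6 after the bound by L.\<close>
      have "0 \<le> (x powr (p - 1) * sqrt (e / L) - p * (x - y) * sqrt (L / e) / 2)\<^sup>2" by simp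
      also have "\<dots> = (x powr (p - 1))\<^sup>2 * (sqrt (e / L))\<^sup>2 - p * (x - y) * x powr (p - 1) * (sqrt (e / L) * sqrt (L / e)) + p\<^sup>2 * (x - y)\<^sup>2 * (sqrt (L / e))\<^sup>2 / 4"
      proof -
        have "(A * s - b * t / 2)\<^sup>2 = A\<^sup>2 * s\<^sup>2 - b * A * (s * t) + b\<^sup>2 * t\<^sup>2 / 4" for A s b t :: real by (simp add: power2_eq_square algebra_simps)
        from this[of "x powr (p - 1)" "sqrt (e / L)" "p * (x - y)" "sqrt (L / e)"] show ?thesis by (simp only: power_mult_distrib)
      qed
      also have "sqrt (e / L) * sqrt (L / e) = 1" using L e by (simp flip: real_sqrt_mult)
      also have "(sqrt (e / L))\<^sup>2 = e / L" using L e by simp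
      also have "(sqrt (L / e))\<^sup>2 = L / e" using L e by simp
      finally have "p * (x - y) * x powr (p - 1) \<le> (x powr (p - 1))\<^sup>2 * (e / L) + p\<^sup>2 * (x - y)\<^sup>2 * (L / e) / 4" by simp
      moreover have "p\<^sup>2 * (x - y)\<^sup>2 * (L / e) / 4 \<le> C * (x - y)\<^sup>2"
      proof -
        have "p\<^sup>2 * (x - y)\<^sup>2 * (L / e) = C * (x - y)\<^sup>2" by (simp add: C_def)
        moreover have "C * (x - y)\<^sup>2 \<ge> 0" using C by simp
        ultimately show ?thesis by simp
      qed
      ultimately show ?thesis by (simp add: mult_ac)
    qed
    also have "e / L * (x powr (p - 1))\<^sup>2 \<le> e * x ^ 6"
    proof -
      have "(x powr (p - 1))\<^sup>2 = x powr (2 * p - 2)"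
        using powr_add[of x "p - 1" "p - 1"] by (simp add: power2_eq_square)
      also have "\<dots> = x ^ 6 * x powr (2 * p - 8)" using p6[OF xy(3), of "2 * p - 2"] by simp
      also have "\<dots> \<le> x ^ 6 * L" unfolding L_def using False xy p by (intro mult_left_mono powr_mono2) auto
      finally have "e / L * (x powr (p - 1))\<^sup>2 \<le> e / L * (x ^ 6 * L)" using e L by (intro mult_left_mono) auto
      then show ?thesis using L by simp
    qed
    finally show ?thesis by simp
  qed
  have "\<bar>x powr p - y powr p\<bar> \<le> e * (x ^ 6 + y ^ 6) + C * (x - y)\<^sup>2" if xy: "x \<ge> 0" "y \<ge> 0" for x y
  proof -
    have ord: "\<bar>x powr p - y powr p\<bar> \<le> e * (x ^ 6 + y ^ 6) + C * (x - y)\<^sup>2" if "0 \<le> y" "y \<le> x" for x y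
    proof (cases "x = 0")
      case False
      have "y powr p \<le> x powr p" using that p by (intro powr_mono2) auto
      moreover have "x powr p - y powr p \<le> e * x ^ 6 + C * (x - y)\<^sup>2" by (rule main) (use that False in auto)
      moreover have "e * y ^ 6 \<ge> 0" using e that by simp
      ultimately show ?thesis by (simp add: distrib_left)
    qed (use that in simp)
    show ?thesis
      using ord[of y x] ord[of x y] xy by (cases "y \<le> x") (simp_all add: abs_minus_commute power2_commute add.commute)
  qed
  then show ?thesis using that C by blast
qed

text \<open>The sixth powers are bounded uniformly in n by the Sobolev inequality, so the e-term of
  \<open>powr_difference\<close> is uniformly small; its quadratic term is an L^2 distance.\<close>

lemma power_functional_tendsto:
  assumes p: "4 \<le> p" "p < 6" and Q [measurable]: "borel_fun Q" and QM: "\<And>x. \<bar>Q x\<bar> \<le> M"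
    and A: "\<And>n. appr UNIV (u n) (G n)" "appr UNIV v H" "L2lim u v"
    and b: "\<And>n. L2sq (G n) \<le> ennreal 1"
  shows "(\<lambda>n. (LBINT x. Q x * \<bar>u n x\<bar> powr p)) \<longlonglongrightarrow> (LBINT x. Q x * \<bar>v x\<bar> powr p)"
proof -
  have M: "M \<ge> 0" using QM[of undefined] by linarith
  note m [measurable] = apprD(1)[OF A(1)] apprD(1)[OF A(2)]
  have six: "integrable lborel (\<lambda>x. \<bar>w x\<bar> ^ 6)" "(LBINT x. \<bar>w x\<bar> ^ 6) \<le> 4096 * (enn2real (L2sq W)) ^ 3" if wA: "appr UNIV w W" for w W
  proof -
    note [measurable] = apprD(1)[OF wA]
    note S = Sobolev[OF wA]
    show "integrable lborel (\<lambda>x. \<bar>w x\<bar> ^ 6)"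
      unfolding integrable_iff_bounded using le_less_trans[OF S] by simp
    have "(LBINT x. \<bar>w x\<bar> ^ 6) = enn2real (NNINT x. ennreal (\<bar>w x\<bar> ^ 6))" by (rule integral_eq_nn_integral) auto
    also have "\<dots> \<le> enn2real (ennreal (4096 * (enn2real (L2sq W)) ^ 3))" by (rule enn2real_mono[OF S]) simp
    finally show "(LBINT x. \<bar>w x\<bar> ^ 6) \<le> 4096 * (enn2real (L2sq W)) ^ 3" by simp
  qed
  have sqi: "integrable lborel (\<lambda>x. (w x)\<^sup>2)" if "appr UNIV w W" for w W
    using integrable_iff_L2sq[OF apprD(1)[OF that]] appr_L2(1)[OF that] by simp
  have Qi: "integrable lborel (\<lambda>x. Q x * \<bar>w x\<bar> powr p)" if wA: "appr UNIV w W" for w W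
  proof -
    note [measurable] = apprD(1)[OF wA]
    obtain C where C: "C \<ge> 0" "\<And>x y. x \<ge> 0 \<Longrightarrow> y \<ge> 0 \<Longrightarrow> \<bar>x powr p - y powr p\<bar> \<le> 1 * (x ^ 6 + y ^ 6) + C * (x - y)\<^sup>2"
      using powr_difference[OF p zero_less_one] by blast
    show ?thesis
    proof (rule Bochner_Integration.integrable_bound)
      show "integrable lborel (\<lambda>x. M * (\<bar>w x\<bar> ^ 6 + C * (w x)\<^sup>2))" using six(1)[OF wA] sqi[OF wA] by simp
      show "AE x in lborel. norm (Q x * \<bar>w x\<bar> powr p) \<le> norm (M * (\<bar>w x\<bar> ^ 6 + C * (w x)\<^sup>2))"
      proof (rule AE_I2)
        fix x
        have "\<bar>w x\<bar> powr p \<le> \<bar>w x\<bar> ^ 6 + C * (w x)\<^sup>2" using C(2)[of "\<bar>w x\<bar>" 0] by simp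
        then have "\<bar>Q x\<bar> * \<bar>w x\<bar> powr p \<le> M * (\<bar>w x\<bar> ^ 6 + C * (w x)\<^sup>2)" using QM[of x] M by (intro mult_mono) auto
        then have "\<bar>Q x * \<bar>w x\<bar> powr p\<bar> \<le> M * (\<bar>w x\<bar> ^ 6 + C * (w x)\<^sup>2)" by (simp only: abs_mult abs_of_nonneg[OF powr_ge_zero])
        then show "norm (Q x * \<bar>w x\<bar> powr p) \<le> norm (M * (\<bar>w x\<bar> ^ 6 + C * (w x)\<^sup>2))"
          unfolding real_norm_def by (rule order_trans[OF _ abs_ge_self])
      qed
    qed measurable
  qed
  \<comment> \<open>Bounds the sum of the two integrals of sixth powers, those of u n having
    gradients with squared norm at most 1.\<close>
  define S where "S = 4096 + 4096 * (enn2real (L2sq H)) ^ 3"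
  have S: "S > 0" by (simp add: S_def add_pos_nonneg)
  have un6: "(LBINT x. \<bar>u n x\<bar> ^ 6) \<le> 4096" for n
  proof -
    have "enn2real (L2sq (G n)) \<le> 1" using enn2real_mono[OF b[of n]] by simp
    then have "(enn2real (L2sq (G n))) ^ 3 \<le> 1" by (rule power_le_one[rotated]) simp
    then show ?thesis using six(2)[OF A(1), of n] by simp
  qed
  show ?thesis
  proof (rule LIMSEQ_I)
    fix r :: real assume r: "r > 0"
    define e where "e = r / (2 * (M + 1) * S)"
    have e: "e > 0" using r M S by (simp add: e_def)
    obtain C where C: "C \<ge> 0" "\<And>x y. x \<ge> 0 \<Longrightarrow> y \<ge> 0 \<Longrightarrow> \<bar>x powr p - y powr p\<bar> \<le> e * (x ^ 6 + y ^ 6) + C * (x - y)\<^sup>2"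
      using powr_difference[OF p e] by blast
    have key: "\<bar>(LBINT x. Q x * \<bar>u n x\<bar> powr p) - (LBINT x. Q x * \<bar>v x\<bar> powr p)\<bar> \<le> M * (e * S + C * enn2real (L2sq (\<lambda>x. u n x - v x)))" for n
    proof -
      have di: "integrable lborel (\<lambda>x. (u n x - v x)\<^sup>2)" by (rule sqi[OF appr_diff[OF A(1,2)]])
      have gi: "integrable lborel (\<lambda>x. M * (e * (\<bar>u n x\<bar> ^ 6 + \<bar>v x\<bar> ^ 6) + C * (u n x - v x)\<^sup>2))"
        using six(1)[OF A(1)] six(1)[OF A(2)] di by simp
      have "\<bar>(LBINT x. Q x * \<bar>u n x\<bar> powr p) - (LBINT x. Q x * \<bar>v x\<bar> powr p)\<bar> = \<bar>(LBINT x. Q x * \<bar>u n x\<bar> powr p - Q x * \<bar>v x\<bar> powr p)\<bar>"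
        by (simp only: Bochner_Integration.integral_diff[OF Qi[OF A(1)] Qi[OF A(2)]])
      also have "\<dots> \<le> (LBINT x. \<bar>Q x * \<bar>u n x\<bar> powr p - Q x * \<bar>v x\<bar> powr p\<bar>)"
        using integral_norm_bound[of lborel "\<lambda>x. Q x * \<bar>u n x\<bar> powr p - Q x * \<bar>v x\<bar> powr p"] by simp
      also have "\<dots> \<le> (LBINT x. M * (e * (\<bar>u n x\<bar> ^ 6 + \<bar>v x\<bar> ^ 6) + C * (u n x - v x)\<^sup>2))"
      proof (rule integral_mono[OF integrable_abs[OF Bochner_Integration.integrable_diff[OF Qi[OF A(1)] Qi[OF A(2)]]] gi])
        fix x
        have "\<bar>\<bar>u n x\<bar> powr p - \<bar>v x\<bar> powr p\<bar> \<le> e * (\<bar>u n x\<bar> ^ 6 + \<bar>v x\<bar> ^ 6) + C * (\<bar>u n x\<bar> - \<bar>v x\<bar>)\<^sup>2" by (rule C(2)) auto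
        also have "(\<bar>u n x\<bar> - \<bar>v x\<bar>)\<^sup>2 \<le> (u n x - v x)\<^sup>2" by (subst abs_le_square_iff[symmetric]) simp
        finally have "\<bar>\<bar>u n x\<bar> powr p - \<bar>v x\<bar> powr p\<bar> \<le> e * (\<bar>u n x\<bar> ^ 6 + \<bar>v x\<bar> ^ 6) + C * (u n x - v x)\<^sup>2" using C(1) by (simp add: mult_left_mono)
        then have "\<bar>Q x\<bar> * \<bar>\<bar>u n x\<bar> powr p - \<bar>v x\<bar> powr p\<bar> \<le> M * (e * (\<bar>u n x\<bar> ^ 6 + \<bar>v x\<bar> ^ 6) + C * (u n x - v x)\<^sup>2)"
          using QM[of x] M by (intro mult_mono) auto
        then show "\<bar>Q x * \<bar>u n x\<bar> powr p - Q x * \<bar>v x\<bar> powr p\<bar> \<le> M * (e * (\<bar>u n x\<bar> ^ 6 + \<bar>v x\<bar> ^ 6) + C * (u n x - v x)\<^sup>2)"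
          by (simp only: right_diff_distrib[symmetric] abs_mult)
      qed
      also have "\<dots> = M * (e * ((LBINT x. \<bar>u n x\<bar> ^ 6) + (LBINT x. \<bar>v x\<bar> ^ 6)) + C * (LBINT x. (u n x - v x)\<^sup>2))"
        using six(1)[OF A(1)] six(1)[OF A(2)] di by simp
      also have "(LBINT x. (u n x - v x)\<^sup>2) = enn2real (L2sq (\<lambda>x. u n x - v x))"
        using integral_eq_L2sq[of "\<lambda>x. u n x - v x"] by simp
      also have "M * (e * ((LBINT x. \<bar>u n x\<bar> ^ 6) + (LBINT x. \<bar>v x\<bar> ^ 6)) + C * enn2real (L2sq (\<lambda>x. u n x - v x)))
        \<le> M * (e * S + C * enn2real (L2sq (\<lambda>x. u n x - v x)))"
        unfolding S_def using un6[of n] six(2)[OF A(2)] e M by (intro mult_left_mono add_right_mono add_mono) auto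
      finally show ?thesis .
    qed
    have eS: "M * (e * S) \<le> r / 2"
    proof -
      have "M * (e * S) \<le> (M + 1) * (e * S)" using e S by (intro mult_right_mono) auto
      also have "\<dots> = r / 2"
      proof -
        have "K * (r / (2 * K * S) * S) = r / 2" if "K > 0" for K using that S by simp
        from this[of "M + 1"] show ?thesis unfolding e_def using M by (simp only: add_nonneg_pos zero_less_one)
      qed
      finally show ?thesis .
    qed
    have "r / (4 * (M * C + 1)) > 0" using r M C by (simp add: add_nonneg_pos)
    from ennreal_tendsto_0D[OF A(3)[unfolded L2lim_def] this] obtain N where
      N: "\<And>n. n \<ge> N \<Longrightarrow> L2sq (\<lambda>x. u n x - v x) \<le> ennreal (r / (4 * (M * C + 1)))" unfolding eventually_sequentially by blast
    show "\<exists>no. \<forall>n\<ge>no. norm ((LBINT x. Q x * \<bar>u n x\<bar> powr p) - (LBINT x. Q x * \<bar>v x\<bar> powr p)) < r"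
    proof (intro exI allI impI)
      fix n assume "n \<ge> N"
      define K where "K = M * C + 1"
      have K: "K > 0" "M * C \<le> K" using M C by (simp_all add: K_def add_nonneg_pos)
      have "enn2real (L2sq (\<lambda>x. u n x - v x)) \<le> r / (4 * K)" using enn2real_mono[OF N[OF \<open>n \<ge> N\<close>]] r K(1) by (simp add: K_def[symmetric])
      then have "M * C * enn2real (L2sq (\<lambda>x. u n x - v x)) \<le> K * (r / (4 * K))" using K M C by (intro mult_mono) auto
      also have "\<dots> = r / 4" using K by simp
      finally have "M * (e * S + C * enn2real (L2sq (\<lambda>x. u n x - v x))) \<le> r / 2 + r / 4" using eS by (simp add: distrib_left mult.assoc)
      then show "norm ((LBINT x. Q x * \<bar>u n x\<bar> powr p) - (LBINT x. Q x * \<bar>v x\<bar> powr p)) < r"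
        using key[of n] r unfolding real_norm_def by argo
    qed
  qed
qed

section \<open>Lebesgue measurable representatives\<close>

text \<open>The bridge between the completed measure of the statement and the Borel calculus:
  measurability, integrability and integrals transfer along equality almost everywhere.\<close>

lemma lebesgue_AE_borel:
  fixes h :: "R3 \<Rightarrow> 'b::euclidean_space"
  assumes h': "borel_fun h'" and ae: "AE x in lborel. h x = h' x"
  shows "h \<in> borel_measurable lebesgue" "integrable lebesgue h \<longleftrightarrow> integrable lborel h'"
    "(\<integral>x. h x \<partial>lebesgue) = (LBINT x. h' x)"
proof -
  have h'l: "h' \<in> borel_measurable lborel" using h' by simp
  have h'm: "h' \<in> borel_measurable lebesgue" by (rule measurable_completion[OF h'l])
  have ae': "AE x in lebesgue. h x = h' x" by (rule AE_completion[OF ae])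
  have "AE x in lebesgue. h' x = h x" using ae' by eventually_elim simp
  from borel_measurable_AE[OF h'm this] show hm: "h \<in> borel_measurable lebesgue" .
  show "integrable lebesgue h \<longleftrightarrow> integrable lborel h'"
    using integrable_cong_AE[OF hm h'm ae'] integrable_completion[OF h'l] by simp
  show "(\<integral>x. h x \<partial>lebesgue) = (LBINT x. h' x)"
    using integral_cong_AE[OF hm h'm ae'] integral_completion[OF h'l] by simp
qed

lemma lebesgue_borel_rep:
  fixes g :: "R3 \<Rightarrow> real"
  assumes "g \<in> borel_measurable lebesgue"
  obtains g' where "borel_fun g'" "AE x in lborel. g x = g' x"
  using completion_ex_borel_measurable_real[OF assms] by auto

text \<open>Membership in H^1 in usable form: an almost everywhere equal Borel function together
  with a Borel gradient.\<close>

definition borel_rep :: "(R3 \<Rightarrow> real) \<Rightarrow> (R3 \<Rightarrow> real) \<Rightarrow> (R3 \<Rightarrow> R3) \<Rightarrow> bool" where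
  "borel_rep u u' G \<longleftrightarrow> (AE x in lborel. u x = u' x) \<and> appr UNIV u' G"

lemma borel_rep_unique:
  assumes "borel_rep u v G" "borel_rep u w H"
  shows "AE x in lborel. v x = w x" "AE x in lborel. G x = H x"
proof -
  have A: "appr UNIV v G" "appr UNIV w H" and ae: "AE x in lborel. u x = v x" "AE x in lborel. u x = w x"
    using assms unfolding borel_rep_def by blast+
  show vw: "AE x in lborel. v x = w x" using ae by eventually_elim simp
  have "AE x in lborel. w x = v x" using ae by eventually_elim simp
  from appr_cong_AE[OF A(2) apprD(1)[OF A(1)] apprD(2)[OF A(2)] this] have B: "appr UNIV v H" by simp
  show "AE x in lborel. G x = H x"
    by (rule wk_unique[OF appr_wk[OF A(1)] appr_wk[OF B] apprD(2)[OF A(1)] appr_L2(2)[OF A(1)] apprD(2)[OF B] appr_L2(2)[OF B]])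
qed

lemma borel_rep_diff:
  assumes "borel_rep u u' G" "borel_rep v v' H"
  shows "borel_rep (\<lambda>x. u x - v x) (\<lambda>x. u' x - v' x) (\<lambda>x. G x - H x)"
proof -
  have A: "appr UNIV u' G" "appr UNIV v' H" and ae: "AE x in lborel. u x = u' x" "AE x in lborel. v x = v' x"
    using assms unfolding borel_rep_def by blast+
  have "AE x in lborel. u x - v x = u' x - v' x" using ae by eventually_elim simp
  then show ?thesis unfolding borel_rep_def using appr_diff[OF A] by blast
qed

lemma borel_rep_test_fun: "test_fun U \<phi> \<Longrightarrow> borel_rep \<phi> \<phi> (gr \<phi>)"
  unfolding borel_rep_def using appr_mono[OF appr_test_fun, of U \<phi> UNIV] by simp

text \<open>The gradient is replaced componentwise by Borel functions and reassembled with
  \<open>T3\<close>; \<open>wk_appr\<close> then turns the weak identity into approximation by test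
  functions.\<close>

lemma weak_grad_borel_rep:
  assumes um: "u \<in> borel_measurable lebesgue" and u2: "integrable lebesgue (\<lambda>x. (u x)\<^sup>2)"
    and w: "weak_grad u G" and G2: "integrable lebesgue (\<lambda>x. (norm (G x))\<^sup>2)"
  obtains v H where "borel_rep u v H" "AE x in lborel. G x = H x"
proof -
  obtain v where v [measurable]: "borel_fun v" "AE x in lborel. u x = v x"
    using lebesgue_borel_rep[OF um] by blast
  have Gm: "G \<in> borel_measurable lebesgue" using w unfolding weak_grad_def by blast
  have comp: "\<exists>g. borel_fun g \<and> (AE x in lborel. G x $ i = g x)" for i
    using lebesgue_borel_rep[OF borel_measurable_vec_nth[OF Gm, of i]] by blast
  obtain g1 g2 g3 where g [measurable]: "borel_fun g1" "borel_fun g2" "borel_fun g3"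
    and gG: "AE x in lborel. G x $ 1 = g1 x" "AE x in lborel. G x $ 2 = g2 x" "AE x in lborel. G x $ 3 = g3 x"
    using comp[of 1] comp[of 2] comp[of 3] by blast
  define H where "H x = T3 (g1 x) (g2 x) (g3 x)" for x
  have Hm [measurable]: "borel_fun H" unfolding H_def by measurable
  have GH: "AE x in lborel. G x = H x" using gG
  proof eventually_elim
    case (elim x)
    then show ?case unfolding H_def using T3_components[of "G x"] by simp
  qed
  have "integrable lborel (\<lambda>x. (norm (v x))\<^sup>2)"
  proof -
    have "AE x in lborel. (u x)\<^sup>2 = (norm (v x))\<^sup>2" using v(2) by eventually_elim simp
    from lebesgue_AE_borel(2)[OF _ this] u2 show ?thesis by simp
  qed
  then have v2: "L2sq v < \<infinity>" using integrable_iff_L2sq[OF v(1)] by blast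
  have "integrable lborel (\<lambda>x. (norm (H x))\<^sup>2)"
  proof -
    have "AE x in lborel. (norm (G x))\<^sup>2 = (norm (H x))\<^sup>2" using GH by eventually_elim simp
    from lebesgue_AE_borel(2)[OF _ this] G2 show ?thesis by simp
  qed
  then have H2: "L2sq H < \<infinity>" using integrable_iff_L2sq[OF Hm] by blast
  have "wk v H" unfolding wk_def
  proof (intro allI impI)
    fix \<phi> i assume \<phi>: "test_fun UNIV \<phi>"
    note [measurable] = test_fun_measurable[OF \<phi>] test_fun_partial_measurable[OF \<phi>]
    have "AE x in lborel. u x * partial i \<phi> x = v x * partial i \<phi> x" using v(2) by eventually_elim simp
    from lebesgue_AE_borel(3)[OF _ this] have 1: "(\<integral>x. u x * partial i \<phi> x \<partial>lebesgue) = (LBINT x. v x * partial i \<phi> x)" by measurable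
    have "AE x in lborel. G x $ i * \<phi> x = H x $ i * \<phi> x" using GH by eventually_elim simp
    from lebesgue_AE_borel(3)[OF _ this] have 2: "(\<integral>x. G x $ i * \<phi> x \<partial>lebesgue) = (LBINT x. H x $ i * \<phi> x)" by measurable
    show "(LBINT x. v x * partial i \<phi> x) = - (LBINT x. H x $ i * \<phi> x)"
      unfolding 1[symmetric] 2[symmetric] using w \<phi> unfolding weak_grad_def by blast
  qed
  from wk_appr[OF this v(1) v2 Hm H2] have "borel_rep u v H" unfolding borel_rep_def using v(2) by blast
  then show ?thesis using GH by (rule that)
qed

lemma H1_borel_rep:
  assumes "u \<in> H1"
  obtains v H where "borel_rep u v H"
proof -
  from assms obtain G where "u \<in> borel_measurable lebesgue" "integrable lebesgue (\<lambda>x. (u x)\<^sup>2)"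
    "weak_grad u G" "integrable lebesgue (\<lambda>x. (norm (G x))\<^sup>2)" unfolding H1_def by blast
  from weak_grad_borel_rep[OF this] show ?thesis using that by blast
qed

lemma borel_rep_square:
  assumes R: "borel_rep u v H"
  shows "integrable lebesgue (\<lambda>x. (u x)\<^sup>2)" "(\<integral>x. (u x)\<^sup>2 \<partial>lebesgue) = enn2real (L2sq v)"
proof -
  have A: "appr UNIV v H" and ae: "AE x in lborel. u x = v x" using R unfolding borel_rep_def by blast+
  note vm [measurable] = apprD(1)[OF A]
  have e: "AE x in lborel. (u x)\<^sup>2 = (norm (v x))\<^sup>2" using ae by eventually_elim simp
  show "integrable lebesgue (\<lambda>x. (u x)\<^sup>2)"
    using lebesgue_AE_borel(2)[OF _ e] integrable_iff_L2sq[OF vm] appr_L2(1)[OF A] by simp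
  show "(\<integral>x. (u x)\<^sup>2 \<partial>lebesgue) = enn2real (L2sq v)"
    using lebesgue_AE_borel(3)[OF _ e] integral_eq_L2sq[OF vm] by simp
qed

lemma borel_rep_weak_grad:
  assumes R: "borel_rep u v H"
  shows "weak_grad u H" "integrable lebesgue (\<lambda>x. (norm (H x))\<^sup>2)"
proof -
  have A: "appr UNIV v H" and ae: "AE x in lborel. u x = v x" using R unfolding borel_rep_def by blast+
  note m [measurable] = apprD[OF A]
  show "integrable lebesgue (\<lambda>x. (norm (H x))\<^sup>2)"
    using lebesgue_AE_borel(2)[of "\<lambda>x. (norm (H x))\<^sup>2" "\<lambda>x. (norm (H x))\<^sup>2"] integrable_iff_L2sq[OF m(2)] appr_L2(2)[OF A] by simp
  show "weak_grad u H" unfolding weak_grad_def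
  proof (intro conjI allI impI)
    show "H \<in> borel_measurable lebesgue" using lebesgue_AE_borel(1)[of H H] m(2) by simp
    fix \<phi> i assume \<phi>: "test_fun UNIV \<phi>"
    note \<phi>m [measurable] = test_fun_measurable[OF \<phi>] test_fun_partial_measurable[OF \<phi>, of i]
    have Hi [measurable]: "borel_fun (\<lambda>x. H x $ i)" by measurable
    have e: "AE x in lborel. u x * partial i \<phi> x = v x * partial i \<phi> x" using ae by eventually_elim simp
    have vm: "borel_fun (\<lambda>x. v x * partial i \<phi> x)" by measurable
    have Hm: "borel_fun (\<lambda>x. H x $ i * \<phi> x)" by measurable
    have e2: "AE x in lborel. H x $ i * \<phi> x = H x $ i * \<phi> x" by simp
    have "integrable lborel (\<lambda>x. v x \<bullet> partial i \<phi> x)"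
      by (rule L2_inner_integrable[OF m(1) \<phi>m(2) appr_L2(1)[OF A] test_fun_L2(1)[OF test_fun_partial[OF \<phi>]]])
    then show "integrable lebesgue (\<lambda>x. u x * partial i \<phi> x)" using lebesgue_AE_borel(2)[OF vm e] by simp
    have "integrable lborel (\<lambda>x. H x $ i \<bullet> \<phi> x)"
      by (rule L2_inner_integrable[OF Hi \<phi>m(1) le_less_trans[OF L2sq_component_le appr_L2(2)[OF A]] test_fun_L2(1)[OF \<phi>]])
    then show "integrable lebesgue (\<lambda>x. H x $ i * \<phi> x)" using lebesgue_AE_borel(2)[OF Hm e2] by simp
    show "(\<integral>x. u x * partial i \<phi> x \<partial>lebesgue) = - (\<integral>x. H x $ i * \<phi> x \<partial>lebesgue)"
      unfolding lebesgue_AE_borel(3)[OF vm e] lebesgue_AE_borel(3)[OF Hm e2]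
      using appr_wk[OF A] \<phi> unfolding wk_def by blast
  qed
qed

text \<open>\<open>grad\<close> selects an arbitrary weak gradient; it is pinned down almost
  everywhere by uniqueness, so integrals of it may be computed with any representative.\<close>

lemma borel_rep_grad:
  assumes R: "borel_rep u v H"
  shows "AE x in lborel. grad u x = H x" "D12sq u = enn2real (L2sq H)"
proof -
  have A: "appr UNIV v H" and ae: "AE x in lborel. u x = v x" using R unfolding borel_rep_def by blast+
  note m [measurable] = apprD[OF A]
  have g: "weak_grad u (grad u) \<and> integrable lebesgue (\<lambda>x. (norm (grad u x))\<^sup>2)"
    unfolding grad_def by (rule someI[of _ H]) (use borel_rep_weak_grad[OF R] in blast)
  obtain w W where W: "borel_rep u w W" "AE x in lborel. grad u x = W x"
    using weak_grad_borel_rep[OF lebesgue_AE_borel(1)[OF m(1) ae] borel_rep_square(1)[OF R]] g by blast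
  show gH: "AE x in lborel. grad u x = H x" using W(2) borel_rep_unique(2)[OF W(1) R] by eventually_elim simp
  have "AE x in lborel. (norm (grad u x))\<^sup>2 = (norm (H x))\<^sup>2" using gH by eventually_elim simp
  from lebesgue_AE_borel(3)[OF _ this] show "D12sq u = enn2real (L2sq H)"
    unfolding D12sq_def using integral_eq_L2sq[OF m(2)] by simp
qed

lemma borel_rep_Xsp:
  assumes V: "\<And>x. V x \<ge> 0" "borel_fun V" and u: "u \<in> Xsp V" and R: "borel_rep u v H"
  shows "L2sq (\<lambda>x. sqrt (V x) * v x) = ennreal (\<integral>x. V x * (u x)\<^sup>2 \<partial>lebesgue)"
    "norm_mu V \<mu> u = sqrt (enn2real (L2sq H) + \<mu> * enn2real (L2sq (\<lambda>x. sqrt (V x) * v x)))"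
proof -
  have A: "appr UNIV v H" and ae: "AE x in lborel. u x = v x" using R unfolding borel_rep_def by blast+
  note [measurable] = apprD(1)[OF A] V(2)
  have e: "AE x in lborel. V x * (u x)\<^sup>2 = V x * (v x)\<^sup>2" using ae by eventually_elim simp
  have m: "borel_fun (\<lambda>x. V x * (v x)\<^sup>2)" by measurable
  have i: "integrable lborel (\<lambda>x. V x * (v x)\<^sup>2)" using u lebesgue_AE_borel(2)[OF m e] unfolding Xsp_def by blast
  have "L2sq (\<lambda>x. sqrt (V x) * v x) = (NNINT x. ennreal (V x * (v x)\<^sup>2))"
    by (rule L2sq_sqrt_mult[OF V(1)])
  also have "\<dots> = ennreal (LBINT x. V x * (v x)\<^sup>2)"
    by (rule nn_integral_eq_integral[OF i]) (simp add: V(1))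
  finally show 1: "L2sq (\<lambda>x. sqrt (V x) * v x) = ennreal (\<integral>x. V x * (u x)\<^sup>2 \<partial>lebesgue)"
    unfolding lebesgue_AE_borel(3)[OF m e] .
  have "(\<integral>x. V x * (u x)\<^sup>2 \<partial>lebesgue) \<ge> 0" by (rule Bochner_Integration.integral_nonneg) (simp add: V(1))
  then show "norm_mu V \<mu> u = sqrt (enn2real (L2sq H) + \<mu> * enn2real (L2sq (\<lambda>x. sqrt (V x) * v x)))"
    unfolding 1 norm_mu_def borel_rep_grad(2)[OF R] by simp
qed

section \<open>The space X and its norm\<close>

lemma Xsp_diff:
  assumes V: "\<And>x. V x \<ge> 0" "borel_fun V" and u: "u \<in> Xsp V" and v: "v \<in> Xsp V"
  shows "(\<lambda>x. u x - v x) \<in> Xsp V"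
proof -
  obtain u' G where R: "borel_rep u u' G" using u H1_borel_rep unfolding Xsp_def by blast
  obtain v' H where S: "borel_rep v v' H" using v H1_borel_rep unfolding Xsp_def by blast
  note D = borel_rep_diff[OF R S]
  have A: "appr UNIV (\<lambda>x. u' x - v' x) (\<lambda>x. G x - H x)" and ae: "AE x in lborel. u x - v x = u' x - v' x"
    using D unfolding borel_rep_def by blast+
  have Am: "appr UNIV u' G" "appr UNIV v' H" using R S unfolding borel_rep_def by blast+
  note m [measurable] = apprD(1)[OF Am(1)] apprD(1)[OF Am(2)] V(2)
  have "(\<lambda>x. u x - v x) \<in> H1"
    unfolding H1_def using lebesgue_AE_borel(1)[OF apprD(1)[OF A] ae] borel_rep_square(1)[OF D] borel_rep_weak_grad[OF D] by blast
  moreover have "integrable lebesgue (\<lambda>x. V x * (u x - v x)\<^sup>2)"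
  proof -
    have e: "AE x in lborel. V x * (u x - v x)\<^sup>2 = (norm (sqrt (V x) * u' x - sqrt (V x) * v' x))\<^sup>2"
      using ae
    proof eventually_elim
      case (elim x)
      have "(norm (sqrt (V x) * u' x - sqrt (V x) * v' x))\<^sup>2 = V x * (u' x - v' x)\<^sup>2"
        using V(1)[of x] by (simp only: right_diff_distrib[symmetric] real_norm_def power2_abs power_mult_distrib real_sqrt_pow2)
      then show ?case unfolding elim by simp
    qed
    have "L2sq (\<lambda>x. sqrt (V x) * u' x - sqrt (V x) * v' x) < \<infinity>"
      by (rule L2sq_finite_diff) (simp_all add: borel_rep_Xsp(1)[OF V u R] borel_rep_Xsp(1)[OF V v S])
    then have "integrable lborel (\<lambda>x. (norm (sqrt (V x) * u' x - sqrt (V x) * v' x))\<^sup>2)"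
      by (subst integrable_iff_L2sq) simp_all
    then show ?thesis using lebesgue_AE_borel(2)[OF _ e] by simp
  qed
  ultimately show ?thesis unfolding Xsp_def by blast
qed

text \<open>The squared norm is a sum of two nonnegative terms, each bounded by e^2. Dividing by
  \<mu> in the second is what expels the mass from the set V > 0 as \<mu> grows.\<close>

lemma L2sq_le_of_norm_mu:
  assumes V: "\<And>x. V x \<ge> 0" "borel_fun V" and \<mu>: "\<mu> \<ge> 1" and u: "u \<in> Xsp V" and R: "borel_rep u v H"
    and le: "norm_mu V \<mu> u \<le> e"
  shows "L2sq H \<le> ennreal (e\<^sup>2)" "L2sq (\<lambda>x. sqrt (V x) * v x) \<le> ennreal (e\<^sup>2 / \<mu>)"
proof -
  have A: "appr UNIV v H" using R unfolding borel_rep_def by blast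
  define D P where "D = enn2real (L2sq H)" and "P = enn2real (L2sq (\<lambda>x. sqrt (V x) * v x))"
  have D: "L2sq H = ennreal D" "D \<ge> 0" using appr_L2(2)[OF A] by (simp_all add: D_def)
  have P: "L2sq (\<lambda>x. sqrt (V x) * v x) = ennreal P" "P \<ge> 0" unfolding P_def borel_rep_Xsp(1)[OF V u R] by simp_all
  have P\<mu>: "\<mu> * P \<ge> 0" using P \<mu> by simp
  have "sqrt (D + \<mu> * P) \<le> e" using le unfolding borel_rep_Xsp(2)[OF V u R] D_def P_def .
  then have "(sqrt (D + \<mu> * P))\<^sup>2 \<le> e\<^sup>2" by (rule power_mono) (use D P\<mu> in simp)
  then have "D + \<mu> * P \<le> e\<^sup>2" using D P\<mu> by simp
  then have "D \<le> e\<^sup>2" "\<mu> * P \<le> e\<^sup>2" using D P\<mu> by linarith+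
  then show "L2sq H \<le> ennreal (e\<^sup>2)" "L2sq (\<lambda>x. sqrt (V x) * v x) \<le> ennreal (e\<^sup>2 / \<mu>)"
    unfolding D(1) P(1) using \<mu> by (auto intro!: ennreal_leI simp: field_simps)
qed

text \<open>Both elements are close to one common point u of the closures; the factor 4 is the
  squared triangle inequality, and \<mu> >= 1 discards the division by \<mu>.\<close>

lemma close_pair:
  assumes V: "\<And>x. V x \<ge> 0" "borel_fun V" and \<mu>: "\<mu> \<ge> 1" and X: "u \<in> Xsp V" "v \<in> Xsp V" "w \<in> Xsp V"
    and R: "borel_rep v a A" "borel_rep w b B"
    and e: "norm_mu V \<mu> (\<lambda>x. u x - v x) < e" "norm_mu V \<mu> (\<lambda>x. u x - w x) < e"
  shows "L2sq (\<lambda>x. A x - B x) \<le> ennreal (4 * e\<^sup>2)" "L2sq (\<lambda>x. sqrt (V x) * (a x - b x)) \<le> ennreal (4 * e\<^sup>2)"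
proof -
  obtain c C where S: "borel_rep u c C" using X(1) H1_borel_rep unfolding Xsp_def by blast
  have ap: "appr UNIV a A" "appr UNIV b B" "appr UNIV c C" using R S unfolding borel_rep_def by blast+
  note [measurable] = apprD[OF ap(1)] apprD[OF ap(2)] apprD[OF ap(3)] V(2)
  have two: "2 * ennreal (e\<^sup>2) + 2 * ennreal (e\<^sup>2) = ennreal (4 * e\<^sup>2)"
  proof -
    have "2 * ennreal (e\<^sup>2) + 2 * ennreal (e\<^sup>2) = ennreal (2 * e\<^sup>2) + ennreal (2 * e\<^sup>2)" by (simp add: ennreal_mult)
    also have "\<dots> = ennreal (2 * e\<^sup>2 + 2 * e\<^sup>2)" by (rule ennreal_plus[symmetric]) simp_all
    finally show ?thesis by simp
  qed
  note D1 = L2sq_le_of_norm_mu[OF V \<mu> Xsp_diff[OF V X(1,2)] borel_rep_diff[OF S R(1)] less_imp_le[OF e(1)]]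
  note D2 = L2sq_le_of_norm_mu[OF V \<mu> Xsp_diff[OF V X(1,3)] borel_rep_diff[OF S R(2)] less_imp_le[OF e(2)]]
  have "e\<^sup>2 / \<mu> \<le> e\<^sup>2 / 1" using \<mu> by (intro divide_left_mono) auto
  then have \<mu>e: "ennreal (e\<^sup>2 / \<mu>) \<le> ennreal (e\<^sup>2)" by (intro ennreal_leI) simp
  have "L2sq (\<lambda>x. A x - B x) \<le> 2 * L2sq (\<lambda>x. A x - C x) + 2 * L2sq (\<lambda>x. C x - B x)" by (rule L2sq_triangle) simp_all
  also have "L2sq (\<lambda>x. A x - C x) = L2sq (\<lambda>x. C x - A x)" by (rule L2sq_commute)
  also have "2 * L2sq (\<lambda>x. C x - A x) + 2 * L2sq (\<lambda>x. C x - B x) \<le> 2 * ennreal (e\<^sup>2) + 2 * ennreal (e\<^sup>2)"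
    by (intro add_mono mult_left_mono D1(1) D2(1)) simp_all
  finally show "L2sq (\<lambda>x. A x - B x) \<le> ennreal (4 * e\<^sup>2)" unfolding two .
  have "L2sq (\<lambda>x. sqrt (V x) * a x - sqrt (V x) * b x)
    \<le> 2 * L2sq (\<lambda>x. sqrt (V x) * a x - sqrt (V x) * c x) + 2 * L2sq (\<lambda>x. sqrt (V x) * c x - sqrt (V x) * b x)"
    by (rule L2sq_triangle) simp_all
  also have "L2sq (\<lambda>x. sqrt (V x) * a x - sqrt (V x) * c x) = L2sq (\<lambda>x. sqrt (V x) * c x - sqrt (V x) * a x)"
    by (rule L2sq_commute)
  also have "2 * L2sq (\<lambda>x. sqrt (V x) * c x - sqrt (V x) * a x) + 2 * L2sq (\<lambda>x. sqrt (V x) * c x - sqrt (V x) * b x) \<le> 2 * ennreal (e\<^sup>2) + 2 * ennreal (e\<^sup>2)"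
    unfolding right_diff_distrib[symmetric]
    by (intro add_mono mult_left_mono order_trans[OF D1(2) \<mu>e] order_trans[OF D2(2) \<mu>e]) simp_all
  finally show "L2sq (\<lambda>x. sqrt (V x) * (a x - b x)) \<le> ennreal (4 * e\<^sup>2)" unfolding two right_diff_distrib[symmetric] .
qed

section \<open>The limit of infinite steepness\<close>

text \<open>The sequence a carries the lower bound on the weighted form and decides what the limit
  is; b only has to be close to a in gradient and potential. The conclusion is stated for b because
  the functional is tested there.\<close>

lemma (in weighted_eigenpair) minimizing_sequence_limit:
  fixes V :: "R3 \<Rightarrow> real"
  assumes V: "\<And>x. V x \<ge> 0" and Vm [measurable]: "borel_fun V" and c: "c > 0" "emeasure lborel {x. V x < c} < \<infinity>"
    and dom: "smooth_bounded_domain \<Omega>" and cl: "closure \<Omega> = {x. V x = 0}"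
    and A: "\<And>n. appr UNIV (a n) (A n)" and A1: "\<And>n. L2sq (A n) \<le> ennreal 1"
    and aV: "\<And>n. L2sq (\<lambda>x. sqrt (V x) * a n x) \<le> ennreal (1 / real (Suc n))"
    and B: "\<And>n. appr UNIV (b n) (B n)"
    and d1: "(\<lambda>n. L2sq (\<lambda>x. A n x - B n x)) \<longlonglongrightarrow> 0" and d2: "(\<lambda>n. L2sq (\<lambda>x. sqrt (V x) * (a n x - b n x))) \<longlonglongrightarrow> 0"
    and ge: "\<And>n. 1 \<le> lams n * (LBINT x. f x * a n x * a n x)" and lams: "lams \<longlonglongrightarrow> lam" and lam: "lam > 0"
  obtains r k where "strict_mono (r :: nat \<Rightarrow> nat)" "k \<noteq> 0" "L2lim (\<lambda>n. b (r n)) (\<lambda>x. k * v x)"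
proof -
  note m [measurable] = apprD(1)[OF A] apprD(2)[OF A] apprD(1)[OF B] apprD(2)[OF B]
  obtain K where K: "K < \<infinity>" "\<And>u G. appr UNIV u G \<Longrightarrow> L2sq u \<le> K * (L2sq G + (NNINT x. ennreal (V x * (u x)\<^sup>2)))"
    using potential_coercive[OF V Vm c] by blast
  have coercive: "L2sq u \<le> K * (L2sq G + L2sq (\<lambda>x. sqrt (V x) * u x))" if "appr UNIV u G" for u G
    using K(2)[OF that] unfolding L2sq_sqrt_mult[OF V] .
  \<comment> \<open>The factor 2 is the sum of the bounds 1 for the gradient and 1 for the potential
    term. The maximum with 1 lets one constant serve for functions and gradients in
    \<open>Rellich\<close>.\<close>
  define C where "C = max 1 (enn2real (K * 2))"
  have C: "C \<ge> 1" "K * 2 \<le> ennreal C" "C \<ge> 0"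
  proof -
    have "K * 2 < \<infinity>" using K(1) by (simp add: ennreal_mult_less_top)
    then have "K * 2 = ennreal (enn2real (K * 2))" by simp
    then show "K * 2 \<le> ennreal C" by (metis C_def ennreal_leI max.cobounded2)
  qed (simp_all add: C_def)
  have tend: "(\<lambda>n. 1 / real (Suc n)) \<longlonglongrightarrow> 0" using LIMSEQ_inverse_real_of_nat by (simp add: inverse_eq_divide)
  have aC: "L2sq (a n) \<le> ennreal C" for n
  proof -
    have "L2sq (\<lambda>x. sqrt (V x) * a n x) \<le> ennreal 1" by (rule order_trans[OF aV]) (rule ennreal_leI, simp)
    then have "L2sq (A n) + L2sq (\<lambda>x. sqrt (V x) * a n x) \<le> ennreal 1 + ennreal 1" by (intro add_mono A1)
    also have "\<dots> = 2" by simp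
    finally have "K * (L2sq (A n) + L2sq (\<lambda>x. sqrt (V x) * a n x)) \<le> K * 2" by (rule mult_left_mono) simp
    then show ?thesis using coercive[OF A, of n] C(2) by (meson order_trans)
  qed
  have AC: "L2sq (A n) \<le> ennreal C" for n by (rule order_trans[OF A1]) (rule ennreal_leI[OF C(1)])
  have aV0: "(\<lambda>n. (NNINT x. ennreal (V x * (a n x)\<^sup>2))) \<longlonglongrightarrow> 0"
  proof (rule tendsto_sandwich[OF _ _ tendsto_const])
    show "(\<lambda>n. ennreal (1 / real (Suc n))) \<longlonglongrightarrow> 0" using tendsto_ennrealI[OF tend] by simp
    show "\<forall>\<^sub>F n in sequentially. (NNINT x. ennreal (V x * (a n x)\<^sup>2)) \<le> ennreal (1 / real (Suc n))"
      using aV unfolding L2sq_sqrt_mult[OF V] by (intro always_eventually allI)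
  qed simp
  have tight: "\<exists>R N. \<forall>n\<ge>N. (NNINT x. ennreal ((norm (a n x))\<^sup>2) * indicator (- cball 0 R) x) \<le> ennreal e" if "e > 0" for e
    by (rule potential_tight[OF V Vm c A A1 aV0 that])
  obtain r w where r: "strict_mono (r :: nat \<Rightarrow> nat)" and wm [measurable]: "borel_fun w" and aw: "L2lim (\<lambda>n. a (r n)) w"
    using Rellich[OF A C(3) aC AC tight] by blast
  obtain W where W: "appr UNIV w W" "L2sq W \<le> ennreal 1"
    using weak_lower_semicontinuity[OF A aw wm A1 zero_le_one] by blast
  obtain s where s: "strict_mono s" and ae: "AE x in lborel. (\<lambda>k. a (r (s k)) x) \<longlonglongrightarrow> w x"
    using L2lim_AE_subseq[OF m(1) wm aw] by blast
  \<comment> \<open>Fatou carries the vanishing potential energy to the limit, so w = 0 wherever V >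
    0.\<close>
  have "L2sq (\<lambda>x. sqrt (V x) * w x) \<le> ennreal 0"
  proof (rule L2sq_Fatou[where F="\<lambda>k x. sqrt (V x) * a (r (s k)) x" and c="\<lambda>k. 1 / real (Suc (r (s k)))"])
    show "AE x in lborel. (\<lambda>k. sqrt (V x) * a (r (s k)) x) \<longlonglongrightarrow> sqrt (V x) * w x"
      using ae by eventually_elim (rule tendsto_mult_left)
    show "(\<lambda>k. 1 / real (Suc (r (s k)))) \<longlonglongrightarrow> 0"
      using LIMSEQ_subseq_LIMSEQ[OF LIMSEQ_subseq_LIMSEQ[OF tend r] s] by (simp add: o_def)
    show "borel_fun (\<lambda>x. sqrt (V x) * a (r (s k)) x)" for k by measurable
    show "L2sq (\<lambda>x. sqrt (V x) * a (r (s k)) x) \<le> ennreal (1 / real (Suc (r (s k))))" for k by (rule aV)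
  qed
  then have "L2sq (\<lambda>x. sqrt (V x) * w x) = 0" by simp
  from L2sq_eq_0_AE[OF _ this] have "AE x in lborel. sqrt (V x) * w x = 0" by simp
  then have zero: "AE x in lborel. x \<notin> closure \<Omega> \<longrightarrow> w x = 0"
    unfolding cl by eventually_elim auto
  have W\<Omega>: "appr \<Omega> w W" by (rule appr_smooth_domain[OF dom W(1) zero])
  \<comment> \<open>The gradients need not converge to W; boundedness of the differences is all that
    the weighted form requires.\<close>
  have bd: "L2sq (\<lambda>x. A (r n) x - W x) \<le> ennreal 4" for n
  proof -
    note [measurable] = apprD(2)[OF W(1)]
    have "L2sq (\<lambda>x. A (r n) x - W x) \<le> 2 * L2sq (\<lambda>x. A (r n) x - 0) + 2 * L2sq (\<lambda>x. 0 - W x)" by (rule L2sq_triangle) simp_all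
    also have "L2sq (\<lambda>x. 0 - W x) = L2sq (\<lambda>x. W x - 0)" by (rule L2sq_commute)
    also have "2 * L2sq (\<lambda>x. A (r n) x - 0) + 2 * L2sq (\<lambda>x. W x - 0) \<le> 2 * ennreal 1 + 2 * ennreal 1"
      using A1[of "r n"] W(2) by (intro add_mono mult_left_mono) simp_all
    finally show ?thesis by simp
  qed
  have sq: "L2lim (\<lambda>n. sq_weight f (a (r n))) (sq_weight f w)"
    by (rule sq_weight_L2lim_bounded[OF fm ff A W(1) aw bd]) simp
  have Ilim: "(\<lambda>n. (LBINT x. f x * a (r n) x * a (r n) x)) \<longlonglongrightarrow> (LBINT x. f x * w x * w x)"
    using weighted_tendsto[OF fm ff _ _ A W(1) sq A W(1) sq, of "\<lambda>x. 1" 1] by simp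
  \<comment> \<open>Together with the gradient bound 1 this puts w in the equality case of Picone's
    inequality.\<close>
  have "1 \<le> lam * (LBINT x. f x * w x * w x)"
    using LIMSEQ_le_const[OF tendsto_mult[OF LIMSEQ_subseq_LIMSEQ[OF lams r, unfolded o_def] Ilim], of 1] ge by blast
  moreover have "enn2real (L2sq W) \<le> 1" using enn2real_mono[OF W(2)] by simp
  ultimately have min: "enn2real (L2sq W) \<le> lam * (LBINT x. f x * w x * w x)" and I1: "1 \<le> lam * (LBINT x. f x * w x * w x)"
    by linarith+
  have "connected \<Omega>" "bounded \<Omega>" using dom unfolding smooth_bounded_domain_def by blast+
  from minimizer_multiple[OF W\<Omega> min this] obtain k where k: "AE x in lborel. w x = k * v x" by blast
  \<comment> \<open>Otherwise the weighted form of w would be zero, against the lower bound just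
    obtained.\<close>
  have "k \<noteq> 0"
  proof
    assume "k = 0"
    then have "AE x in lborel. f x * w x * w x = 0" using k by auto
    then have "(LBINT x. f x * w x * w x) = 0" by (rule integral_eq_zero_AE)
    then show False using I1 by simp
  qed
  moreover have "L2lim (\<lambda>n. b (r n)) (\<lambda>x. k * v x)"
  proof -
    \<comment> \<open>Coercivity applied to the difference turns closeness in gradient and potential
      into closeness in L^2.\<close>
    have "(\<lambda>n. L2sq (\<lambda>x. b n x - a n x)) \<longlonglongrightarrow> 0"
    proof (rule tendsto_sandwich[OF _ _ tendsto_const])
      have "(\<lambda>n. K * (L2sq (\<lambda>x. A n x - B n x) + L2sq (\<lambda>x. sqrt (V x) * (a n x - b n x)))) \<longlonglongrightarrow> K * (0 + 0)"
        by (intro ennreal_tendsto_cmult tendsto_add d1 d2) (use K(1) in simp)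
      then show "(\<lambda>n. K * (L2sq (\<lambda>x. A n x - B n x) + L2sq (\<lambda>x. sqrt (V x) * (a n x - b n x)))) \<longlonglongrightarrow> 0" by simp
      show "\<forall>\<^sub>F n in sequentially. L2sq (\<lambda>x. b n x - a n x) \<le> K * (L2sq (\<lambda>x. A n x - B n x) + L2sq (\<lambda>x. sqrt (V x) * (a n x - b n x)))"
      proof (intro always_eventually allI)
        fix n
        show "L2sq (\<lambda>x. b n x - a n x) \<le> K * (L2sq (\<lambda>x. A n x - B n x) + L2sq (\<lambda>x. sqrt (V x) * (a n x - b n x)))"
          using coercive[OF appr_diff[OF A B], of n n] unfolding L2sq_commute[of "b n" "a n"] .
      qed
    qed simp
    then have "(\<lambda>n. L2sq (\<lambda>x. b (r n) x - a (r n) x)) \<longlonglongrightarrow> 0"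
      using LIMSEQ_subseq_LIMSEQ[OF _ r] by (fastforce simp: o_def)
    from L2lim_from_diff[OF m(1) m(3) wm aw this] have bw: "L2lim (\<lambda>n. b (r n)) w" .
    have "L2sq (\<lambda>x. b (r n) x - w x) = L2sq (\<lambda>x. b (r n) x - k * v x)" for n
      by (rule L2sq_cong_AE) (use k in eventually_elim, simp)
    then show ?thesis using bw unfolding L2lim_def by simp
  qed
  ultimately show ?thesis using r that by blast
qed

section \<open>From the limit to the contradiction\<close>

lemma powr_functional_multiple:
  fixes Q v :: "R3 \<Rightarrow> real"
  shows "(LBINT x. Q x * \<bar>k * v x\<bar> powr p) = \<bar>k\<bar> powr p * (LBINT x. Q x * \<bar>v x\<bar> powr p)"
proof -
  have "(\<lambda>x. Q x * \<bar>k * v x\<bar> powr p) = (\<lambda>x. \<bar>k\<bar> powr p * (Q x * \<bar>v x\<bar> powr p))"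
    by (rule ext) (simp add: abs_mult powr_mult mult_ac)
  then show ?thesis by simp
qed

text \<open>The parameter \<alpha> treats both forms of the functional at once: it is zero unless p
  = 4. Powers pass to the limit by \<open>power_functional_tendsto\<close>, the gradient term only
  by lower semicontinuity, whose direction suits its negative sign in the functional. The limit is k
  v, and |k|^p is divided out at the end.\<close>

lemma limit_functional_nonneg:
  assumes p: "4 \<le> p" "p < 6" and Q: "borel_fun Q" "\<And>x. \<bar>Q x\<bar> \<le> M"
    and B: "\<And>n. appr UNIV (b n) (B n)" "\<And>n. L2sq (B n) \<le> ennreal 1" and vH: "appr UNIV v H"
    and k: "k \<noteq> 0" and lim: "L2lim b (\<lambda>x. k * v x)" and \<alpha>: "\<alpha> \<ge> 0"
    and pos: "\<And>n. \<alpha> * (enn2real (L2sq (B n)))\<^sup>2 \<le> (LBINT x. Q x * \<bar>b n x\<bar> powr p)" and \<alpha>p: "\<alpha> \<noteq> 0 \<Longrightarrow> p = 4"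
  shows "\<alpha> * (enn2real (L2sq H))\<^sup>2 \<le> (LBINT x. Q x * \<bar>v x\<bar> powr p)"
proof -
  define J where "J = (LBINT x. Q x * \<bar>v x\<bar> powr p)"
  define D where "D = enn2real (L2sq H)"
  have kp: "\<bar>k\<bar> powr p > 0" using k by simp
  note kv = appr_cmult[OF vH, of k]
  have "(\<lambda>n. (LBINT x. Q x * \<bar>b n x\<bar> powr p)) \<longlonglongrightarrow> (LBINT x. Q x * \<bar>k * v x\<bar> powr p)"
    by (rule power_functional_tendsto[OF p Q B(1) kv lim B(2)])
  then have L: "(\<lambda>n. (LBINT x. Q x * \<bar>b n x\<bar> powr p)) \<longlonglongrightarrow> \<bar>k\<bar> powr p * J"
    unfolding powr_functional_multiple J_def .
  show ?thesis
  proof (cases "\<alpha> = 0")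
    case True
    have "0 \<le> (LBINT x. Q x * \<bar>b n x\<bar> powr p)" for n using pos[of n] True by simp
    then have "0 \<le> \<bar>k\<bar> powr p * J" by (intro LIMSEQ_le_const[OF L]) blast
    then show ?thesis using True kp unfolding J_def by (simp add: zero_le_mult_iff)
  next
    case False
    then have a: "\<alpha> > 0" and p4: "p = 4" using \<alpha> \<alpha>p by simp_all
    have k4: "\<bar>k\<bar> powr p = (k\<^sup>2)\<^sup>2" using k unfolding p4 by (simp add: powr_numeral)
    have "\<alpha> * (k\<^sup>2 * D)\<^sup>2 \<le> \<bar>k\<bar> powr p * J"
    proof (rule field_le_epsilon)
      fix e :: real assume e: "e > 0"
      \<comment> \<open>The integrals lie below l from some index on, which bounds the squared
        gradient norms of the tail by sqrt (l / \<alpha>).\<close>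
      define l where "l = \<bar>k\<bar> powr p * J + e"
      have "\<forall>\<^sub>F n in sequentially. (LBINT x. Q x * \<bar>b n x\<bar> powr p) < l"
        by (rule order_tendstoD(2)[OF L]) (simp add: l_def e)
      then obtain N where N: "\<And>n. n \<ge> N \<Longrightarrow> (LBINT x. Q x * \<bar>b n x\<bar> powr p) < l"
        unfolding eventually_sequentially by blast
      have sq: "(enn2real (L2sq (B n)))\<^sup>2 \<le> l / \<alpha>" if "n \<ge> N" for n
        using N[OF that] pos[of n] a by (simp add: pos_le_divide_eq mult.commute)
      have l0: "l / \<alpha> \<ge> 0" using order_trans[OF zero_le_power2 sq[of N]] by simp
      have le: "L2sq (B (n + N)) \<le> ennreal (sqrt (l / \<alpha>))" for n
      proof -
        have "enn2real (L2sq (B (n + N))) \<le> sqrt (l / \<alpha>)" by (rule real_le_rsqrt[OF sq]) simp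
        then have "ennreal (enn2real (L2sq (B (n + N)))) \<le> ennreal (sqrt (l / \<alpha>))" by (rule ennreal_leI)
        then show ?thesis using appr_L2(2)[OF B(1)] by simp
      qed
      \<comment> \<open>Lower semicontinuity wants its bound for every index, so it is applied to
        the shifted sequence. The gradient it returns must be k H by uniqueness.\<close>
      have "strict_mono (\<lambda>n. n + N)" by (simp add: strict_mono_def)
      note lim' = L2lim_subseq[OF lim this]
      have "sqrt (l / \<alpha>) \<ge> 0" using l0 by simp
      then obtain W where W: "appr UNIV (\<lambda>x. k * v x) W" "L2sq W \<le> ennreal (sqrt (l / \<alpha>))"
        using weak_lower_semicontinuity[OF B(1) lim' apprD(1)[OF kv] le] by blast
      have "AE x in lborel. W x = k *\<^sub>R H x"
        by (rule wk_unique[OF appr_wk[OF W(1)] appr_wk[OF kv] apprD(2)[OF W(1)] appr_L2(2)[OF W(1)] apprD(2)[OF kv] appr_L2(2)[OF kv]])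
      then have "L2sq W = L2sq (\<lambda>x. k *\<^sub>R H x)" by (rule L2sq_cong_AE)
      also have "\<dots> = ennreal (k\<^sup>2) * L2sq H" by (rule L2sq_scaleR[OF apprD(2)[OF vH]])
      finally have "enn2real (L2sq W) = k\<^sup>2 * D" by (simp add: D_def enn2real_mult)
      moreover have "enn2real (L2sq W) \<le> sqrt (l / \<alpha>)" using enn2real_mono[OF W(2)] l0 by simp
      ultimately have "(k\<^sup>2 * D)\<^sup>2 \<le> (sqrt (l / \<alpha>))\<^sup>2" by (intro power_mono) (simp_all add: D_def)
      then have "(k\<^sup>2 * D)\<^sup>2 \<le> l / \<alpha>" using l0 by simp
      then have "\<alpha> * (k\<^sup>2 * D)\<^sup>2 \<le> l" using a by (simp add: pos_le_divide_eq mult.commute)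
      then show "\<alpha> * (k\<^sup>2 * D)\<^sup>2 \<le> \<bar>k\<bar> powr p * J + e" unfolding l_def .
    qed
    then have "(k\<^sup>2)\<^sup>2 * (\<alpha> * D\<^sup>2) \<le> (k\<^sup>2)\<^sup>2 * J" unfolding k4 by (simp add: power_mult_distrib mult_ac)
    moreover have "(k\<^sup>2)\<^sup>2 > 0" using k by simp
    ultimately show ?thesis unfolding D_def J_def by (meson mult_le_cancel_left_pos)
  qed
qed

text \<open>Converts the eigenpair of the statement into Borel form. The approximating test
  functions of \<open>H10\<close> give membership in the closure, and a change on a null set makes
  the eigenfunction positive at every point of \<Omega>.\<close>

lemma principal_eigenpair_weighted:
  assumes eig: "principal_eigenpair f \<Omega> lam1 phi1" and op: "open \<Omega>"
    and f': "borel_fun f'" "AE x in lborel. f x = f' x" "(NNINT x. ennreal (\<bar>f' x\<bar> powr (3/2))) < \<infinity>"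
  obtains v H where "borel_rep phi1 v H" "weighted_eigenpair \<Omega> v f' H lam1"
proof -
  have h10: "phi1 \<in> H10 \<Omega>" and off: "\<And>x. x \<notin> \<Omega> \<Longrightarrow> phi1 x = 0" and pos: "AE x in lebesgue. x \<in> \<Omega> \<longrightarrow> phi1 x > 0"
    and eq: "\<And>\<phi>. test_fun \<Omega> \<phi> \<Longrightarrow> (\<integral>x. grad phi1 x \<bullet> (\<chi> i. partial i \<phi> x) \<partial>lebesgue) = lam1 * (\<integral>x. f x * phi1 x * \<phi> x \<partial>lebesgue)"
    using eig unfolding principal_eigenpair_def by blast+
  obtain \<phi> where \<phi>: "\<And>n. test_fun \<Omega> (\<phi> n)" "(\<lambda>n. H1_norm (\<lambda>x. phi1 x - \<phi> n x)) \<longlonglongrightarrow> 0"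
    and h1: "phi1 \<in> H1" using h10 unfolding H10_def by blast
  obtain u H where R: "borel_rep phi1 u H" using H1_borel_rep[OF h1] by blast
  have A: "appr UNIV u H" and ae: "AE x in lborel. phi1 x = u x" using R unfolding borel_rep_def by blast+
  note m [measurable] = apprD[OF A]
  \<comment> \<open>The squared H^1 distance splits into the distances of functions and of
    gradients, so one null sequence dominates both.\<close>
  have Hn: "ennreal ((H1_norm (\<lambda>x. phi1 x - \<phi> n x))\<^sup>2) = L2sq (\<lambda>x. H x - gr (\<phi> n) x) + L2sq (\<lambda>x. u x - \<phi> n x)" for n
  proof -
    note D = borel_rep_diff[OF R borel_rep_test_fun[OF \<phi>(1)[of n]]]
    have B: "appr UNIV (\<lambda>x. u x - \<phi> n x) (\<lambda>x. H x - gr (\<phi> n) x)" using D unfolding borel_rep_def by blast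
    have "(H1_norm (\<lambda>x. phi1 x - \<phi> n x))\<^sup>2 = enn2real (L2sq (\<lambda>x. H x - gr (\<phi> n) x)) + enn2real (L2sq (\<lambda>x. u x - \<phi> n x))"
      unfolding H1_norm_def borel_rep_grad(2)[OF D] borel_rep_square(2)[OF D] by simp
    then show ?thesis using appr_L2[OF B] by (simp add: ennreal_plus)
  qed
  have lim0: "(\<lambda>n. ennreal ((H1_norm (\<lambda>x. phi1 x - \<phi> n x))\<^sup>2)) \<longlonglongrightarrow> 0"
    using tendsto_ennrealI[OF tendsto_power[OF \<phi>(2), of 2]] by simp
  have Lu: "L2lim \<phi> u" unfolding L2lim_def
  proof (rule tendsto_sandwich[OF _ _ tendsto_const lim0])
    show "\<forall>\<^sub>F n in sequentially. L2sq (\<lambda>x. \<phi> n x - u x) \<le> ennreal ((H1_norm (\<lambda>x. phi1 x - \<phi> n x))\<^sup>2)"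
    proof (intro always_eventually allI)
      fix n show "L2sq (\<lambda>x. \<phi> n x - u x) \<le> ennreal ((H1_norm (\<lambda>x. phi1 x - \<phi> n x))\<^sup>2)"
        unfolding Hn L2sq_commute[of "\<phi> n" u] by simp
    qed
  qed simp
  have LH: "L2lim (\<lambda>n. gr (\<phi> n)) H" unfolding L2lim_def
  proof (rule tendsto_sandwich[OF _ _ tendsto_const lim0])
    show "\<forall>\<^sub>F n in sequentially. L2sq (\<lambda>x. gr (\<phi> n) x - H x) \<le> ennreal ((H1_norm (\<lambda>x. phi1 x - \<phi> n x))\<^sup>2)"
    proof (intro always_eventually allI)
      fix n show "L2sq (\<lambda>x. gr (\<phi> n) x - H x) \<le> ennreal ((H1_norm (\<lambda>x. phi1 x - \<phi> n x))\<^sup>2)"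
        unfolding Hn L2sq_commute[of "gr (\<phi> n)" H] by simp
    qed
  qed simp
  have A\<Omega>: "appr \<Omega> u H" by (rule appr_from_test_seq[OF m \<phi>(1) Lu LH])
  \<comment> \<open>The value 1 is arbitrary and is taken only on the null subset of \<Omega> where
    u fails to be positive.\<close>
  define v where "v x = (if x \<in> \<Omega> then if u x > 0 then u x else 1 else 0)" for x
  have [measurable]: "\<Omega> \<in> sets borel" using op by simp
  have vm [measurable]: "borel_fun v" unfolding v_def by measurable
  have "AE x in lborel. x \<in> \<Omega> \<longrightarrow> phi1 x > 0" using pos unfolding AE_completion_iff .
  with ae have uv: "AE x in lborel. u x = v x"
  proof eventually_elim
    case (elim x)
    then show ?case using off[of x] by (auto simp: v_def)
  qed
  have V: "appr \<Omega> v H" by (rule appr_cong_AE[OF A\<Omega> vm m(2) uv]) simp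
  have ae': "AE x in lborel. phi1 x = v x" using ae uv by eventually_elim simp
  have R': "borel_rep phi1 v H" unfolding borel_rep_def using ae' appr_mono[OF V, of UNIV] by simp
  have "weighted_eigenpair \<Omega> v f' H lam1"
  proof
    show "open \<Omega>" "appr \<Omega> v H" "borel_fun f'" "(NNINT x. ennreal (\<bar>f' x\<bar> powr (3/2))) < \<infinity>"
      by (rule op V f')+
    show "v x > 0" if "x \<in> \<Omega>" for x using that by (simp add: v_def)
    show "v x = 0" if "x \<notin> \<Omega>" for x using that by (simp add: v_def)
    fix \<phi> assume \<phi>: "test_fun \<Omega> \<phi>"
    note [measurable] = test_fun_measurable[OF \<phi>] test_fun_gr_measurable[OF \<phi>] f'(1)
    have "AE x in lborel. grad phi1 x \<bullet> (\<chi> i. partial i \<phi> x) = H x \<bullet> gr \<phi> x"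
      using borel_rep_grad(1)[OF R] unfolding gr_def[symmetric] by eventually_elim simp
    from lebesgue_AE_borel(3)[OF _ this]
    have 1: "(\<integral>x. grad phi1 x \<bullet> (\<chi> i. partial i \<phi> x) \<partial>lebesgue) = (LBINT x. H x \<bullet> gr \<phi> x)" by measurable
    have "AE x in lborel. f x * phi1 x * \<phi> x = f' x * v x * \<phi> x" using f'(2) ae' by eventually_elim simp
    from lebesgue_AE_borel(3)[OF _ this]
    have 2: "(\<integral>x. f x * phi1 x * \<phi> x \<partial>lebesgue) = (LBINT x. f' x * v x * \<phi> x)" by measurable
    show "(LBINT x. H x \<bullet> gr \<phi> x) = lam1 * (LBINT x. f' x * v x * \<phi> x)"
      using eq[OF \<phi>] unfolding 1 2 .
  qed
  with R' show ?thesis by (rule that)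
qed

lemma Phi_borel_rep:
  assumes R: "borel_rep u v H" and Q: "borel_fun Q'" "AE x in lborel. Q x = Q' x"
  shows "Phi Q a p u = (LBINT x. Q' x * \<bar>v x\<bar> powr p) - (if p = 4 then a else 0) * (enn2real (L2sq H))\<^sup>2"
proof -
  have A: "appr UNIV v H" and ae: "AE x in lborel. u x = v x" using R unfolding borel_rep_def by blast+
  note [measurable] = apprD(1)[OF A] Q(1)
  have "AE x in lborel. Q x * \<bar>u x\<bar> powr p = Q' x * \<bar>v x\<bar> powr p" using Q(2) ae by eventually_elim simp
  from lebesgue_AE_borel(3)[OF _ this]
  have "(\<integral>x. Q x * \<bar>u x\<bar> powr p \<partial>lebesgue) = (LBINT x. Q' x * \<bar>v x\<bar> powr p)" by measurable
  then show ?thesis unfolding Phi_def borel_rep_grad(2)[OF R] by auto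
qed

text \<open>Extracts, from one common point of the closures, a member of each set within distance e
  of it, and records their properties as statements about Borel pairs. The strict inequalities are
  weakened because only the weak ones survive a limit.\<close>

lemma closures_intersect:
  assumes V: "\<And>x. V x \<ge> 0" "borel_fun V"
    and f': "borel_fun f'" "AE x in lborel. f x = f' x"
    and Q': "borel_fun Q'" "AE x in lborel. Q x = Q' x"
    and \<mu>: "\<mu> \<ge> 1" and e: "e > 0"
    and ne: "Xclosure V \<mu> (Lambda_minus V f lam \<mu>) \<inter> Xclosure V \<mu> (Theta_plus V Q a p \<mu>) \<noteq> {}"
  shows "\<exists>v A w B. appr UNIV v A \<and> L2sq A \<le> ennreal 1 \<and> L2sq (\<lambda>x. sqrt (V x) * v x) \<le> ennreal (1 / \<mu>)
    \<and> appr UNIV w B \<and> L2sq B \<le> ennreal 1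
    \<and> L2sq (\<lambda>x. A x - B x) \<le> ennreal (4 * e\<^sup>2) \<and> L2sq (\<lambda>x. sqrt (V x) * (v x - w x)) \<le> ennreal (4 * e\<^sup>2)
    \<and> 1 \<le> lam * (LBINT x. f' x * v x * v x)
    \<and> (if p = 4 then a else 0) * (enn2real (L2sq B))\<^sup>2 \<le> (LBINT x. Q' x * \<bar>w x\<bar> powr p)"
proof -
  obtain u where u: "u \<in> Xclosure V \<mu> (Lambda_minus V f lam \<mu>)" "u \<in> Xclosure V \<mu> (Theta_plus V Q a p \<mu>)" using ne by blast
  obtain s where s: "s \<in> Lambda_minus V f lam \<mu>" "norm_mu V \<mu> (\<lambda>x. u x - s x) < e" using u(1) e unfolding Xclosure_def by blast
  obtain t where t: "t \<in> Theta_plus V Q a p \<mu>" "norm_mu V \<mu> (\<lambda>x. u x - t x) < e" using u(2) e unfolding Xclosure_def by blast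
  have uX: "u \<in> Xsp V" using u(1) unfolding Xclosure_def by blast
  have s': "s \<in> Xsp V" "norm_mu V \<mu> s = 1" "(norm_mu V \<mu> s)\<^sup>2 - lam * (\<integral>x. f x * (s x)\<^sup>2 \<partial>lebesgue) < 0"
    using s(1) unfolding Lambda_minus_def by blast+
  have t': "t \<in> Xsp V" "norm_mu V \<mu> t = 1" "Phi Q a p t > 0" using t(1) unfolding Theta_plus_def by blast+
  obtain v A where R: "borel_rep s v A" using s'(1) H1_borel_rep unfolding Xsp_def by blast
  obtain w B where S: "borel_rep t w B" using t'(1) H1_borel_rep unfolding Xsp_def by blast
  have ap: "appr UNIV v A" "appr UNIV w B" and ae: "AE x in lborel. s x = v x" using R S unfolding borel_rep_def by blast+
  note [measurable] = apprD(1)[OF ap(1)] f'(1)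
  note a1 = L2sq_le_of_norm_mu[OF V \<mu> s'(1) R eq_refl[OF s'(2)]]
  note b1 = L2sq_le_of_norm_mu[OF V \<mu> t'(1) S eq_refl[OF t'(2)]]
  have "AE x in lborel. f x * (s x)\<^sup>2 = f' x * v x * v x" using f'(2) ae by eventually_elim (simp add: power2_eq_square)
  from lebesgue_AE_borel(3)[OF _ this]
  have 1: "(\<integral>x. f x * (s x)\<^sup>2 \<partial>lebesgue) = (LBINT x. f' x * v x * v x)" by measurable
  have I: "1 \<le> lam * (LBINT x. f' x * v x * v x)" using s'(3) unfolding 1 s'(2) by simp
  have P: "(if p = 4 then a else 0) * (enn2real (L2sq B))\<^sup>2 \<le> (LBINT x. Q' x * \<bar>w x\<bar> powr p)"
    using t'(3) unfolding Phi_borel_rep[OF S Q'] by linarith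
  show ?thesis
    using ap a1 b1 close_pair[OF V \<mu> uX s'(1) t'(1) R S s(2) t(2)] I P by (intro exI[of _ v] exI[of _ A] exI[of _ w] exI[of _ B]) simp
qed

theorem theorem3p5:
  fixes V f Q :: "R3 \<Rightarrow> real" and \<Omega> :: "R3 set" and a p lam1 :: real and phi1 :: "R3 \<Rightarrow> real"
  assumes p: "4 \<le> p" "p < 6"
    and V1: "\<forall>x. V x \<ge> 0" "continuous_on UNIV V"
    and V2: "\<exists>c>0. {x. V x < c} \<noteq> {} \<and> emeasure lebesgue {x. V x < c} < \<infinity>"
    and V3: "\<Omega> = interior {x. V x = 0}" "smooth_bounded_domain \<Omega>" "closure \<Omega> = {x. V x = 0}"
    and D1: "f \<in> borel_measurable lebesgue" "integrable lebesgue (\<lambda>x. \<bar>f x\<bar> powr (3/2))"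
            "emeasure lebesgue {x \<in> \<Omega>. f x > 0} > 0"
    and D2: "Q \<in> borel_measurable lebesgue" "\<exists>M. AE x in lebesgue. \<bar>Q x\<bar> \<le> M"
            "emeasure lebesgue {x \<in> \<Omega>. Q x > 0} > 0"
    and eig: "principal_eigenpair f \<Omega> lam1 phi1"
    and a: "a > 0"
    and neg: "Phi Q a p phi1 < 0"
  shows "\<exists>\<delta>0>0. \<forall>lam. lam1 \<le> lam \<and> lam < lam1 + \<delta>0 \<longrightarrow>
           (\<exists>\<mu>s>0. \<forall>\<mu>>\<mu>s. Xclosure V \<mu> (Lambda_minus V f lam \<mu>) \<inter> Xclosure V \<mu> (Theta_plus V Q a p \<mu>) = {})"
proof (rule ccontr)
  assume contra: "\<not> ?thesis"
  have V: "\<And>x. V x \<ge> 0" and Vm [measurable]: "borel_fun V"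
    using V1 by (simp_all add: borel_measurable_continuous_onI)
  obtain c where c: "c > 0" "emeasure lebesgue {x. V x < c} < \<infinity>" using V2 by blast
  have "{x. V x < c} \<in> sets lborel" by measurable
  then have cl: "emeasure lborel {x. V x < c} < \<infinity>" using c(2) by simp
  have op: "open \<Omega>" using V3(2) unfolding smooth_bounded_domain_def by blast
  have lam1: "lam1 > 0" using eig unfolding principal_eigenpair_def by blast
  obtain f' where f': "borel_fun f'" "AE x in lborel. f x = f' x" using lebesgue_borel_rep[OF D1(1)] by blast
  note [measurable] = f'(1)
  have "AE x in lborel. \<bar>f x\<bar> powr (3/2) = \<bar>f' x\<bar> powr (3/2)" using f'(2) by eventually_elim simp
  from lebesgue_AE_borel(2)[OF _ this] D1(2) have "integrable lborel (\<lambda>x. \<bar>f' x\<bar> powr (3/2))" by simp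
  then have ff: "(NNINT x. ennreal (\<bar>f' x\<bar> powr (3/2))) < \<infinity>" unfolding integrable_iff_bounded by simp
  obtain M where M: "AE x in lborel. \<bar>Q x\<bar> \<le> M" using D2(2) unfolding AE_completion_iff by blast
  obtain q where q [measurable]: "borel_fun q" "AE x in lborel. Q x = q x" using lebesgue_borel_rep[OF D2(1)] by blast
  \<comment> \<open>Clamping turns the essential bound into a bound at every point without changing
    the function off a null set; the absolute value makes the interval nonempty whatever the sign of
    M.\<close>
  define Q' where "Q' x = max (- \<bar>M\<bar>) (min \<bar>M\<bar> (q x))" for x
  have Q'm: "borel_fun Q'" unfolding Q'_def by measurable
  have Q'e: "AE x in lborel. Q x = Q' x" using M q(2) by eventually_elim (auto simp: Q'_def)
  have Q'M: "\<bar>Q' x\<bar> \<le> \<bar>M\<bar>" for x by (auto simp: Q'_def)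
  obtain v H where R: "borel_rep phi1 v H" and eig': "weighted_eigenpair \<Omega> v f' H lam1"
    using principal_eigenpair_weighted[OF eig op f' ff] by blast
  interpret weighted_eigenpair \<Omega> v f' H lam1 by (rule eig')
  define \<alpha> where "\<alpha> = (if p = 4 then a else 0)"
  \<comment> \<open>The negated statement refutes the candidate 1 / (n + 1) for the margin above
    lam1 and then n + 1 for the steepness threshold. So the potential terms are at most 1 / (n + 1),
    and the same number is used as the closeness of the pair.\<close>
  have "\<forall>n. \<exists>l b A w B. lam1 \<le> l \<and> l < lam1 + 1 / real (Suc n) \<and> appr UNIV b A \<and> L2sq A \<le> ennreal 1 \<and> L2sq (\<lambda>x. sqrt (V x) * b x) \<le> ennreal (1 / real (Suc n))
    \<and> appr UNIV w B \<and> L2sq B \<le> ennreal 1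
    \<and> L2sq (\<lambda>x. A x - B x) \<le> ennreal (4 * (1 / real (Suc n))\<^sup>2) \<and> L2sq (\<lambda>x. sqrt (V x) * (b x - w x)) \<le> ennreal (4 * (1 / real (Suc n))\<^sup>2)
    \<and> 1 \<le> l * (LBINT x. f' x * b x * b x) \<and> \<alpha> * (enn2real (L2sq B))\<^sup>2 \<le> (LBINT x. Q' x * \<bar>w x\<bar> powr p)"
    (is "\<forall>n. ?ex n")
  proof
    fix n
    have n: "1 / real (Suc n) > 0" "real (Suc n) > 0" by simp_all
    obtain l where l: "lam1 \<le> l" "l < lam1 + 1 / real (Suc n)"
      and nl: "\<not> (\<exists>\<mu>s>0. \<forall>\<mu>>\<mu>s. Xclosure V \<mu> (Lambda_minus V f l \<mu>) \<inter> Xclosure V \<mu> (Theta_plus V Q a p \<mu>) = {})"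
      using contra n(1) by blast
    obtain \<mu> where \<mu>: "\<mu> > real (Suc n)" "Xclosure V \<mu> (Lambda_minus V f l \<mu>) \<inter> Xclosure V \<mu> (Theta_plus V Q a p \<mu>) \<noteq> {}"
      using nl n(2) by blast
    have \<mu>1: "\<mu> \<ge> 1" using \<mu>(1) by simp
    have "1 / \<mu> \<le> 1 / real (Suc n)" using \<mu>(1) by (intro divide_left_mono) auto
    then have \<mu>n: "ennreal (1 / \<mu>) \<le> ennreal (1 / real (Suc n))" by (rule ennreal_leI)
    show "?ex n"
      using closures_intersect[OF V Vm f' Q'm Q'e \<mu>1 n(1) \<mu>(2), folded \<alpha>_def] l order_trans[OF _ \<mu>n] by blast
  qed
  then obtain l b A w B where seq: "\<forall>n. lam1 \<le> l n \<and> l n < lam1 + 1 / real (Suc n) \<and> appr UNIV (b n) (A n) \<and> L2sq (A n) \<le> ennreal 1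
    \<and> L2sq (\<lambda>x. sqrt (V x) * b n x) \<le> ennreal (1 / real (Suc n)) \<and> appr UNIV (w n) (B n) \<and> L2sq (B n) \<le> ennreal 1
    \<and> L2sq (\<lambda>x. A n x - B n x) \<le> ennreal (4 * (1 / real (Suc n))\<^sup>2) \<and> L2sq (\<lambda>x. sqrt (V x) * (b n x - w n x)) \<le> ennreal (4 * (1 / real (Suc n))\<^sup>2)
    \<and> 1 \<le> l n * (LBINT x. f' x * b n x * b n x) \<and> \<alpha> * (enn2real (L2sq (B n)))\<^sup>2 \<le> (LBINT x. Q' x * \<bar>w n x\<bar> powr p)"
    unfolding choice_iff by (elim exE)
  from seq have l: "\<And>n. lam1 \<le> l n" "\<And>n. l n < lam1 + 1 / real (Suc n)"
    and b: "\<And>n. appr UNIV (b n) (A n)" "\<And>n. L2sq (A n) \<le> ennreal 1" "\<And>n. L2sq (\<lambda>x. sqrt (V x) * b n x) \<le> ennreal (1 / real (Suc n))"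
    and w: "\<And>n. appr UNIV (w n) (B n)" "\<And>n. L2sq (B n) \<le> ennreal 1"
    and d: "\<And>n. L2sq (\<lambda>x. A n x - B n x) \<le> ennreal (4 * (1 / real (Suc n))\<^sup>2)" "\<And>n. L2sq (\<lambda>x. sqrt (V x) * (b n x - w n x)) \<le> ennreal (4 * (1 / real (Suc n))\<^sup>2)"
    and I: "\<And>n. 1 \<le> l n * (LBINT x. f' x * b n x * b n x)"
    and P: "\<And>n. \<alpha> * (enn2real (L2sq (B n)))\<^sup>2 \<le> (LBINT x. Q' x * \<bar>w n x\<bar> powr p)"
    by blast+
  have tend: "(\<lambda>n. 1 / real (Suc n)) \<longlonglongrightarrow> 0" using LIMSEQ_inverse_real_of_nat by (simp add: inverse_eq_divide)
  have "(\<lambda>n. 4 * (1 / real (Suc n))\<^sup>2) \<longlonglongrightarrow> 4 * 0\<^sup>2" by (intro tendsto_intros tend)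
  from tendsto_ennrealI[OF this] have e0: "(\<lambda>n. ennreal (4 * (1 / real (Suc n))\<^sup>2)) \<longlonglongrightarrow> 0" by simp
  have d0: "(\<lambda>n. L2sq (\<lambda>x. A n x - B n x)) \<longlonglongrightarrow> 0" "(\<lambda>n. L2sq (\<lambda>x. sqrt (V x) * (b n x - w n x))) \<longlonglongrightarrow> 0"
    by (rule tendsto_sandwich[OF _ _ tendsto_const e0]; (rule always_eventually, rule allI, (rule zero_le | rule d)))+
  have ll: "l \<longlonglongrightarrow> lam1"
  proof (rule tendsto_sandwich[OF _ _ tendsto_const])
    show "(\<lambda>n. lam1 + 1 / real (Suc n)) \<longlonglongrightarrow> lam1" using tendsto_add[OF tendsto_const tend] by simp
    show "\<forall>\<^sub>F n in sequentially. lam1 \<le> l n" using l(1) by (intro always_eventually allI)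
    show "\<forall>\<^sub>F n in sequentially. l n \<le> lam1 + 1 / real (Suc n)" using l(2) by (intro always_eventually allI less_imp_le)
  qed
  obtain r k where r: "strict_mono (r :: nat \<Rightarrow> nat)" "k \<noteq> 0" "L2lim (\<lambda>n. w (r n)) (\<lambda>x. k * v x)"
    using minimizing_sequence_limit[OF V Vm c(1) cl V3(2,3) b w(1) d0 I ll lam1] by blast
  \<comment> \<open>This says that the functional is nonnegative at the eigenfunction, against the
    assumed sign.\<close>
  have "\<alpha> * (enn2real (L2sq H))\<^sup>2 \<le> (LBINT x. Q' x * \<bar>v x\<bar> powr p)"
    by (rule limit_functional_nonneg[OF p Q'm Q'M w(1) w(2) appr_mono[OF vH subset_UNIV] r(2,3) _ P])
      (use a in \<open>auto simp: \<alpha>_def split: if_splits\<close>)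
  then show False using neg unfolding Phi_borel_rep[OF R Q'm Q'e] \<alpha>_def by linarith
qed

end
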